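(* Let $1<\beta\le2$ and for $t\in\mathbb R$ let $\lambda_t$ be the leading eigenvalue of $\mathcal L_t$. Then the following hold. (1) The function $t\in\mathbb R\mapsto\lambda_t\in(1,\infty)$ is strictly increasing and satisfies $\lim_{t\to-\infty}\lambda_t=1$ and $\lim_{t\to\infty}\lambda_t=\infty$. (2) The function $t\in\mathbb R\mapsto\lambda_t\in(1,\infty)$ can be extended to an analytic function on some region of $\mathbb C$ including $\mathbb R$. In particular, it is real-analytic on $\mathbb R$. (3) The pressure $P(t):=P(t\chi_{C_1})$ is equal to $\log\lambda_t$. Furthermore, $\alpha(t):=\dfrac{dP(t)}{dt}=\displaystyle\int_{X_\beta}\chi_{C_1}\,d\mu_t$, where $\mu_t$ is the unique equilibrium state of $t\chi_{C_1}$. (4) The function $\alpha(t)$ is positive and strictly increasing on $\mathbb R$ and satisfies $$\lim_{t\to-\infty}\alpha(t)=0,\qquad\lim_{t\to\infty}\alpha(t)=c_\beta:=\sup_{\mu\in M(X_\beta)}\int_{X_\beta}\chi_{C_1}\,d\mu.$$ In addition, $\Lambda_\alpha=\emptyset$ if $\alpha\notin[0,c_\beta]$. (5) For $p\in(0,c_\beta)$ let $t(p)\in\mathbb R$ be the real number satisfying $\alpha(t(p))=p$. Then the function $p\in(0,c_\beta)\mapsto t(p)\in\mathbb R$ is real-analytic. (6) The function $\alpha\in(0,c_\beta)\mapsto\dim_H\Lambda_\alpha\in[0,1]$ is real-analytic and concave.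
   Context: For $1<\beta\le2$, $\tau_\beta(x)=\beta x-[\beta x]$ on $[0,1]$ and $g_n(x)=[\beta\tau_\beta^{n-1}(x)]$ are the greedy digits of $x$. $\{0,1\}^{\mathbb N}$ carries the product topology, the lexicographic order $\preceq$ and the left shift $\sigma$. $\underline0=000\cdots$ and $\underline1=(q_n(1))_{n\ge1}:=\lim_{y\nearrow1}(g_n(y))_{n\ge1}$ (quasi-greedy expansion of $1$). The beta-shift is $X_\beta=\{\underline x\in\{0,1\}^{\mathbb N}:\sigma^n(\underline x)\preceq\underline1\ \forall n\ge0\}$ with the map $\sigma$. $M(X_\beta)$ is the set of $\sigma$-invariant Borel probability measures on $X_\beta$. $C_1=\{(x_i)\in X_\beta:x_1=1\}$ and $\chi_{C_1}$ is its indicator function. Function spaces: for $f:X_\beta\to\mathbb C$, $\mathrm{var}(f)$ is the supremum of $\sum_{i=1}^n|f(x_i)-f(x_{i-1})|$ over finite chains $\underline0=x_0\prec x_1\prec\dots\prec x_n=\underline1$ in $X_\beta$; $BV=\{f:\mathrm{var}(f)<\infty\}$ with norm $\|f\|_{BV}=|f|_\infty+\mathrm{var}(f)$. $\mathcal N$ is the set of $f\in BV$ vanishing off a countable set, $\mathcal B=BV/\mathcal N$ with the quotient norm, and $\mathcal F\subset\mathcal B$ is the closure of the linear span of indicator functions of intervals in $X_\beta$. $\mathcal L_tf(x)=\sum_{y:\sigma(y)=x}e^{t\chi_{C_1}(y)}f(y)$ is a bounded operator on $\mathcal F$; its leading eigenvalue $\lambda_t$ is the unique eigenvalue of largest modulus.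 It is positive, and equals the inverse of the unique positive zero of $1-\phi_t(z)$, where $\phi_t(z)=\sum_{n\ge1}q_n(1)H_{n-1}(t,\underline1)z^n$, $H_0=1$, $H_n(t,\underline1)=\exp(t\sum_{i=1}^nq_i(1))$. The topological pressure of a continuous $\phi$ is $P(\phi)=\lim_{n\to\infty}\frac1n\log\sum_{A}\exp(\sup_{\underline x\in A}\sum_{i=0}^{n-1}\phi(\sigma^i\underline x))$, the sum being over all (nonempty) $n$-cylinder sets $A$ of $X_\beta$; by the variational principle it equals $\sup_{m\in M(X_\beta)}\{h_m(\sigma)+\int\phi\,dm\}$, and an equilibrium state of $\phi$ is a measure in $M(X_\beta)$ attaining this supremum. For $\alpha\in\mathbb R$, $\Lambda_\alpha=\{(x_i)\in X_\beta:\lim_{n\to\infty}\frac1n\sum_{i=1}^nx_i=\alpha\}$. Hausdorff dimension is with respect to the metric $d_\beta(\underline x,\underline y)=\beta^{-\min\{k\ge0:x_{k+1}\ne y_{k+1}\}}$ for $\underline x\ne\underline y$. *)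

theory Defs
  imports "HOL-Probability.Probability"
begin

section \<open>Greedy digits and the beta-shift\<close>

text \<open>
  Sequences are indexed from 0, so \<open>x 0\<close> is the first digit \<open>x\<^sub>1\<close>.  The type
  \<^typ>\<open>nat \<Rightarrow> nat\<close> carries the product of the discrete topologies.
\<close>

type_synonym digits = "nat \<Rightarrow> nat"

definition beta_map :: "real \<Rightarrow> real \<Rightarrow> real" where
  "beta_map \<beta> x = \<beta> * x - of_int \<lfloor>\<beta> * x\<rfloor>"

definition greedy :: "real \<Rightarrow> real \<Rightarrow> digits" where
  "greedy \<beta> x = (\<lambda>n. nat \<lfloor>\<beta> * (beta_map \<beta> ^^ n) x\<rfloor>)"

definition quasi_greedy_one :: "real \<Rightarrow> digits" where
  "quasi_greedy_one \<beta> = (THE q. (greedy \<beta> \<longlongrightarrow> q) (at_left 1))"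

definition shift :: "digits \<Rightarrow> digits" where
  "shift x = (\<lambda>n. x (Suc n))"

definition lex_less :: "digits \<Rightarrow> digits \<Rightarrow> bool" where
  "lex_less x y \<longleftrightarrow> (\<exists>n. (\<forall>k<n. x k = y k) \<and> x n < y n)"

definition lex_le :: "digits \<Rightarrow> digits \<Rightarrow> bool" where
  "lex_le x y \<longleftrightarrow> lex_less x y \<or> x = y"

definition beta_shift :: "real \<Rightarrow> digits set" where
  "beta_shift \<beta> = {x. (\<forall>n. x n \<in> {0, 1}) \<and>
     (\<forall>n. lex_le ((shift ^^ n) x) (quasi_greedy_one \<beta>))}"

definition one_cylinder :: "real \<Rightarrow> digits set" where
  "one_cylinder \<beta> = {x \<in> beta_shift \<beta>. x 0 = 1}"

definition chi :: "real \<Rightarrow> digits \<Rightarrow> real" where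
  "chi \<beta> = indicator (one_cylinder \<beta>)"


section \<open>Functions of bounded variation and the transfer operator\<close>

text \<open>
  Functions on the beta-shift are total functions on \<^typ>\<open>digits\<close>.  Everything below depends
  only on their values on the beta-shift, and in the quotient space functions that agree there
  are identified, so the values elsewhere play no role.
\<close>

definition variation_sums :: "real \<Rightarrow> (digits \<Rightarrow> complex) \<Rightarrow> real set" where
  "variation_sums \<beta> f =
     {(\<Sum>i<n. cmod (f (c (Suc i)) - f (c i))) | (n :: nat) (c :: nat \<Rightarrow> digits).
        (\<forall>i\<le>n. c i \<in> beta_shift \<beta>) \<and> (\<forall>i<n. lex_less (c i) (c (Suc i))) \<and>
        c 0 = (\<lambda>_. 0) \<and> c n = quasi_greedy_one \<beta>}"

definition BV :: "real \<Rightarrow> (digits \<Rightarrow> complex) set" where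
  "BV \<beta> = {f. bdd_above (variation_sums \<beta> f)}"

definition bv_norm :: "real \<Rightarrow> (digits \<Rightarrow> complex) \<Rightarrow> real" where
  "bv_norm \<beta> f = (SUP x\<in>beta_shift \<beta>. cmod (f x)) + Sup (variation_sums \<beta> f)"

definition BV_null :: "real \<Rightarrow> (digits \<Rightarrow> complex) set" where
  "BV_null \<beta> = {f \<in> BV \<beta>. countable {x \<in> beta_shift \<beta>. f x \<noteq> 0}}"

definition BV_rel :: "real \<Rightarrow> ((digits \<Rightarrow> complex) \<times> (digits \<Rightarrow> complex)) set" where
  "BV_rel \<beta> = {(f, g). f \<in> BV \<beta> \<and> g \<in> BV \<beta> \<and> (\<lambda>x. f x - g x) \<in> BV_null \<beta>}"

definition BV_class :: "real \<Rightarrow> (digits \<Rightarrow> complex) \<Rightarrow> (digits \<Rightarrow> complex) set" where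
  "BV_class \<beta> f = BV_rel \<beta> `` {f}"

definition BV_quotient :: "real \<Rightarrow> (digits \<Rightarrow> complex) set set" where
  "BV_quotient \<beta> = BV \<beta> // BV_rel \<beta>"

definition class_diff ::
    "(digits \<Rightarrow> complex) set \<Rightarrow> (digits \<Rightarrow> complex) set \<Rightarrow> (digits \<Rightarrow> complex) set" where
  "class_diff c d = {(\<lambda>x. f x - g x) | f g. f \<in> c \<and> g \<in> d}"

definition quotient_norm :: "real \<Rightarrow> (digits \<Rightarrow> complex) set \<Rightarrow> real" where
  "quotient_norm \<beta> c = (INF f\<in>c. bv_norm \<beta> f)"

text \<open>
  Intervals are the order-convex subsets.  The beta-shift is compact, hence order complete, so
  these are the same as the sets described by (open or closed) endpoints.
\<close>

definition shift_intervals :: "real \<Rightarrow> digits set set" where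
  "shift_intervals \<beta> = {I. I \<subseteq> beta_shift \<beta> \<and>
     (\<forall>x\<in>I. \<forall>y\<in>I. \<forall>z\<in>beta_shift \<beta>. lex_le x z \<and> lex_le z y \<longrightarrow> z \<in> I)}"

definition step_functions :: "real \<Rightarrow> (digits \<Rightarrow> complex) set" where
  "step_functions \<beta> =
     {(\<lambda>x. \<Sum>I\<in>S. a I * indicator I x) | (S :: digits set set) (a :: digits set \<Rightarrow> complex).
        finite S \<and> S \<subseteq> shift_intervals \<beta>}"

definition step_closure :: "real \<Rightarrow> (digits \<Rightarrow> complex) set set" where
  "step_closure \<beta> = {c \<in> BV_quotient \<beta>.
     \<forall>e>0. \<exists>s\<in>step_functions \<beta>. quotient_norm \<beta> (class_diff c (BV_class \<beta> s)) < e}"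

definition transfer :: "real \<Rightarrow> real \<Rightarrow> (digits \<Rightarrow> complex) \<Rightarrow> digits \<Rightarrow> complex" where
  "transfer \<beta> t f x =
     (\<Sum>y\<in>{y \<in> beta_shift \<beta>. shift y = x}. of_real (exp (t * chi \<beta> y)) * f y)"

definition transfer_class ::
    "real \<Rightarrow> real \<Rightarrow> (digits \<Rightarrow> complex) set \<Rightarrow> (digits \<Rightarrow> complex) set" where
  "transfer_class \<beta> t c = (\<Union>f\<in>c. BV_class \<beta> (transfer \<beta> t f))"

definition scale_class ::
    "real \<Rightarrow> complex \<Rightarrow> (digits \<Rightarrow> complex) set \<Rightarrow> (digits \<Rightarrow> complex) set" where
  "scale_class \<beta> z c = (\<Union>f\<in>c. BV_class \<beta> (\<lambda>x. z * f x))"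

definition is_eigenvalue :: "real \<Rightarrow> real \<Rightarrow> complex \<Rightarrow> bool" where
  "is_eigenvalue \<beta> t z \<longleftrightarrow>
     (\<exists>c\<in>step_closure \<beta>. c \<noteq> BV_class \<beta> (\<lambda>_. 0) \<and> transfer_class \<beta> t c = scale_class \<beta> z c)"

definition is_leading_eigenvalue :: "real \<Rightarrow> real \<Rightarrow> complex \<Rightarrow> bool" where
  "is_leading_eigenvalue \<beta> t z \<longleftrightarrow>
     is_eigenvalue \<beta> t z \<and> (\<forall>w. is_eigenvalue \<beta> t w \<and> w \<noteq> z \<longrightarrow> cmod w < cmod z)"

definition leading_eigenvalue :: "real \<Rightarrow> real \<Rightarrow> real" where
  "leading_eigenvalue \<beta> t = (THE l. is_leading_eigenvalue \<beta> t (complex_of_real l))"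


section \<open>Pressure, entropy and equilibrium states\<close>

definition cylinders :: "real \<Rightarrow> nat \<Rightarrow> digits set set" where
  "cylinders \<beta> n = (\<lambda>w. {x \<in> beta_shift \<beta>. \<forall>i<n. x i = w i}) ` beta_shift \<beta>"

definition pressure :: "real \<Rightarrow> (digits \<Rightarrow> real) \<Rightarrow> real" where
  "pressure \<beta> \<phi> =
     lim (\<lambda>n. ln (\<Sum>A\<in>cylinders \<beta> n. exp (SUP x\<in>A. \<Sum>i<n. \<phi> ((shift ^^ i) x))) / real n)"

definition invariant_measures :: "real \<Rightarrow> digits measure set" where
  "invariant_measures \<beta> = {m. prob_space m \<and> sets m = sets (restrict_space borel (beta_shift \<beta>)) \<and>
     shift \<in> measurable m m \<and> distr m m shift = m}"

definition finite_partitions :: "'a measure \<Rightarrow> 'a set set set" where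
  "finite_partitions m = {\<xi>. finite \<xi> \<and> \<xi> \<subseteq> sets m \<and> partition_on (space m) \<xi>}"

definition partition_entropy :: "'a measure \<Rightarrow> 'a set set \<Rightarrow> real" where
  "partition_entropy m \<xi> = - (\<Sum>A\<in>\<xi>. measure m A * ln (measure m A))"

text \<open>
  The join of the preimages of \<open>\<xi>\<close> under the first \<open>n\<close> iterates of \<open>T\<close>.  It may contain the
  empty set, which contributes nothing to the entropy because \<open>0 * ln 0 = 0\<close>.
\<close>

definition iterated_join :: "'a measure \<Rightarrow> ('a \<Rightarrow> 'a) \<Rightarrow> 'a set set \<Rightarrow> nat \<Rightarrow> 'a set set" where
  "iterated_join m T \<xi> n =
     (\<lambda>a. {x \<in> space m. \<forall>i<n. (T ^^ i) x \<in> a i}) ` ({..<n} \<rightarrow>\<^sub>E \<xi>)"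

text \<open>Kolmogorov--Sinai entropy.\<close>

definition metric_entropy :: "'a measure \<Rightarrow> ('a \<Rightarrow> 'a) \<Rightarrow> ereal" where
  "metric_entropy m T =
     (SUP \<xi>\<in>finite_partitions m.
        ereal (lim (\<lambda>n. partition_entropy m (iterated_join m T \<xi> n) / real n)))"

definition free_energy :: "(digits \<Rightarrow> real) \<Rightarrow> digits measure \<Rightarrow> ereal" where
  "free_energy \<phi> m = metric_entropy m shift + ereal (\<integral>x. \<phi> x \<partial>m)"

definition is_equilibrium_state :: "real \<Rightarrow> (digits \<Rightarrow> real) \<Rightarrow> digits measure \<Rightarrow> bool" where
  "is_equilibrium_state \<beta> \<phi> m \<longleftrightarrow> m \<in> invariant_measures \<beta> \<and>
     free_energy \<phi> m = (SUP m'\<in>invariant_measures \<beta>. free_energy \<phi> m')"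

definition pressure_fun :: "real \<Rightarrow> real \<Rightarrow> real" where
  "pressure_fun \<beta> t = pressure \<beta> (\<lambda>x. t * chi \<beta> x)"

definition alpha :: "real \<Rightarrow> real \<Rightarrow> real" where
  "alpha \<beta> t = deriv (pressure_fun \<beta>) t"

definition max_frequency :: "real \<Rightarrow> real" where
  "max_frequency \<beta> = (SUP m\<in>invariant_measures \<beta>. \<integral>x. chi \<beta> x \<partial>m)"

definition alpha_inverse :: "real \<Rightarrow> real \<Rightarrow> real" where
  "alpha_inverse \<beta> p = (THE t. alpha \<beta> t = p)"


section \<open>Level sets, Hausdorff dimension and real analyticity\<close>

definition level_set :: "real \<Rightarrow> real \<Rightarrow> digits set" where
  "level_set \<beta> a = {x \<in> beta_shift \<beta>. (\<lambda>n. (\<Sum>i<n. real (x i)) / real n) \<longlonglongrightarrow> a}"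

definition beta_dist :: "real \<Rightarrow> digits \<Rightarrow> digits \<Rightarrow> real" where
  "beta_dist \<beta> x y = (if x = y then 0 else \<beta> powr (- real (LEAST k. x k \<noteq> y k)))"

definition diam :: "('a \<Rightarrow> 'a \<Rightarrow> real) \<Rightarrow> 'a set \<Rightarrow> ennreal" where
  "diam d U = (SUP x\<in>U. SUP y\<in>U. ennreal (d x y))"

text \<open>
  The metric is passed explicitly because the library's metric on \<^typ>\<open>nat \<Rightarrow> nat\<close> is a
  different one.
\<close>

definition hausdorff_premeasure ::
    "('a \<Rightarrow> 'a \<Rightarrow> real) \<Rightarrow> real \<Rightarrow> real \<Rightarrow> 'a set \<Rightarrow> ennreal" where
  "hausdorff_premeasure d s \<delta> A =
     (INF U\<in>{U :: nat \<Rightarrow> 'a set. A \<subseteq> (\<Union>i. U i) \<and> (\<forall>i. diam d (U i) \<le> ennreal \<delta>)}.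
        \<Sum>i. ennreal (enn2real (diam d (U i)) powr s))"

definition hausdorff_measure :: "('a \<Rightarrow> 'a \<Rightarrow> real) \<Rightarrow> real \<Rightarrow> 'a set \<Rightarrow> ennreal" where
  "hausdorff_measure d s A = (SUP \<delta>\<in>{0<..}. hausdorff_premeasure d s \<delta> A)"

text \<open>
  The infimum runs over positive \<open>s\<close> only, which does not change its value and avoids the
  convention \<open>0 powr 0 = 0\<close>.
\<close>

definition hausdorff_dim :: "('a \<Rightarrow> 'a \<Rightarrow> real) \<Rightarrow> 'a set \<Rightarrow> ennreal" where
  "hausdorff_dim d A = (INF s\<in>{s. 0 < s \<and> hausdorff_measure d s A = 0}. ennreal s)"

definition real_analytic_on :: "(real \<Rightarrow> real) \<Rightarrow> real set \<Rightarrow> bool" where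
  "real_analytic_on f S \<longleftrightarrow>
     (\<forall>x\<in>S. \<exists>r>0. \<exists>a. \<forall>y. \<bar>y - x\<bar> < r \<longrightarrow> (\<lambda>n. a n * (y - x) ^ n) sums f y)"

end

theory Submission
  imports Defs "HOL-Complex_Analysis.Complex_Analysis"
begin

text \<open>
  Everything is read off the orbit of the quasi-greedy expansion \<open>q\<close> of 1.  The cylinder weights
  of the transfer operator along \<open>q\<close> form a probability sequence exactly when \<open>z = 1 / \<lambda>\<^sub>t\<close>, and
  the iterates of the constant function then satisfy a renewal equation.  The renewal theorem yields a positive
  eigenfunction and uniform convergence of the normalised iterates on indicators of intervals, which
  excludes other eigenvalues of modulus at least \<open>\<lambda>\<^sub>t\<close>.  The equation \<open>\<phi>\<^sub>t(e\<^sup>-\<^sup>P) = 1\<close> is solved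
  analytically for \<open>P\<close>, and differentiating it twice gives \<open>P' > 0\<close> and \<open>P'' > 0\<close>.

  The equilibrium state is built from a piecewise linear interval map with slopes \<open>\<lambda>\<^sub>t\<close> and
  \<open>\<lambda>\<^sub>t e\<^sup>-\<^sup>t\<close>.  It has the Gibbs upper bound, so it attains the supremum in the variational inequality,
  and comparing any equilibrium state with perturbed potentials gives uniqueness.  The Gibbs bound
  together with a large deviation estimate makes it a mass distribution on the level set, and the count of cylinders with
  prescribed digit frequency gives the matching upper bound \<open>(P(t) - t \<alpha>) / ln \<beta>\<close> for the dimension at
  \<open>\<alpha> = P'(t)\<close>.  This is the infimum of the affine functions \<open>\<alpha> \<mapsto> (P(s) - s \<alpha>) / ln \<beta>\<close>, hence
  concave.
\<close>

section \<open>The quasi-greedy expansion\<close>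

text \<open>The beta-shift need not be of finite type, so no finite transition matrix is available.
  Its substitute is the countable family \<open>u j\<close>, the indicators of the points below
  \<open>qs j\<close>: the operator maps each of them into the span of \<open>u 0\<close> and
  \<open>u (Suc j)\<close>, which is where the renewal structure comes from. The obstacle is
  analytic: a power series with nonnegative coefficients may stay below 1 up to its radius of
  convergence, and then the equation for the eigenvalue would have no solution. Room is gained from
  the fact that lowering digits keeps a sequence admissible: below a word with k ones there are 2^k
  admissible words, of total weight (1+e^t)^k by the binomial theorem. Bounded partition functions
  therefore bound (1+e^t)^k z^n, and for t > 0 the number e^t is a power of 1+e^t with exponent
  below 1, so the single weights e^(tk) z^n decay geometrically, uniformly over words. This estimate
  (\<open>decay\<close>) supplies the summable tails for the renewal theorem, the smallness of the
  one cylinder cut by the end of an interval, and the complex neighbourhood on which the implicit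
  equation makes sense.\<close>

lemma shift_pow: "(shift ^^ n) x = (\<lambda>i. x (i + n))"
  by (induction n arbitrary: x) (auto simp: shift_def fun_eq_iff)

text \<open>The left-limit version of \<open>beta_map\<close>: rounding up and subtracting 1 gives
  values in (0,1], so where \<beta>x is an integer the smaller digit is taken and the value is 1
  instead of 0.\<close>

definition qmap :: "real \<Rightarrow> real \<Rightarrow> real" where
  "qmap \<beta> x = \<beta> * x - (of_int \<lceil>\<beta> * x\<rceil> - 1)"

definition qdigits :: "real \<Rightarrow> real \<Rightarrow> digits" where
  "qdigits \<beta> x = (\<lambda>n. nat (\<lceil>\<beta> * (qmap \<beta> ^^ n) x\<rceil> - 1))"

lemma qmap_range: "0 < qmap \<beta> x \<and> qmap \<beta> x \<le> 1"
  unfolding qmap_def using ceiling_correct[of "\<beta> * x"] by linarith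

lemma qmap_pow_range:
  assumes "0 < x" "x \<le> 1"
  shows "0 < (qmap \<beta> ^^ n) x \<and> (qmap \<beta> ^^ n) x \<le> 1"
  by (cases n) (use assms qmap_range in auto)

lemma filterlim_mult_at_left:
  fixes a c :: real
  assumes "0 < c" "filterlim f (at_left a) F"
  shows "filterlim (\<lambda>x. c * f x) (at_left (c * a)) F"
proof -
  have "((\<lambda>x. c * f x) \<longlongrightarrow> c * a) F"
    using assms(2) by (intro tendsto_intros) (auto simp: filterlim_at)
  moreover have "eventually (\<lambda>x. f x < a) F"
    using assms(2) by (auto simp: filterlim_at elim: eventually_mono)
  hence "eventually (\<lambda>x. c * f x < c * a) F"
    by eventually_elim (use assms(1) in auto)
  ultimately show ?thesis
    by (auto simp: filterlim_at elim: eventually_mono)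
qed

lemma floor_at_left: "eventually (\<lambda>y::real. \<lfloor>y\<rfloor> = \<lceil>a\<rceil> - 1) (at_left a)"
proof -
  have "eventually (\<lambda>y. y \<in> {of_int (\<lceil>a\<rceil> - 1)<..<a}) (at_left a)"
    by (rule eventually_at_left_real) (use ceiling_correct[of a] in auto)
  thus ?thesis
  proof eventually_elim
    case (elim y)
    thus ?case using ceiling_correct[of a] by (intro floor_unique; simp; linarith)
  qed
qed

text \<open>Just below a point the floor is its ceiling minus 1, and each branch is increasing and
  affine. The limit is taken in \<open>at_left\<close> because the orbit must stay strictly below
  its limit point for the next floor to be determined.\<close>

lemma beta_orbit_at_left:
  assumes "1 < \<beta>"
  shows "filterlim (beta_map \<beta> ^^ n) (at_left ((qmap \<beta> ^^ n) 1)) (at_left 1) \<and>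
         eventually (\<lambda>y. greedy \<beta> y n = qdigits \<beta> 1 n) (at_left 1)"
proof (induction n)
  have step: "eventually (\<lambda>y. \<lfloor>\<beta> * (beta_map \<beta> ^^ n) y\<rfloor> = \<lceil>\<beta> * (qmap \<beta> ^^ n) 1\<rceil> - 1) (at_left 1)"
    if "filterlim (beta_map \<beta> ^^ n) (at_left ((qmap \<beta> ^^ n) 1)) (at_left 1)" for n
    using filterlim_mult_at_left[OF _ that, of \<beta>] floor_at_left assms
    by (auto simp: filterlim_iff)
  {
    case 0
    show ?case using step[of 0]
      by (auto simp: greedy_def qdigits_def filterlim_ident id_def elim!: eventually_mono)
  next
    case (Suc n)
    hence lim: "filterlim (beta_map \<beta> ^^ n) (at_left ((qmap \<beta> ^^ n) 1)) (at_left 1)" by blast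
    have m: "filterlim (\<lambda>y. \<beta> * (beta_map \<beta> ^^ n) y) (at_left (\<beta> * (qmap \<beta> ^^ n) 1)) (at_left 1)"
      by (rule filterlim_mult_at_left) (use assms lim in auto)
    let ?c = "real_of_int (\<lceil>\<beta> * (qmap \<beta> ^^ n) 1\<rceil> - 1)"
    have "filterlim (\<lambda>y. \<beta> * (beta_map \<beta> ^^ n) y - ?c) (at_left (\<beta> * (qmap \<beta> ^^ n) 1 - ?c)) (at_left 1)"
      using m unfolding filterlim_at
      by (auto intro!: tendsto_intros elim: eventually_mono)
    moreover have "eventually (\<lambda>y. \<beta> * (beta_map \<beta> ^^ n) y - ?c = (beta_map \<beta> ^^ Suc n) y) (at_left 1)"
      using step[OF lim] by eventually_elim (simp add: beta_map_def)
    ultimately have F: "filterlim (beta_map \<beta> ^^ Suc n) (at_left ((qmap \<beta> ^^ Suc n) 1)) (at_left 1)"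
      by (subst (asm) filterlim_cong[OF refl refl]) (auto simp: qmap_def)
    show ?case using F step[OF F]
      by (auto simp: greedy_def qdigits_def o_def elim!: eventually_mono)
  }
qed

text \<open>The factors of the product are discrete, so coordinatewise convergence means that each
  digit is eventually constant.\<close>

lemma tendsto_digits_iff:
  fixes f :: "'a \<Rightarrow> digits"
  shows "(f \<longlongrightarrow> g) F \<longleftrightarrow> (\<forall>n. eventually (\<lambda>x. f x n = g n) F)"
proof -
  have "(f \<longlongrightarrow> g) F \<longleftrightarrow> (\<forall>n. ((\<lambda>x. f x n) \<longlongrightarrow> g n) F)"
    using limitin_componentwise[of "\<lambda>_. euclidean" UNIV f g F]
    by (simp add: euclidean_product_topology limitin_canonical_iff)
  thus ?thesis by (simp add: tendsto_discrete)
qed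

lemma quasi_greedy_one_eq:
  assumes "1 < \<beta>"
  shows "quasi_greedy_one \<beta> = qdigits \<beta> 1"
  unfolding quasi_greedy_one_def
proof (rule the_equality)
  show lim: "(greedy \<beta> \<longlongrightarrow> qdigits \<beta> 1) (at_left 1)"
    using beta_orbit_at_left[OF assms] by (auto simp: tendsto_digits_iff)
  fix q assume "(greedy \<beta> \<longlongrightarrow> q) (at_left 1)"
  hence A: "eventually (\<lambda>x. greedy \<beta> x n = q n) (at_left 1)" for n
    by (simp add: tendsto_digits_iff)
  have B: "eventually (\<lambda>x. greedy \<beta> x n = qdigits \<beta> 1 n) (at_left 1)" for n
    using lim by (simp add: tendsto_digits_iff)
  have "eventually (\<lambda>x::real. q n = qdigits \<beta> 1 n) (at_left 1)" for n
    using A[of n] B[of n] by eventually_elim simp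
  thus "q = qdigits \<beta> 1" by (auto simp: fun_eq_iff)
qed

lemma qdigits_shift: "(shift ^^ n) (qdigits \<beta> x) = qdigits \<beta> ((qmap \<beta> ^^ n) x)"
  by (auto simp: shift_pow qdigits_def fun_eq_iff funpow_add)

lemma qdigits_real:
  assumes "0 < \<beta>" "0 < x" "x \<le> 1"
  shows "real (qdigits \<beta> x n) = \<beta> * (qmap \<beta> ^^ n) x - (qmap \<beta> ^^ Suc n) x"
proof -
  have "0 < \<beta> * (qmap \<beta> ^^ n) x" using qmap_pow_range[OF assms(2,3)] assms(1) by simp
  hence "\<lceil>\<beta> * (qmap \<beta> ^^ n) x\<rceil> \<ge> 1" by linarith
  thus ?thesis by (simp add: qdigits_def qmap_def)
qed

text \<open>While the digits agree, both orbits undergo the same increasing affine map, so their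
  order survives until the first disagreement and decides it. As the orbit of 1 never exceeds 1, no
  shift of \<open>q\<close> exceeds \<open>q\<close>.\<close>

lemma qdigits_mono:
  assumes "0 < \<beta>" "x \<le> y" "0 < x" "y \<le> 1"
  shows "lex_le (qdigits \<beta> x) (qdigits \<beta> y)"
proof (cases "qdigits \<beta> x = qdigits \<beta> y")
  case False
  define n where "n = (LEAST n. qdigits \<beta> x n \<noteq> qdigits \<beta> y n)"
  have n: "qdigits \<beta> x n \<noteq> qdigits \<beta> y n"
    unfolding n_def by (rule LeastI_ex) (use False in blast)
  have lt: "qdigits \<beta> x k = qdigits \<beta> y k" if "k < n" for k
    using that not_less_Least unfolding n_def by blast
  have "(qmap \<beta> ^^ k) x \<le> (qmap \<beta> ^^ k) y" if "k \<le> n" for k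
    using that
  proof (induction k)
    case (Suc k)
    have "real (qdigits \<beta> x k) = real (qdigits \<beta> y k)" using lt[of k] Suc.prems by simp
    hence "\<beta> * (qmap \<beta> ^^ k) x - (qmap \<beta> ^^ Suc k) x = \<beta> * (qmap \<beta> ^^ k) y - (qmap \<beta> ^^ Suc k) y"
      using qdigits_real[of \<beta> x k] qdigits_real[of \<beta> y k] assms by linarith
    moreover have "\<beta> * (qmap \<beta> ^^ k) x \<le> \<beta> * (qmap \<beta> ^^ k) y"
      using Suc assms by auto
    ultimately show ?case by linarith
  qed (use assms in auto)
  from this[of n] have "qdigits \<beta> x n \<le> qdigits \<beta> y n"
    unfolding qdigits_def using assms by (intro nat_mono diff_right_mono ceiling_mono mult_left_mono) auto
  thus ?thesis using n lt by (auto simp: lex_le_def lex_less_def intro!: exI[of _ n])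
qed (auto simp: lex_le_def)

section \<open>Lexicographically maximal sequences\<close>

lemma lex_total: "lex_less x y \<or> x = y \<or> lex_less y x"
proof (cases "x = y")
  case False
  define n where "n = (LEAST n. x n \<noteq> y n)"
  have n: "x n \<noteq> y n"
    unfolding n_def by (rule LeastI_ex) (use False in blast)
  have lt: "x k = y k" if "k < n" for k
    using that not_less_Least unfolding n_def by blast
  show ?thesis using n lt unfolding lex_less_def by (metis linorder_neqE_nat)
qed auto

lemma lex_less_irrefl [simp]: "\<not> lex_less x x"
  by (auto simp: lex_less_def)

lemma lex_less_trans: "lex_less x y \<Longrightarrow> lex_less y z \<Longrightarrow> lex_less x z"
  unfolding lex_less_def
  by (metis (no_types, lifting) dual_order.strict_trans linorder_neqE_nat)

lemma lex_le_trans: "lex_le x y \<Longrightarrow> lex_le y z \<Longrightarrow> lex_le x z"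
  unfolding lex_le_def using lex_less_trans by blast

lemma lex_le_refl [simp]: "lex_le x x"
  by (simp add: lex_le_def)

lemma lex_less_le_trans: "lex_less x y \<Longrightarrow> lex_le y z \<Longrightarrow> lex_less x z"
  unfolding lex_le_def using lex_less_trans by blast

lemma lex_less_iff_not_le: "lex_less x y \<longleftrightarrow> \<not> lex_le y x"
  unfolding lex_le_def using lex_total lex_less_trans lex_less_irrefl by blast

lemma pointwise_le_imp_lex_le: "(\<And>i. x i \<le> y i) \<Longrightarrow> lex_le x y"
  unfolding lex_le_def using lex_total[of x y]
  by (metis lex_less_def linorder_not_less)

definition cons :: "nat \<Rightarrow> digits \<Rightarrow> digits" where
  "cons a x = case_nat a x"

lemma cons_0 [simp]: "cons a x 0 = a" and cons_Suc [simp]: "cons a x (Suc n) = x n"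
  by (auto simp: cons_def)

lemma shift_cons [simp]: "shift (cons a x) = x"
  by (auto simp: shift_def)

lemma cons_shift: "cons (x 0) (shift x) = x"
  by (auto simp: shift_def cons_def fun_eq_iff split: nat.split)

lemma cons_eq_iff [simp]: "cons a x = cons b y \<longleftrightarrow> a = b \<and> x = y"
  by (metis cons_0 shift_cons)

lemma lex_less_cons: "lex_less (cons a x) y \<longleftrightarrow> a < y 0 \<or> a = y 0 \<and> lex_less x (shift y)"
  (is "?l \<longleftrightarrow> ?r")
proof
  assume ?l
  then obtain n where n: "\<forall>k<n. cons a x k = y k" "cons a x n < y n" by (auto simp: lex_less_def)
  show ?r
  proof (cases n)
    case (Suc m)
    have "a = y 0" using n(1) Suc by (metis cons_0 zero_less_Suc)
    moreover have "lex_less x (shift y)"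
      unfolding lex_less_def shift_def using n Suc by (intro exI[of _ m]) force
    ultimately show ?thesis by simp
  qed (use n in auto)
next
  assume ?r
  thus ?l
  proof (elim disjE conjE)
    assume "a < y 0" thus ?l by (auto simp: lex_less_def intro!: exI[of _ 0])
  next
    assume a: "a = y 0" "lex_less x (shift y)"
    then obtain n where "\<forall>k<n. x k = y (Suc k)" "x n < y (Suc n)" by (auto simp: lex_less_def shift_def)
    thus ?l unfolding lex_less_def using a(1)
      by (intro exI[of _ "Suc n"]) (auto simp: cons_def split: nat.split)
  qed
qed

lemma lex_le_cons: "lex_le (cons a x) y \<longleftrightarrow> a < y 0 \<or> a = y 0 \<and> lex_le x (shift y)"
  unfolding lex_le_def lex_less_cons using cons_shift[of y] cons_eq_iff[of a x "y 0" "shift y"] by metis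

section \<open>The beta-shift: combinatorics of sequences dominated by \<open>q\<close>\<close>

locale beta_setting =
  fixes \<beta> :: real
  assumes beta1: "1 < \<beta>" and beta2: "\<beta> \<le> 2"
begin

definition q :: digits where "q = quasi_greedy_one \<beta>"
abbreviation X :: "digits set" where "X \<equiv> beta_shift \<beta>"
abbreviation zero :: digits where "zero \<equiv> (\<lambda>_. 0)"
definition qs :: "nat \<Rightarrow> digits" where "qs j = (shift ^^ j) q"

lemma q_eq: "q = qdigits \<beta> 1"
  using quasi_greedy_one_eq[OF beta1] by (simp add: q_def)

lemma q01: "q n = 0 \<or> q n = 1"
proof -
  have "\<beta> * (qmap \<beta> ^^ n) 1 \<le> 2 * 1"
    using qmap_pow_range[of 1 n \<beta>] beta1 beta2 by (intro mult_mono) auto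
  hence "\<lceil>\<beta> * (qmap \<beta> ^^ n) 1\<rceil> \<le> 2" by (simp add: ceiling_le_iff)
  hence "q n \<le> 1" unfolding q_eq qdigits_def by linarith
  thus ?thesis by linarith
qed

lemma q_le1: "q n \<le> 1"
  using q01[of n] by auto

lemma q0: "q 0 = 1"
proof -
  have "\<lceil>\<beta>\<rceil> = 2" using beta1 beta2 by linarith
  thus ?thesis by (simp add: q_eq qdigits_def)
qed

lemma qs_le: "lex_le (qs j) q"
  unfolding qs_def q_eq qdigits_shift
  using qmap_pow_range[of 1 j \<beta>] beta1 by (intro qdigits_mono) auto

lemma qs_0: "qs 0 = q" by (simp add: qs_def)
lemma qs_app: "qs j i = q (i + j)" by (simp add: qs_def shift_pow)
lemma shift_qs: "shift (qs j) = qs (Suc j)" by (simp add: qs_def)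

lemma q_partial: "(\<Sum>i<n. real (q i) / \<beta> ^ Suc i) = 1 - (qmap \<beta> ^^ n) 1 / \<beta> ^ n"
proof (induction n)
  case (Suc n)
  have "real (q n) / \<beta> ^ Suc n = (qmap \<beta> ^^ n) 1 / \<beta> ^ n - (qmap \<beta> ^^ Suc n) 1 / \<beta> ^ Suc n"
    unfolding q_eq using qdigits_real[of \<beta> 1 n] beta1 by (simp add: diff_divide_distrib)
  with Suc show ?case by simp
qed simp

text \<open>At t = 0 this is the normalisation equation at z = 1/\<beta>; it later identifies
  \<open>Pr 0\<close> with ln \<beta>.\<close>

lemma q_sums: "(\<lambda>n. real (q n) / \<beta> ^ Suc n) sums 1"
proof -
  have "(\<lambda>n. (1/\<beta>)^n) \<longlonglongrightarrow> 0" using beta1 by (intro LIMSEQ_power_zero) auto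
  hence "(\<lambda>n. (qmap \<beta> ^^ n) 1 / \<beta> ^ n) \<longlonglongrightarrow> 0"
  proof (rule tendsto_sandwich[rotated 3])
    show "\<forall>\<^sub>F n in sequentially. 0 \<le> (qmap \<beta> ^^ n) 1 / \<beta> ^ n"
      using qmap_pow_range[of 1 _ \<beta>] beta1 by (auto intro!: always_eventually simp: less_imp_le)
    show "\<forall>\<^sub>F n in sequentially. (qmap \<beta> ^^ n) 1 / \<beta> ^ n \<le> (1/\<beta>)^n"
      using qmap_pow_range[of 1 _ \<beta>] beta1
      by (auto intro!: always_eventually simp: divide_simps)
  qed auto
  hence "(\<lambda>n. 1 - (qmap \<beta> ^^ n) 1 / \<beta> ^ n) \<longlonglongrightarrow> 1 - 0" by (intro tendsto_intros)
  thus ?thesis unfolding sums_def q_partial by simp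
qed

text \<open>After the last digit 1 the orbit would be multiplied by \<beta> at each step and leave
  (0,1].\<close>

lemma q_inf: "\<exists>m\<ge>n. q m = 1"
proof (rule ccontr)
  assume "\<not> ?thesis"
  hence z: "q m = 0" if "m \<ge> n" for m using q01 that by blast
  have pos: "(qmap \<beta> ^^ n) 1 > 0" using qmap_pow_range[of 1 n \<beta>] by auto
  have e: "(qmap \<beta> ^^ (n + k)) 1 = \<beta> ^ k * (qmap \<beta> ^^ n) 1" for k
  proof (induction k)
    case (Suc k)
    have "\<beta> * (qmap \<beta> ^^ (n+k)) 1 = (qmap \<beta> ^^ Suc (n+k)) 1"
      using qdigits_real[of \<beta> 1 "n+k"] z[of "n+k"] beta1 by (simp add: q_eq)
    thus ?case using Suc by simp
  qed simp
  obtain k where "1 / (qmap \<beta> ^^ n) 1 < \<beta> ^ k" using real_arch_pow[OF beta1] by blast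
  hence "1 < (qmap \<beta> ^^ (n+k)) 1" using pos e by (simp add: divide_simps)
  thus False using qmap_pow_range[of 1 "n+k" \<beta>] by auto
qed

lemma in_X_iff: "x \<in> X \<longleftrightarrow> (\<forall>n. x n \<le> 1) \<and> (\<forall>n. lex_le ((shift ^^ n) x) q)"
proof -
  have "x n \<in> {0,1} \<longleftrightarrow> x n \<le> 1" for n by auto
  thus ?thesis by (auto simp: beta_shift_def q_def)
qed

lemma X_le1: "x \<in> X \<Longrightarrow> x n \<le> 1" by (auto simp: in_X_iff)
lemma X_01: "x \<in> X \<Longrightarrow> x n = 0 \<or> x n = 1" using X_le1[of x n] by auto
lemma X_le_q: "x \<in> X \<Longrightarrow> lex_le x q" unfolding in_X_iff by (metis funpow_0)

lemma q_in_X: "q \<in> X"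
  using q_le1 qs_le by (auto simp: in_X_iff qs_def)

lemma shift_in_X: "x \<in> X \<Longrightarrow> shift x \<in> X"
  unfolding in_X_iff by (metis funpow_Suc_right o_apply shift_def)

lemma shift_pow_in_X: "x \<in> X \<Longrightarrow> (shift ^^ n) x \<in> X"
  by (induction n) (auto intro: shift_in_X)

lemma qs_in_X: "qs j \<in> X"
  unfolding qs_def by (intro shift_pow_in_X q_in_X)

text \<open>Lowering digits lowers every shift in the lexicographic order. This gives the
  admissibility of zero-padded words, the lower bound \<open>L_pow_one_ge\<close> and the
  uncountability of the space.\<close>

lemma hereditary:
  assumes "x \<in> X" "\<And>i. y i \<le> x i" shows "y \<in> X"
  unfolding in_X_iff
proof (intro conjI allI)
  show "y n \<le> 1" for n using assms X_le1 order_trans by blast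
  show "lex_le ((shift ^^ n) y) q" for n
  proof (rule lex_le_trans)
    show "lex_le ((shift ^^ n) y) ((shift ^^ n) x)"
      using assms(2) by (intro pointwise_le_imp_lex_le) (simp add: shift_pow)
    show "lex_le ((shift ^^ n) x) q" using assms(1) in_X_iff by blast
  qed
qed

lemma zero_in_X: "zero \<in> X" by (rule hereditary[OF q_in_X]) auto

text \<open>Prepending 0 creates no violation because \<open>q\<close> begins with 1; prepending 1
  ties with that first digit, so the comparison passes on to \<open>qs 1\<close>.\<close>

lemma cons_in_X_iff: "cons a x \<in> X \<longleftrightarrow> x \<in> X \<and> (a = 0 \<or> a = 1 \<and> lex_le x (qs 1))"
proof -
  have s: "(shift ^^ Suc n) (cons a x) = (shift ^^ n) x" for n
    by (auto simp: shift_pow shift_def fun_eq_iff)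
  have "cons a x \<in> X \<longleftrightarrow> a \<le> 1 \<and> x \<in> X \<and> lex_le (cons a x) q"
  proof
    assume "cons a x \<in> X" thus "a \<le> 1 \<and> x \<in> X \<and> lex_le (cons a x) q"
      using shift_in_X[of "cons a x"] X_le1[of "cons a x" 0] X_le_q by auto
  next
    assume A: "a \<le> 1 \<and> x \<in> X \<and> lex_le (cons a x) q"
    show "cons a x \<in> X" unfolding in_X_iff
    proof (intro conjI allI)
      show "cons a x n \<le> 1" for n using A X_le1 by (cases n) auto
      show "lex_le ((shift ^^ n) (cons a x)) q" for n
        using A s in_X_iff by (cases n) auto
    qed
  qed
  also have "\<dots> \<longleftrightarrow> x \<in> X \<and> (a = 0 \<or> a = 1 \<and> lex_le x (qs 1))"
    using q0 unfolding lex_le_cons qs_def by auto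
  finally show ?thesis .
qed

lemma preimage_eq:
  "{y \<in> X. shift y = x} = (if x \<notin> X then {} else if lex_le x (qs 1) then {cons 0 x, cons 1 x} else {cons 0 x})"
proof -
  have "{y \<in> X. shift y = x} = {cons a x |a. cons a x \<in> X}"
    by (auto, metis cons_shift)
  thus ?thesis by (auto simp: cons_in_X_iff)
qed

end

section \<open>The transfer operator and the renewal equation\<close>

text \<open>If \<open>p j\<close> is the probability of a waiting time \<open>Suc j\<close>, then
  \<open>renew p n\<close> is the probability of a renewal at time \<open>n\<close>.\<close>

fun renew :: "(nat \<Rightarrow> real) \<Rightarrow> nat \<Rightarrow> real" where
  "renew p 0 = 1"
| "renew p (Suc n) = (\<Sum>j\<le>n. p j * renew p (n - j))"

declare renew.simps(2) [simp del]

lemma renew_bounds: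
  assumes "\<And>n. 0 \<le> p n" "\<And>n. (\<Sum>j<n. p j) \<le> 1"
  shows "0 \<le> renew p n \<and> renew p n \<le> 1"
proof (induction n rule: less_induct)
  case (less n)
  show ?case
  proof (cases n)
    case (Suc m)
    have "(\<Sum>j\<le>m. p j * renew p (m - j)) \<le> (\<Sum>j\<le>m. p j * 1)"
      using less Suc assms(1) by (intro sum_mono mult_left_mono) auto
    also have "\<dots> \<le> 1" using assms(2)[of "Suc m"] by (simp add: lessThan_Suc_atMost)
    finally show ?thesis using less Suc assms(1)
      by (auto simp: renew.simps intro!: sum_nonneg mult_nonneg_nonneg)
  qed auto
qed

context beta_setting
begin

section \<open>Weighted transfer operators and the initial segments cut off by the orbit of
  \<open>q\<close>\<close>

definition tr :: "(digits \<Rightarrow> real) \<Rightarrow> (digits \<Rightarrow> real) \<Rightarrow> digits \<Rightarrow> real" where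
  "tr \<Phi> f x = (\<Sum>y\<in>{y \<in> X. shift y = x}. exp (\<Phi> y) * f y)"

definition chit :: "real \<Rightarrow> digits \<Rightarrow> real" where "chit t x = t * chi \<beta> x"
abbreviation L :: "real \<Rightarrow> (digits \<Rightarrow> real) \<Rightarrow> digits \<Rightarrow> real" where "L t \<equiv> tr (chit t)"

text \<open>With digits indexed from 0, \<open>p t z n\<close> is the term of index \<open>n + 1\<close> of the series \<open>\<phi>\<^sub>t(z)\<close>.\<close>

definition u :: "nat \<Rightarrow> digits \<Rightarrow> real" where "u j x = (if lex_le x (qs j) then 1 else 0)"
definition S :: "nat \<Rightarrow> digits \<Rightarrow> real" where "S n x = (\<Sum>i<n. real (x i))"
definition H :: "real \<Rightarrow> nat \<Rightarrow> real" where "H t n = exp (t * S n q)"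
definition c :: "real \<Rightarrow> real \<Rightarrow> nat \<Rightarrow> real" where "c t z n = H t n * z ^ n"
definition p :: "real \<Rightarrow> real \<Rightarrow> nat \<Rightarrow> real" where "p t z n = real (q n) * H t n * z ^ Suc n"

lemma chi_eq: "x \<in> X \<Longrightarrow> chi \<beta> x = real (x 0)"
  using X_01[of x 0] by (auto simp: chi_def one_cylinder_def indicator_def)

lemma u_0: "x \<in> X \<Longrightarrow> u 0 x = 1"
  using X_le_q by (simp add: u_def qs_0)

lemma u_range: "0 \<le> u j x \<and> u j x \<le> 1" by (simp add: u_def)

lemma tr_X: "x \<in> X \<Longrightarrow> tr \<Phi> f x =
    exp (\<Phi> (cons 0 x)) * f (cons 0 x) + (if lex_le x (qs 1) then exp (\<Phi> (cons 1 x)) * f (cons 1 x) else 0)"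
  unfolding tr_def preimage_eq by simp

lemma L_X: "x \<in> X \<Longrightarrow> L t f x = f (cons 0 x) + (if lex_le x (qs 1) then exp t * f (cons 1 x) else 0)"
  by (simp add: tr_X chit_def chi_eq cons_in_X_iff)

lemma tr_cong: "(\<And>x. x \<in> X \<Longrightarrow> f x = g x) \<Longrightarrow> tr \<Phi> f = tr \<Phi> g"
  unfolding tr_def by (intro ext sum.cong) auto

lemma tr_pow_cong: "(\<And>x. x \<in> X \<Longrightarrow> f x = g x) \<Longrightarrow> x \<in> X \<Longrightarrow> (tr \<Phi> ^^ n) f x = (tr \<Phi> ^^ n) g x"
proof (induction n arbitrary: x)
  case (Suc n)
  thus ?case using tr_cong[of "(tr \<Phi> ^^ n) f" "(tr \<Phi> ^^ n) g"] by simp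
qed auto

lemma tr_mono: "(\<And>x. x \<in> X \<Longrightarrow> f x \<le> g x) \<Longrightarrow> tr \<Phi> f x \<le> tr \<Phi> g x"
  unfolding tr_def by (intro sum_mono mult_left_mono) auto

lemma tr_pow_mono: "(\<And>x. x \<in> X \<Longrightarrow> f x \<le> g x) \<Longrightarrow> x \<in> X \<Longrightarrow> (tr \<Phi> ^^ n) f x \<le> (tr \<Phi> ^^ n) g x"
  by (induction n arbitrary: x) (auto intro: tr_mono)

lemma tr_add: "tr \<Phi> (\<lambda>x. f x + g x) = (\<lambda>x. tr \<Phi> f x + tr \<Phi> g x)"
  unfolding tr_def by (simp add: sum.distrib algebra_simps)

lemma tr_diff: "tr \<Phi> (\<lambda>x. f x - g x) = (\<lambda>x. tr \<Phi> f x - tr \<Phi> g x)"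
  unfolding tr_def by (simp add: sum_subtractf algebra_simps)

lemma tr_cmult: "tr \<Phi> (\<lambda>x. a * f x) = (\<lambda>x. a * tr \<Phi> f x)"
  unfolding tr_def by (simp add: sum_distrib_left algebra_simps)

lemma tr_sum: "tr \<Phi> (\<lambda>x. \<Sum>i\<in>I. f i x) = (\<lambda>x. \<Sum>i\<in>I. tr \<Phi> (f i) x)"
  unfolding tr_def by (simp add: sum_distrib_left) (intro ext sum.swap)

lemma tr_pow_add: "(tr \<Phi> ^^ n) (\<lambda>x. f x + g x) = (\<lambda>x. (tr \<Phi> ^^ n) f x + (tr \<Phi> ^^ n) g x)"
  by (induction n) (auto simp: tr_add)

lemma tr_pow_diff: "(tr \<Phi> ^^ n) (\<lambda>x. f x - g x) = (\<lambda>x. (tr \<Phi> ^^ n) f x - (tr \<Phi> ^^ n) g x)"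
  by (induction n) (auto simp: tr_diff)

lemma tr_pow_cmult: "(tr \<Phi> ^^ n) (\<lambda>x. a * f x) = (\<lambda>x. a * (tr \<Phi> ^^ n) f x)"
  by (induction n) (auto simp: tr_cmult)

lemma tr_pow_sum: "(tr \<Phi> ^^ n) (\<lambda>x. \<Sum>i\<in>I. f i x) = (\<lambda>x. \<Sum>i\<in>I. (tr \<Phi> ^^ n) (f i) x)"
  by (induction n) (auto simp: tr_sum)

lemma tr_pow_abs_le:
  assumes "\<And>x. x \<in> X \<Longrightarrow> \<bar>f x\<bar> \<le> g x" "x \<in> X"
  shows "\<bar>(tr \<Phi> ^^ n) f x\<bar> \<le> (tr \<Phi> ^^ n) g x"
proof -
  have "(tr \<Phi> ^^ n) f x \<le> (tr \<Phi> ^^ n) g x"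
    using assms by (intro tr_pow_mono) (auto simp: abs_le_iff)
  moreover have "(tr \<Phi> ^^ n) (\<lambda>x. (-1) * f x) x \<le> (tr \<Phi> ^^ n) g x"
    using assms by (intro tr_pow_mono) (auto simp: abs_le_iff)
  ultimately show ?thesis unfolding tr_pow_cmult by auto
qed

text \<open>If \<open>q j\<close> is 1, every point of the 0-branch lies below \<open>qs j\<close>,
  and a point of the 1-branch does so when its shift is below \<open>qs (Suc j)\<close>. If
  \<open>q j\<close> is 0, only the 0-branch can lie below, under the same condition on the shift.
  One formula covers both cases.\<close>

lemma L_u:
  assumes "x \<in> X"
  shows "L t (u j) x = real (q j) * u 0 x + exp (t * real (q j)) * u (Suc j) x"
proof -
  have q: "qs j 0 = q j" by (simp add: qs_app)
  have c0: "lex_le (cons 0 x) (qs j) \<longleftrightarrow> q j = 1 \<or> lex_le x (qs (Suc j))"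
    using q01[of j] by (auto simp: lex_le_cons q shift_qs)
  have c1: "lex_le (cons 1 x) (qs j) \<longleftrightarrow> q j = 1 \<and> lex_le x (qs (Suc j))"
    using q01[of j] by (auto simp: lex_le_cons q shift_qs)
  \<comment> \<open>After a digit 1 of \<open>q\<close>, lying below \<open>qs (Suc j)\<close>
    already makes the prepended 1 admissible, so the branch condition of \<open>L_X\<close> is
    absorbed.\<close>
  have "lex_le (qs (Suc j)) (qs 1)" if "q j = 1"
  proof -
    have "lex_le (cons 1 (qs (Suc j))) q"
      using qs_le[of j] that cons_shift[of "qs j"] by (simp add: q shift_qs)
    thus ?thesis by (simp add: lex_le_cons q0 qs_def)
  qed
  hence imp: "lex_le x (qs 1)" if "q j = 1" "lex_le x (qs (Suc j))"
    using that lex_le_trans by blast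
  show ?thesis
    using q01[of j] imp unfolding L_X[OF assms] u_0[OF assms]
    unfolding u_def c0 c1 by auto
qed

lemma S_Suc: "S (Suc n) x = S n x + real (x n)" by (simp add: S_def)
lemma S_0 [simp]: "S 0 x = 0" by (simp add: S_def)
lemma S_nonneg: "0 \<le> S n x" by (simp add: S_def sum_nonneg)
lemma S_le: "x \<in> X \<Longrightarrow> S n x \<le> real n"
  unfolding S_def using sum_mono[of "{..<n}" "\<lambda>i. real (x i)" "\<lambda>_. 1"] X_le1[of x] by auto

lemma H_Suc: "H t (Suc n) = H t n * exp (t * real (q n))"
  by (simp add: H_def S_Suc algebra_simps exp_add)
lemma H_pos: "0 < H t n" by (simp add: H_def)
lemma H_0 [simp]: "H t 0 = 1" by (simp add: H_def)

lemma c_pos: "0 < z \<Longrightarrow> 0 < c t z n" by (simp add: c_def H_pos)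
lemma p_nonneg: "0 \<le> z \<Longrightarrow> 0 \<le> p t z n" by (simp add: p_def H_pos less_imp_le)
lemma c_0 [simp]: "c t z 0 = 1" by (simp add: c_def)
lemma p_eq_c: "p t z n = real (q n) * c t z n * z" by (simp add: p_def c_def)

text \<open>The orbit of the constant function under the transfer operator is a renewal sequence.\<close>

lemma L_pow_one:
  assumes "x \<in> X"
  shows "z ^ n * (L t ^^ n) (\<lambda>_. 1) x = (\<Sum>j\<le>n. renew (p t z) (n - j) * c t z j * u j x)"
  using assms
proof (induction n arbitrary: x)
  case (Suc n)
  let ?v = "renew (p t z)"
  have "z ^ Suc n * (L t ^^ Suc n) (\<lambda>_. 1) x = z * L t (\<lambda>y. z ^ n * (L t ^^ n) (\<lambda>_. 1) y) x"
    by (simp add: tr_cmult)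
  also have "L t (\<lambda>y. z ^ n * (L t ^^ n) (\<lambda>_. 1) y) = L t (\<lambda>y. \<Sum>j\<le>n. (?v (n - j) * c t z j) * u j y)"
    by (rule tr_cong) (use Suc.IH in auto)
  also have "L t (\<lambda>y. \<Sum>j\<le>n. (?v (n - j) * c t z j) * u j y) x =
      (\<Sum>j\<le>n. (?v (n - j) * c t z j) * (real (q j) * u 0 x + exp (t * real (q j)) * u (Suc j) x))"
    by (simp only: tr_sum tr_cmult L_u[OF Suc.prems])
  \<comment> \<open>The \<open>u 0\<close> terms collect to the renewal recursion at
    \<open>Suc n\<close>; all others only move their index up by one.\<close>
  also have "z * \<dots> = (\<Sum>j\<le>n. p t z j * ?v (n - j)) * u 0 x + (\<Sum>j\<le>n. ?v (n - j) * c t z (Suc j) * u (Suc j) x)"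
    by (simp add: sum_distrib_left sum_distrib_right sum.distrib algebra_simps p_eq_c c_def H_Suc)
  also have "\<dots> = (\<Sum>j\<le>Suc n. ?v (Suc n - j) * c t z j * u j x)"
    by (subst sum.atMost_Suc_shift) (simp add: renew.simps)
  finally show ?case .
qed (simp add: u_0)

lemma L_pow_one_le:
  assumes "x \<in> X" "0 < z" "\<And>n. (\<Sum>j<n. p t z j) \<le> 1" "summable (c t z)"
  shows "z ^ n * (L t ^^ n) (\<lambda>_. 1) x \<le> suminf (c t z)"
proof -
  have "z ^ n * (L t ^^ n) (\<lambda>_. 1) x \<le> (\<Sum>j\<le>n. c t z j)"
    unfolding L_pow_one[OF assms(1)]
  proof (rule sum_mono)
    fix j
    have "renew (p t z) (n - j) * (c t z j * u j x) \<le> 1 * (c t z j * 1)"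
      using renew_bounds[of "p t z" "n - j"] p_nonneg[of z t] assms u_range[of j x] c_pos[of z t j]
      by (intro mult_mono) auto
    thus "renew (p t z) (n - j) * c t z j * u j x \<le> c t z j" by (simp add: mult.assoc)
  qed
  also have "\<dots> \<le> suminf (c t z)"
    using assms c_pos[of z t] by (intro sum_le_suminf) (auto simp: less_imp_le)
  finally show ?thesis .
qed

text \<open>Every word below an admissible word is admissible, so a word with many ones has
  exponentially many admissible words below it.\<close>

lemma L_pow_one_ge:
  assumes "x \<in> X" "\<And>i. y i \<le> x (i + n)"
  shows "(1 + exp t) powr S n x \<le> (L t ^^ n) (\<lambda>_. 1) y"
  using assms(2)
proof (induction n arbitrary: y)
  case (Suc n)
  let ?f = "(L t ^^ n) (\<lambda>_. 1)"
  have yX: "y \<in> X"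
    by (rule hereditary[OF shift_pow_in_X[OF assms(1), of "Suc n"]]) (use Suc.prems in \<open>auto simp: shift_pow shift_def\<close>)
  have IH: "(1 + exp t) powr S n x \<le> ?f (cons a y)" if "a \<le> x n" for a
  proof (rule Suc.IH)
    show "cons a y i \<le> x (i + n)" for i
      using that Suc.prems[of "i - 1"] by (cases i) auto
  qed
  have nn: "0 \<le> ?f w" if "w \<in> X" for w
    using tr_pow_mono[of "\<lambda>_. 0" "\<lambda>_. 1" w n "chit t"] that tr_pow_cmult[of n "chit t" 0 "\<lambda>_. 1"] by simp
  show ?case
  proof (cases "x n = 0")
    case True
    thus ?thesis using IH[of 0] nn[of "cons 1 y"] yX
      by (auto simp: L_X S_Suc cons_in_X_iff intro!: add_increasing2)
  next
    case False
    hence x1: "x n = 1" using X_01[OF assms(1), of n] by auto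
    have "cons 1 y \<in> X"
    proof (rule hereditary[OF shift_pow_in_X[OF assms(1), of n]])
      show "cons 1 y i \<le> (shift ^^ n) x i" for i
        using x1 Suc.prems[of "i - 1"] by (cases i) (auto simp: shift_pow)
    qed
    hence le: "lex_le y (qs 1)" by (simp add: cons_in_X_iff)
    have "(1 + exp t) powr S (Suc n) x = (1 + exp t) * (1 + exp t) powr S n x"
      using exp_gt_zero[of t] by (simp add: S_Suc x1 powr_add add_pos_pos)
    also have "\<dots> = (1 + exp t) powr S n x + exp t * (1 + exp t) powr S n x"
      by (simp add: algebra_simps)
    also have "\<dots> \<le> ?f (cons 0 y) + exp t * ?f (cons 1 y)"
      using IH[of 0] IH[of 1] x1 by (intro add_mono mult_left_mono) auto
    finally show ?thesis using yX le by (simp add: L_X)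
  qed
qed (use order_refl in \<open>auto simp: add_pos_pos\<close>)

section \<open>Geometric decay of word weights and the root of the normalisation equation\<close>

lemma c_summable:
  assumes "0 < z" "z < 1" "summable (p t z)"
  shows "summable (c t z)"
proof -
  \<comment> \<open>Telescoping: up to a constant, the sum of \<open>c\<close> is the sum of the drops of the powers of \<open>z\<close>.\<close>
  define E where "E = exp t - 1"
  have step: "c t z (Suc n) = z * c t z n + E * p t z n" for n
    using q01[of n] by (auto simp: c_def p_def H_Suc E_def algebra_simps)
  have bnd: "(1 - z) * (\<Sum>j<n. c t z j) \<le> 1 + \<bar>E\<bar> * suminf (p t z)" for n
  proof -
    have "(\<Sum>j<n. c t z (Suc j)) = z * (\<Sum>j<n. c t z j) + E * (\<Sum>j<n. p t z j)"
      by (simp add: step sum.distrib sum_distrib_left)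
    moreover have "(\<Sum>j<n. c t z (Suc j)) \<ge> (\<Sum>j<n. c t z j) - 1"
    proof -
      have "(\<Sum>j<n. c t z j) \<le> (\<Sum>j<Suc n. c t z j)" using c_pos[OF assms(1), of t n] by simp
      also have "\<dots> = 1 + (\<Sum>j<n. c t z (Suc j))" by (simp add: sum.lessThan_Suc_shift del: sum.lessThan_Suc)
      finally show ?thesis by simp
    qed
    moreover have "E * (\<Sum>j<n. p t z j) \<le> \<bar>E\<bar> * suminf (p t z)"
      using assms p_nonneg[of z t]
      by (intro mult_mono sum_le_suminf sum_nonneg) auto
    ultimately show ?thesis by (simp add: algebra_simps)
  qed
  show ?thesis
  proof (rule summableI_nonneg_bounded)
    show "(\<Sum>j<n. c t z j) \<le> (1 + \<bar>E\<bar> * suminf (p t z)) / (1 - z)" for n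
      using bnd[of n] assms by (simp add: pos_le_divide_eq mult.commute)
  qed (use c_pos[OF assms(1)] in \<open>auto intro: less_imp_le\<close>)
qed

lemma exp_decay:
  assumes z: "0 < z" "z < 1" and C: "\<And>x n. x \<in> X \<Longrightarrow> (1 + exp t) powr S n x * z ^ n \<le> C"
  shows "\<exists>\<theta> C'. 0 < \<theta> \<and> \<theta> < 1 \<and> 0 < C' \<and> (\<forall>x\<in>X. \<forall>n. exp (t * S n x) * z ^ n \<le> C' * \<theta> ^ n)"
proof (cases "t \<le> 0")
  case True
  have "exp (t * S n x) * z ^ n \<le> 1 * z ^ n" for n x
    using True S_nonneg[of n x] z by (intro mult_right_mono) (auto simp: mult_nonpos_nonneg)
  thus ?thesis using z by (intro exI[of _ z] exI[of _ 1]) auto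
next
  case False
  define a where "a = t / ln (1 + exp t)"
  have e1: "1 + exp t > 1" by simp
  have "ln (exp t) < ln (1 + exp t)" by (subst ln_less_cancel_iff) (auto simp: add_pos_pos)
  hence lt: "t < ln (1 + exp t)" by simp
  hence a: "0 < a" "a < 1" using False by (auto simp: a_def)
  have ea: "(1 + exp t) powr a = exp t"
    using lt False e1 by (simp add: powr_def a_def) (smt (verit) exp_gt_zero)
  have "exp (t * S n x) * z ^ n \<le> (C powr a) * (z powr (1 - a)) ^ n" if "x \<in> X" for n x
  proof -
    have "exp (t * S n x) = (1 + exp t) powr (a * S n x)"
      using e1 by (simp add: powr_powr[symmetric] ea) (simp add: powr_def)
    moreover have "z ^ n = (z ^ n) powr a * (z powr (1 - a)) ^ n"
      using z by (simp add: powr_powr mult.commute flip: powr_realpow powr_add) (simp add: algebra_simps)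
    moreover have "((1 + exp t) powr S n x * z ^ n) powr a \<le> C powr a"
      using C[OF that, of n] a z by (intro powr_mono2) auto
    moreover have "((1 + exp t) powr S n x * z ^ n) powr a = (1 + exp t) powr (a * S n x) * (z ^ n) powr a"
      using z by (simp add: powr_mult powr_powr mult.commute)
    moreover have "0 \<le> (z powr (1 - a)) ^ n" by simp
    ultimately show ?thesis by (metis (no_types, lifting) mult.assoc mult_right_mono)
  qed
  moreover have "C > 0"
    using C[OF zero_in_X, of 0] exp_gt_zero[of t] by (simp split: if_splits)
  moreover have "0 < z powr (1 - a)" "z powr (1 - a) < 1"
    using z a powr_less_mono2[of "1 - a" z 1] by auto
  ultimately show ?thesis by (intro exI[of _ "z powr (1 - a)"] exI[of _ "C powr a"]) auto
qed

lemma p_sums_unique: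
  assumes "0 < z" "0 < z'" "p t z sums 1" "p t z' sums 1"
  shows "z = z'"
proof -
  have False if "0 < a" "a < b" "p t a sums 1" "p t b sums 1" for a b
  proof -
    have s: "summable (p t a)" "summable (p t b)" using that by (auto simp: sums_iff)
    have le: "p t a n \<le> p t b n" for n
      unfolding p_def using that H_pos[of t n] by (intro mult_left_mono power_mono) auto
    have "0 < suminf (\<lambda>n. p t b n - p t a n)"
    proof (rule suminf_pos2[where i=0])
      show "summable (\<lambda>n. p t b n - p t a n)" using s by (rule summable_diff[rotated])
    qed (use le that in \<open>auto simp: p_def q0\<close>)
    thus False using suminf_diff[OF s(2,1)] that by (simp add: sums_iff)
  qed
  thus ?thesis using assms by (metis linorder_neqE_linordered_idom)
qed

text \<open>The hypothesis speaks of bounded partial sums instead of the sum 1, because the lemma is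
  applied in \<open>p_sums_ex\<close> at the supremum of the admissible \<open>z\<close>, before a
  solution is known to exist.\<close>

lemma partial_sums_bound_decay:
  assumes "0 < z" "z < 1" "\<And>n. (\<Sum>j<n. p t z j) \<le> 1"
  shows "(\<exists>C. \<forall>x\<in>X. \<forall>n. z ^ n * (L t ^^ n) (\<lambda>_. 1) x \<le> C) \<and>
    (\<exists>\<theta> C'. 0 < \<theta> \<and> \<theta> < 1 \<and> 0 < C' \<and> (\<forall>x\<in>X. \<forall>n. exp (t * S n x) * z ^ n \<le> C' * \<theta> ^ n))"
proof
  have "summable (p t z)"
    by (rule summableI_nonneg_bounded[where x=1]) (use assms p_nonneg in auto)
  hence c: "summable (c t z)" by (rule c_summable[OF assms(1,2)])
  have B: "z ^ n * (L t ^^ n) (\<lambda>_. 1) x \<le> suminf (c t z)" if "x \<in> X" for x n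
    by (rule L_pow_one_le[OF that assms(1,3) c])
  thus "\<exists>C. \<forall>x\<in>X. \<forall>n. z ^ n * (L t ^^ n) (\<lambda>_. 1) x \<le> C" by blast
  show "\<exists>\<theta> C'. 0 < \<theta> \<and> \<theta> < 1 \<and> 0 < C' \<and> (\<forall>x\<in>X. \<forall>n. exp (t * S n x) * z ^ n \<le> C' * \<theta> ^ n)"
  proof (rule exp_decay[OF assms(1,2)])
    fix x n assume x: "x \<in> X"
    have "(1 + exp t) powr S n x \<le> (L t ^^ n) (\<lambda>_. 1) zero"
      by (rule L_pow_one_ge[OF x]) auto
    hence "(1 + exp t) powr S n x * z ^ n \<le> z ^ n * (L t ^^ n) (\<lambda>_. 1) zero"
      using assms by (simp add: mult.commute)
    also have "\<dots> \<le> suminf (c t z)" by (rule B[OF zero_in_X])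
    finally show "(1 + exp t) powr S n x * z ^ n \<le> suminf (c t z)" .
  qed
qed

text \<open>Take the largest z in [0,1] whose partial sums stay at most 1. By the decay the series
  converges beyond it, hence is continuous there, and a value below 1 would leave room for a larger
  z.\<close>

lemma p_sums_ex: "\<exists>z. 0 < z \<and> z < 1 \<and> p t z sums 1"
proof -
  define A where "A = {z\<in>{0..1}. \<forall>K. (\<Sum>j<K. p t z j) \<le> 1}"
  define w where "w = Sup A"
  have "A = {0..1} \<inter> (\<Inter>K. {z. (\<Sum>j<K. p t z j) \<le> 1})" by (auto simp: A_def)
  moreover have "closed {z. (\<Sum>j<K. p t z j) \<le> 1}" for K
    unfolding p_def by (intro closed_Collect_le continuous_intros)
  ultimately have "closed A" by auto
  have bdd: "bdd_above A" by (auto simp: A_def bdd_above_def)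
  have "0 \<in> A" by (auto simp: A_def p_def)
  hence wA: "w \<in> A" unfolding w_def using \<open>closed A\<close> bdd by (intro closed_contains_Sup) auto
  \<comment> \<open>Since \<open>S j q\<close> is at most j, this z makes the term of index j at
    most 2^(-j-1). The supremum is therefore positive.\<close>
  have small: "exp (- \<bar>t\<bar>) / 2 \<in> A"
  proof -
    let ?z = "exp (- \<bar>t\<bar>) / 2"
    have z: "0 < ?z" "?z \<le> 1/2" by auto
    have "p t ?z j \<le> (1/2) ^ Suc j" for j
    proof -
      have "t * S j q \<le> \<bar>t\<bar> * real j"
        using S_le[OF q_in_X, of j] S_nonneg[of j q] by (intro mult_mono) auto
      hence "H t j * exp (- \<bar>t\<bar>) ^ j \<le> 1"
        by (simp add: H_def exp_of_nat_mult[symmetric] mult.commute flip: exp_add)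
      hence "real (q j) * (H t j * exp (- \<bar>t\<bar>) ^ j) * exp (- \<bar>t\<bar>) \<le> 1 * 1 * 1"
        using q_le1[of j] H_pos[of t j] by (intro mult_mono mult_nonneg_nonneg) (auto intro: less_imp_le)
      thus ?thesis by (simp add: p_def power_divide divide_simps algebra_simps)
    qed
    hence "(\<Sum>j<K. p t ?z j) \<le> (\<Sum>j<K. (1/2) ^ Suc j)" for K by (intro sum_mono)
    moreover have "(\<Sum>j<K. (1/2::real) ^ Suc j) = 1 - (1/2)^K" for K
      by (induction K) auto
    ultimately have "(\<Sum>j<K. p t ?z j) \<le> 1" for K
      by (smt (verit) zero_le_power zero_le_divide_1_iff)
    moreover have "exp (- \<bar>t\<bar>) \<le> 2" using exp_le_one_iff[of "- \<bar>t\<bar>"] by linarith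
    ultimately show ?thesis by (simp add: A_def)
  qed
  have w0: "0 < w"
    using cSup_upper[OF small bdd] unfolding w_def by (smt (verit) exp_gt_zero half_gt_zero)
  obtain m where m: "m \<ge> 1" "q m = 1" using q_inf by blast
  \<comment> \<open>At z = 1 the term of index 0 is already 1, and a later digit 1 of
    \<open>q\<close> adds something positive.\<close>
  have "w \<noteq> 1"
  proof
    assume "w = 1"
    have "(\<Sum>j\<in>{0,m}. p t 1 j) \<le> (\<Sum>j<Suc m. p t 1 j)"
      by (rule sum_mono2) (use p_nonneg in auto)
    also have "\<dots> \<le> 1" using wA \<open>w = 1\<close> by (auto simp: A_def simp del: sum.lessThan_Suc)
    finally show False using m H_pos[of t m] by (simp add: p_def q0)
  qed
  hence w1: "w < 1" using wA by (auto simp: A_def)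
  have ps: "\<And>K. (\<Sum>j<K. p t w j) \<le> 1" using wA by (auto simp: A_def)
  obtain \<theta> C where th: "0 < \<theta>" "\<theta> < 1" "0 < C"
    and dec: "\<And>x n. x \<in> X \<Longrightarrow> exp (t * S n x) * w ^ n \<le> C * \<theta> ^ n"
    using partial_sums_bound_decay[OF w0 w1 ps] by metis
  \<comment> \<open>Any factor strictly between 1 and 1/\<theta>: then w r exceeds w and is still
    within the range of geometric decay.\<close>
  define r where "r = (1 + 1 / \<theta>) / 2"
  have r: "1 < r" "r * \<theta> < 1" using th by (auto simp: r_def field_simps)
  define a where "a n = real (q n) * H t n" for n
  have dom: "norm (a n * (w * r) ^ n) \<le> C * (r * \<theta>) ^ n" for n
  proof -
    have "a n * w ^ n \<le> 1 * (C * \<theta> ^ n)"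
      unfolding a_def mult.assoc
    proof (rule mult_mono)
      show "H t n * w ^ n \<le> C * \<theta> ^ n" using dec[OF q_in_X, of n] by (simp add: H_def)
    qed (use q_le1[of n] w0 H_pos[of t n] in auto)
    moreover have "0 \<le> a n * w ^ n" using w0 H_pos[of t n] by (simp add: a_def less_imp_le)
    ultimately have "a n * w ^ n * r ^ n \<le> C * \<theta> ^ n * r ^ n" using r by (intro mult_right_mono) auto
    moreover have "0 \<le> a n" using H_pos[of t n] by (simp add: a_def less_imp_le)
    ultimately show ?thesis using w0 r by (simp add: power_mult_distrib algebra_simps)
  qed
  have "summable (\<lambda>n. C * (r * \<theta>) ^ n)"
    using r th by (intro summable_mult summable_geometric) (auto simp: abs_mult)
  hence sr: "summable (\<lambda>n. a n * (w * r) ^ n)"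
    using dom by (rule summable_comparison_test'[where N=0])
  define g where "g z = z * (\<Sum>n. a n * z ^ n)" for z :: real
  have pz: "p t z sums g z" if "0 < z" "z < w * r" for z
  proof -
    have "summable (\<lambda>n. a n * z ^ n)"
      by (rule powser_inside[OF sr]) (use that in auto)
    hence "(\<lambda>n. z * (a n * z ^ n)) sums g z" unfolding g_def by (intro sums_mult summable_sums)
    moreover have "p t z = (\<lambda>n. z * (a n * z ^ n))" by (auto simp: p_def a_def)
    ultimately show ?thesis by simp
  qed
  have wr: "w < w * r" using w0 r by simp
  have "isCont (\<lambda>z. \<Sum>n. a n * z ^ n) w"
    by (rule isCont_powser[OF sr]) (use wr w0 in auto)
  hence cont: "isCont g w" unfolding g_def by (intro continuous_intros)
  have gw: "g w \<le> 1"
    using suminf_le_const[of "p t w" 1] pz[OF w0 wr] ps by (simp add: sums_iff)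
  have "g w = 1"
  proof (rule ccontr)
    assume "g w \<noteq> 1"
    hence "g w < 1" using gw by simp
    hence "eventually (\<lambda>z. g z < 1) (at_right w)"
      using cont unfolding isCont_def by (intro order_tendstoD(2)) (auto intro: filterlim_at_split[THEN iffD1, THEN conjunct2] filterlim_mono simp: filterlim_at_split)
    moreover have "eventually (\<lambda>z. z \<in> {w<..<min 1 (w * r)}) (at_right w)"
      by (rule eventually_at_right_real) (use w1 wr in auto)
    ultimately have "eventually (\<lambda>z. g z < 1 \<and> z \<in> {w<..<min 1 (w * r)}) (at_right w)"
      by (rule eventually_conj)
    then obtain z where z: "g z < 1" "w < z" "z < 1" "z < w * r"
      using eventually_happens'[OF trivial_limit_at_right_real] by force
    have "(\<Sum>j<K. p t z j) \<le> 1" for K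
    proof -
      have s: "p t z sums g z" using pz z w0 by auto
      have "(\<Sum>j<K. p t z j) \<le> suminf (p t z)"
        by (rule sum_le_suminf) (use s p_nonneg z w0 in \<open>auto simp: sums_iff\<close>)
      thus ?thesis using s z by (simp add: sums_iff)
    qed
    hence "z \<in> A" using z w0 by (auto simp: A_def)
    hence "z \<le> w" unfolding w_def using bdd by (rule cSup_upper)
    thus False using z by simp
  qed
  thus ?thesis using pz[OF w0 wr] w0 w1 by auto
qed

definition zt :: "real \<Rightarrow> real" where "zt t = (THE z. 0 < z \<and> z < 1 \<and> p t z sums 1)"

lemma zt: "0 < zt t" "zt t < 1" "p t (zt t) sums 1"
proof -
  have "\<exists>!z. 0 < z \<and> z < 1 \<and> p t z sums 1" using p_sums_ex p_sums_unique by metis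
  from theI'[OF this] show "0 < zt t" "zt t < 1" "p t (zt t) sums 1" unfolding zt_def by auto
qed

lemma zt_unique: "0 < z \<Longrightarrow> p t z sums 1 \<Longrightarrow> z = zt t"
  using p_sums_unique zt by blast

lemma p_partial: "(\<Sum>j<n. p t (zt t) j) \<le> 1"
  using sum_le_suminf[of "p t (zt t)" "{..<n}"] zt[of t] p_nonneg[of "zt t" t] by (auto simp: sums_iff)

lemma c_zt_summable: "summable (c t (zt t))"
  using c_summable zt by (auto simp: sums_iff)

lemma L_bound: "\<exists>C>0. \<forall>x\<in>X. \<forall>n. zt t ^ n * (L t ^^ n) (\<lambda>_. 1) x \<le> C"
proof -
  obtain C where C: "\<forall>x\<in>X. \<forall>n. zt t ^ n * (L t ^^ n) (\<lambda>_. 1) x \<le> C"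
    using partial_sums_bound_decay[OF zt(1,2)[of t] p_partial] by blast
  thus ?thesis by (intro exI[of _ "max 1 C"]) (auto simp: le_max_iff_disj)
qed

lemma decay: "\<exists>\<theta> C. 0 < \<theta> \<and> \<theta> < 1 \<and> 0 < C \<and> (\<forall>x\<in>X. \<forall>n. exp (t * S n x) * zt t ^ n \<le> C * \<theta> ^ n)"
  using partial_sums_bound_decay[OF zt(1,2)[of t] p_partial] by blast

definition lam :: "real \<Rightarrow> real" where "lam t = 1 / zt t"

lemma lam_gt1: "1 < lam t" using zt[of t] by (simp add: lam_def)

end

section \<open>The renewal theorem\<close>

lemma ex_limsup:
  fixes x :: "nat \<Rightarrow> real"
  assumes "\<And>n. \<bar>x n\<bar> \<le> 1"
  shows "\<exists>V. \<bar>V\<bar> \<le> 1 \<and> (\<forall>e>0. eventually (\<lambda>n. x n < V + e) sequentially) \<and> (\<forall>e>0. \<forall>N. \<exists>n\<ge>N. x n > V - e)"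
proof -
  define A where "A = {y. eventually (\<lambda>n. x n < y) sequentially}"
  define V where "V = Inf A"
  have A2: "y \<in> A" if "y > 1" for y
  proof -
    have "x n < y" for n using assms[of n] that by linarith
    thus ?thesis by (simp add: A_def)
  qed
  have lb: "-1 \<le> y" if "y \<in> A" for y
  proof -
    have "eventually (\<lambda>n. x n < y) sequentially" using that by (simp add: A_def)
    then obtain N where "\<forall>n\<ge>N. x n < y" unfolding eventually_sequentially by blast
    hence "x N < y" by simp
    thus ?thesis using assms[of N] by linarith
  qed
  have bdd: "bdd_below A" using lb by (intro bdd_belowI[of A "-1"])
  have ne: "A \<noteq> {}" using A2[of 2] by auto
  have ev: "eventually (\<lambda>n. x n < V + e) sequentially" if e: "e > 0" for e
  proof -
    have "Inf A < V + e" using e by (simp add: V_def)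
    then obtain y where "y \<in> A" "y < V + e"
      using cInf_less_iff[OF ne bdd, of "V + e"] by blast
    thus ?thesis unfolding A_def by (auto elim!: eventually_mono)
  qed
  have fr: "\<exists>n\<ge>N. x n > V - e" if e: "e > 0" for e N
  proof (rule ccontr)
    assume neg: "\<not> ?thesis"
    have "x n < V - e/2" if "n \<ge> N" for n
    proof -
      have "x n \<le> V - e" using neg that by (auto simp: not_less)
      thus ?thesis using e by linarith
    qed
    hence "V - e/2 \<in> A" unfolding A_def by (auto intro: eventually_sequentiallyI)
    hence "V \<le> V - e/2" unfolding V_def using bdd by (intro cInf_lower)
    thus False using e by simp
  qed
  have "-1 \<le> V" unfolding V_def using ne lb by (intro cInf_greatest)
  moreover have "V \<le> 1"
  proof (rule field_le_epsilon)
    show "V \<le> 1 + e" if "e > 0" for e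
      unfolding V_def using bdd A2[of "1+e"] that by (intro cInf_lower) auto
  qed
  ultimately show ?thesis using ev fr by (intro exI[of _ V]) (auto simp: abs_le_iff)
qed

text \<open>Because \<open>p 0 > 0\<close>, a value close to the upper limit forces its predecessor to be close
  to the upper limit as well.\<close>

lemma renewal_chain:
  fixes x p :: "nat \<Rightarrow> real"
  assumes x1: "\<And>n. \<bar>x n\<bar> \<le> 1" and rec: "\<And>n. x (Suc n) = (\<Sum>j\<le>n. p j * x (n - j))"
    and p: "\<And>n. 0 \<le> p n" "p sums 1" "0 < p 0"
    and V: "\<bar>V\<bar> \<le> 1" "\<And>e. e > 0 \<Longrightarrow> eventually (\<lambda>n. x n < V + e) sequentially"
       "\<And>e N. e > 0 \<Longrightarrow> \<exists>n\<ge>N. x n > V - e"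
  shows "e > 0 \<Longrightarrow> \<exists>n\<ge>N + k. \<forall>i\<le>k. x (n - i) \<ge> V - e"
proof (induction k arbitrary: e N)
  case 0
  thus ?case using V(3)[of e N] by (auto intro: less_imp_le)
next
  case (Suc k)
  define T where "T n = 1 - (\<Sum>j<n. p j)" for n
  have T0: "T \<longlonglongrightarrow> 0"
    using p(2) unfolding T_def sums_def by (auto intro!: tendsto_eq_intros)
  \<comment> \<open>Below, the gap under the upper limit at \<open>Suc m\<close> is at most 2d, the
    possibly negative gaps at indices below \<open>N0\<close> cost 3d, and the mass outside the
    recursion costs d. So p 0 times the gap at m is at most 6d, which is below e p 0.\<close>
  define d where "d = min 1 (min e (e * p 0 / 8))"
  have d: "0 < d" "d \<le> 1" "d \<le> e" "d \<le> e * p 0 / 8" using Suc.prems p(3) by (auto simp: d_def)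
  obtain N0 where N0: "\<And>n. n \<ge> N0 \<Longrightarrow> x n < V + d" using V(2)[OF d(1)] by (auto simp: eventually_sequentially)
  have "eventually (\<lambda>n. T n < d) sequentially" using T0 d by (intro order_tendstoD)
  then obtain N1 where N1: "\<And>n. n \<ge> N1 \<Longrightarrow> T n < d" by (auto simp: eventually_sequentially)
  obtain n where n: "n \<ge> (N + N0 + N1 + 2) + k" "\<forall>i\<le>k. x (n - i) \<ge> V - d"
    using Suc.IH[OF d(1)] by blast
  define m where "m = n - k - 1"
  have nk: "n - k = Suc m" and m: "m \<ge> N0 + N1" using n(1) by (auto simp: m_def)
  have Tn: "0 \<le> T k" for k using sum_le_suminf[of p "{..<k}"] p by (auto simp: T_def sums_iff)
  define y where "y i = V + d - x i" for i
  have ylow: "-3 \<le> y i" for i using x1[of i] V(1) d by (auto simp: y_def abs_le_iff)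
  have y0: "0 \<le> y i" if "i \<ge> N0" for i using N0[OF that] by (simp add: y_def)
  have "y (Suc m) = V + d - (\<Sum>j\<le>m. p j * x (m - j))" by (simp add: y_def rec)
  also have "\<dots> = (\<Sum>j\<le>m. p j * y (m - j)) + T (Suc m) * (V + d)"
    by (simp add: y_def T_def lessThan_Suc_atMost sum_subtractf sum.distrib sum_distrib_left algebra_simps)
  \<comment> \<open>Gaps at indices m - j \<ge> \<open>N0\<close> are nonnegative; the remaining
    ones carry little weight because m - \<open>N0\<close> is large.\<close>
  also have "(\<Sum>j\<le>m. p j * y (m - j)) = (\<Sum>j\<le>m - N0. p j * y (m - j)) + (\<Sum>j\<in>{m-N0<..m}. p j * y (m - j))"
    by (subst sum.union_disjoint[symmetric]) (auto intro!: sum.cong)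
  also have "(\<Sum>j\<le>m - N0. p j * y (m - j)) = p 0 * y m + (\<Sum>j\<in>{1..m-N0}. p j * y (m - j))"
    by (simp add: atMost_atLeast0 sum.atLeast_Suc_atMost)
  finally have eq: "y (Suc m) = p 0 * y m + (\<Sum>j\<in>{1..m-N0}. p j * y (m - j)) + (\<Sum>j\<in>{m-N0<..m}. p j * y (m - j)) + T (Suc m) * (V + d)" .
  have s1: "0 \<le> (\<Sum>j\<in>{1..m-N0}. p j * y (m - j))"
    using m p y0 by (intro sum_nonneg mult_nonneg_nonneg) auto
  have "(\<Sum>j\<in>{m-N0<..m}. p j * (-3)) \<le> (\<Sum>j\<in>{m-N0<..m}. p j * y (m - j))"
    using p ylow by (intro sum_mono mult_left_mono) auto
  moreover have "(\<Sum>j\<in>{m-N0<..m}. p j) \<le> T (m - N0)"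
  proof -
    have "(\<Sum>j\<in>{m-N0<..m}. p j) + (\<Sum>j<m-N0. p j) = (\<Sum>j\<in>{m-N0<..m} \<union> {..<m-N0}. p j)"
      by (subst sum.union_disjoint) auto
    also have "\<dots> \<le> suminf p" using p by (intro sum_le_suminf) (auto simp: sums_iff)
    finally show ?thesis using p by (simp add: T_def sums_iff)
  qed
  moreover have "T (m - N0) < d" using N1[of "m - N0"] m by simp
  ultimately have s2: "-3 * d \<le> (\<Sum>j\<in>{m-N0<..m}. p j * y (m - j))"
    unfolding sum_distrib_right[symmetric] by linarith
  have "T (Suc m) * (V + d) \<ge> T (Suc m) * (-1)"
    using Tn V(1) d by (intro mult_left_mono) (auto simp: abs_le_iff)
  hence s3: "T (Suc m) * (V + d) \<ge> - d" using N1[of "Suc m"] m by simp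
  have "y (Suc m) \<le> 2 * d" using n(2) nk by (auto simp: y_def)
  hence "p 0 * y m \<le> 6 * d" using eq s1 s2 s3 by linarith
  also have "\<dots> \<le> 6 * (e * p 0 / 8)" using d by simp
  finally have "p 0 * y m \<le> p 0 * e" using Suc.prems p by (simp add: algebra_simps)
  hence "y m \<le> e" using p(3) by simp
  moreover have "n - Suc k = m" by (simp add: m_def)
  ultimately have ym: "x (n - Suc k) \<ge> V - e" using d(1) by (simp add: y_def)
  show ?case
  proof (intro exI[of _ n] conjI allI impI)
    show "n \<ge> N + Suc k" using n by simp
    show "V - e \<le> x (n - i)" if "i \<le> Suc k" for i
    proof (cases "i = Suc k")
      case False
      hence "V - d \<le> x (n - i)" using that n(2) by auto
      thus ?thesis using d by linarith
    qed (use ym in simp)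
  qed
qed

text \<open>The factor 1 - \<Sum>i<j p i is the probability that a waiting time exceeds j, so the
  term of index j stands for the last renewal up to time n occurring at n - j. The sum is an
  invariant of the recursion.\<close>

lemma renewal_identity:
  "(\<Sum>j\<le>n. (1 - (\<Sum>i<j. p i)) * renew p (n - j)) = 1"
proof (induction n)
  case (Suc n)
  show ?case
    by (subst sum.atMost_Suc_shift)
      (use Suc in \<open>simp add: renew.simps algebra_simps sum.distrib sum_subtractf\<close>)
qed simp

text \<open>A long stretch of values near the upper limit V, provided by
  \<open>renewal_chain\<close>, is inserted into \<open>renewal_identity\<close> and gives M V \<le>
  1, where M is the sum of the tails. A stretch near the lower limit -W gives 1 \<le> - M W, so the
  two limits agree.\<close>

theorem renewal_limit:
  assumes p: "\<And>n. 0 \<le> p n" "p sums 1" "0 < p 0"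
    and T: "summable (\<lambda>n. 1 - (\<Sum>i<n. p i))"
  shows "convergent (renew p)"
proof -
  let ?v = "renew p"
  define T where "T n = 1 - (\<Sum>i<n. p i)" for n
  define M where "M = suminf T"
  have Tn: "0 \<le> T k" for k using sum_le_suminf[of p "{..<k}"] p by (auto simp: T_def sums_iff)
  have sT: "summable T" using T by (simp add: T_def[abs_def])
  have M1: "1 \<le> M" using sum_le_suminf[OF sT, of "{..<1}"] Tn by (simp add: M_def T_def)
  have v: "0 \<le> ?v n" "?v n \<le> 1" for n
    using renew_bounds[of p n] p(1) sum_le_suminf[of p "{..<_}"] p by (auto simp: sums_iff)
  have id: "(\<Sum>j\<le>n. T j * ?v (n - j)) = 1" for n unfolding T_def by (rule renewal_identity)
  have split: "(\<Sum>j\<le>n. T j * ?v (n - j)) = (\<Sum>j\<le>k. T j * ?v (n - j)) + (\<Sum>j\<in>{k<..n}. T j * ?v (n - j))" if "k \<le> n" for n k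
    by (subst sum.union_disjoint[symmetric]) (use that in \<open>auto intro!: sum.cong\<close>)
  obtain V where V: "\<bar>V\<bar> \<le> 1" "\<forall>e>0. eventually (\<lambda>n. ?v n < V + e) sequentially" "\<forall>e>0. \<forall>N. \<exists>n\<ge>N. ?v n > V - e"
    using ex_limsup[of ?v] v by (auto simp: abs_le_iff)
  obtain W where W: "\<bar>W\<bar> \<le> 1" "\<forall>e>0. eventually (\<lambda>n. - ?v n < W + e) sequentially" "\<forall>e>0. \<forall>N. \<exists>n\<ge>N. - ?v n > W - e"
    using ex_limsup[of "\<lambda>n. - ?v n"] v by (auto simp: abs_le_iff)
  have lim_k: "(\<lambda>k. \<Sum>j\<le>k. T j) \<longlonglongrightarrow> M"
    using summable_LIMSEQ'[OF sT] by (simp add: M_def)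
  have up: "M * (V - e) \<le> 1" if e: "e > 0" for e
  proof -
    have "(\<Sum>j\<le>k. T j) * (V - e) \<le> 1" for k
    proof -
      obtain n where n: "n \<ge> 0 + k" "\<forall>i\<le>k. ?v (n - i) \<ge> V - e"
        using renewal_chain[of ?v p V e 0 k] V p e v by (auto simp: abs_le_iff renew.simps)
      have "(\<Sum>j\<le>k. T j) * (V - e) \<le> (\<Sum>j\<le>k. T j * ?v (n - j))"
        unfolding sum_distrib_right using n Tn by (intro sum_mono mult_left_mono) auto
      also have "\<dots> \<le> 1"
      proof -
        have "0 \<le> (\<Sum>j\<in>{k<..n}. T j * ?v (n - j))"
          using Tn v by (intro sum_nonneg mult_nonneg_nonneg) auto
        thus ?thesis using split[of k n] id[of n] n(1) by linarith
      qed
      finally show ?thesis .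
    qed
    moreover have "(\<lambda>k. (\<Sum>j\<le>k. T j) * (V - e)) \<longlonglongrightarrow> M * (V - e)" using lim_k by (intro tendsto_intros)
    ultimately show ?thesis by (intro LIMSEQ_le_const2) auto
  qed
  have lo: "M * (- W + e) \<ge> 1" if e: "e > 0" for e
  proof -
    have "(\<Sum>j\<le>k. T j) * (- W + e) + (M - (\<Sum>j\<le>k. T j)) \<ge> 1" for k
    proof -
      obtain n where n: "n \<ge> 0 + k" "\<forall>i\<le>k. - ?v (n - i) \<ge> W - e"
        using renewal_chain[of "\<lambda>n. - ?v n" p W e 0 k] W p e v by (auto simp: abs_le_iff renew.simps sum_negf)
      have "(\<Sum>j\<le>k. T j * ?v (n - j)) \<le> (\<Sum>j\<le>k. T j) * (- W + e)"
        unfolding sum_distrib_right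
      proof (intro sum_mono mult_left_mono)
        fix i assume "i \<in> {..k}" thus "?v (n - i) \<le> - W + e" using n(2)[rule_format, of i] by simp
      qed (use Tn in auto)
      moreover have "(\<Sum>j\<in>{k<..n}. T j * ?v (n - j)) \<le> (\<Sum>j\<in>{k<..n}. T j * 1)"
        using Tn v by (intro sum_mono mult_left_mono) auto
      moreover have "(\<Sum>j\<in>{k<..n}. T j) + (\<Sum>j\<le>k. T j) \<le> M"
        unfolding M_def by (subst sum.union_disjoint[symmetric]) (auto intro!: sum_le_suminf sT simp: Tn)
      ultimately show ?thesis using split[of k n] id[of n] n(1) by simp
    qed
    moreover have "(\<lambda>k. (\<Sum>j\<le>k. T j) * (- W + e) + (M - (\<Sum>j\<le>k. T j))) \<longlonglongrightarrow> M * (- W + e) + (M - M)"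
      using lim_k by (intro tendsto_intros)
    ultimately show ?thesis by (intro LIMSEQ_le_const[of _ _ 1]) auto
  qed
  have VW: "V \<le> - W"
  proof (rule field_le_epsilon)
    fix e :: real assume e: "e > 0"
    have "M * (V - e/2) \<le> M * (- W + e/2)" using up[of "e/2"] lo[of "e/2"] e by linarith
    thus "V \<le> - W + e" using M1 by simp
  qed
  have "?v \<longlonglongrightarrow> V"
  proof (rule LIMSEQ_I)
    fix r :: real assume r: "r > 0"
    have "eventually (\<lambda>n. ?v n < V + r) sequentially" "eventually (\<lambda>n. - ?v n < W + r) sequentially"
      using V(2) W(2) r by auto
    hence "eventually (\<lambda>n. norm (?v n - V) < r) sequentially"
    proof eventually_elim
      case (elim n)
      thus ?case using VW by (auto simp: abs_less_iff)
    qed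
    thus "\<exists>no. \<forall>n\<ge>no. norm (?v n - V) < r" by (simp add: eventually_sequentially)
  qed
  thus ?thesis by (auto simp: convergent_def)
qed

context beta_setting
begin

section \<open>Asymptotics of the iterated transfer operator\<close>

definition v :: "real \<Rightarrow> nat \<Rightarrow> real" where "v t = renew (p t (zt t))"
definition cc :: "real \<Rightarrow> nat \<Rightarrow> real" where "cc t = c t (zt t)"
text \<open>The coefficients \<open>v t (n - j)\<close> in \<open>L_pow_one\<close> tend to a
  constant, so up to scaling this series is the only possible limit of the normalised iterates of
  1.\<close>

definition h :: "real \<Rightarrow> digits \<Rightarrow> real" where "h t x = (\<Sum>j. cc t j * u j x)"

lemma v_convergent: "convergent (v t)"
  unfolding v_def
proof (rule renewal_limit)
  let ?p = "p t (zt t)"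
  show "0 \<le> ?p n" for n using p_nonneg zt by (simp add: less_imp_le)
  show "?p sums 1" by (rule zt)
  show "0 < ?p 0" using zt by (simp add: p_def q0)
  obtain \<theta> C where th: "0 < \<theta>" "\<theta> < 1" "0 < C"
    and dec: "\<And>x n. x \<in> X \<Longrightarrow> exp (t * S n x) * zt t ^ n \<le> C * \<theta> ^ n" using decay[of t] by metis
  have le: "?p n \<le> C * \<theta> ^ n" for n
  proof -
    have "?p n = (real (q n) * zt t) * (exp (t * S n q) * zt t ^ n)" by (simp add: p_def H_def)
    also have "\<dots> \<le> 1 * (C * \<theta> ^ n)"
    proof (rule mult_mono)
      show "real (q n) * zt t \<le> 1" using q_le1[of n] zt[of t] by (intro mult_le_one) auto
    qed (use dec[OF q_in_X, of n] zt[of t] in auto)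
    finally show ?thesis by simp
  qed
  have T: "1 - (\<Sum>i<n. ?p i) \<le> C / (1 - \<theta>) * \<theta> ^ n" for n
  proof -
    have s: "summable ?p" using zt by (simp add: sums_iff)
    have g: "(\<lambda>i. C * \<theta> ^ (i + n)) sums (C * \<theta> ^ n * (1 / (1 - \<theta>)))"
      using sums_mult[OF geometric_sums[of \<theta>], of "C * \<theta> ^ n"] th by (simp add: power_add algebra_simps)
    have "1 - (\<Sum>i<n. ?p i) = (\<Sum>i. ?p (i + n))"
      using suminf_minus_initial_segment[OF s, of n] zt(3)[of t] by (simp add: sums_iff)
    also have "\<dots> \<le> (\<Sum>i. C * \<theta> ^ (i + n))"
      using le g by (intro suminf_le) (auto simp: sums_iff s intro: summable_ignore_initial_segment)
    also have "\<dots> = C / (1 - \<theta>) * \<theta> ^ n" using g by (simp add: sums_iff)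
    finally show ?thesis .
  qed
  show "summable (\<lambda>n. 1 - (\<Sum>i<n. ?p i))"
  proof (rule summable_comparison_test')
    show "summable (\<lambda>n. C / (1 - \<theta>) * \<theta> ^ n)" using th by (intro summable_mult summable_geometric) auto
    show "norm (1 - (\<Sum>i<n. ?p i)) \<le> C / (1 - \<theta>) * \<theta> ^ n" if "n \<ge> 0" for n
      using T[of n] p_partial[of t n] by simp
  qed
qed

lemma cc_pos: "0 < cc t n" using c_pos zt by (simp add: cc_def)
lemma cc_0: "cc t 0 = 1" by (simp add: cc_def)
lemma cc_summable: "summable (cc t)" using c_zt_summable by (simp add: cc_def)

lemma h_summable: "summable (\<lambda>j. cc t j * u j x)"
  by (rule summable_comparison_test'[OF cc_summable[of t], of 0])
    (use cc_pos[of t] u_range in \<open>auto simp: abs_mult less_imp_le intro!: mult_left_le\<close>)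

lemma h_ge1: "x \<in> X \<Longrightarrow> 1 \<le> h t x"
  using sum_le_suminf[OF h_summable[of t x], of "{..<1}"] cc_pos[of t] u_range
  by (simp add: h_def cc_0 u_0 less_imp_le)

lemma h_nonneg: "0 \<le> h t x"
  unfolding h_def using cc_pos[of t] u_range by (intro suminf_nonneg h_summable) (auto simp: less_imp_le)

definition Ch :: "real \<Rightarrow> real" where "Ch t = suminf (cc t)"

lemma h_le: "h t x \<le> Ch t"
  unfolding h_def Ch_def using cc_pos[of t] u_range
  by (intro suminf_le h_summable cc_summable) (auto simp: less_imp_le intro!: mult_left_le)

lemma Ch_ge1: "1 \<le> Ch t" using h_ge1[OF zero_in_X] h_le order_trans by blast

text \<open>The eigenvalue equation is exactly the normalisation \<open>\<Sum>p = 1\<close>.\<close>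

lemma L_h:
  assumes "x \<in> X" shows "L t (h t) x = lam t * h t x"
proof -
  have e: "cc t j * (real (q j) * u 0 x + exp (t * real (q j)) * u (Suc j) x) =
      lam t * (p t (zt t) j + cc t (Suc j) * u (Suc j) x)" for j
    using zt[of t] by (simp add: u_0[OF assms] lam_def p_eq_c cc_def c_def H_Suc field_simps)
  have "L t (h t) x = (\<Sum>j. cc t j * u j (cons 0 x)) +
      (\<Sum>j. cc t j * (if lex_le x (qs 1) then exp t * u j (cons 1 x) else 0))"
    unfolding L_X[OF assms] h_def
    using suminf_mult[OF h_summable[of t "cons 1 x"], of "exp t"] by (auto simp: algebra_simps simp del: One_nat_def)
  also have "\<dots> = (\<Sum>j. cc t j * u j (cons 0 x) + cc t j * (if lex_le x (qs 1) then exp t * u j (cons 1 x) else 0))"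
  proof (rule suminf_add[OF h_summable])
    show "summable (\<lambda>j. cc t j * (if lex_le x (qs 1) then exp t * u j (cons 1 x) else 0))"
      using summable_mult[OF h_summable[of t "cons 1 x"], of "exp t"]
      by (cases "lex_le x (qs 1)") (simp_all add: mult.left_commute)
  qed
  also have "\<dots> = (\<Sum>j. cc t j * L t (u j) x)"
    by (simp add: L_X[OF assms] algebra_simps)
  also have "\<dots> = (\<Sum>j. lam t * (p t (zt t) j + cc t (Suc j) * u (Suc j) x))"
    unfolding L_u[OF assms] e ..
  also have "\<dots> = lam t * (\<Sum>j. p t (zt t) j + cc t (Suc j) * u (Suc j) x)"
    using zt(3)[of t] h_summable[of t x] by (intro suminf_mult summable_add) (auto simp: sums_iff summable_Suc_iff[of "\<lambda>j. cc t j * u j x"])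
  also have "(\<Sum>j. p t (zt t) j + cc t (Suc j) * u (Suc j) x) = 1 + (\<Sum>j. cc t (Suc j) * u (Suc j) x)"
    using zt(3)[of t] h_summable[of t x]
    by (subst suminf_add[symmetric]) (auto simp: sums_iff summable_Suc_iff[of "\<lambda>j. cc t j * u j x"])
  also have "\<dots> = h t x"
    unfolding h_def using suminf_split_head[OF h_summable[of t x]] by (simp add: cc_0 u_0[OF assms])
  finally show ?thesis .
qed

section \<open>Normalised iterates and their uniform limits\<close>

definition N :: "real \<Rightarrow> nat \<Rightarrow> (digits \<Rightarrow> real) \<Rightarrow> digits \<Rightarrow> real" where
  "N t n f x = zt t ^ n * (L t ^^ n) f x"

lemma N_h: "x \<in> X \<Longrightarrow> N t n (h t) x = h t x"
proof (induction n arbitrary: x)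
  case (Suc n)
  have "(L t ^^ Suc n) (h t) x = L t (\<lambda>y. lam t ^ n * h t y) x"
    unfolding funpow.simps o_apply
  proof (rule fun_cong[OF tr_cong])
    fix y assume "y \<in> X"
    from Suc.IH[OF this] show "(L t ^^ n) (h t) y = lam t ^ n * h t y"
      using zt[of t] by (simp add: N_def lam_def field_simps)
  qed
  also have "\<dots> = lam t ^ Suc n * h t x" by (simp add: tr_cmult L_h[OF Suc.prems])
  finally show ?case using zt[of t] by (simp add: N_def lam_def power_divide)
qed (simp add: N_def)

lemma N_add: "N t n (\<lambda>x. f x + g x) x = N t n f x + N t n g x"
  by (simp add: N_def tr_pow_add algebra_simps)
lemma N_diff: "N t n (\<lambda>x. f x - g x) x = N t n f x - N t n g x"
  by (simp add: N_def tr_pow_diff algebra_simps)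
lemma N_cmult: "N t n (\<lambda>x. a * f x) x = a * N t n f x"
  by (simp add: N_def tr_pow_cmult algebra_simps)
lemma N_sum: "N t n (\<lambda>x. \<Sum>i\<in>I. f i x) x = (\<Sum>i\<in>I. N t n (f i) x)"
  by (simp add: N_def tr_pow_sum sum_distrib_left)
lemma N_cong: "(\<And>x. x \<in> X \<Longrightarrow> f x = g x) \<Longrightarrow> x \<in> X \<Longrightarrow> N t n f x = N t n g x"
  unfolding N_def using tr_pow_cong[of f g x n] by simp
lemma N_abs_le: "(\<And>x. x \<in> X \<Longrightarrow> \<bar>f x\<bar> \<le> g x) \<Longrightarrow> x \<in> X \<Longrightarrow> \<bar>N t n f x\<bar> \<le> N t n g x"
  unfolding N_def using tr_pow_abs_le[of f g x n] zt[of t] by (simp add: abs_mult)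
lemma N_compose: "N t n (N t k f) x = N t (n + k) f x"
proof -
  have "N t k f = (\<lambda>x. zt t ^ k * (L t ^^ k) f x)" by (simp add: N_def[abs_def])
  thus ?thesis unfolding N_def[of t "n + k"] funpow_add o_apply
    by (simp add: N_def tr_pow_cmult power_add)
qed

definition asym :: "real \<Rightarrow> (digits \<Rightarrow> real) \<Rightarrow> real \<Rightarrow> bool" where
  "asym t f \<kappa> \<longleftrightarrow> uniform_limit X (\<lambda>n x. N t n f x) (\<lambda>x. \<kappa> * h t x) sequentially"

lemma asym_add: "asym t f a \<Longrightarrow> asym t g b \<Longrightarrow> asym t (\<lambda>x. f x + g x) (a + b)"
  unfolding asym_def N_add distrib_right by (rule uniform_limit_add)

lemma asym_cmult: "asym t f a \<Longrightarrow> asym t (\<lambda>x. r * f x) (r * a)"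
  unfolding asym_def N_cmult mult.assoc
  by (rule bounded_linear.uniform_limit[OF bounded_linear_mult_right])

lemma asym_cong: "(\<And>x. x \<in> X \<Longrightarrow> f x = g x) \<Longrightarrow> asym t f a = asym t g a"
  unfolding asym_def by (intro uniform_limit_cong' N_cong) auto

lemma asym_zero: "asym t (\<lambda>_. 0) 0"
  using N_cmult[of t _ 0 "\<lambda>_. 0"] by (simp add: asym_def uniform_limit_const)

lemma asym_sum: "finite I \<Longrightarrow> (\<And>i. i \<in> I \<Longrightarrow> asym t (f i) (a i)) \<Longrightarrow> asym t (\<lambda>x. \<Sum>i\<in>I. f i x) (\<Sum>i\<in>I. a i)"
  by (induction I rule: finite_induct) (auto intro: asym_add asym_zero)

text \<open>Applying the operator only shifts the sequence of iterates. This is used from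
  \<open>u j\<close> to its image in \<open>asym_u\<close>, and from the image of a cylinder back to
  the cylinder in \<open>asym_cyl_u\<close>.\<close>

lemma asym_N_iff: "asym t (N t k f) a \<longleftrightarrow> asym t f a"
proof -
  have "asym t (N t k f) a \<longleftrightarrow> (\<forall>e>0. eventually (\<lambda>n. \<forall>x\<in>X. dist (N t (n + k) f x) (a * h t x) < e) sequentially)"
    unfolding asym_def uniform_limit_iff N_compose ..
  also have "\<dots> \<longleftrightarrow> asym t f a"
    unfolding asym_def uniform_limit_iff
    using eventually_sequentially_seg[of "\<lambda>n. \<forall>x\<in>X. dist (N t n f x) (a * h t x) < e" k for e] by simp
  finally show ?thesis .
qed

text \<open>Dominated convergence for series, with majorant \<open>cc\<close>. As \<open>u j\<close>
  is at most 1, the error bound does not involve x, which makes the limit uniform.\<close>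

lemma asym_one: "asym t (\<lambda>_. 1) (lim (v t))"
proof -
  let ?V = "lim (v t)"
  have vlim: "v t \<longlonglongrightarrow> ?V" using v_convergent by (simp add: convergent_LIMSEQ_iff)
  have v01: "0 \<le> v t n \<and> v t n \<le> 1" for n
    unfolding v_def by (rule renew_bounds) (use p_nonneg[of "zt t" t] zt[of t] p_partial in \<open>auto simp: less_imp_le\<close>)
  have V01: "0 \<le> ?V" "?V \<le> 1"
    using LIMSEQ_le_const[OF vlim] LIMSEQ_le_const2[OF vlim] v01 by blast+
  define d where "d j n = \<bar>(if j \<le> n then v t (n - j) else 0) - ?V\<bar> * cc t j" for j n
  have dle: "norm (d j n) \<le> cc t j" for j n
  proof -
    have "\<bar>(if j \<le> n then v t (n - j) else 0) - ?V\<bar> \<le> 1" using v01[of "n - j"] V01 by (auto simp: abs_le_iff)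
    thus ?thesis unfolding d_def using cc_pos[of t j] by (simp add: abs_mult mult_left_le_one_le)
  qed
  have dlim: "(\<lambda>n. d j n) \<longlonglongrightarrow> 0" for j
  proof -
    have "(\<lambda>n. v t (n - j)) \<longlonglongrightarrow> ?V"
      using LIMSEQ_offset[of "\<lambda>n. v t (n - j)" j ?V] vlim by simp
    moreover have "eventually (\<lambda>n. v t (n - j) = (if j \<le> n then v t (n - j) else 0)) sequentially"
      using eventually_ge_at_top[of j] by eventually_elim simp
    ultimately have "(\<lambda>n. (if j \<le> n then v t (n - j) else 0)) \<longlonglongrightarrow> ?V"
      by (rule Lim_transform_eventually)
    hence "(\<lambda>n. \<bar>(if j \<le> n then v t (n - j) else 0) - ?V\<bar> * cc t j) \<longlonglongrightarrow> \<bar>?V - ?V\<bar> * cc t j"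
      by (intro tendsto_intros)
    thus ?thesis by (simp add: d_def)
  qed
  have D: "(\<lambda>n. \<Sum>j. d j n) \<longlonglongrightarrow> (\<Sum>j. 0::real)"
  proof -
    have "eventually (\<lambda>(k, n). norm (d k n) \<le> cc t k) (at_top \<times>\<^sub>F sequentially)"
      by (rule always_eventually) (use dle in auto)
    from tannerys_theorem[OF dlim this cc_summable] show ?thesis by simp
  qed
  have ds: "summable (\<lambda>j. d j n)" for n
    by (rule summable_comparison_test'[OF cc_summable[of t], of 0]) (use dle in auto)
  have bound: "\<bar>N t n (\<lambda>_. 1) x - ?V * h t x\<bar> \<le> (\<Sum>j. d j n)" if x: "x \<in> X" for n x
  proof -
    let ?w = "\<lambda>j. if j \<le> n then v t (n - j) else 0"
    have "N t n (\<lambda>_. 1) x = (\<Sum>j\<le>n. ?w j * (cc t j * u j x))"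
      unfolding N_def L_pow_one[OF x] v_def cc_def by (intro sum.cong) auto
    also have "\<dots> = (\<Sum>j. ?w j * (cc t j * u j x))"
      by (rule suminf_finite[symmetric]) auto
    finally have N1: "N t n (\<lambda>_. 1) x = (\<Sum>j. ?w j * (cc t j * u j x))" .
    have s1: "summable (\<lambda>j. ?w j * (cc t j * u j x))"
      by (rule summable_finite[of "{..n}"]) auto
    have s2: "summable (\<lambda>j. ?V * (cc t j * u j x))" by (intro summable_mult h_summable)
    have "N t n (\<lambda>_. 1) x - ?V * h t x = (\<Sum>j. ?w j * (cc t j * u j x) - ?V * (cc t j * u j x))"
      unfolding N1 h_def suminf_mult[OF h_summable[of t x], symmetric] using suminf_diff[OF s1 s2] by simp
    also have "norm \<dots> \<le> (\<Sum>j. d j n)"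
    proof (rule norm_suminf_le)
      show "summable (\<lambda>j. d j n)" by (rule ds)
      show "norm (?w j * (cc t j * u j x) - ?V * (cc t j * u j x)) \<le> d j n" for j
      proof -
        have "norm (?w j * (cc t j * u j x) - ?V * (cc t j * u j x)) = \<bar>?w j - ?V\<bar> * cc t j * u j x"
          using cc_pos[of t j] u_range[of j x] by (simp add: left_diff_distrib[symmetric] abs_mult)
        also have "\<dots> \<le> d j n"
          unfolding d_def using cc_pos[of t j] u_range[of j x] by (intro mult_left_le) auto
        finally show ?thesis .
      qed
    qed
    finally show ?thesis by simp
  qed
  show ?thesis unfolding asym_def
  proof (rule uniform_limitI)
    fix e :: real assume "e > 0"
    with D have "eventually (\<lambda>n. (\<Sum>j. d j n) < e) sequentially" by (intro order_tendstoD) auto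
    thus "\<forall>\<^sub>F n in sequentially. \<forall>x\<in>X. dist (N t n (\<lambda>_. 1) x) (?V * h t x) < e"
    proof eventually_elim
      case (elim n)
      thus ?case using bound[of _ n] by (auto simp: dist_real_def intro: le_less_trans)
    qed
  qed
qed

lemma N_one_bound: "\<exists>C>0. \<forall>x\<in>X. \<forall>n. N t n (\<lambda>_. 1) x \<le> C"
  using L_bound by (simp add: N_def)

lemma N_sup_bound:
  assumes C: "\<forall>x\<in>X. \<forall>n. N t n (\<lambda>_. 1) x \<le> C"
    and f: "\<And>x. x \<in> X \<Longrightarrow> \<bar>f x\<bar> \<le> e" and e: "0 \<le> e" and x: "x \<in> X"
  shows "\<bar>N t n f x\<bar> \<le> e * C"
proof -
  have "\<bar>N t n f x\<bar> \<le> N t n (\<lambda>x. e * 1) x" by (rule N_abs_le) (use f x in auto)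
  also have "\<dots> \<le> e * C" unfolding N_cmult using C x e by (intro mult_left_mono) auto
  finally show ?thesis .
qed

text \<open>Closeness is asked of the iterates from some index on, not of f and g themselves:
  distinct indicators are never uniformly close, but their iterates may be. The limit F is within e
  of a multiple of h for each e, hence is a multiple, with the factor read off at
  \<open>zero\<close>.\<close>

lemma asym_closure:
  assumes "\<And>e. e > 0 \<Longrightarrow> \<exists>g \<kappa> M. asym t g \<kappa> \<and> (\<forall>n\<ge>M. \<forall>x\<in>X. \<bar>N t n (\<lambda>x. f x - g x) x\<bar> \<le> e)"
  shows "\<exists>\<kappa>. asym t f \<kappa>"
proof -
  have cau: "uniformly_Cauchy_on X (\<lambda>n x. N t n f x)"
  proof (rule uniformly_Cauchy_onI)
    fix e :: real assume e: "e > 0"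
    obtain g \<kappa> M where g: "asym t g \<kappa>" "\<forall>n\<ge>M. \<forall>x\<in>X. \<bar>N t n (\<lambda>x. f x - g x) x\<bar> \<le> e/8"
      using assms[of "e/8"] e by auto
    from g(1) have "eventually (\<lambda>n. \<forall>x\<in>X. dist (N t n g x) (\<kappa> * h t x) < e/8) sequentially"
      unfolding asym_def uniform_limit_iff by (rule allE[of _ "e/8"]) (use e in simp)
    then obtain M' where M': "\<And>n x. n \<ge> M' \<Longrightarrow> x \<in> X \<Longrightarrow> dist (N t n g x) (\<kappa> * h t x) < e/8"
      by (auto simp: eventually_sequentially)
    have "\<bar>N t n f x - \<kappa> * h t x\<bar> < e/2" if "n \<ge> max M M'" "x \<in> X" for n x
    proof -
      have "\<bar>N t n f x - N t n g x\<bar> \<le> e/8" using g(2) that by (simp add: N_diff)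
      moreover have "\<bar>N t n g x - \<kappa> * h t x\<bar> < e/8" using M'[of n x] that by (simp add: dist_real_def)
      ultimately show ?thesis using e by linarith
    qed
    hence "\<forall>x\<in>X. \<forall>m\<ge>max M M'. \<forall>n\<ge>max M M'. dist (N t m f x) (N t n f x) < e"
      by (intro ballI allI impI) (smt (verit, ccfv_SIG) dist_real_def field_sum_of_halves)
    thus "\<exists>M. \<forall>x\<in>X. \<forall>m\<ge>M. \<forall>n\<ge>M. dist (N t m f x) (N t n f x) < e" by blast
  qed
  then obtain F where F: "uniform_limit X (\<lambda>n x. N t n f x) F sequentially"
    using Cauchy_uniformly_convergent uniformly_convergent_on_def by blast
  define \<kappa> where "\<kappa> = F zero / h t zero"
  have Fx: "\<exists>k. \<forall>x\<in>X. \<bar>F x - k * h t x\<bar> \<le> e" if e: "e > 0" for e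
  proof -
    obtain g k M where g: "asym t g k" "\<forall>n\<ge>M. \<forall>x\<in>X. \<bar>N t n (\<lambda>x. f x - g x) x\<bar> \<le> e"
      using assms[OF e] by auto
    have "\<bar>F x - k * h t x\<bar> \<le> e" if x: "x \<in> X" for x
    proof -
      have "(\<lambda>n. \<bar>N t n f x - N t n g x\<bar>) \<longlonglongrightarrow> \<bar>F x - k * h t x\<bar>"
        using tendsto_uniform_limitI[OF F x] tendsto_uniform_limitI[OF g(1)[unfolded asym_def] x]
        by (intro tendsto_intros)
      thus ?thesis by (rule LIMSEQ_le_const2) (use g(2) x in \<open>auto simp: N_diff intro!: exI[of _ M]\<close>)
    qed
    thus ?thesis by blast
  qed
  have "F x = \<kappa> * h t x" if x: "x \<in> X" for x
  proof -
    have "\<bar>F x - \<kappa> * h t x\<bar> \<le> 0 + e" if e: "e > 0" for e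
    proof -
      have C1: "1 + Ch t > 0" using Ch_ge1[of t] by simp
      obtain k where k: "\<forall>x\<in>X. \<bar>F x - k * h t x\<bar> \<le> e / (1 + Ch t)" using Fx[of "e / (1 + Ch t)"] e C1 by auto
      have h0: "1 \<le> h t zero" using h_ge1 zero_in_X by auto
      have "\<bar>\<kappa> - k\<bar> * 1 \<le> \<bar>\<kappa> - k\<bar> * h t zero" using h0 by (intro mult_left_mono) auto
      also have "\<dots> = \<bar>F zero - k * h t zero\<bar>" using h0 by (simp add: \<kappa>_def abs_mult[symmetric] field_simps abs_if)
      also have "\<dots> \<le> e / (1 + Ch t)" using k zero_in_X by auto
      finally have kk: "\<bar>\<kappa> - k\<bar> \<le> e / (1 + Ch t)" by simp
      have "F x - \<kappa> * h t x = (F x - k * h t x) - (\<kappa> - k) * h t x" by (simp add: algebra_simps)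
      also have "\<bar>\<dots>\<bar> \<le> \<bar>F x - k * h t x\<bar> + \<bar>(\<kappa> - k) * h t x\<bar>" by (rule abs_triangle_ineq4)
      also have "\<bar>(\<kappa> - k) * h t x\<bar> = \<bar>\<kappa> - k\<bar> * h t x" using h_nonneg[of t x] by (simp add: abs_mult)
      finally have "\<bar>F x - \<kappa> * h t x\<bar> \<le> \<bar>F x - k * h t x\<bar> + \<bar>\<kappa> - k\<bar> * h t x" .
      also have "\<dots> \<le> e / (1 + Ch t) + e / (1 + Ch t) * Ch t"
        using k x kk h_le[of t x] h_nonneg[of t x] by (intro add_mono mult_mono) auto
      also have "\<dots> = e / (1 + Ch t) * (1 + Ch t)" by (simp add: distrib_left)
      also have "\<dots> = e" using C1 by simp
      finally show ?thesis by simp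
    qed
    hence "\<bar>F x - \<kappa> * h t x\<bar> \<le> 0" by (rule field_le_epsilon)
    thus ?thesis by simp
  qed
  hence "asym t f \<kappa>"
    unfolding asym_def using F by (metis (no_types, lifting) uniform_limit_cong')
  thus ?thesis ..
qed

lemma asym_closure_sup:
  assumes "\<And>e. e > 0 \<Longrightarrow> \<exists>g \<kappa>. asym t g \<kappa> \<and> (\<forall>x\<in>X. \<bar>f x - g x\<bar> \<le> e)"
  shows "\<exists>\<kappa>. asym t f \<kappa>"
proof (rule asym_closure)
  fix e :: real assume e: "e > 0"
  obtain C where C: "C > 0" "\<forall>x\<in>X. \<forall>n. N t n (\<lambda>_. 1) x \<le> C" using N_one_bound by blast
  obtain g \<kappa> where g: "asym t g \<kappa>" "\<forall>x\<in>X. \<bar>f x - g x\<bar> \<le> e / C" using assms[of "e / C"] e C by auto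
  have "\<bar>N t n (\<lambda>x. f x - g x) x\<bar> \<le> e / C * C" if "x \<in> X" for n x
    by (rule N_sup_bound[OF C(2)]) (use g(2) that e C in auto)
  thus "\<exists>g \<kappa> M. asym t g \<kappa> \<and> (\<forall>n\<ge>M. \<forall>x\<in>X. \<bar>N t n (\<lambda>x. f x - g x) x\<bar> \<le> e)"
    using g(1) C by auto
qed

text \<open>Solving \<open>L_u\<close> for \<open>u (Suc j)\<close> expresses it by
  \<open>u 0\<close> and the image of \<open>u j\<close>.\<close>

lemma asym_u: "\<exists>\<kappa>. asym t (u j) \<kappa>"
proof (induction j)
  case 0
  have "asym t (u 0) (lim (v t)) = asym t (\<lambda>_. 1) (lim (v t))" by (rule asym_cong) (simp add: u_0)
  thus ?case using asym_one by blast
next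
  case (Suc j)
  obtain a where a: "asym t (u j) a" using Suc by blast
  hence "asym t (N t 1 (u j)) a" by (simp add: asym_N_iff)
  moreover have "asym t (u 0) (lim (v t)) = asym t (\<lambda>_. 1) (lim (v t))" by (rule asym_cong) (simp add: u_0)
  hence "asym t (u 0) (lim (v t))" using asym_one by blast
  ultimately have A: "asym t (\<lambda>x. exp (- t * real (q j)) * ((lam t * N t 1 (u j) x) + (- real (q j)) * u 0 x))
      (exp (- t * real (q j)) * (lam t * a + (- real (q j)) * lim (v t)))"
    by (intro asym_cmult asym_add)
  have "asym t (u (Suc j)) b = asym t (\<lambda>x. exp (- t * real (q j)) * ((lam t * N t 1 (u j) x) + (- real (q j)) * u 0 x)) b" for b
  proof (rule asym_cong)
    fix x assume x: "x \<in> X"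
    have "lam t * N t 1 (u j) x = L t (u j) x" using zt[of t] by (simp add: N_def lam_def)
    thus "u (Suc j) x = exp (- t * real (q j)) * ((lam t * N t 1 (u j) x) + (- real (q j)) * u 0 x)"
      by (simp add: L_u[OF x] exp_minus)
  qed
  thus ?case using A by blast
qed

section \<open>Cylinders and zero-padded words\<close>

definition trunc :: "nat \<Rightarrow> digits \<Rightarrow> digits" where "trunc n x = (\<lambda>i. if i < n then x i else 0)"
text \<open>A word of length n is represented by its continuation with zeros, which is admissible by
  heredity. Words are thus points of X at which functions can be evaluated.\<close>

definition W :: "nat \<Rightarrow> digits set" where "W n = {x \<in> X. \<forall>i\<ge>n. x i = 0}"
definition cyl :: "nat \<Rightarrow> digits \<Rightarrow> digits set" where "cyl n w = {x \<in> X. trunc n x = w}"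

lemma trunc_in_W: "x \<in> X \<Longrightarrow> trunc n x \<in> W n"
  unfolding W_def by (auto simp: trunc_def intro: hereditary)

lemma W_X: "w \<in> W n \<Longrightarrow> w \<in> X" by (simp add: W_def)
lemma trunc_W: "w \<in> W n \<Longrightarrow> trunc n w = w" by (auto simp: W_def trunc_def fun_eq_iff)

lemma W_0: "W 0 = {zero}" using zero_in_X by (auto simp: W_def)

lemma W_Suc: "W (Suc n) = {y. \<exists>w\<in>W n. y \<in> {y \<in> X. shift y = w}}"
proof safe
  fix y assume y: "y \<in> W (Suc n)"
  show "\<exists>w\<in>W n. y \<in> {y \<in> X. shift y = w}"
    by (rule bexI[of _ "shift y"]) (use y shift_in_X in \<open>auto simp: W_def shift_def\<close>)
next
  fix y assume y: "y \<in> X" "shift y \<in> W n"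
  have "y i = 0" if "i \<ge> Suc n" for i
    using y(2) that unfolding W_def shift_def by (cases i) auto
  thus "y \<in> W (Suc n)" using y by (simp add: W_def)
qed

lemma finite_W: "finite (W n)"
proof (induction n)
  case (Suc n)
  have "W (Suc n) = (\<Union>w\<in>W n. {y \<in> X. shift y = w})" unfolding W_Suc by auto
  moreover have "finite {y \<in> X. shift y = w}" for w unfolding preimage_eq by simp
  ultimately show ?case using Suc by simp
qed (simp add: W_0)

definition birk :: "(digits \<Rightarrow> real) \<Rightarrow> nat \<Rightarrow> digits \<Rightarrow> real" where
  "birk \<Phi> n x = (\<Sum>i<n. \<Phi> ((shift ^^ i) x))"

lemma birk_Suc_shift: "birk \<Phi> (Suc n) x = \<Phi> x + birk \<Phi> n (shift x)"
  by (simp add: birk_def sum.lessThan_Suc_shift funpow_swap1 del: sum.lessThan_Suc)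

lemma birk_chit: "x \<in> X \<Longrightarrow> birk (chit t) n x = t * S n x"
  by (simp add: birk_def S_def chit_def chi_eq shift_pow_in_X sum_distrib_left) (simp add: shift_pow)

text \<open>The zero-padded words of length n are exactly the n-th preimages of \<open>zero\<close>,
  so evaluation at \<open>zero\<close> turns the iterate into a partition function over
  cylinders.\<close>

lemma tr_pow_zero: "(tr \<Phi> ^^ n) f zero = (\<Sum>w\<in>W n. exp (birk \<Phi> n w) * f w)"
proof (induction n arbitrary: f)
  case 0
  show ?case by (simp add: W_0 birk_def)
next
  case (Suc n)
  have "(tr \<Phi> ^^ Suc n) f zero = (tr \<Phi> ^^ n) (tr \<Phi> f) zero" by (simp add: funpow_swap1)
  also have "\<dots> = (\<Sum>w\<in>W n. \<Sum>y\<in>{y \<in> X. shift y = w}. exp (birk \<Phi> (Suc n) y) * f y)"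
    unfolding Suc.IH by (auto simp: tr_def sum_distrib_left birk_Suc_shift exp_add intro!: sum.cong)
  also have "\<dots> = (\<Sum>y\<in>(\<Union>w\<in>W n. {y \<in> X. shift y = w}). exp (birk \<Phi> (Suc n) y) * f y)"
    by (rule sum.UNION_disjoint[symmetric]) (use finite_W preimage_eq in auto)
  also have "(\<Union>w\<in>W n. {y \<in> X. shift y = w}) = W (Suc n)" unfolding W_Suc by auto
  finally show ?case .
qed

lemma u_cons_0: "x \<in> X \<Longrightarrow> u j (cons 0 x) = (if q j = 1 then u 0 x else u (Suc j) x)"
  using q01[of j] u_0[of x] by (auto simp: u_def lex_le_cons qs_app shift_qs)

lemma u_cons_1: "u j (cons 1 x) = (if q j = 1 then u (Suc j) x else 0)"
  using q01[of j] by (auto simp: u_def lex_le_cons qs_app shift_qs)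

lemma qs_Suc_le:
  assumes "q j = 1" shows "lex_le (qs (Suc j)) (qs 1)"
proof -
  have "cons 1 (qs (Suc j)) = qs j"
    using cons_shift[of "qs j"] assms by (simp add: shift_qs) (simp add: qs_app)
  hence "lex_le (cons 1 (qs (Suc j))) q" using qs_le[of j] by simp
  thus ?thesis by (simp add: lex_le_cons q0 qs_def)
qed

text \<open>On a cylinder one inverse branch survives at each step, and along it \<open>u j\<close>
  turns into \<open>u 0\<close>, \<open>u (Suc j)\<close> or 0. So k steps produce the weight of the
  word times a single \<open>u i\<close>, or nothing.\<close>

lemma L_pow_cyl:
  assumes "w \<in> W k"
  shows "\<exists>a i. (a = 0 \<or> a = 1) \<and> (\<forall>x\<in>X. (L t ^^ k) (\<lambda>x. indicator (cyl k w) x * u j x) x = a * exp (t * S k w) * u i x)"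
  using assms
proof (induction k arbitrary: w j)
  case 0
  hence "\<forall>x\<in>X. (L t ^^ 0) (\<lambda>x. indicator (cyl 0 w) x * u j x) x = 1 * exp (t * S 0 w) * u j x"
    by (auto simp: W_0 cyl_def trunc_def)
  thus ?case by (intro exI[of _ 1] exI[of _ j] conjI disjI2 refl)
next
  case (Suc k)
  let ?w = "shift w" and ?f = "\<lambda>x. indicator (cyl (Suc k) w) x * u j x"
  have w': "?w \<in> W k" and wX: "w \<in> X" using Suc.prems unfolding W_Suc by auto
  have S: "S (Suc k) w = real (w 0) + S k ?w"
    by (simp add: S_def sum.lessThan_Suc_shift shift_def del: sum.lessThan_Suc)
  have tr_iff: "trunc (Suc k) (cons a x) = w \<longleftrightarrow> a = w 0 \<and> trunc k x = ?w" for a x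
  proof -
    have "trunc (Suc k) (cons a x) = cons a (trunc k x)"
      by (auto simp: trunc_def cons_def fun_eq_iff split: nat.split)
    thus ?thesis using cons_shift[of w] cons_eq_iff by metis
  qed
  have ex: "\<exists>b i. (b = 0 \<or> b = 1) \<and> (\<forall>x\<in>X. L t ?f x = b * exp (t * real (w 0)) * (indicator (cyl k ?w) x * u i x))"
  proof (cases "w 0 = 0")
    case True
    have "L t ?f x = 1 * exp (t * real (w 0)) * (indicator (cyl k ?w) x * u (if q j = 1 then 0 else Suc j) x)"
      if x: "x \<in> X" for x
      unfolding L_X[OF x] using x True by (auto simp: cyl_def tr_iff cons_in_X_iff u_cons_0 indicator_def)
    thus ?thesis by (intro exI[of _ 1] exI[of _ "if q j = 1 then 0 else Suc j"] conjI disjI2 refl ballI)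
  next
    case False
    hence w1: "w 0 = 1" using X_01[OF wX, of 0] by auto
    have "L t ?f x = (if q j = 1 then 1 else 0) * exp (t * real (w 0)) * (indicator (cyl k ?w) x * u (Suc j) x)"
      if x: "x \<in> X" for x
    proof -
      have "u (Suc j) x = 0" if "q j = 1" "\<not> lex_le x (qs 1)"
        using that qs_Suc_le[of j] lex_le_trans by (auto simp: u_def)
      thus ?thesis unfolding L_X[OF x] using x w1 u_cons_1[of j x]
        by (auto simp: cyl_def tr_iff cons_in_X_iff indicator_def)
    qed
    thus ?thesis by (intro exI[of _ "if q j = 1 then 1 else 0"] exI[of _ "Suc j"] conjI ballI) simp_all
  qed
  then obtain b i where b: "b = 0 \<or> b = 1"
    and Lf: "\<forall>x\<in>X. L t ?f x = b * exp (t * real (w 0)) * (indicator (cyl k ?w) x * u i x)" by blast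
  obtain a i' where a: "a = 0 \<or> a = 1"
    and IH: "\<forall>x\<in>X. (L t ^^ k) (\<lambda>x. indicator (cyl k ?w) x * u i x) x = a * exp (t * S k ?w) * u i' x"
    using Suc.IH[OF w'] by blast
  have R: "(L t ^^ Suc k) ?f x = (b * a) * exp (t * S (Suc k) w) * u i' x" if x: "x \<in> X" for x
  proof -
    have "(L t ^^ Suc k) ?f x = (L t ^^ k) (L t ?f) x" by (simp add: funpow_swap1)
    also have "\<dots> = (L t ^^ k) (\<lambda>x. (b * exp (t * real (w 0))) * (indicator (cyl k ?w) x * u i x)) x"
      by (rule tr_pow_cong) (use Lf x in auto)
    also have "\<dots> = (b * exp (t * real (w 0))) * (a * exp (t * S k ?w) * u i' x)"
      unfolding tr_pow_cmult using IH x by simp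
    also have "\<dots> = (b * a) * exp (t * S (Suc k) w) * u i' x"
      by (simp add: S distrib_left exp_add)
    finally show ?thesis .
  qed
  show ?case
  proof (intro exI[of _ "b * a"] exI[of _ i'] conjI ballI)
    show "b * a = 0 \<or> b * a = 1" using a b by auto
    fix x assume x: "x \<in> X"
    show "(L t ^^ Suc k) ?f x = b * a * exp (t * S (Suc k) w) * u i' x" by (rule R[OF x])
  qed
qed

lemma asym_cyl_u: 
  assumes "w \<in> W k" shows "\<exists>\<kappa>. asym t (\<lambda>x. indicator (cyl k w) x * u j x) \<kappa>"
proof -
  obtain a i where a: "\<forall>x\<in>X. (L t ^^ k) (\<lambda>x. indicator (cyl k w) x * u j x) x = a * exp (t * S k w) * u i x"
    using L_pow_cyl[OF assms, of t j] by (elim exE conjE) (rule that)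
  obtain \<kappa> where "asym t (u i) \<kappa>" using asym_u by blast
  hence "asym t (\<lambda>x. (zt t ^ k * (a * exp (t * S k w))) * u i x) (zt t ^ k * (a * exp (t * S k w)) * \<kappa>)"
    by (rule asym_cmult)
  hence "asym t (N t k (\<lambda>x. indicator (cyl k w) x * u j x)) (zt t ^ k * (a * exp (t * S k w)) * \<kappa>)"
    by (subst asym_cong[of _ "\<lambda>x. (zt t ^ k * (a * exp (t * S k w))) * u i x"]) (use a in \<open>auto simp: N_def\<close>)
  thus ?thesis unfolding asym_N_iff by (rule exI)
qed

text \<open>Cut the series of h and bound the rest uniformly by the tail of \<open>cc\<close>. The
  constant obtained here turns out, in \<open>equilibrium_cyl\<close>, to be the mass of the
  cylinder under every equilibrium state.\<close>

lemma asym_cyl_h: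
  assumes "w \<in> W k" shows "\<exists>\<kappa>. asym t (\<lambda>x. indicator (cyl k w) x * h t x) \<kappa>"
proof (rule asym_closure_sup)
  fix e :: real assume e: "e > 0"
  obtain K where K: "\<And>n. n \<ge> K \<Longrightarrow> norm (\<Sum>i. cc t (i + n)) < e"
    using suminf_exist_split[OF e cc_summable[of t]] by blast
  let ?g = "\<lambda>x. \<Sum>j<K. cc t j * (indicator (cyl k w) x * u j x)"
  define \<kappa> where "\<kappa> j = (SOME \<kappa>. asym t (\<lambda>x. indicator (cyl k w) x * u j x) \<kappa>)" for j
  have "asym t (\<lambda>x. indicator (cyl k w) x * u j x) (\<kappa> j)" for j
    unfolding \<kappa>_def by (rule someI_ex, rule asym_cyl_u[OF assms])
  hence "asym t ?g (\<Sum>j<K. cc t j * \<kappa> j)" by (intro asym_sum asym_cmult) auto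
  moreover have "\<bar>indicator (cyl k w) x * h t x - ?g x\<bar> \<le> e" if "x \<in> X" for x
  proof -
    have "h t x - (\<Sum>j<K. cc t j * u j x) = (\<Sum>j. cc t (j + K) * u (j + K) x)"
      unfolding h_def using suminf_minus_initial_segment[OF h_summable[of t x], of K] by simp
    moreover have "0 \<le> \<dots>"
      using cc_pos[of t] u_range h_summable[of t x]
      by (intro suminf_nonneg summable_ignore_initial_segment[of "\<lambda>j. cc t j * u j x"]) (auto simp: less_imp_le)
    moreover have "(\<Sum>j. cc t (j + K) * u (j + K) x) \<le> (\<Sum>j. cc t (j + K))"
      using cc_pos[of t] u_range h_summable[of t x] cc_summable[of t]
      by (intro suminf_le summable_ignore_initial_segment[of "\<lambda>j. cc t j * u j x"] summable_ignore_initial_segment[of "cc t"])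
         (auto simp: less_imp_le intro!: mult_left_le)
    moreover have "indicator (cyl k w) x * h t x - ?g x = indicator (cyl k w) x * (h t x - (\<Sum>j<K. cc t j * u j x))"
      by (simp add: right_diff_distrib sum_distrib_left algebra_simps)
    ultimately show ?thesis using K[of K] by (auto simp: indicator_def)
  qed
  ultimately show "\<exists>g \<kappa>. asym t g \<kappa> \<and> (\<forall>x\<in>X. \<bar>indicator (cyl k w) x * h t x - g x\<bar> \<le> e)"
    by (intro exI conjI ballI)
qed

section \<open>The leading eigenvalue\<close>

lemma trunc_lex: "lex_less (trunc k x) (trunc k y) \<Longrightarrow> lex_less x y"
proof -
  assume "lex_less (trunc k x) (trunc k y)"
  then obtain n where n: "\<forall>i<n. trunc k x i = trunc k y i" "trunc k x n < trunc k y n"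
    unfolding lex_less_def by blast
  hence "n < k" by (auto simp: trunc_def split: if_splits)
  hence "\<forall>i<n. x i = y i" "x n < y n" using n by (auto simp: trunc_def)
  thus ?thesis unfolding lex_less_def by blast
qed

text \<open>A down-closed set cuts at most one cylinder of each level, and the contribution of that
  cylinder decays.\<close>

lemma asym_downset:
  assumes D: "D \<subseteq> X" "\<And>x y. x \<in> X \<Longrightarrow> y \<in> D \<Longrightarrow> lex_le x y \<Longrightarrow> x \<in> D"
  shows "\<exists>\<kappa>. asym t (indicator D) \<kappa>"
proof (rule asym_closure)
  fix e :: real assume e: "e > 0"
  obtain \<theta> C where th: "0 < \<theta>" "\<theta> < 1" "0 < C"
    and dec: "\<And>x n. x \<in> X \<Longrightarrow> exp (t * S n x) * zt t ^ n \<le> C * \<theta> ^ n" using decay[of t] by metis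
  obtain B where B: "B > 0" "\<forall>x\<in>X. \<forall>n. N t n (\<lambda>_. 1) x \<le> B" using N_one_bound by blast
  \<comment> \<open>The single exceptional cylinder will contribute at most C \<theta>^k B to all
    later iterates.\<close>
  obtain k where k: "\<theta> ^ k < e / (C * B)"
    using real_arch_pow_inv[of "e / (C * B)" \<theta>] th e B by auto
  define U where "U = {w \<in> W k. cyl k w \<subseteq> D}"
  define f where "f x = (\<Sum>w\<in>U. indicator (cyl k w) x * u 0 x)" for x
  have finU: "finite U" unfolding U_def using finite_W by auto
  define \<kappa> where "\<kappa> w = (SOME \<kappa>. asym t (\<lambda>x. indicator (cyl k w) x * u 0 x) \<kappa>)" for w
  have "asym t (\<lambda>x. indicator (cyl k w) x * u 0 x) (\<kappa> w)" if "w \<in> W k" for w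
    unfolding \<kappa>_def by (rule someI_ex, rule asym_cyl_u[OF that])
  hence af: "asym t f (\<Sum>w\<in>U. \<kappa> w)"
    unfolding f_def[abs_def] using finU by (intro asym_sum) (auto simp: U_def)
  have f_eq: "f x = (if trunc k x \<in> U then 1 else 0)" if x: "x \<in> X" for x
  proof -
    have "f x = (\<Sum>w\<in>U. if w = trunc k x then 1 else 0)"
      unfolding f_def by (intro sum.cong) (use x u_0 in \<open>auto simp: cyl_def\<close>)
    thus ?thesis using finU by (simp add: sum.delta')
  qed
  \<comment> \<open>If a cylinder meets D without being contained in it, all smaller cylinders lie
    inside D and all larger ones outside, so f and the indicator of D differ on that cylinder
    only.\<close>
  have "\<exists>w\<in>W k. \<forall>x\<in>X. \<bar>indicator D x - f x\<bar> \<le> (indicator (cyl k w) x :: real)"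
  proof (cases "\<exists>x\<in>D. trunc k x \<notin> U")
    case False
    have "\<bar>indicator D x - f x\<bar> \<le> (indicator (cyl k zero) x :: real)" if x: "x \<in> X" for x
      using False f_eq[OF x] x D(1) by (auto simp: indicator_def U_def cyl_def)
    moreover have "zero \<in> W k" using zero_in_X by (simp add: W_def)
    ultimately show ?thesis by blast
  next
    case True
    then obtain a where a: "a \<in> D" "trunc k a \<notin> U" by blast
    have aX: "a \<in> X" using a D by blast
    have "trunc k a \<in> W k" using aX by (rule trunc_in_W)
    then obtain b where b: "b \<in> X" "trunc k b = trunc k a" "b \<notin> D"
      using a(2) unfolding U_def cyl_def by auto
    have "\<bar>indicator D x - f x\<bar> \<le> (indicator (cyl k (trunc k a)) x :: real)" if x: "x \<in> X" for x
    proof (cases "trunc k x = trunc k a")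
      case True thus ?thesis using f_eq[OF x] a(2) x by (auto simp: indicator_def cyl_def)
    next
      case False
      have "indicator D x = f x"
      proof (cases "x \<in> D")
        case xD: True
        have "lex_less (trunc k x) (trunc k a)"
        proof (rule ccontr)
          assume "\<not> ?thesis"
          hence "lex_less (trunc k b) (trunc k x)" using False lex_total b(2) by metis
          hence "lex_le b x" using trunc_lex by (auto simp: lex_le_def)
          thus False using D(2)[OF b(1) xD] b(3) by blast
        qed
        hence "y \<in> D" if "y \<in> X" "trunc k y = trunc k x" for y
          using trunc_lex[of k y a] D(2)[OF that(1) a(1)] that(2) by (simp add: lex_le_def)
        hence "cyl k (trunc k x) \<subseteq> D" unfolding cyl_def by blast
        thus ?thesis using xD f_eq[OF x] trunc_in_W[OF x] by (auto simp: U_def)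
      next
        case xD: False
        hence "trunc k x \<notin> U" using x by (auto simp: U_def cyl_def)
        thus ?thesis using xD f_eq[OF x] by auto
      qed
      thus ?thesis by (auto simp: indicator_def)
    qed
    thus ?thesis using trunc_in_W[OF aX] by blast
  qed
  then obtain w where w: "w \<in> W k" "\<And>x. x \<in> X \<Longrightarrow> \<bar>indicator D x - f x\<bar> \<le> (indicator (cyl k w) x :: real)" by blast
  obtain a i where a: "a = 0 \<or> a = 1"
    and Lk: "\<forall>x\<in>X. (L t ^^ k) (\<lambda>x. indicator (cyl k w) x * u 0 x) x = a * exp (t * S k w) * u i x"
    using L_pow_cyl[OF w(1), of t 0] by blast
  have Nk: "N t k (indicator (cyl k w)) x \<le> C * \<theta> ^ k \<and> 0 \<le> N t k (indicator (cyl k w)) x" if x: "x \<in> X" for x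
  proof -
    have "N t k (indicator (cyl k w)) x = N t k (\<lambda>x. indicator (cyl k w) x * u 0 x) x"
      by (rule N_cong) (use x u_0 in auto)
    also have "\<dots> = (a * u i x) * (exp (t * S k w) * zt t ^ k)"
      using Lk x by (simp add: N_def)
    finally have eq: "N t k (indicator (cyl k w)) x = (a * u i x) * (exp (t * S k w) * zt t ^ k)" .
    have au: "0 \<le> a * u i x" "a * u i x \<le> 1" using a u_range[of i x] by auto
    have "(a * u i x) * (exp (t * S k w) * zt t ^ k) \<le> 1 * (C * \<theta> ^ k)"
      by (rule mult_mono[OF au(2) dec[OF W_X[OF w(1)], of k]]) (use zt[of t] in auto)
    thus ?thesis using eq au zt[of t] by auto
  qed
  have "\<bar>N t n (\<lambda>x. indicator D x - f x) x\<bar> \<le> e" if n: "n \<ge> k" and x: "x \<in> X" for n x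
  proof -
    have "\<bar>N t n (\<lambda>x. indicator D x - f x) x\<bar> \<le> N t n (indicator (cyl k w)) x"
      by (rule N_abs_le[OF w(2) x])
    also have "\<dots> = N t (n - k) (N t k (indicator (cyl k w))) x" unfolding N_compose using n by simp
    also have "\<dots> \<le> \<bar>\<dots>\<bar>" by simp
    also have "\<dots> \<le> (C * \<theta> ^ k) * B"
      by (rule N_sup_bound[OF B(2)]) (use Nk th x in auto)
    also have "\<dots> = \<theta> ^ k * (C * B)" by simp
    also have "\<dots> \<le> e" using k th B by (simp add: pos_less_divide_eq less_imp_le)
    finally show ?thesis .
  qed
  thus "\<exists>g \<kappa> M. asym t g \<kappa> \<and> (\<forall>n\<ge>M. \<forall>x\<in>X. \<bar>N t n (\<lambda>x. indicator D x - g x) x\<bar> \<le> e)"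
    using af by (intro exI[of _ f] exI[of _ "\<Sum>w\<in>U. \<kappa> w"] exI[of _ k]) auto
qed

definition dn :: "digits set \<Rightarrow> digits set" where "dn I = {x \<in> X. \<exists>y\<in>I. lex_le x y}"

text \<open>An order-convex set is its down-closure minus the points below all of its elements, and
  both are down-closed. This reduces intervals to \<open>asym_downset\<close>.\<close>

lemma interval_diff:
  assumes "I \<in> shift_intervals \<beta>"
  shows "(indicator I x :: 'a :: ring_1) = indicator (dn I) x - indicator (dn I - I) x"
    and "\<And>x y. x \<in> X \<Longrightarrow> y \<in> dn I \<Longrightarrow> lex_le x y \<Longrightarrow> x \<in> dn I"
    and "\<And>x y. x \<in> X \<Longrightarrow> y \<in> dn I - I \<Longrightarrow> lex_le x y \<Longrightarrow> x \<in> dn I - I"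
proof -
  have I: "I \<subseteq> X" "\<And>x y z. x \<in> I \<Longrightarrow> y \<in> I \<Longrightarrow> z \<in> X \<Longrightarrow> lex_le x z \<Longrightarrow> lex_le z y \<Longrightarrow> z \<in> I"
    using assms unfolding shift_intervals_def by blast+
  have "I \<subseteq> dn I" using I(1) lex_le_refl unfolding dn_def by blast
  thus "(indicator I x :: 'a) = indicator (dn I) x - indicator (dn I - I) x" by (auto simp: indicator_def)
  show *: "x \<in> dn I" if "x \<in> X" "y \<in> dn I" "lex_le x y" for x y
    using that lex_le_trans unfolding dn_def by blast
  show "x \<in> dn I - I" if y: "x \<in> X" "y \<in> dn I - I" "lex_le x y" for x y
  proof -
    have "x \<notin> I"
    proof
      assume "x \<in> I"
      moreover obtain z where "z \<in> I" "lex_le y z" using y unfolding dn_def by blast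
      ultimately have "y \<in> I" using I(2)[of x z y] y unfolding dn_def by blast
      thus False using y by blast
    qed
    thus ?thesis using * y by blast
  qed
qed

lemma asym_interval:
  assumes "I \<in> shift_intervals \<beta>" shows "\<exists>\<kappa>. asym t (indicator I) \<kappa>"
proof -
  have A: "\<exists>a. asym t (indicator (dn I)) a"
  proof (rule asym_downset)
    show "dn I \<subseteq> X" by (auto simp: dn_def)
  qed (rule interval_diff(2)[OF assms])
  have B: "\<exists>b. asym t (indicator (dn I - I)) b"
  proof (rule asym_downset)
    show "dn I - I \<subseteq> X" by (auto simp: dn_def)
  qed (rule interval_diff(3)[OF assms])
  from A obtain a where a: "asym t (indicator (dn I)) a" ..
  from B obtain b where b: "asym t (indicator (dn I - I)) b" ..
  have AB: "asym t (\<lambda>x. indicator (dn I) x + (-1) * indicator (dn I - I) x) (a + (-1) * b)"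
    using a b by (intro asym_add asym_cmult)
  have eq: "(\<lambda>x. indicator (dn I) x + (-1) * indicator (dn I - I) x :: real) = indicator I"
    by (rule ext) (simp add: interval_diff(1)[OF assms])
  show ?thesis using AB unfolding eq by (rule exI)
qed

subsection \<open>Bounded variation\<close>

lemma zero_less_q: "lex_less zero q" using q0 unfolding lex_less_def by (intro exI[of _ 0]) auto

lemma variationE:
  assumes "r \<in> variation_sums \<beta> f"
  obtains n c where "r = (\<Sum>i<n. cmod (f (c (Suc i)) - f (c i)))" "\<forall>i\<le>n. c i \<in> X"
      "\<forall>i<n. lex_less (c i) (c (Suc i))" "c 0 = zero" "c n = quasi_greedy_one \<beta>"
  using assms unfolding variation_sums_def by blast

lemma variation_nonempty: "variation_sums \<beta> f \<noteq> {}"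
proof -
  have "(\<Sum>i<1. cmod (f ((\<lambda>i. if i = 0 then zero else q) (Suc i)) - f ((\<lambda>i. if i = 0 then zero else q) i))) \<in> variation_sums \<beta> f"
    unfolding variation_sums_def using zero_in_X q_in_X zero_less_q
    by (intro CollectI exI[of _ 1] exI[of _ "\<lambda>i::nat. if i = 0 then zero else q"]) (auto simp: q_def)
  thus ?thesis by blast
qed

lemma variation_cong: "(\<And>x. x \<in> X \<Longrightarrow> f x = g x) \<Longrightarrow> variation_sums \<beta> f = variation_sums \<beta> g"
proof -
  have *: "v \<in> variation_sums \<beta> g" if "\<And>x. x \<in> X \<Longrightarrow> f x = g x" and r: "v \<in> variation_sums \<beta> f" for f g v
  proof -
    obtain n c where nc: "v = (\<Sum>i<n. cmod (f (c (Suc i)) - f (c i)))" "\<forall>i\<le>n. c i \<in> X"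
      "\<forall>i<n. lex_less (c i) (c (Suc i))" "c 0 = zero" "c n = quasi_greedy_one \<beta>"
      by (rule variationE[OF r])
    have "v = (\<Sum>i<n. cmod (g (c (Suc i)) - g (c i)))"
      unfolding nc(1) using that(1) nc(2) by (intro sum.cong) auto
    thus ?thesis unfolding variation_sums_def using nc by blast
  qed
  assume "\<And>x. x \<in> X \<Longrightarrow> f x = g x"
  thus ?thesis using *[of f g] *[of g f] by auto
qed

lemma BV_cong: "(\<And>x. x \<in> X \<Longrightarrow> f x = g x) \<Longrightarrow> f \<in> BV \<beta> \<longleftrightarrow> g \<in> BV \<beta>"
  unfolding BV_def using variation_cong[of f g] by simp

lemma variation_le:
  assumes "f \<in> BV \<beta>" "r \<in> variation_sums \<beta> f" shows "r \<le> Sup (variation_sums \<beta> f)"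
  using assms unfolding BV_def by (intro cSup_upper) auto

text \<open>Chains in \<open>variation_sums\<close> must run from \<open>zero\<close> to
  \<open>q\<close>, so x is inserted between the two; if x is one of them, the two-point chain
  serves.\<close>

lemma BV_diff_bound:
  assumes "f \<in> BV \<beta>" "x \<in> X" shows "cmod (f x - f zero) \<le> Sup (variation_sums \<beta> f)"
proof -
  have "\<exists>v\<in>variation_sums \<beta> f. cmod (f x - f zero) \<le> v"
  proof (cases "x = zero \<or> x = q")
    case True
    let ?c = "\<lambda>i::nat. if i = 0 then zero else q"
    have "(\<Sum>i<1. cmod (f (?c (Suc i)) - f (?c i))) \<in> variation_sums \<beta> f"
      unfolding variation_sums_def using zero_in_X q_in_X zero_less_q
      by (intro CollectI exI[of _ 1] exI[of _ ?c]) (auto simp: q_def)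
    thus ?thesis by (rule bexI[rotated]) (use True in auto)
  next
    case False
    let ?c = "\<lambda>i::nat. if i = 0 then zero else if i = 1 then x else q"
    have "lex_less zero x" using False lex_total[of zero x] by (auto simp: lex_less_def)
    moreover have "lex_less x q" using False X_le_q[OF assms(2)] by (simp add: lex_le_def)
    ultimately have "(\<Sum>i<2. cmod (f (?c (Suc i)) - f (?c i))) \<in> variation_sums \<beta> f"
      unfolding variation_sums_def using zero_in_X q_in_X assms(2)
      by (intro CollectI exI[of _ 2] exI[of _ ?c]) (auto simp: q_def less_2_cases_iff)
    thus ?thesis by (rule bexI[rotated]) (auto simp: numeral_2_eq_2)
  qed
  thus ?thesis using variation_le[OF assms(1)] order_trans by blast
qed

lemma Sup_variation_nonneg: "f \<in> BV \<beta> \<Longrightarrow> 0 \<le> Sup (variation_sums \<beta> f)"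
  using BV_diff_bound[OF _ zero_in_X] by simp

lemma BV_bounded: "f \<in> BV \<beta> \<Longrightarrow> bdd_above ((\<lambda>x. cmod (f x)) ` X)"
proof (rule bdd_aboveI2)
  fix x assume "f \<in> BV \<beta>" "x \<in> X"
  thus "cmod (f x) \<le> cmod (f zero) + Sup (variation_sums \<beta> f)"
    using BV_diff_bound[of f x] norm_triangle_ineq2[of "f x" "f zero"] by linarith
qed

lemma cmod_le_bv_norm: "f \<in> BV \<beta> \<Longrightarrow> x \<in> X \<Longrightarrow> cmod (f x) \<le> bv_norm \<beta> f"
  unfolding bv_norm_def using cSUP_upper[OF _ BV_bounded, of x f] Sup_variation_nonneg[of f] by fastforce

lemma bv_norm_nonneg: "f \<in> BV \<beta> \<Longrightarrow> 0 \<le> bv_norm \<beta> f"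
  using cmod_le_bv_norm[OF _ zero_in_X] norm_ge_zero order_trans by blast

lemma BV_lincomb:
  assumes "f \<in> BV \<beta>" "g \<in> BV \<beta>" shows "(\<lambda>x. a * f x + b * g x) \<in> BV \<beta>"
  unfolding BV_def
proof (rule CollectI, rule bdd_aboveI)
  fix v assume "v \<in> variation_sums \<beta> (\<lambda>x. a * f x + b * g x)"
  from variationE[OF this] obtain n c where nc: "v = (\<Sum>i<n. cmod (a * f (c (Suc i)) + b * g (c (Suc i)) - (a * f (c i) + b * g (c i))))"
     "\<forall>i\<le>n. c i \<in> X" "\<forall>i<n. lex_less (c i) (c (Suc i))" "c 0 = zero" "c n = quasi_greedy_one \<beta>" .
  have f: "(\<Sum>i<n. cmod (f (c (Suc i)) - f (c i))) \<in> variation_sums \<beta> f"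
    and g: "(\<Sum>i<n. cmod (g (c (Suc i)) - g (c i))) \<in> variation_sums \<beta> g"
    unfolding variation_sums_def using nc by blast+
  have "v \<le> (\<Sum>i<n. cmod a * cmod (f (c (Suc i)) - f (c i)) + cmod b * cmod (g (c (Suc i)) - g (c i)))"
    unfolding nc(1)
  proof (rule sum_mono)
    fix i
    have "a * f (c (Suc i)) + b * g (c (Suc i)) - (a * f (c i) + b * g (c i)) =
        a * (f (c (Suc i)) - f (c i)) + b * (g (c (Suc i)) - g (c i))" by (simp add: algebra_simps)
    thus "cmod (a * f (c (Suc i)) + b * g (c (Suc i)) - (a * f (c i) + b * g (c i))) \<le>
        cmod a * cmod (f (c (Suc i)) - f (c i)) + cmod b * cmod (g (c (Suc i)) - g (c i))"
      using norm_triangle_ineq[of "a * (f (c (Suc i)) - f (c i))" "b * (g (c (Suc i)) - g (c i))"]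
      by (simp only: norm_mult)
  qed
  also have "\<dots> \<le> cmod a * Sup (variation_sums \<beta> f) + cmod b * Sup (variation_sums \<beta> g)"
    unfolding sum.distrib sum_distrib_left[symmetric]
    by (intro add_mono mult_left_mono variation_le f g assms) auto
  finally show "v \<le> cmod a * Sup (variation_sums \<beta> f) + cmod b * Sup (variation_sums \<beta> g)" .
qed

lemma BV_diff: "f \<in> BV \<beta> \<Longrightarrow> g \<in> BV \<beta> \<Longrightarrow> (\<lambda>x. f x - g x) \<in> BV \<beta>"
  using BV_lincomb[of f g 1 "-1"] by simp

lemma BV_cmult: "f \<in> BV \<beta> \<Longrightarrow> (\<lambda>x. a * f x) \<in> BV \<beta>"
  using BV_lincomb[of f f a 0] by simp

text \<open>Along a chain, the variation of a monotone function telescopes to the difference of its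
  end values.\<close>

lemma antitone_BV:
  assumes anti: "\<And>x y. x \<in> X \<Longrightarrow> y \<in> X \<Longrightarrow> lex_less x y \<Longrightarrow> g y \<le> g x"
    and range: "\<And>x. x \<in> X \<Longrightarrow> 0 \<le> g x \<and> g x \<le> B"
  shows "(\<lambda>x. complex_of_real (g x)) \<in> BV \<beta>" "bv_norm \<beta> (\<lambda>x. complex_of_real (g x)) \<le> 2 * B"
proof -
  have vB: "v \<le> B" if r: "v \<in> variation_sums \<beta> (\<lambda>x. complex_of_real (g x))" for v
  proof -
    obtain n c where nc: "v = (\<Sum>i<n. cmod (complex_of_real (g (c (Suc i))) - complex_of_real (g (c i))))"
       "\<forall>i\<le>n. c i \<in> X" "\<forall>i<n. lex_less (c i) (c (Suc i))"
      by (rule variationE[OF r])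
    have "v = (\<Sum>i<n. g (c i) - g (c (Suc i)))"
      unfolding nc(1)
    proof (rule sum.cong[OF refl])
      fix i assume "i \<in> {..<n}"
      hence "g (c (Suc i)) \<le> g (c i)" using nc by (intro anti) auto
      thus "cmod (complex_of_real (g (c (Suc i))) - complex_of_real (g (c i))) = g (c i) - g (c (Suc i))"
        by (simp add: norm_of_real flip: of_real_diff)
    qed
    also have "\<dots> = g (c 0) - g (c n)" by (rule sum_lessThan_telescope')
    also have "\<dots> \<le> B" using range[of "c 0"] range[of "c n"] nc(2) by auto
    finally show ?thesis .
  qed
  show "(\<lambda>x. complex_of_real (g x)) \<in> BV \<beta>" unfolding BV_def using vB by (intro CollectI bdd_aboveI[of _ B])
  have "(SUP x\<in>X. cmod (complex_of_real (g x))) \<le> B"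
    using range zero_in_X by (intro cSUP_least) auto
  moreover have "Sup (variation_sums \<beta> (\<lambda>x. complex_of_real (g x))) \<le> B"
    using vB variation_nonempty by (intro cSup_least) auto
  ultimately show "bv_norm \<beta> (\<lambda>x. complex_of_real (g x)) \<le> 2 * B" unfolding bv_norm_def by simp
qed

lemma downset_BV:
  assumes "\<And>x y. x \<in> X \<Longrightarrow> y \<in> D \<Longrightarrow> lex_le x y \<Longrightarrow> x \<in> D"
  shows "indicator D \<in> BV \<beta>"
proof -
  have "(\<lambda>x. complex_of_real (indicator D x)) \<in> BV \<beta>"
  proof (rule antitone_BV[where B=1])
    show "indicator D y \<le> (indicator D x :: real)" if "x \<in> X" "y \<in> X" "lex_less x y" for x y
      using assms[of x y] that by (cases "y \<in> D") (simp_all add: lex_le_def)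
  qed (simp add: indicator_def)
  thus ?thesis by (simp add: of_real_indicator)
qed

lemma interval_BV:
  assumes "I \<in> shift_intervals \<beta>" shows "indicator I \<in> BV \<beta>"
proof -
  have "(\<lambda>x. indicator (dn I) x - indicator (dn I - I) x) \<in> BV \<beta>"
    using interval_diff(2,3)[OF assms] by (intro BV_diff downset_BV) blast+
  moreover have "indicator I \<in> BV \<beta> \<longleftrightarrow> (\<lambda>x. indicator (dn I) x - indicator (dn I - I) x) \<in> BV \<beta>"
    by (rule BV_cong) (rule interval_diff(1)[OF assms])
  ultimately show ?thesis by blast
qed

lemma zero_BV: "(\<lambda>_. 0) \<in> BV \<beta>"
  using antitone_BV(1)[of "\<lambda>_. 0" 0] by simp

lemma step_BV:
  assumes "s \<in> step_functions \<beta>" shows "s \<in> BV \<beta>"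
proof -
  obtain S a where s: "s = (\<lambda>x. \<Sum>I\<in>S. a I * indicator I x)" "finite S" "S \<subseteq> shift_intervals \<beta>"
    using assms unfolding step_functions_def by auto
  have "(\<lambda>x. \<Sum>I\<in>S. a I * indicator I x :: complex) \<in> BV \<beta>" using s(2,3)
  proof (induction S rule: finite_induct)
    case (insert I S)
    have "(\<lambda>x. a I * indicator I x + 1 * (\<Sum>I\<in>S. a I * indicator I x)) \<in> BV \<beta>"
      using insert by (intro BV_lincomb interval_BV) auto
    thus ?case by (simp only: sum.insert[OF insert.hyps(1,2)] mult_1_left)
  qed (simp add: zero_BV)
  thus ?thesis by (simp add: s)
qed

subsection \<open>Eigenvalues modulo countably supported functions\<close>

definition aeq :: "(digits \<Rightarrow> bool) \<Rightarrow> bool" where "aeq P \<longleftrightarrow> countable {x \<in> X. \<not> P x}"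

lemma aeq_mono: "aeq P \<Longrightarrow> (\<And>x. x \<in> X \<Longrightarrow> P x \<Longrightarrow> Q x) \<Longrightarrow> aeq Q"
  unfolding aeq_def by (erule countable_subset[rotated]) auto

lemma aeq_all: "(\<And>x. x \<in> X \<Longrightarrow> P x) \<Longrightarrow> aeq P"
proof -
  assume "\<And>x. x \<in> X \<Longrightarrow> P x"
  hence "{x \<in> X. \<not> P x} = {}" by blast
  thus "aeq P" unfolding aeq_def by (simp only: countable_empty)
qed

lemma aeq_conj: "aeq P \<Longrightarrow> aeq Q \<Longrightarrow> aeq (\<lambda>x. P x \<and> Q x)"
proof -
  assume "aeq P" "aeq Q"
  hence "countable ({x \<in> X. \<not> P x} \<union> {x \<in> X. \<not> Q x})" unfolding aeq_def by auto
  thus ?thesis unfolding aeq_def by (rule countable_subset[rotated]) auto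
qed

lemma aeq_all_nat: "(\<And>n::nat. aeq (P n)) \<Longrightarrow> aeq (\<lambda>x. \<forall>n. P n x)"
proof -
  assume "\<And>n. aeq (P n)"
  hence "countable (\<Union>n. {x \<in> X. \<not> P n x})" unfolding aeq_def by auto
  thus ?thesis unfolding aeq_def by (rule countable_subset[rotated]) auto
qed

text \<open>The points with a bad preimage form the image of a countable set. Hence the transfer
  operator respects equality off countable sets.\<close>

lemma aeq_preimage: "aeq P \<Longrightarrow> aeq (\<lambda>x. \<forall>y\<in>{y \<in> X. shift y = x}. P y)"
proof -
  assume "aeq P"
  hence "countable (shift ` {x \<in> X. \<not> P x})" unfolding aeq_def by auto
  thus ?thesis unfolding aeq_def by (rule countable_subset[rotated]) auto
qed

lemma BV_rel_iff: "(f, g) \<in> BV_rel \<beta> \<longleftrightarrow> f \<in> BV \<beta> \<and> g \<in> BV \<beta> \<and> aeq (\<lambda>x. f x = g x)"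
proof -
  have "{x \<in> X. f x - g x \<noteq> 0} = {x \<in> X. f x \<noteq> g x}" by auto
  thus ?thesis using BV_diff[of f g] by (auto simp: BV_rel_def BV_null_def aeq_def)
qed

lemma BV_class_iff: "g \<in> BV_class \<beta> f \<longleftrightarrow> f \<in> BV \<beta> \<and> g \<in> BV \<beta> \<and> aeq (\<lambda>x. f x = g x)"
  unfolding BV_class_def by (simp only: Image_singleton_iff BV_rel_iff)

lemma BV_class_eq:
  assumes "f \<in> BV \<beta>" "g \<in> BV \<beta>" "aeq (\<lambda>x. f x = g x)"
  shows "BV_class \<beta> f = BV_class \<beta> g"
proof (rule set_eqI)
  fix k
  have "aeq (\<lambda>x. f x = k x) \<longleftrightarrow> aeq (\<lambda>x. g x = k x)"
  proof
    assume "aeq (\<lambda>x. f x = k x)"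
    from aeq_conj[OF this assms(3)] show "aeq (\<lambda>x. g x = k x)" by (rule aeq_mono) metis
  next
    assume "aeq (\<lambda>x. g x = k x)"
    from aeq_conj[OF this assms(3)] show "aeq (\<lambda>x. f x = k x)" by (rule aeq_mono) metis
  qed
  thus "k \<in> BV_class \<beta> f \<longleftrightarrow> k \<in> BV_class \<beta> g" using assms(1,2) by (simp add: BV_class_iff)
qed

lemma class_diff_BV:
  assumes "d \<in> class_diff (BV_class \<beta> f) (BV_class \<beta> g)"
  shows "d \<in> BV \<beta>" "aeq (\<lambda>x. d x = f x - g x)"
proof -
  obtain f1 g1 where d: "d = (\<lambda>x. f1 x - g1 x)" "f1 \<in> BV_class \<beta> f" "g1 \<in> BV_class \<beta> g"
    using assms unfolding class_diff_def by blast
  show "d \<in> BV \<beta>" unfolding d(1) using d(2,3) by (intro BV_diff) (simp_all add: BV_class_iff)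
  have "aeq (\<lambda>x. f x = f1 x)" "aeq (\<lambda>x. g x = g1 x)" using d by (simp_all add: BV_class_iff)
  from aeq_conj[OF this] show "aeq (\<lambda>x. d x = f x - g x)" by (rule aeq_mono) (simp add: d)
qed

abbreviation T :: "real \<Rightarrow> (digits \<Rightarrow> complex) \<Rightarrow> digits \<Rightarrow> complex" where "T t \<equiv> transfer \<beta> t"

lemma T_aeq: "aeq (\<lambda>x. f x = g x) \<Longrightarrow> aeq (\<lambda>x. T t f x = T t g x)"
  by (drule aeq_preimage, erule aeq_mono) (auto simp: transfer_def intro!: sum.cong)

lemma T_bound: "aeq (\<lambda>x. cmod (f x) \<le> k x) \<Longrightarrow> aeq (\<lambda>x. cmod (T t f x) \<le> L t k x)"
proof (drule aeq_preimage, erule aeq_mono)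
  fix x assume A: "\<forall>y\<in>{y \<in> X. shift y = x}. cmod (f y) \<le> k y"
  have "cmod (T t f x) \<le> (\<Sum>y\<in>{y \<in> X. shift y = x}. cmod (of_real (exp (t * chi \<beta> y)) * f y))"
    unfolding transfer_def by (rule norm_sum)
  also have "\<dots> \<le> L t k x"
    unfolding tr_def chit_def using A by (intro sum_mono) (simp add: norm_mult)
  finally show "cmod (T t f x) \<le> L t k x" .
qed

lemma T_pow_bound: "aeq (\<lambda>x. cmod (f x) \<le> k x) \<Longrightarrow> aeq (\<lambda>x. cmod ((T t ^^ n) f x) \<le> (L t ^^ n) k x)"
  by (induction n) (simp_all add: T_bound)

lemma T_cmult: "T t (\<lambda>x. a * f x) = (\<lambda>x. a * T t f x)"
  unfolding transfer_def by (simp add: sum_distrib_left algebra_simps)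

lemma T_sum: "T t (\<lambda>x. \<Sum>i\<in>I. f i x) = (\<lambda>x. \<Sum>i\<in>I. T t (f i) x)"
  unfolding transfer_def by (simp add: sum_distrib_left) (intro ext sum.swap)

lemma T_diff: "T t (\<lambda>x. f x - g x) = (\<lambda>x. T t f x - T t g x)"
  unfolding transfer_def by (simp add: sum_subtractf algebra_simps)

lemma T_of_real: "T t (\<lambda>x. of_real (f x)) = (\<lambda>x. of_real (L t f x))"
  unfolding transfer_def tr_def chit_def by simp

lemma T_pow_cmult: "(T t ^^ n) (\<lambda>x. a * f x) = (\<lambda>x. a * (T t ^^ n) f x)"
  by (induction n) (simp_all add: T_cmult)
lemma T_pow_sum: "(T t ^^ n) (\<lambda>x. \<Sum>i\<in>I. f i x) = (\<lambda>x. \<Sum>i\<in>I. (T t ^^ n) (f i) x)"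
  by (induction n) (simp_all add: T_sum)
lemma T_pow_diff: "(T t ^^ n) (\<lambda>x. f x - g x) = (\<lambda>x. (T t ^^ n) f x - (T t ^^ n) g x)"
  by (induction n) (simp_all add: T_diff)
lemma T_pow_of_real: "(T t ^^ n) (\<lambda>x. of_real (f x)) = (\<lambda>x. of_real ((L t ^^ n) f x))"
  by (induction n) (simp_all add: T_of_real)

text \<open>Any of the infinitely many ones of \<open>q\<close> may be replaced by 0, so Cantor's
  diagonal sequence can be placed on those positions. Uncountability shows that the class of h,
  which is at least 1 on X, is not the zero class.\<close>

lemma uncountable_X: "uncountable X"
proof
  assume "countable X"
  define A where "A = {i. q i = 1}"
  have A: "infinite A" unfolding A_def infinite_nat_iff_unbounded_le using q_inf by auto
  define e where "e = from_nat_into X"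
  define x where "x i = (if i \<in> A then 1 - e (the_inv (enumerate A) i) i else 0)" for i
  have "x \<in> X" by (rule hereditary[OF q_in_X]) (simp add: x_def A_def)
  then obtain k where k: "e k = x"
    using from_nat_into_surj[OF \<open>countable X\<close>, of x] unfolding e_def by blast
  have inj: "inj (enumerate A)" using strict_mono_enumerate[OF A] by (rule strict_mono_imp_inj_on)
  have "x (enumerate A k) = 1 - e (the_inv (enumerate A) (enumerate A k)) (enumerate A k)"
    using enumerate_in_set[OF A, of k] by (simp add: x_def)
  hence "x (enumerate A k) = 1 - x (enumerate A k)"
    unfolding the_inv_f_f[OF inj] k .
  thus False by presburger
qed

lemma u_antitone: "lex_less x y \<Longrightarrow> u j y \<le> u j x"
  unfolding u_def using lex_less_le_trans by (auto simp: lex_le_def)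

section \<open>The eigenvalue \<open>lam t\<close> and the exclusion of competing
  eigenvalues\<close>

abbreviation hC :: "real \<Rightarrow> digits \<Rightarrow> complex" where "hC t \<equiv> (\<lambda>x. complex_of_real (h t x))"

text \<open>The tails of the series of h are antitone, so their BV norm is at most twice the tail of
  \<open>cc\<close>. Thus the partial sums converge to h in BV norm and not only uniformly.\<close>

lemma h_tail_BV:
  "(\<lambda>x. complex_of_real (h t x - (\<Sum>j<K. cc t j * u j x))) \<in> BV \<beta>"
  "bv_norm \<beta> (\<lambda>x. complex_of_real (h t x - (\<Sum>j<K. cc t j * u j x))) \<le> 2 * (\<Sum>j. cc t (j + K))"
proof -
  have eq: "h t x - (\<Sum>j<K. cc t j * u j x) = (\<Sum>j. cc t (j + K) * u (j + K) x)" for x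
    unfolding h_def using suminf_minus_initial_segment[OF h_summable[of t x], of K] by simp
  have s: "summable (\<lambda>j. cc t (j + K) * u (j + K) x)" for x
    using h_summable[of t x] by (rule summable_ignore_initial_segment[of "\<lambda>j. cc t j * u j x"])
  have sc: "summable (\<lambda>j. cc t (j + K))" using cc_summable by (rule summable_ignore_initial_segment)
  have anti: "(\<Sum>j. cc t (j + K) * u (j + K) y) \<le> (\<Sum>j. cc t (j + K) * u (j + K) x)"
    if "lex_less x y" for x y
    using cc_pos[of t] u_antitone[OF that] by (intro suminf_le s) (simp add: less_imp_le mult_left_mono)
  have rng: "0 \<le> (\<Sum>j. cc t (j + K) * u (j + K) x) \<and> (\<Sum>j. cc t (j + K) * u (j + K) x) \<le> (\<Sum>j. cc t (j + K))" for x
  proof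
    show "0 \<le> (\<Sum>j. cc t (j + K) * u (j + K) x)"
      using cc_pos[of t] u_range by (intro suminf_nonneg s) (simp add: less_imp_le)
    show "(\<Sum>j. cc t (j + K) * u (j + K) x) \<le> (\<Sum>j. cc t (j + K))"
      using cc_pos[of t] u_range by (intro suminf_le s sc) (simp add: less_imp_le mult_left_le)
  qed
  show "(\<lambda>x. complex_of_real (h t x - (\<Sum>j<K. cc t j * u j x))) \<in> BV \<beta>"
    unfolding eq by (rule antitone_BV(1)) (rule anti, assumption, rule rng)
  show "bv_norm \<beta> (\<lambda>x. complex_of_real (h t x - (\<Sum>j<K. cc t j * u j x))) \<le> 2 * (\<Sum>j. cc t (j + K))"
    unfolding eq by (rule antitone_BV(2)) (rule anti, assumption, rule rng)
qed

lemma h_BV: "hC t \<in> BV \<beta>"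
  using h_tail_BV(1)[of t 0] by simp

lemma h_partial_step:
  "\<exists>s\<in>step_functions \<beta>. \<forall>x\<in>X. s x = complex_of_real (\<Sum>j<K. cc t j * u j x)"
proof -
  define I where "I j = {x \<in> X. lex_le x (qs j)}" for j
  \<comment> \<open>Different j may cut off the same initial segment, while a step function is
    indexed by sets; equal segments receive the sum of their coefficients.\<close>
  define a where "a J = (\<Sum>j\<in>{j\<in>{..<K}. I j = J}. complex_of_real (cc t j))" for J
  define s where "s x = (\<Sum>J\<in>I ` {..<K}. a J * indicator J x)" for x
  have "I j \<in> shift_intervals \<beta>" for j
    unfolding shift_intervals_def I_def using lex_le_trans by blast
  hence "s \<in> step_functions \<beta>" unfolding step_functions_def s_def[abs_def]
    by (intro CollectI exI[of _ "I ` {..<K}"] exI[of _ a]) auto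
  moreover have "s x = complex_of_real (\<Sum>j<K. cc t j * u j x)" if x: "x \<in> X" for x
  proof -
    have "complex_of_real (\<Sum>j<K. cc t j * u j x) = (\<Sum>j<K. complex_of_real (cc t j) * indicator (I j) x)"
      unfolding of_real_sum of_real_mult
      by (intro sum.cong arg_cong2[of _ _ _ _ "(*)"]) (use x in \<open>simp_all add: u_def I_def indicator_def\<close>)
    also have "\<dots> = (\<Sum>J\<in>I ` {..<K}. \<Sum>j\<in>{j\<in>{..<K}. I j = J}. complex_of_real (cc t j) * indicator (I j) x)"
      by (rule sum.image_gen) simp
    also have "\<dots> = s x" unfolding s_def a_def sum_distrib_right by (intro sum.cong) auto
    finally show ?thesis by simp
  qed
  ultimately show ?thesis by blast
qed

lemma lam_eigenvalue: "is_eigenvalue \<beta> t (complex_of_real (lam t))"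
proof -
  let ?K = "BV_class \<beta> (hC t)"
  have hK: "hC t \<in> ?K" using h_BV aeq_all[of "\<lambda>x. hC t x = hC t x"] by (simp add: BV_class_iff)
  have Kq: "?K \<in> BV_quotient \<beta>" unfolding BV_quotient_def BV_class_def by (rule quotientI[OF h_BV])
  have "\<exists>s\<in>step_functions \<beta>. quotient_norm \<beta> (class_diff ?K (BV_class \<beta> s)) < e" if e: "e > 0" for e
  proof -
    have "e / 2 > 0" using e by simp
    then obtain K where K: "norm (\<Sum>i. cc t (i + K)) < e / 2"
      using suminf_exist_split[OF _ cc_summable[of t], of "e / 2"] by blast
    obtain s where s: "s \<in> step_functions \<beta>" "\<forall>x\<in>X. s x = complex_of_real (\<Sum>j<K. cc t j * u j x)"
      using h_partial_step by blast
    define d where "d x = hC t x - s x" for x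
    have ssc: "s \<in> BV_class \<beta> s" using step_BV[OF s(1)] aeq_all[of "\<lambda>x. s x = s x"] by (simp add: BV_class_iff)
    have dd: "d \<in> class_diff ?K (BV_class \<beta> s)"
      unfolding class_diff_def d_def[abs_def]
      by (intro CollectI exI[of _ "hC t"] exI[of _ s] conjI refl hK ssc)
    have deq: "d x = complex_of_real (h t x - (\<Sum>j<K. cc t j * u j x))" if "x \<in> X" for x
      using s(2) that by (simp add: d_def)
    have "bv_norm \<beta> d = bv_norm \<beta> (\<lambda>x. complex_of_real (h t x - (\<Sum>j<K. cc t j * u j x)))"
      unfolding bv_norm_def using variation_cong[OF deq] deq by simp
    also have "\<dots> \<le> 2 * (\<Sum>j. cc t (j + K))" by (rule h_tail_BV)
    also have "\<dots> < e" using K by simp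
    finally have "bv_norm \<beta> d < e" .
    moreover have "quotient_norm \<beta> (class_diff ?K (BV_class \<beta> s)) \<le> bv_norm \<beta> d"
      unfolding quotient_norm_def
    proof (rule cINF_lower[OF _ dd])
      show "bdd_below (bv_norm \<beta> ` class_diff ?K (BV_class \<beta> s))"
        by (rule bdd_belowI2[of _ 0]) (rule bv_norm_nonneg[OF class_diff_BV(1)])
    qed
    ultimately show ?thesis using s(1) by (intro bexI[of _ s]) simp_all
  qed
  hence "?K \<in> step_closure \<beta>" unfolding step_closure_def using Kq by blast
  moreover have "?K \<noteq> BV_class \<beta> (\<lambda>_. 0)"
  proof
    assume "?K = BV_class \<beta> (\<lambda>_. 0)"
    hence "aeq (\<lambda>x. 0 = hC t x)" using hK by (simp add: BV_class_iff)
    hence "countable {x \<in> X. 0 \<noteq> hC t x}" unfolding aeq_def by simp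
    moreover have "{x \<in> X. 0 \<noteq> hC t x} = X" using h_ge1[of _ t] by force
    ultimately show False using uncountable_X by simp
  qed
  moreover have "transfer_class \<beta> t ?K = scale_class \<beta> (complex_of_real (lam t)) ?K"
  proof -
    let ?l = "complex_of_real (lam t)"
    let ?R = "BV_class \<beta> (\<lambda>x. ?l * hC t x)"
    have TX: "T t (hC t) x = ?l * hC t x" if "x \<in> X" for x
      by (simp add: T_of_real L_h[OF that])
    have ThBV: "T t (hC t) \<in> BV \<beta>" 
      using BV_cong[of "T t (hC t)" "\<lambda>x. ?l * hC t x"] TX BV_cmult[OF h_BV, of ?l t] by simp
    have 1: "BV_class \<beta> (T t f) = ?R" if "f \<in> ?K" "T t f \<in> BV \<beta>" for f
    proof (rule BV_class_eq)
      show "T t f \<in> BV \<beta>" by fact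
      show "(\<lambda>x. ?l * hC t x) \<in> BV \<beta>" by (rule BV_cmult[OF h_BV])
      have "aeq (\<lambda>x. hC t x = f x)" using that by (simp add: BV_class_iff)
      from T_aeq[OF this, of t] show "aeq (\<lambda>x. T t f x = ?l * hC t x)"
        by (rule aeq_mono) (simp add: TX)
    qed
    \<comment> \<open>A representative whose image is not in BV has an empty class and so adds
      nothing to the union in \<open>transfer_class\<close>.\<close>
    have 2: "BV_class \<beta> (T t f) = {}" if "T t f \<notin> BV \<beta>" for f
      using that by (auto simp: BV_class_iff)
    have 3: "BV_class \<beta> (\<lambda>x. ?l * f x) = ?R" if "f \<in> ?K" for f
    proof (rule BV_class_eq)
      show "(\<lambda>x. ?l * f x) \<in> BV \<beta>" using that by (intro BV_cmult) (simp add: BV_class_iff)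
      show "(\<lambda>x. ?l * hC t x) \<in> BV \<beta>" by (rule BV_cmult[OF h_BV])
      have "aeq (\<lambda>x. hC t x = f x)" using that by (simp add: BV_class_iff)
      thus "aeq (\<lambda>x. ?l * f x = ?l * hC t x)" by (rule aeq_mono) simp
    qed
    have "transfer_class \<beta> t ?K = ?R"
      unfolding transfer_class_def using 1 2 hK ThBV by blast
    moreover have "scale_class \<beta> ?l ?K = ?R"
      unfolding scale_class_def using 3 hK by blast
    ultimately show ?thesis by simp
  qed
  ultimately show ?thesis unfolding is_eigenvalue_def by blast
qed

text \<open>By the asymptotics of interval indicators, consecutive normalised iterates of a step
  function become uniformly close; this is where an eigenfunction for another large eigenvalue
  differs.\<close>

lemma step_Cauchy:
  assumes "s \<in> step_functions \<beta>" "e > 0"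
  shows "\<exists>n. \<forall>x\<in>X. cmod (of_real (zt t ^ Suc n) * (T t ^^ Suc n) s x - of_real (zt t ^ n) * (T t ^^ n) s x) \<le> e"
proof -
  obtain A a where s: "s = (\<lambda>x. \<Sum>I\<in>A. a I * indicator I x)" "finite A" "A \<subseteq> shift_intervals \<beta>"
    using assms unfolding step_functions_def by auto
  define M where "M = (\<Sum>I\<in>A. cmod (a I)) + 1"
  have M: "M > 0" unfolding M_def by (simp add: add_nonneg_pos sum_nonneg)
  define \<delta> where "\<delta> = e / M"
  have \<delta>: "\<delta> > 0" using assms(2) M by (simp add: \<delta>_def)
  have ev: "eventually (\<lambda>n. \<forall>x\<in>X. \<bar>N t (Suc n) (indicator I) x - N t n (indicator I) x\<bar> < \<delta>) sequentially"
    if I: "I \<in> A" for I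
  proof -
    obtain \<kappa> where \<kappa>: "asym t (indicator I) \<kappa>" using asym_interval[of I t] I s(3) by blast
    define P where "P n \<longleftrightarrow> (\<forall>x\<in>X. dist (N t n (indicator I) x) (\<kappa> * h t x) < \<delta> / 2)" for n
    have P: "eventually P sequentially"
    proof -
      have "\<delta> / 2 > 0" using \<delta> by simp
      from \<kappa>[unfolded asym_def uniform_limit_iff, rule_format, OF this] show ?thesis unfolding P_def .
    qed
    hence "eventually (\<lambda>n. P (Suc n)) sequentially" by (simp add: eventually_sequentially_Suc)
    with P show ?thesis
    proof eventually_elim
      case (elim n)
      show ?case
      proof
        fix x assume "x \<in> X"
        hence "\<bar>N t n (indicator I) x - \<kappa> * h t x\<bar> < \<delta> / 2" "\<bar>N t (Suc n) (indicator I) x - \<kappa> * h t x\<bar> < \<delta> / 2"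
          using elim unfolding P_def dist_real_def by blast+
        thus "\<bar>N t (Suc n) (indicator I) x - N t n (indicator I) x\<bar> < \<delta>" by linarith
      qed
    qed
  qed
  have "eventually (\<lambda>n. \<forall>I\<in>A. \<forall>x\<in>X. \<bar>N t (Suc n) (indicator I) x - N t n (indicator I) x\<bar> < \<delta>) sequentially"
    by (rule eventually_ball_finite[OF s(2)]) (use ev in blast)
  then obtain n where n: "\<And>I x. I \<in> A \<Longrightarrow> x \<in> X \<Longrightarrow> \<bar>N t (Suc n) (indicator I) x - N t n (indicator I) x\<bar> < \<delta>"
    using eventually_happens'[OF sequentially_bot] by blast
  have Ts: "of_real (zt t ^ n) * (T t ^^ n) s x = (\<Sum>I\<in>A. a I * of_real (N t n (indicator I) x))" for n x
  proof -
    have "(T t ^^ n) s x = (\<Sum>I\<in>A. a I * (T t ^^ n) (\<lambda>x. of_real (indicator I x)) x)"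
      unfolding s(1) T_pow_sum T_pow_cmult by (simp add: of_real_indicator)
    thus ?thesis unfolding T_pow_of_real by (simp add: N_def sum_distrib_left algebra_simps)
  qed
  have "cmod (of_real (zt t ^ Suc n) * (T t ^^ Suc n) s x - of_real (zt t ^ n) * (T t ^^ n) s x) \<le> e" if x: "x \<in> X" for x
  proof -
    have "of_real (zt t ^ Suc n) * (T t ^^ Suc n) s x - of_real (zt t ^ n) * (T t ^^ n) s x =
        (\<Sum>I\<in>A. a I * of_real (N t (Suc n) (indicator I) x - N t n (indicator I) x))"
      unfolding Ts by (simp add: sum_subtractf[symmetric] right_diff_distrib)
    also have "cmod \<dots> \<le> (\<Sum>I\<in>A. cmod (a I) * \<delta>)"
    proof (rule sum_norm_le)
      fix I assume I: "I \<in> A"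
      have "cmod (a I * of_real (N t (Suc n) (indicator I) x - N t n (indicator I) x)) =
          cmod (a I) * \<bar>N t (Suc n) (indicator I) x - N t n (indicator I) x\<bar>"
        by (simp only: norm_mult norm_of_real)
      also have "\<dots> \<le> cmod (a I) * \<delta>" using n[OF I x] by (intro mult_left_mono) simp_all
      finally show "cmod (a I * of_real (N t (Suc n) (indicator I) x - N t n (indicator I) x)) \<le> cmod (a I) * \<delta>" .
    qed
    also have "\<dots> = (M - 1) * \<delta>"
      unfolding sum_distrib_right[symmetric] by (simp add: M_def)
    also have "\<dots> = M * \<delta> - \<delta>" by (simp only: left_diff_distrib mult_1_left)
    also have "M * \<delta> = e" using M by (simp add: \<delta>_def)
    also have "e - \<delta> \<le> e" using \<delta> by simp
    finally show ?thesis .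
  qed
  thus ?thesis by blast
qed

text \<open>Suppose |w| \<ge> \<open>lam t\<close> and put \<omega> = w / \<open>lam t\<close>, so
  |\<omega>| \<ge> 1 and \<omega> \<noteq> 1. The normalised iterates of an eigenfunction f are
  \<omega>^n f, so consecutive ones differ by at least |\<omega> - 1| |f|. Those of a nearby step
  function become close, which forces f = 0 off a countable set.\<close>

lemma eigenvalue_less:
  assumes ev: "is_eigenvalue \<beta> t w" and ne: "w \<noteq> complex_of_real (lam t)"
  shows "cmod w < lam t"
proof (rule ccontr)
  assume "\<not> ?thesis"
  hence big: "lam t \<le> cmod w" by simp
  obtain K where K: "K \<in> step_closure \<beta>" "K \<noteq> BV_class \<beta> (\<lambda>_. 0)" "transfer_class \<beta> t K = scale_class \<beta> w K"
    using ev unfolding is_eigenvalue_def by blast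
  have "K \<in> BV_quotient \<beta>" using K(1) unfolding step_closure_def by blast
  then obtain f where f: "f \<in> BV \<beta>" "K = BV_class \<beta> f"
    unfolding BV_quotient_def BV_class_def by (elim quotientE)
  have fK: "f \<in> K" using f aeq_all[of "\<lambda>x. f x = f x"] by (simp add: BV_class_iff)
  have "(\<lambda>x. w * f x) \<in> BV_class \<beta> (\<lambda>x. w * f x)"
    using BV_cmult[OF f(1)] aeq_all[of "\<lambda>x. w * f x = w * f x"] by (simp add: BV_class_iff)
  hence "(\<lambda>x. w * f x) \<in> transfer_class \<beta> t K" unfolding K(3) scale_class_def using fK by blast
  then obtain f' where f': "f' \<in> K" "(\<lambda>x. w * f x) \<in> BV_class \<beta> (T t f')" unfolding transfer_class_def by blast
  have "aeq (\<lambda>x. T t f' x = w * f x)" using f'(2) by (simp add: BV_class_iff)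
  moreover have "aeq (\<lambda>x. T t f x = T t f' x)" using f'(1) unfolding f(2) by (intro T_aeq) (simp add: BV_class_iff)
  ultimately have "aeq (\<lambda>x. T t f' x = w * f x \<and> T t f x = T t f' x)" by (rule aeq_conj)
  hence E: "aeq (\<lambda>x. T t f x = w * f x)" by (rule aeq_mono) simp
  have En: "aeq (\<lambda>x. (T t ^^ n) f x = w ^ n * f x)" for n
  proof (induction n)
    case (Suc n)
    from T_aeq[OF Suc, of t] have "aeq (\<lambda>x. T t ((T t ^^ n) f) x = w ^ n * T t f x)"
      unfolding T_cmult .
    from aeq_conj[OF this E] show ?case by (rule aeq_mono) simp
  qed (simp add: aeq_all)
  define \<omega> where "\<omega> = w * of_real (zt t)"
  have \<omega>1: "1 \<le> cmod \<omega>" using big zt[of t] by (simp add: \<omega>_def norm_mult lam_def field_simps)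
  have \<omega>ne: "\<omega> \<noteq> 1"
  proof
    assume "\<omega> = 1"
    hence "w = 1 / of_real (zt t)" using zt[of t] by (simp add: \<omega>_def field_simps)
    thus False using ne by (simp add: lam_def)
  qed
  obtain C where C: "C > 0" "\<forall>x\<in>X. \<forall>n. N t n (\<lambda>_. 1) x \<le> C" using N_one_bound by blast
  have main: "aeq (\<lambda>x. cmod (f x) * cmod (\<omega> - 1) \<le> d)" if d: "d > 0" for d
  proof -
    \<comment> \<open>Three errors of size e C will occur: two from replacing f by s, one from
      consecutive iterates of s.\<close>
    define e where "e = d / (3 * C)"
    have e: "e > 0" using d C by (simp add: e_def)
    obtain s where s: "s \<in> step_functions \<beta>" "quotient_norm \<beta> (class_diff K (BV_class \<beta> s)) < e"
      using K(1) e unfolding step_closure_def by blast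
    have "s \<in> BV_class \<beta> s" using step_BV[OF s(1)] aeq_all[of "\<lambda>x. s x = s x"] by (simp add: BV_class_iff)
    hence ne: "class_diff K (BV_class \<beta> s) \<noteq> {}" using fK unfolding class_diff_def by blast
    have "bdd_below (bv_norm \<beta> ` class_diff K (BV_class \<beta> s))"
      unfolding f(2) by (rule bdd_belowI2[of _ 0]) (rule bv_norm_nonneg[OF class_diff_BV(1)])
    then obtain g where g: "g \<in> class_diff K (BV_class \<beta> s)" "bv_norm \<beta> g < e"
      using s(2) ne unfolding quotient_norm_def by (subst (asm) cINF_less_iff) auto
    have gB: "g \<in> BV \<beta>" "aeq (\<lambda>x. g x = f x - s x)" using class_diff_BV[of g f s] g(1) unfolding f(2) by blast+
    have fs: "aeq (\<lambda>x. cmod (f x - s x) \<le> e * 1)"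
      by (rule aeq_mono[OF gB(2)]) (use cmod_le_bv_norm[OF gB(1)] g(2) in force)
    have fsn: "aeq (\<lambda>x. cmod (of_real (zt t ^ n) * ((T t ^^ n) f x - (T t ^^ n) s x)) \<le> e * C)" for n
    proof (rule aeq_mono[OF T_pow_bound[OF fs, of n t]])
      fix x assume x: "x \<in> X" and le: "cmod ((T t ^^ n) (\<lambda>x. f x - s x) x) \<le> (L t ^^ n) (\<lambda>x. e * 1) x"
      have "cmod (of_real (zt t ^ n) * ((T t ^^ n) f x - (T t ^^ n) s x)) = zt t ^ n * cmod ((T t ^^ n) (\<lambda>x. f x - s x) x)"
        using zt[of t] by (simp add: norm_mult norm_power T_pow_diff)
      also have "\<dots> \<le> zt t ^ n * (e * (L t ^^ n) (\<lambda>_. 1) x)"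
        using le zt[of t] unfolding tr_pow_cmult by (intro mult_left_mono) simp_all
      also have "\<dots> = e * N t n (\<lambda>_. 1) x" by (simp add: N_def)
      also have "\<dots> \<le> e * C" using C x e by (intro mult_left_mono) simp_all
      finally show "cmod (of_real (zt t ^ n) * ((T t ^^ n) f x - (T t ^^ n) s x)) \<le> e * C" .
    qed
    have "e * C > 0" using e C by simp
    then obtain n where n: "\<forall>x\<in>X. cmod (of_real (zt t ^ Suc n) * (T t ^^ Suc n) s x - of_real (zt t ^ n) * (T t ^^ n) s x) \<le> e * C"
      using step_Cauchy[OF s(1)] by blast
    show ?thesis
    proof (rule aeq_mono[OF aeq_conj[OF aeq_conj[OF fsn[of n] fsn[of "Suc n"]] aeq_conj[OF En[of n] En[of "Suc n"]]]])
      fix x assume x: "x \<in> X"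
      let ?Z = "\<lambda>n. complex_of_real (zt t ^ n)"
      assume "(cmod (?Z n * ((T t ^^ n) f x - (T t ^^ n) s x)) \<le> e * C \<and>
          cmod (?Z (Suc n) * ((T t ^^ Suc n) f x - (T t ^^ Suc n) s x)) \<le> e * C) \<and>
          (T t ^^ n) f x = w ^ n * f x \<and> (T t ^^ Suc n) f x = w ^ Suc n * f x"
      hence A: "cmod (?Z n * (w ^ n * f x - (T t ^^ n) s x)) \<le> e * C"
        "cmod (?Z (Suc n) * (w ^ Suc n * f x - (T t ^^ Suc n) s x)) \<le> e * C" by metis+
      define za zb zc where "za = ?Z n * (w ^ n * f x - (T t ^^ n) s x)"
        and "zb = ?Z (Suc n) * (w ^ Suc n * f x - (T t ^^ Suc n) s x)"
        and "zc = ?Z (Suc n) * (T t ^^ Suc n) s x - ?Z n * (T t ^^ n) s x"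
      have le: "cmod za \<le> e * C" "cmod zb \<le> e * C" "cmod zc \<le> e * C"
        unfolding za_def zb_def zc_def by (rule A(1), rule A(2), rule n[rule_format, OF x])
      have "\<omega> ^ n * (\<omega> - 1) * f x = zb - za + zc"
        unfolding za_def zb_def zc_def \<omega>_def by (simp add: power_mult_distrib algebra_simps)
      also have "cmod \<dots> \<le> cmod zb + cmod za + cmod zc"
        using norm_triangle_ineq[of "zb - za" zc] norm_triangle_ineq4[of zb za] by linarith
      also have "\<dots> \<le> d" using le C by (simp add: e_def)
      finally have B: "cmod (\<omega> ^ n * (\<omega> - 1) * f x) \<le> d" .
      have "1 * (cmod (f x) * cmod (\<omega> - 1)) \<le> cmod \<omega> ^ n * (cmod (f x) * cmod (\<omega> - 1))"
        using \<omega>1 by (intro mult_right_mono one_le_power) simp_all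
      also have "\<dots> = cmod (\<omega> ^ n * (\<omega> - 1) * f x)" by (simp add: norm_mult norm_power)
      finally show "cmod (f x) * cmod (\<omega> - 1) \<le> d" using B by simp
    qed
  qed
  have "aeq (\<lambda>x. \<forall>m. cmod (f x) * cmod (\<omega> - 1) \<le> 1 / real (Suc m))"
    by (rule aeq_all_nat, rule main) simp
  hence "aeq (\<lambda>x. f x = 0)"
  proof (rule aeq_mono)
    fix x assume A: "\<forall>m. cmod (f x) * cmod (\<omega> - 1) \<le> 1 / real (Suc m)"
    have "cmod (f x) * cmod (\<omega> - 1) \<le> 0"
    proof (rule ccontr)
      assume "\<not> ?thesis"
      then obtain m where "inverse (real (Suc m)) < cmod (f x) * cmod (\<omega> - 1)"
        using reals_Archimedean[of "cmod (f x) * cmod (\<omega> - 1)"] by auto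
      thus False using A[rule_format, of m] by (simp add: inverse_eq_divide)
    qed
    thus "f x = 0" using \<omega>ne by (simp add: mult_le_0_iff)
  qed
  hence "BV_class \<beta> f = BV_class \<beta> (\<lambda>_. 0)" by (intro BV_class_eq f zero_BV)
  thus False using K(2) f(2) by simp
qed

lemma leading_eigenvalue_lam:
  "is_leading_eigenvalue \<beta> t (complex_of_real (lam t))" "leading_eigenvalue \<beta> t = lam t"
proof -
  have c: "cmod (complex_of_real (lam t)) = lam t" using lam_gt1[of t] by simp
  show L: "is_leading_eigenvalue \<beta> t (complex_of_real (lam t))"
    unfolding is_leading_eigenvalue_def c using lam_eigenvalue eigenvalue_less by blast
  show "leading_eigenvalue \<beta> t = lam t"
    unfolding leading_eigenvalue_def
  proof (rule the_equality)
    show "is_leading_eigenvalue \<beta> t (complex_of_real (lam t))" by (rule L)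
    fix l assume l: "is_leading_eigenvalue \<beta> t (complex_of_real l)"
    show "l = lam t"
    proof (rule ccontr)
      assume "l \<noteq> lam t"
      hence ne: "complex_of_real l \<noteq> complex_of_real (lam t)" by simp
      have "cmod (complex_of_real l) < cmod (complex_of_real (lam t))"
        unfolding c using l ne eigenvalue_less unfolding is_leading_eigenvalue_def by blast
      moreover have "cmod (complex_of_real (lam t)) < cmod (complex_of_real l)"
        using l ne lam_eigenvalue unfolding is_leading_eigenvalue_def by metis
      ultimately show False by simp
    qed
  qed
qed

end

section \<open>Real functions with a local holomorphic extension\<close>

text \<open>Real analyticity in a form in which products, compositions, derivatives and inverses are
  inherited from holomorphic functions. \<open>rext_power_series\<close> returns to power series,
  and \<open>rext_global\<close> glues the local extensions.\<close>

definition rext :: "(real \<Rightarrow> real) \<Rightarrow> real \<Rightarrow> bool" where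
  "rext f x \<longleftrightarrow> (\<exists>r>0. \<exists>F. F holomorphic_on ball (complex_of_real x) r \<and>
     (\<forall>y. \<bar>y - x\<bar> < r \<longrightarrow> F (of_real y) = of_real (f y)))"

lemma of_real_ball_iff: "complex_of_real y \<in> ball (of_real x) r \<longleftrightarrow> \<bar>y - x\<bar> < r"
  by (simp add: dist_norm abs_minus_commute flip: of_real_diff)

lemma rextI:
  assumes "0 < r" "F holomorphic_on ball (complex_of_real x) r"
    "\<And>y. \<bar>y - x\<bar> < r \<Longrightarrow> F (of_real y) = of_real (f y)"
  shows "rext f x"
  using assms unfolding rext_def by blast

lemma rext_const: "rext (\<lambda>_. c) x"
  by (rule rextI[where r=1 and F="\<lambda>_. of_real c"]) auto

lemma rext_id: "rext (\<lambda>x. x) x"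
  by (rule rextI[where r=1 and F="\<lambda>z. z"]) (auto intro: holomorphic_intros)

lemma rext_diff:
  assumes "rext f x" "rext g x" shows "rext (\<lambda>x. f x - g x) x"
proof -
  obtain r F where F: "r > 0" "F holomorphic_on ball (complex_of_real x) r" "\<forall>y. \<bar>y - x\<bar> < r \<longrightarrow> F (of_real y) = of_real (f y)"
    using assms(1) unfolding rext_def by blast
  obtain s G where G: "s > 0" "G holomorphic_on ball (complex_of_real x) s" "\<forall>y. \<bar>y - x\<bar> < s \<longrightarrow> G (of_real y) = of_real (g y)"
    using assms(2) unfolding rext_def by blast
  show ?thesis
  proof (rule rextI[where r="min r s" and F="\<lambda>z. F z - G z"])
    show "(\<lambda>z. F z - G z) holomorphic_on ball (complex_of_real x) (min r s)"
      using F(2) G(2) by (intro holomorphic_intros) (auto elim!: holomorphic_on_subset)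
  qed (use F G in auto)
qed

lemma rext_mult:
  assumes "rext f x" "rext g x" shows "rext (\<lambda>x. f x * g x) x"
proof -
  obtain r F where F: "r > 0" "F holomorphic_on ball (complex_of_real x) r" "\<forall>y. \<bar>y - x\<bar> < r \<longrightarrow> F (of_real y) = of_real (f y)"
    using assms(1) unfolding rext_def by blast
  obtain s G where G: "s > 0" "G holomorphic_on ball (complex_of_real x) s" "\<forall>y. \<bar>y - x\<bar> < s \<longrightarrow> G (of_real y) = of_real (g y)"
    using assms(2) unfolding rext_def by blast
  show ?thesis
  proof (rule rextI[where r="min r s" and F="\<lambda>z. F z * G z"])
    show "(\<lambda>z. F z * G z) holomorphic_on ball (complex_of_real x) (min r s)"
      using F(2) G(2) by (intro holomorphic_intros) (auto elim!: holomorphic_on_subset)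
  qed (use F G in auto)
qed

lemma rext_cong_near:
  assumes "rext f x" "d > 0" "\<And>y. \<bar>y - x\<bar> < d \<Longrightarrow> f y = g y"
  shows "rext g x"
proof -
  obtain r F where F: "r > 0" "F holomorphic_on ball (complex_of_real x) r" "\<forall>y. \<bar>y - x\<bar> < r \<longrightarrow> F (of_real y) = of_real (f y)"
    using assms(1) unfolding rext_def by blast
  show ?thesis
  proof (rule rextI[where r="min r d" and F=F])
    show "F holomorphic_on ball (complex_of_real x) (min r d)"
      using F(2) by (rule holomorphic_on_subset) auto
  qed (use F assms in auto)
qed

lemma rext_compose:
  assumes "rext g x" "rext f (g x)" shows "rext (\<lambda>x. f (g x)) x"
proof -
  obtain r G where G: "r > 0" "G holomorphic_on ball (complex_of_real x) r" "\<forall>y. \<bar>y - x\<bar> < r \<longrightarrow> G (of_real y) = of_real (g y)"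
    using assms(1) unfolding rext_def by blast
  obtain s F where F: "s > 0" "F holomorphic_on ball (complex_of_real (g x)) s" "\<forall>y. \<bar>y - g x\<bar> < s \<longrightarrow> F (of_real y) = of_real (f y)"
    using assms(2) unfolding rext_def by blast
  have Gx: "G (of_real x) = of_real (g x)" using G by simp
  have "continuous_on (ball (complex_of_real x) r) G" using G(2) by (rule holomorphic_on_imp_continuous_on)
  hence "isCont G (of_real x)" using G(1) by (simp add: continuous_on_eq_continuous_at)
  then obtain d where d: "d > 0" "\<And>z. dist z (of_real x) < d \<Longrightarrow> dist (G z) (of_real (g x)) < s"
    using F(1) Gx unfolding continuous_at_eps_delta by metis
  show ?thesis
  proof (rule rextI[where r="min r d" and F="\<lambda>z. F (G z)"])
    have "G ` ball (complex_of_real x) (min r d) \<subseteq> ball (of_real (g x)) s"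
      using d(2) by (auto simp: dist_commute)
    moreover have "G holomorphic_on ball (complex_of_real x) (min r d)"
      using G(2) by (rule holomorphic_on_subset) auto
    ultimately show "(\<lambda>z. F (G z)) holomorphic_on ball (complex_of_real x) (min r d)"
      using holomorphic_on_compose_gen[of G _ F] F(2) by (auto simp: o_def)
    fix y assume y: "\<bar>y - x\<bar> < min r d"
    hence "dist (complex_of_real y) (of_real x) < d" by (simp add: dist_norm flip: of_real_diff)
    from d(2)[OF this] have "dist (complex_of_real (g y)) (of_real (g x)) < s" using G(3) y by simp
    hence "\<bar>g y - g x\<bar> < s" by (simp add: dist_norm flip: of_real_diff)
    thus "F (G (of_real y)) = of_real (f (g y))" using F(3) G(3) y by simp
  qed (use G d in auto)
qed

lemma rext_entire:
  assumes "F holomorphic_on UNIV" "\<And>y. F (of_real y) = of_real (f y)" shows "rext f x"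
  by (rule rextI[where r=1 and F=F]) (use assms in \<open>auto elim: holomorphic_on_subset\<close>)

text \<open>The imaginary part of F vanishes along the real axis near y, so the complex derivative
  there is real.\<close>

lemma of_real_derivative:
  assumes "(F has_field_derivative D) (at (complex_of_real y))"
    "d > 0" "\<And>w. \<bar>w - y\<bar> < d \<Longrightarrow> F (of_real w) = of_real (f w)"
  shows "(f has_real_derivative Re D) (at y)" "D = of_real (Re D)"
proof -
  have v: "((\<lambda>x. F (of_real x)) has_vector_derivative D) (at y)"
    using assms(1) by (rule has_vector_derivative_real_field)
  have near: "F (of_real w) = of_real (f w)" if "w \<in> ball y d" for w
    using that assms(3) by (simp add: dist_real_def abs_minus_commute)
  have "((\<lambda>x. Re (F (of_real x))) has_vector_derivative Re D) (at y)"
    by (rule bounded_linear.has_vector_derivative[OF bounded_linear_Re v])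
  hence "(f has_vector_derivative Re D) (at y)"
    by (rule has_vector_derivative_transform_within_open[of _ _ _ "ball y d"]) (use near assms(2) in auto)
  thus "(f has_real_derivative Re D) (at y)"
    by (simp add: has_real_derivative_iff_has_vector_derivative)
  have "((\<lambda>x. Im (F (of_real x))) has_vector_derivative Im D) (at y)"
    by (rule bounded_linear.has_vector_derivative[OF bounded_linear_Im v])
  hence "((\<lambda>x. 0) has_vector_derivative Im D) (at y)"
    by (rule has_vector_derivative_transform_within_open[of _ _ _ "ball y d"]) (use near assms(2) in auto)
  moreover have "((\<lambda>x. 0::real) has_vector_derivative 0) (at y)" by simp
  ultimately have "Im D = 0" using vector_derivative_unique_at by blast
  thus "D = of_real (Re D)" by (simp add: complex_eq_iff)
qed

lemma rext_deriv:
  assumes "rext f x"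
  shows "\<exists>r>0. \<forall>y. \<bar>y - x\<bar> < r \<longrightarrow> (f has_real_derivative deriv f y) (at y)" "rext (deriv f) x"
proof -
  obtain r F where F: "r > 0" "F holomorphic_on ball (complex_of_real x) r" "\<forall>y. \<bar>y - x\<bar> < r \<longrightarrow> F (of_real y) = of_real (f y)"
    using assms(1) unfolding rext_def by blast
  have D: "(f has_real_derivative Re (deriv F (of_real y))) (at y) \<and> deriv F (of_real y) = of_real (Re (deriv F (of_real y)))"
    if y: "\<bar>y - x\<bar> < r" for y
  proof -
    have "(F has_field_derivative deriv F (of_real y)) (at (of_real y))"
      by (rule holomorphic_derivI[OF F(2)]) (use y in \<open>auto simp: of_real_ball_iff simp del: mem_ball\<close>)
    moreover have "F (of_real w) = of_real (f w)" if "\<bar>w - y\<bar> < r - \<bar>y - x\<bar>" for w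
      using F(3) that by auto
    ultimately show ?thesis using of_real_derivative[of F _ y "r - \<bar>y - x\<bar>" f] y by auto
  qed
  have e: "deriv f y = Re (deriv F (of_real y))" if "\<bar>y - x\<bar> < r" for y
    using D[OF that] DERIV_imp_deriv by blast
  show "\<exists>r>0. \<forall>y. \<bar>y - x\<bar> < r \<longrightarrow> (f has_real_derivative deriv f y) (at y)"
    using D e F(1) by (intro exI[of _ r]) auto
  show "rext (deriv f) x"
  proof (rule rextI[OF F(1), of "deriv F"])
    show "deriv F holomorphic_on ball (complex_of_real x) r" using F(2) by (intro holomorphic_deriv) auto
  qed (use D e in metis)
qed

lemma rext_power_series:
  assumes "rext f x"
  shows "\<exists>r>0. \<exists>a. \<forall>y. \<bar>y - x\<bar> < r \<longrightarrow> (\<lambda>n. a n * (y - x) ^ n) sums f y"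
proof -
  obtain r F where F: "r > 0" "F holomorphic_on ball (complex_of_real x) r" "\<forall>y. \<bar>y - x\<bar> < r \<longrightarrow> F (of_real y) = of_real (f y)"
    using assms(1) unfolding rext_def by blast
  define b where "b n = (deriv ^^ n) F (of_real x) / fact n" for n
  have "(\<lambda>n. Re (b n) * (y - x) ^ n) sums f y" if y: "\<bar>y - x\<bar> < r" for y
  proof -
    have "(\<lambda>n. b n * (of_real y - of_real x) ^ n) sums F (of_real y)"
      unfolding b_def by (rule holomorphic_power_series[OF F(2)]) (use y of_real_ball_iff in blast)
    hence "(\<lambda>n. Re (b n * (of_real y - of_real x) ^ n)) sums Re (F (of_real y))" by (rule sums_Re)
    moreover have "Re (b n * (of_real y - of_real x) ^ n) = Re (b n) * (y - x) ^ n" for n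
      by (simp flip: of_real_diff of_real_power)
    ultimately show ?thesis using F(3) y by simp
  qed
  thus ?thesis using F(1) by (intro exI[of _ r] conjI exI[of _ "\<lambda>n. Re (b n)"]) auto
qed

text \<open>The candidate is the local holomorphic inverse of the extension of f. It agrees with g
  because continuity keeps g near x, inside the disc on which the extension is injective.\<close>

lemma rext_inverse:
  assumes f: "rext f x" and D: "deriv f x \<noteq> 0"
    and g: "isCont g (f x)" "g (f x) = x" "eventually (\<lambda>z. f (g z) = z) (nhds (f x))"
  shows "rext g (f x)"
proof -
  obtain r F where F: "r > 0" "F holomorphic_on ball (complex_of_real x) r" "\<forall>y. \<bar>y - x\<bar> < r \<longrightarrow> F (of_real y) = of_real (f y)"
    using assms(1) unfolding rext_def by blast
  have Fx: "F (of_real x) = of_real (f x)" using F by simp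
  have "(F has_field_derivative deriv F (of_real x)) (at (of_real x))"
    using F(1) by (intro holomorphic_derivI[OF F(2)]) auto
  from of_real_derivative[OF this F(1)] F(3) have "(f has_real_derivative Re (deriv F (of_real x))) (at x)" by blast
  hence "Re (deriv F (of_real x)) = deriv f x" by (simp add: DERIV_imp_deriv)
  hence "deriv F (of_real x) \<noteq> 0" using D by auto
  then obtain s where s: "s > 0" "ball (complex_of_real x) s \<subseteq> ball (of_real x) r"
      "open (F ` ball (of_real x) s)" "inj_on F (ball (of_real x) s)"
    using has_complex_derivative_locally_invertible[OF F(2), of "of_real x"] F(1) by auto
  have hs: "F holomorphic_on ball (of_real x) s" using F(2) s(2) by (rule holomorphic_on_subset)
  obtain G where G: "G holomorphic_on F ` ball (of_real x) s" "\<And>z. z \<in> ball (of_real x) s \<Longrightarrow> G (F z) = z"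
    using holomorphic_has_inverse[OF hs open_ball s(4)] by metis
  have "of_real (f x) \<in> F ` ball (of_real x) s" using Fx s(1) by (metis centre_in_ball imageI)
  then obtain e where e: "e > 0" "ball (complex_of_real (f x)) e \<subseteq> F ` ball (of_real x) s"
    using s(3) open_contains_ball by blast
  obtain d1 where d1: "d1 > 0" "\<And>z. dist z (f x) < d1 \<Longrightarrow> dist (g z) x < min r s"
    using g(1,2) F(1) s(1) unfolding continuous_at_eps_delta by (metis min_less_iff_conj)
  obtain d2 where d2: "d2 > 0" "\<And>z. dist z (f x) < d2 \<Longrightarrow> f (g z) = z"
    using g(3) unfolding eventually_nhds_metric by blast
  show ?thesis
  proof (rule rextI[where r="min e (min d1 d2)" and F=G])
    show "G holomorphic_on ball (complex_of_real (f x)) (min e (min d1 d2))"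
      using G(1) by (rule holomorphic_on_subset) (use e(2) in auto)
    fix z assume z: "\<bar>z - f x\<bar> < min e (min d1 d2)"
    have gz: "\<bar>g z - x\<bar> < min r s" using d1(2)[of z] z by (simp add: dist_real_def)
    have "F (of_real (g z)) = of_real z" using F(3) gz d2(2)[of z] z by (simp add: dist_real_def)
    moreover have "complex_of_real (g z) \<in> ball (of_real x) s" using gz by (simp add: of_real_ball_iff del: mem_ball)
    ultimately show "G (of_real z) = of_real (g z)" using G(2) by metis
  qed (use e d1 d2 in auto)
qed

text \<open>The discs are centred on the real axis, so with z its real part also lies in each of two
  overlapping discs. Their convex intersection contains a real segment, on which both extensions
  equal f, and the identity theorem makes them agree.\<close>

lemma rext_global:
  assumes "\<And>x. rext f x"
  shows "\<exists>G F. open G \<and> connected G \<and> \<real> \<subseteq> G \<and> F analytic_on G \<and> (\<forall>x. F (complex_of_real x) = of_real (f x))"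
proof -
  obtain r F where rF: "\<And>x. r x > 0" "\<And>x. F x holomorphic_on ball (complex_of_real x) (r x)"
      "\<And>x y. \<bar>y - x\<bar> < r x \<Longrightarrow> F x (of_real y) = of_real (f y)"
    using assms unfolding rext_def by metis
  define B where "B x = ball (complex_of_real x) (r x)" for x
  define G where "G = (\<Union>x. B x)"
  have consistent: "F x z = F y z" if z: "z \<in> B x" "z \<in> B y" for x y z
  proof -
    let ?S = "B x \<inter> B y"
    have Re_in: "complex_of_real (Re z) \<in> B a" if "z \<in> B a" for a
    proof -
      have "\<bar>Re z - a\<bar> \<le> cmod (z - of_real a)" using abs_Re_le_cmod[of "z - of_real a"] by simp
      thus ?thesis using that by (simp add: B_def dist_norm norm_minus_commute flip: of_real_diff)
    qed
    have conn: "connected ?S" unfolding B_def by (intro convex_connected convex_Int convex_ball)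
    have op: "open ?S" unfolding B_def by auto
    define w where "w = complex_of_real (Re z)"
    have w: "w \<in> ?S" using Re_in z by (auto simp: w_def)
    then obtain e where e: "e > 0" "ball w e \<subseteq> ?S" using op open_contains_ball by blast
    define U where "U = complex_of_real ` {Re z<..<Re z + e}"
    have U: "U \<subseteq> ?S"
    proof
      fix a assume "a \<in> U"
      then obtain b where b: "a = of_real b" "Re z < b" "b < Re z + e" unfolding U_def by auto
      hence "a \<in> ball w e" unfolding w_def by (simp add: dist_norm flip: of_real_diff)
      thus "a \<in> ?S" using e(2) by blast
    qed
    have lim: "w islimpt U" unfolding islimpt_approachable
    proof (intro allI impI)
      fix d :: real assume d: "d > 0"
      let ?b = "Re z + min d e / 2"
      have "complex_of_real ?b \<in> U" unfolding U_def by (rule imageI) (use d e in auto)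
      moreover have "complex_of_real ?b \<noteq> w" unfolding w_def of_real_eq_iff using d e by auto
      moreover have "dist (complex_of_real ?b) w < d"
        unfolding w_def dist_norm of_real_diff[symmetric] norm_of_real using d e by auto
      ultimately show "\<exists>x'\<in>U. x' \<noteq> w \<and> dist x' w < d" by blast
    qed
    have "F x z - F y z = 0"
    proof (rule analytic_continuation[of "\<lambda>z. F x z - F y z" ?S U w])
      show "(\<lambda>z. F x z - F y z) holomorphic_on ?S"
        using rF(2)[of x] rF(2)[of y] unfolding B_def by (intro holomorphic_intros) (auto elim!: holomorphic_on_subset)
      fix a assume a: "a \<in> U"
      then obtain b where b: "a = of_real b" unfolding U_def by auto
      have "\<bar>b - x\<bar> < r x" "\<bar>b - y\<bar> < r y"
        using a U unfolding b B_def using of_real_ball_iff by blast+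
      thus "F x a - F y a = 0" unfolding b by (simp add: rF(3))
    qed (use op conn U w lim z in auto)
    thus ?thesis by simp
  qed
  define E where "E z = F (SOME x. z \<in> B x) z" for z
  have E: "E z = F x z" if "z \<in> B x" for x z
    unfolding E_def using that by (intro consistent) (auto intro: someI)
  have own: "complex_of_real x \<in> B x" for x using rF(1)[of x] by (simp add: B_def)
  have op: "open G" unfolding G_def B_def by auto
  have "E holomorphic_on B x" for x
    using rF(2)[of x] E[of _ x] unfolding B_def[symmetric] by (metis (no_types, lifting) holomorphic_transform)
  hence "E holomorphic_on G" unfolding G_def by (intro holomorphic_on_UN_open) (auto simp: B_def)
  hence "E analytic_on G" using op by (simp add: analytic_on_open)
  moreover have "connected G"
  proof -
    have "G = (\<Union>x. B x \<union> \<real>)"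
      unfolding G_def using own by (auto simp: Reals_def)
    moreover have "connected (\<Union>x. B x \<union> (\<real> :: complex set))"
    proof (rule connected_Union)
      fix s assume "s \<in> range (\<lambda>x. B x \<union> (\<real> :: complex set))"
      then obtain x where s: "s = B x \<union> \<real>" by blast
      have "connected (\<real> :: complex set)"
        unfolding Reals_def by (intro connected_continuous_image continuous_intros) auto
      moreover have "B x \<inter> \<real> \<noteq> {}" using own[of x] by (metis Int_iff Reals_of_real empty_iff)
      ultimately show "connected s" unfolding s B_def by (intro connected_Un) auto
    next
      show "\<Inter> (range (\<lambda>x. B x \<union> (\<real> :: complex set))) \<noteq> {}" using Reals_0 by blast
    qed
    ultimately show ?thesis by simp
  qed
  moreover have "\<real> \<subseteq> G" unfolding G_def using own by (auto simp: Reals_def)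
  moreover have "E (of_real x) = of_real (f x)" for x using E[OF own[of x]] rF(1)[of x] rF(3)[of x x] by simp
  ultimately show ?thesis using op by blast
qed

section \<open>Series of holomorphic functions with a summable majorant\<close>

lemma series_holomorphic:
  assumes "open A" "\<And>n. g n holomorphic_on A" "\<And>n z. z \<in> A \<Longrightarrow> cmod (g n z) \<le> M n" "summable M"
  shows "(\<lambda>z. \<Sum>n. g n z) holomorphic_on A"
proof (rule holomorphic_uniform_sequence[OF assms(1), where f="\<lambda>n z. \<Sum>k<n. g k z"])
  show "(\<lambda>z. \<Sum>k<n. g k z) holomorphic_on A" for n using assms(2) by (intro holomorphic_intros)
  fix z assume z: "z \<in> A"
  then obtain d where d: "d > 0" "cball z d \<subseteq> A" using assms(1) open_contains_cball by blast
  have "uniform_limit (cball z d) (\<lambda>n z. \<Sum>k<n. g k z) (\<lambda>z. \<Sum>n. g n z) sequentially"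
    using assms(3,4) d by (intro Weierstrass_m_test) auto
  thus "\<exists>d>0. cball z d \<subseteq> A \<and> uniform_limit (cball z d) (\<lambda>n z. \<Sum>k<n. g k z) (\<lambda>z. \<Sum>n. g n z) sequentially"
    using d by blast
qed

lemma series_const_deriv:
  assumes "open A" "\<And>n. g n holomorphic_on A" "\<And>n z. z \<in> A \<Longrightarrow> cmod (g n z) \<le> M n" "summable M"
    "\<And>z. z \<in> A \<Longrightarrow> (\<lambda>n. g n z) sums c" "z \<in> A"
  shows "(\<lambda>n. deriv (g n) z) sums 0"
proof -
  have "\<exists>g'. \<forall>x\<in>A. ((\<lambda>_. c) has_field_derivative g' x) (at x) \<and> ((\<lambda>n. \<Sum>k<n. deriv (g k) x) \<longlongrightarrow> g' x) sequentially"
  proof (rule has_complex_derivative_uniform_sequence[OF assms(1), where f="\<lambda>n z. \<Sum>k<n. g k z"])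
    show "((\<lambda>z. \<Sum>k<n. g k z) has_field_derivative (\<Sum>k<n. deriv (g k) x)) (at x)" if "x \<in> A" for n x
      using assms(1,2) that by (intro DERIV_sum holomorphic_derivI) auto
    fix x assume x: "x \<in> A"
    then obtain d where d: "d > 0" "cball x d \<subseteq> A" using assms(1) open_contains_cball by blast
    have "uniform_limit (cball x d) (\<lambda>n z. \<Sum>k<n. g k z) (\<lambda>z. \<Sum>n. g n z) sequentially"
      using assms(3,4) d by (intro Weierstrass_m_test) auto
    moreover have "(\<Sum>n. g n z) = c" if "z \<in> cball x d" for z using assms(5) d that by (auto simp: sums_iff)
    ultimately have "uniform_limit (cball x d) (\<lambda>n z. \<Sum>k<n. g k z) (\<lambda>_. c) sequentially"
      by (metis (no_types, lifting) uniform_limit_cong')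
    thus "\<exists>d>0. cball x d \<subseteq> A \<and> uniform_limit (cball x d) (\<lambda>n z. \<Sum>k<n. g k z) (\<lambda>_. c) sequentially"
      using d by blast
  qed
  then obtain g' where g': "((\<lambda>_. c) has_field_derivative g' z) (at z)" "(\<lambda>n. \<Sum>k<n. deriv (g k) z) \<longlonglongrightarrow> g' z"
    using assms(6) by blast
  have "g' z = 0" using g'(1) DERIV_const DERIV_unique by blast
  thus ?thesis using g'(2) by (simp add: sums_def)
qed


context beta_setting
begin

section \<open>Analyticity of the pressure\<close>

definition Pr :: "real \<Rightarrow> real" where "Pr t = ln (lam t)"

lemma Pr_pos: "0 < Pr t" using lam_gt1[of t] by (simp add: Pr_def)
lemma exp_Pr: "exp (Pr t) = lam t" using lam_gt1[of t] by (simp add: Pr_def)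
lemma exp_minus_Pr: "exp (- Pr t) = zt t"
  using lam_gt1[of t] zt[of t] by (simp add: exp_minus exp_Pr lam_def)

text \<open>The terms of the normalisation series at z = exp (-s), for complex t and s. For real t
  the equation \<Sum>n \<open>en n t s\<close> = 1 has the real solution s =
  \<open>Pr t\<close>.\<close>

definition en :: "nat \<Rightarrow> complex \<Rightarrow> complex \<Rightarrow> complex" where
  "en n t s = of_real (q n) * exp (t * of_real (S n q) - s * of_real (real (Suc n)))"

lemma en_real: "en n (of_real t) (of_real s) = of_real (p t (exp (- s)) n)"
proof -
  have "exp (- s) ^ Suc n = exp (- (s * real (Suc n)))"
    by (subst exp_of_nat_mult[symmetric]) (simp add: mult.commute)
  hence "exp (t * S n q - s * real (Suc n)) = H t n * exp (- s) ^ Suc n"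
    by (simp only: H_def exp_add[symmetric]) simp
  moreover have "en n (of_real t) (of_real s) = of_real (real (q n) * exp (t * S n q - s * real (Suc n)))"
    unfolding en_def of_real_mult of_real_exp of_real_diff exp_of_real[symmetric] by simp
  ultimately show ?thesis by (simp add: p_def)
qed

lemma p_Pr: "p t (exp (- Pr t)) sums 1"
  unfolding exp_minus_Pr by (rule zt)

lemma Pr_unique: "p t (exp (- s)) sums 1 \<Longrightarrow> s = Pr t"
  using zt_unique[of "exp (- s)" t] by (simp add: exp_minus_Pr[symmetric])

text \<open>At the base point the terms decay like \<theta>^n. Moving t and s by at most d changes
  the exponent by at most 2dn + d, and d = - ln \<theta> / 4 turns the rate \<theta> into its square
  root.\<close>

lemma en_bound:
  "\<exists>d>0. \<exists>K \<theta>. 0 < \<theta> \<and> \<theta> < 1 \<and> 0 < K \<and>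
    (\<forall>t s n. cmod (t - of_real t0) \<le> d \<and> cmod (s - of_real (Pr t0)) \<le> d \<longrightarrow> cmod (en n t s) \<le> K * \<theta> ^ n)"
proof -
  obtain \<theta> C where th: "0 < \<theta>" "\<theta> < 1" "0 < C"
    and dec: "\<And>x n. x \<in> X \<Longrightarrow> exp (t0 * S n x) * zt t0 ^ n \<le> C * \<theta> ^ n" using decay[of t0] by metis
  define d where "d = - ln \<theta> / 4"
  have d: "d > 0" using th by (simp add: d_def)
  have e2: "\<theta> * exp (2 * d) < 1"
  proof -
    have "\<theta> * exp (2 * d) = exp (ln \<theta> + 2 * d)" using th by (simp add: exp_add)
    also have "\<dots> < exp 0" unfolding exp_less_cancel_iff using th by (simp add: d_def)
    finally show ?thesis by simp
  qed
  have "cmod (en n t s) \<le> C * exp d * (\<theta> * exp (2 * d)) ^ n"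
    if ts: "cmod (t - of_real t0) \<le> d" "cmod (s - of_real (Pr t0)) \<le> d" for t s n
  proof -
    have rt: "\<bar>Re t - t0\<bar> \<le> d" using abs_Re_le_cmod[of "t - of_real t0"] ts by simp
    have rs: "\<bar>Re s - Pr t0\<bar> \<le> d" using abs_Re_le_cmod[of "s - of_real (Pr t0)"] ts by simp
    have "(Re t - t0) * S n q \<le> d * real n"
      using rt S_le[OF q_in_X, of n] S_nonneg[of n q] d by (intro mult_mono) auto
    moreover have "(Pr t0 - Re s) * real (Suc n) \<le> d * real (Suc n)"
      using rs by (intro mult_right_mono) auto
    moreover have "Re (t * of_real (S n q) - s * of_real (real (Suc n))) =
        t0 * S n q - Pr t0 * real n - Pr t0 + (Re t - t0) * S n q + (Pr t0 - Re s) * real (Suc n)"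
      by (simp add: algebra_simps)
    ultimately have le: "Re (t * of_real (S n q) - s * of_real (real (Suc n))) \<le> t0 * S n q - Pr t0 * real n + (d + 2 * d * real n)"
      using Pr_pos[of t0] by (simp add: algebra_simps)
    have "cmod (en n t s) = real (q n) * exp (Re (t * of_real (S n q) - s * of_real (real (Suc n))))"
      unfolding en_def norm_mult norm_exp_eq_Re by simp
    also have "\<dots> \<le> 1 * exp (t0 * S n q - Pr t0 * real n + (d + 2 * d * real n))"
      using le q_le1[of n] by (intro mult_mono) auto
    also have "\<dots> = (exp (t0 * S n q) * zt t0 ^ n) * (exp d * exp (2 * d) ^ n)"
      unfolding exp_minus_Pr[symmetric]
      by (simp add: exp_of_nat_mult[symmetric] algebra_simps flip: exp_add)
    also have "\<dots> \<le> (C * \<theta> ^ n) * (exp d * exp (2 * d) ^ n)"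
      using dec[OF q_in_X, of n] by (intro mult_right_mono) auto
    also have "\<dots> = C * exp d * (\<theta> * exp (2 * d)) ^ n" by (simp add: power_mult_distrib)
    finally show ?thesis .
  qed
  thus ?thesis using d e2 th
    by (intro exI[of _ d] conjI exI[of _ "C * exp d"] exI[of _ "\<theta> * exp (2 * d)"]) auto
qed

lemma summable_Suc_geometric:
  assumes "0 < \<theta>" "\<theta> < (1::real)" shows "summable (\<lambda>n. K * (real (Suc n) * \<theta> ^ n))"
proof -
  have "(\<lambda>n. real (Suc n) * \<theta> ^ n) sums (1 / (1 - \<theta>)\<^sup>2)" using geometric_deriv_sums[of \<theta>] assms by simp
  thus ?thesis by (intro summable_mult) (simp add: sums_iff)
qed

text \<open>The implicit equation \<open>\<Sum>n. en n t s = 1\<close> is solved for \<open>s\<close> near \<open>Pr t0\<close> by Newton's method with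
  the derivative frozen at the base point, which is a contraction uniformly in \<open>t\<close>.\<close>

lemma Pr_implicit:
  "\<exists>r>0. \<exists>f M. f holomorphic_on ball (complex_of_real t0) r \<and>
     (\<forall>t. \<bar>t - t0\<bar> < r \<longrightarrow> f (of_real t) = of_real (Pr t)) \<and>
     summable M \<and>
     (\<forall>z\<in>ball (complex_of_real t0) r. (\<lambda>n. en n z (f z)) sums 1 \<and> (\<forall>n. cmod (en n z (f z)) \<le> M n))"
proof -
  obtain d K \<theta> where d: "d > 0" and th: "0 < \<theta>" "\<theta> < 1" "0 < K"
    and bnd: "\<And>t s n. cmod (t - of_real t0) \<le> d \<Longrightarrow> cmod (s - of_real (Pr t0)) \<le> d \<Longrightarrow> cmod (en n t s) \<le> K * \<theta> ^ n"
    using en_bound[of t0] by metis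
  define s0 where "s0 = complex_of_real (Pr t0)"
  define M where "M n = K * \<theta> ^ n" for n
  have sM: "summable M" unfolding M_def using th by (intro summable_mult summable_geometric) auto
  define M1 where "M1 n = K * (real (Suc n) * \<theta> ^ n)" for n
  have sM1: "summable M1" unfolding M1_def by (rule summable_Suc_geometric[OF th(1,2)])
  define F where "F t s = (\<Sum>n. en n t s)" for t s
  define gn where "gn n t s = - of_real (real (Suc n)) * en n t s" for n t s
  define G where "G t s = (\<Sum>n. gn n t s)" for t s
  define D where "D = ball (complex_of_real t0) d"
  define E where "E = ball s0 d"
  have bnd': "cmod (en n t s) \<le> M n" "cmod (gn n t s) \<le> M1 n" if "t \<in> D" "s \<in> E" for n t s
  proof -
    show "cmod (en n t s) \<le> M n"
      unfolding M_def using that by (intro bnd) (auto simp: D_def E_def s0_def dist_norm norm_minus_commute)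
    hence "real (Suc n) * cmod (en n t s) \<le> real (Suc n) * M n" by (intro mult_left_mono) auto
    thus "cmod (gn n t s) \<le> M1 n" by (simp add: gn_def M1_def M_def norm_mult algebra_simps del: of_nat_Suc)
  qed
  have en_der: "((\<lambda>s. en n t s) has_field_derivative gn n t s) (at s)" for n t s
    unfolding en_def gn_def by (auto intro!: derivative_eq_intros simp del: of_nat_Suc)
  have F_der: "((\<lambda>s. F t s) has_field_derivative G t s) (at s)" if ts: "t \<in> D" "s \<in> E" for t s
  proof -
    have "\<exists>g'. \<forall>x\<in>E. (F t has_field_derivative g' x) (at x) \<and> ((\<lambda>n. \<Sum>k<n. gn k t x) \<longlongrightarrow> g' x) sequentially"
    proof (rule has_complex_derivative_uniform_sequence[where f="\<lambda>n s. \<Sum>k<n. en k t s"])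
      show "open E" by (simp add: E_def)
      show "((\<lambda>s. \<Sum>k<n. en k t s) has_field_derivative (\<Sum>k<n. gn k t x)) (at x)" for n x
        by (intro DERIV_sum en_der)
      fix x assume x: "x \<in> E"
      then obtain r where r: "r > 0" "cball x r \<subseteq> E" unfolding E_def using open_contains_cball open_ball by blast
      have "uniform_limit (cball x r) (\<lambda>n s. \<Sum>k<n. en k t s) (F t) sequentially"
        unfolding F_def[abs_def] by (rule Weierstrass_m_test[OF _ sM]) (use bnd'(1)[OF ts(1)] r in blast)
      thus "\<exists>r>0. cball x r \<subseteq> E \<and> uniform_limit (cball x r) (\<lambda>n s. \<Sum>k<n. en k t s) (F t) sequentially"
        using r by blast
    qed
    then obtain g' where g': "\<forall>x\<in>E. (F t has_field_derivative g' x) (at x) \<and> ((\<lambda>n. \<Sum>k<n. gn k t x) \<longlongrightarrow> g' x) sequentially" by blast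
    have "summable (\<lambda>n. gn n t s)" by (rule summable_comparison_test'[OF sM1, of 0]) (use bnd'(2)[OF ts] in blast)
    hence "(\<lambda>n. \<Sum>k<n. gn k t s) \<longlonglongrightarrow> G t s" unfolding G_def by (rule summable_LIMSEQ)
    hence "g' s = G t s" using g' ts(2) LIMSEQ_unique by blast
    thus ?thesis using g' ts(2) by metis
  qed
  have cen: "((\<lambda>z. en n (fst z) (snd z)) \<longlongrightarrow> en n (of_real t0) s0) (nhds (of_real t0, s0))" for n
  proof -
    have "((\<lambda>z. z) \<longlongrightarrow> (complex_of_real t0, s0)) (nhds (of_real t0, s0))" by (rule filterlim_ident)
    from tendsto_fst[OF this] tendsto_snd[OF this] show ?thesis
      unfolding en_def by (auto intro!: tendsto_intros)
  qed
  have nearDE: "eventually (\<lambda>z. fst z \<in> D \<and> snd z \<in> E) (nhds (complex_of_real t0, s0))"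
  proof -
    have "open (D \<times> E)" by (auto simp: D_def E_def intro: open_Times)
    moreover have "(complex_of_real t0, s0) \<in> D \<times> E" using d by (simp add: D_def E_def)
    ultimately have "eventually (\<lambda>z. z \<in> D \<times> E) (nhds (complex_of_real t0, s0))" by (rule eventually_nhds_in_open)
    thus ?thesis by eventually_elim auto
  qed
  have evp: "eventually (\<lambda>(n, z). fst z \<in> D \<and> snd z \<in> E) (at_top \<times>\<^sub>F nhds (complex_of_real t0, s0))"
    unfolding eventually_prod_filter
    by (rule exI[of _ "\<lambda>_. True"], rule exI[of _ "\<lambda>z. fst z \<in> D \<and> snd z \<in> E"]) (use nearDE in simp)
  have ev1: "eventually (\<lambda>(n, z). norm (en n (fst z) (snd z)) \<le> M n) (at_top \<times>\<^sub>F nhds (complex_of_real t0, s0))"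
    and ev2: "eventually (\<lambda>(n, z). norm (gn n (fst z) (snd z)) \<le> M1 n) (at_top \<times>\<^sub>F nhds (complex_of_real t0, s0))"
    by (rule eventually_mono[OF evp], auto intro: bnd')+
  have F_lim: "((\<lambda>z. F (fst z) (snd z)) \<longlongrightarrow> F (of_real t0) s0) (nhds (of_real t0, s0))"
    unfolding F_def
    using tannerys_theorem[of "\<lambda>n z. en n (fst z) (snd z)", OF cen ev1 sM] by simp
  have cgn: "((\<lambda>z. gn n (fst z) (snd z)) \<longlongrightarrow> gn n (of_real t0) s0) (nhds (of_real t0, s0))" for n
    unfolding gn_def by (intro tendsto_intros cen)
  have G_lim: "((\<lambda>z. G (fst z) (snd z)) \<longlongrightarrow> G (of_real t0) s0) (nhds (of_real t0, s0))"
    unfolding G_def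
    using tannerys_theorem[of "\<lambda>n z. gn n (fst z) (snd z)", OF cgn ev2 sM1] by simp
  define G0 where "G0 = G (of_real t0) s0"
  have F_real: "F (of_real t) (of_real s) \<in> \<real>" if ts: "of_real t \<in> D" "of_real s \<in> E" for t s
  proof -
    have "summable (p t (exp (- s)))"
      by (rule summable_comparison_test'[OF sM, of 0]) (use bnd'(1)[OF ts] in \<open>simp add: en_real\<close>)
    hence "F (of_real t) (of_real s) = of_real (suminf (p t (exp (- s))))"
      unfolding F_def en_real by (rule suminf_of_real[symmetric])
    thus ?thesis by simp
  qed
  have tD: "complex_of_real t0 \<in> D" and sE: "s0 \<in> E" using d by (auto simp: D_def E_def)
  have F0: "F (of_real t0) s0 = 1"
    using p_Pr[of t0] unfolding F_def s0_def en_real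
    by (subst suminf_of_real[symmetric]) (auto simp: sums_iff)
  have gn0: "gn n (of_real t0) s0 = of_real (- (real (Suc n) * p t0 (exp (- Pr t0)) n))" for n
    unfolding gn_def s0_def en_real by (simp only: of_real_mult of_real_minus mult_minus_left)
  have s_mean: "summable (\<lambda>n. real (Suc n) * p t0 (exp (- Pr t0)) n)"
  proof (rule summable_comparison_test'[OF sM1, of 0])
    fix n
    show "norm (real (Suc n) * p t0 (exp (- Pr t0)) n) \<le> M1 n"
      using bnd'(2)[OF tD sE, of n] unfolding gn0 norm_of_real by (simp only: real_norm_def abs_minus_cancel)
  qed
  \<comment> \<open>The s-derivative at the base point is minus the mean waiting time of the renewal
    process, hence real and nonzero.\<close>
  have "G0 = of_real (- (\<Sum>n. real (Suc n) * p t0 (exp (- Pr t0)) n))"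
    unfolding G0_def G_def gn0 suminf_minus[OF s_mean, symmetric]
    by (rule suminf_of_real[symmetric]) (rule summable_minus[OF s_mean])
  moreover have "(\<Sum>n. real (Suc n) * p t0 (exp (- Pr t0)) n) > 0"
  proof (rule suminf_pos2[OF s_mean, of 0])
    show "0 \<le> real (Suc n) * p t0 (exp (- Pr t0)) n" for n by (intro mult_nonneg_nonneg p_nonneg) auto
  qed (simp add: p_def q0)
  ultimately have G0: "G0 \<noteq> 0" "G0 \<in> \<real>" by (auto simp: Reals_def)
  have "eventually (\<lambda>z. dist (G (fst z) (snd z)) G0 < cmod G0 / 2) (nhds (complex_of_real t0, s0))"
    using G_lim G0 unfolding G0_def by (intro tendstoD) auto
  hence "eventually (\<lambda>z. (fst z \<in> D \<and> snd z \<in> E) \<and> dist (G (fst z) (snd z)) G0 < cmod G0 / 2) (nhds (complex_of_real t0) \<times>\<^sub>F nhds s0)"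
    using nearDE unfolding nhds_prod by (rule eventually_conj[rotated])
  then obtain P Q where PQ: "eventually P (nhds (complex_of_real t0))" "eventually Q (nhds s0)"
      "\<And>t s. P t \<Longrightarrow> Q s \<Longrightarrow> (t \<in> D \<and> s \<in> E) \<and> dist (G t s) G0 < cmod G0 / 2"
    unfolding eventually_prod_filter by (metis fst_conv snd_conv)
  obtain e1 where e1: "e1 > 0" "\<And>s. dist s s0 < e1 \<Longrightarrow> Q s"
    using PQ(2) unfolding eventually_nhds_metric by blast
  obtain e2 where e2: "e2 > 0" "\<And>t. dist t (complex_of_real t0) < e2 \<Longrightarrow> P t"
    using PQ(1) unfolding eventually_nhds_metric by blast
  define \<rho> where "\<rho> = e1 / 2"
  have \<rho>: "\<rho> > 0" using e1 by (simp add: \<rho>_def)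
  \<comment> \<open>This margin lets the first Newton step move \<open>s0\<close> by at most half
    the radius; the contraction accounts for the other half in \<open>self\<close>.\<close>
  have "eventually (\<lambda>z. dist (F (fst z) (snd z)) 1 < cmod G0 * (\<rho> / 2)) (nhds (complex_of_real t0, s0))"
    using F_lim G0 \<rho> unfolding F0 by (intro tendstoD) auto
  then obtain P' Q' where PQ': "eventually P' (nhds (complex_of_real t0))" "eventually Q' (nhds s0)"
      "\<And>t s. P' t \<Longrightarrow> Q' s \<Longrightarrow> dist (F t s) 1 < cmod G0 * (\<rho> / 2)"
    unfolding nhds_prod eventually_prod_filter by (metis fst_conv snd_conv)
  have "Q' s0" using PQ'(2) by (rule eventually_nhds_x_imp_x)
  obtain e3 where e3: "e3 > 0" "\<And>t. dist t (complex_of_real t0) < e3 \<Longrightarrow> P' t"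
    using PQ'(1) unfolding eventually_nhds_metric by blast
  define r where "r = min e2 e3"
  define B where "B = ball (complex_of_real t0) r"
  have r: "r > 0" using e2 e3 by (simp add: r_def)
  have near: "t \<in> D \<and> s \<in> E \<and> dist (G t s) G0 < cmod G0 / 2" if "t \<in> B" "s \<in> cball s0 \<rho>" for t s
    using PQ(3)[of t s] e1 e2 that by (auto simp: B_def r_def \<rho>_def dist_commute)
  have F_near: "cmod (F t s0 - 1) \<le> cmod G0 * (\<rho> / 2)" if "t \<in> B" for t
  proof -
    have "dist (F t s0) 1 < cmod G0 * (\<rho> / 2)"
      using \<open>Q' s0\<close> that by (intro PQ'(3) e3) (auto simp: B_def r_def dist_commute)
    thus ?thesis by (simp add: dist_norm)
  qed
  define \<Phi> where "\<Phi> t s = s - (F t s - 1) / G0" for t s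
  have contr: "cmod (\<Phi> t a - \<Phi> t b) \<le> 1/2 * cmod (a - b)"
    if t: "t \<in> B" and ab: "a \<in> cball s0 \<rho>" "b \<in> cball s0 \<rho>" for t a b
  proof (rule field_differentiable_bound[OF convex_cball[of s0 \<rho>] _ _ ab(1) ab(2), where f'="\<lambda>s. 1 - G t s / G0"])
    fix s assume s: "s \<in> cball s0 \<rho>"
    have "((\<lambda>s. F t s) has_field_derivative G t s) (at s)" using near[OF t s] by (intro F_der) auto
    from has_field_derivative_at_within[OF this]
    show "(\<Phi> t has_field_derivative 1 - G t s / G0) (at s within cball s0 \<rho>)"
      unfolding \<Phi>_def[abs_def] using G0 by (auto intro!: derivative_eq_intros)
    have "cmod (1 - G t s / G0) = dist (G t s) G0 / cmod G0"
      using G0 by (simp add: dist_norm norm_minus_commute diff_divide_distrib flip: norm_divide)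
    also have "\<dots> \<le> 1/2" using near[OF t s] G0 by (simp add: divide_le_eq)
    finally show "cmod (1 - G t s / G0) \<le> 1/2" .
  qed
  have self: "\<Phi> t s \<in> cball s0 \<rho>" if t: "t \<in> B" and s: "s \<in> cball s0 \<rho>" for t s
  proof -
    have "cmod (\<Phi> t s - \<Phi> t s0) \<le> 1/2 * cmod (s - s0)" by (rule contr[OF t s]) (use \<rho> in auto)
    also have "\<dots> \<le> 1/2 * \<rho>" using s by (simp add: dist_norm norm_minus_commute)
    finally have "cmod (\<Phi> t s - \<Phi> t s0) \<le> 1/2 * \<rho>" .
    moreover have "cmod (\<Phi> t s0 - s0) = cmod (F t s0 - 1) / cmod G0" by (simp add: \<Phi>_def norm_divide)
    hence "cmod (\<Phi> t s0 - s0) \<le> \<rho> / 2" using F_near[OF t] G0 by (simp add: divide_le_eq mult.commute)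
    ultimately have "cmod (\<Phi> t s - s0) \<le> \<rho>"
      using norm_triangle_ineq[of "\<Phi> t s - \<Phi> t s0" "\<Phi> t s0 - s0"] by simp
    thus ?thesis by (simp add: dist_norm norm_minus_commute)
  qed
  define fk where "fk k t = ((\<Phi> t) ^^ k) s0" for k t
  have fk_in: "fk k t \<in> cball s0 \<rho>" if "t \<in> B" for k t
    by (induction k) (use \<rho> self[OF that] in \<open>auto simp: fk_def\<close>)
  have fk_diff: "cmod (fk (Suc k) t - fk k t) \<le> \<rho> * (1/2) ^ k" if t: "t \<in> B" for k t
  proof (induction k)
    case 0
    thus ?case using self[OF t, of s0] \<rho> by (simp add: fk_def dist_norm norm_minus_commute)
  next
    case (Suc k)
    have "cmod (fk (Suc (Suc k)) t - fk (Suc k) t) \<le> 1/2 * cmod (fk (Suc k) t - fk k t)"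
      using contr[OF t fk_in[OF t, of "Suc k"] fk_in[OF t, of k]] by (simp add: fk_def)
    also have "\<dots> \<le> 1/2 * (\<rho> * (1/2) ^ k)" using Suc by (intro mult_left_mono) auto
    finally show ?case by simp
  qed
  have fk_hol: "fk k holomorphic_on B" for k
  proof (induction k)
    case 0
    show ?case by (simp add: fk_def[abs_def])
  next
    case (Suc k)
    have "(\<lambda>t. F t (fk k t)) holomorphic_on B"
      unfolding F_def
    proof (rule series_holomorphic[OF _ _ _ sM])
      show "open B" by (simp add: B_def)
      show "(\<lambda>t. en n t (fk k t)) holomorphic_on B" for n
        unfolding en_def by (intro holomorphic_intros Suc)
      show "cmod (en n t (fk k t)) \<le> M n" if "t \<in> B" for n t
        using near[OF that fk_in[OF that, of k]] by (intro bnd') auto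
    qed
    hence "(\<lambda>t. fk k t - (F t (fk k t) - 1) / G0) holomorphic_on B" using G0 Suc by (intro holomorphic_intros) auto
    thus ?case by (simp add: fk_def[abs_def] \<Phi>_def)
  qed
  \<comment> \<open>The limit of the iterates, written as a telescoping series so that a geometric
    majorant yields holomorphy.\<close>
  define f where "f t = s0 + (\<Sum>k. fk (Suc k) t - fk k t)" for t
  have sg: "summable (\<lambda>k. \<rho> * (1/2::real) ^ k)" by (intro summable_mult summable_geometric) auto
  have "(\<lambda>t. \<Sum>k. fk (Suc k) t - fk k t) holomorphic_on B"
    by (rule series_holomorphic[OF _ _ _ sg]) (use fk_hol fk_diff in \<open>auto simp: B_def intro!: holomorphic_intros\<close>)
  hence f_hol: "f holomorphic_on B" unfolding f_def[abs_def] by (intro holomorphic_intros)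
  have f_lim: "(\<lambda>k. fk k t) \<longlonglongrightarrow> f t" if t: "t \<in> B" for t
  proof -
    have "summable (\<lambda>k. fk (Suc k) t - fk k t)"
      by (rule summable_comparison_test'[OF sg, of 0]) (use fk_diff[OF t] in blast)
    hence "(\<lambda>k. s0 + (\<Sum>j<k. fk (Suc j) t - fk j t)) \<longlonglongrightarrow> f t"
      unfolding f_def by (intro tendsto_intros summable_LIMSEQ)
    moreover have "s0 + (\<Sum>j<k. fk (Suc j) t - fk j t) = fk k t" for k
      using sum_lessThan_telescope[of "\<lambda>j. fk j t" k] by (simp only: add_diff_cancel_left') (simp add: fk_def)
    ultimately show ?thesis by simp
  qed
  have f_in: "f t \<in> cball s0 \<rho>" if t: "t \<in> B" for t
    by (rule closed_sequentially[OF closed_cball _ f_lim[OF t]]) (use fk_in[OF t] in blast)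
  have f_sol: "F t (f t) = 1" if t: "t \<in> B" for t
  proof -
    have "isCont (F t) (f t)" using near[OF t f_in[OF t]] by (intro DERIV_isCont[OF F_der]) auto
    hence "(\<lambda>k. F t (fk k t)) \<longlonglongrightarrow> F t (f t)" using f_lim[OF t] by (rule isCont_tendsto_compose)
    hence "(\<lambda>k. fk k t - (F t (fk k t) - 1) / G0) \<longlonglongrightarrow> f t - (F t (f t) - 1) / G0"
      using f_lim[OF t] G0 by (intro tendsto_intros) auto
    moreover have "(\<lambda>k. fk k t - (F t (fk k t) - 1) / G0) = (\<lambda>k. fk (Suc k) t)" by (simp add: fk_def \<Phi>_def)
    moreover have "(\<lambda>k. fk (Suc k) t) \<longlonglongrightarrow> f t" using f_lim[OF t] by (rule LIMSEQ_Suc)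
    ultimately have "f t - (F t (f t) - 1) / G0 = f t" using LIMSEQ_unique by metis
    thus ?thesis using G0 by simp
  qed
  have f_M: "cmod (en n t (f t)) \<le> M n" if t: "t \<in> B" for t n
    using near[OF t f_in[OF t]] by (intro bnd') auto
  have f_sums: "(\<lambda>n. en n t (f t)) sums 1" if t: "t \<in> B" for t
  proof -
    have "summable (\<lambda>n. en n t (f t))"
      by (rule summable_comparison_test'[OF sM, of 0]) (use f_M[OF t] in blast)
    thus ?thesis using f_sol[OF t] unfolding F_def by (simp add: sums_iff)
  qed
  have f_real: "f (of_real t) = of_real (Pr t)" if "\<bar>t - t0\<bar> < r" for t
  proof -
    have t: "complex_of_real t \<in> B" using that unfolding B_def of_real_ball_iff .
    \<comment> \<open>At real t all iterates are real because \<open>s0\<close> and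
      \<open>G0\<close> are. The limit is then a real solution, and \<open>Pr_unique\<close>
      identifies it.\<close>
    have "fk k (of_real t) \<in> \<real>" for k
    proof (induction k)
      case (Suc k)
      then obtain s where s: "fk k (of_real t) = of_real s" by (auto simp: Reals_def)
      have "F (of_real t) (of_real s) \<in> \<real>"
        using near[OF t fk_in[OF t, of k]] unfolding s by (intro F_real) auto
      hence "of_real s - (F (of_real t) (of_real s) - 1) / G0 \<in> \<real>" using G0 by (intro Reals_diff Reals_divide) auto
      thus ?case using s by (simp add: fk_def \<Phi>_def)
    qed (simp add: fk_def s0_def)
    hence "f (of_real t) \<in> \<real>" by (intro closed_sequentially[OF closed_complex_Reals _ f_lim[OF t]]) blast
    then obtain s where s: "f (of_real t) = of_real s" by (auto simp: Reals_def)
    have "(\<lambda>n. complex_of_real (p t (exp (- s)) n)) sums of_real 1"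
      using f_sums[OF t] unfolding s en_real by simp
    hence "p t (exp (- s)) sums 1" unfolding sums_of_real_iff .
    thus ?thesis using Pr_unique s by simp
  qed
  show ?thesis
    using r f_hol f_real sM f_sums f_M unfolding B_def
    by (intro exI[of _ r] conjI exI[of _ f] exI[of _ M] allI impI ballI) blast+
qed

lemma Pr_rext: "rext Pr t"
proof -
  obtain r f where "r > 0" "f holomorphic_on ball (complex_of_real t) r" "\<forall>y. \<bar>y - t\<bar> < r \<longrightarrow> f (of_real y) = of_real (Pr y)"
    using Pr_implicit[of t] by blast
  thus ?thesis by (intro rextI) auto
qed

lemma lam_rext: "rext lam t"
proof -
  have "rext (\<lambda>x. exp (Pr x)) t"
    by (rule rext_compose[OF Pr_rext]) (rule rext_entire[of exp], auto simp: exp_of_real intro: holomorphic_intros)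
  thus ?thesis by (simp add: exp_Pr)
qed

lemma Pr_DERIV: "(Pr has_real_derivative deriv Pr t) (at t)"
  using rext_deriv(1)[OF Pr_rext[of t]] by auto

definition al :: "real \<Rightarrow> real" where "al t = deriv Pr t"

lemma al_rext: "rext al t" unfolding al_def[abs_def] by (rule rext_deriv(2)[OF Pr_rext])

lemma al_DERIV: "(al has_real_derivative deriv al t) (at t)"
  using rext_deriv(1)[OF al_rext[of t]] by auto

text \<open>Differentiating the implicit equation twice expresses the derivatives of the pressure as the
  mean and the variance of the renewal process.\<close>

lemma al_pos: "0 < al t" and al_deriv_pos: "0 < deriv al t"
proof -
  obtain r f M where r: "r > 0" and f: "f holomorphic_on ball (complex_of_real t) r"
     and fP: "\<And>y. \<bar>y - t\<bar> < r \<Longrightarrow> f (of_real y) = of_real (Pr y)" and M: "summable M"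
     and fs: "\<And>z. z \<in> ball (complex_of_real t) r \<Longrightarrow> (\<lambda>n. en n z (f z)) sums 1"
     and fM: "\<And>z n. z \<in> ball (complex_of_real t) r \<Longrightarrow> cmod (en n z (f z)) \<le> M n"
    using Pr_implicit[of t] by metis
  let ?B = "ball (complex_of_real t) r" and ?C = "ball (complex_of_real t) (r/2)"
  have tB: "complex_of_real t \<in> ?B" "complex_of_real t \<in> ?C" using r by auto
  define g where "g n z = en n z (f z)" for n z
  have gh: "g n holomorphic_on ?B" for n unfolding g_def en_def by (intro holomorphic_intros f)
  have f1h: "deriv f holomorphic_on ?B" using f by (intro holomorphic_deriv) auto
  define D1 where "D1 n z = of_real (S n q) - of_real (real (Suc n)) * deriv f z" for n z
  have dg: "deriv (g n) z = g n z * D1 n z" if "z \<in> ?B" for n z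
  proof -
    have "(f has_field_derivative deriv f z) (at z)" using f that by (intro holomorphic_derivI) auto
    hence "((\<lambda>z. en n z (f z)) has_field_derivative en n z (f z) * D1 n z) (at z)"
      unfolding en_def D1_def by (auto intro!: derivative_eq_intros simp: algebra_simps)
    thus ?thesis unfolding g_def by (rule DERIV_imp_deriv)
  qed
  have sums1: "(\<lambda>n. deriv (g n) z) sums 0" if "z \<in> ?B" for z
    by (rule series_const_deriv[OF open_ball gh _ M _ that]) (use fM fs in \<open>auto simp: g_def\<close>)
  \<comment> \<open>Cauchy's estimate on discs of half the radius supplies the majorant for
    differentiating the series a second time.\<close>
  have bound1: "cmod (deriv (g n) z) \<le> M n / (r/2)" if z: "z \<in> ?C" for n z
  proof -
    have sub: "cball z (r/2) \<subseteq> ?B"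
    proof
      fix w assume "w \<in> cball z (r/2)"
      thus "w \<in> ?B" using z dist_triangle[of "complex_of_real t" w z] by simp
    qed
    have "norm ((deriv ^^ 1) (g n) z) \<le> fact 1 * M n / (r/2) ^ 1"
    proof (rule Cauchy_inequality)
      show "g n holomorphic_on ball z (r/2)" using gh sub by (meson ball_subset_cball holomorphic_on_subset)
      show "continuous_on (cball z (r/2)) (g n)"
        using gh sub by (meson holomorphic_on_imp_continuous_on holomorphic_on_subset)
      show "cmod (g n w) \<le> M n" if "cmod (z - w) = r/2" for w
        unfolding g_def by (rule fM) (use sub that in \<open>auto simp: dist_norm subset_iff\<close>)
    qed (use r in auto)
    thus ?thesis by simp
  qed
  have dgh: "deriv (g n) holomorphic_on ?C" for n
    by (rule holomorphic_on_subset[OF holomorphic_deriv[OF gh]]) (use r in auto)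
  have sums2: "(\<lambda>n. deriv (deriv (g n)) (of_real t)) sums 0"
    by (rule series_const_deriv[where c=0, OF open_ball dgh bound1 _ _ tB(2)])
      (use M sums1 r in \<open>auto intro: summable_mult2\<close>)
  have ddg: "deriv (deriv (g n)) (of_real t) =
      g n (of_real t) * ((D1 n (of_real t))\<^sup>2 - of_real (real (Suc n)) * deriv (deriv f) (of_real t))" for n
  proof -
    have "deriv (deriv (g n)) (of_real t) = deriv (\<lambda>z. g n z * D1 n z) (of_real t)"
    proof (rule deriv_cong_ev)
      have "eventually (\<lambda>z. z \<in> ?B) (nhds (of_real t))" by (rule eventually_nhds_in_open) (use tB in auto)
      thus "\<forall>\<^sub>F z in nhds (of_real t). deriv (g n) z = g n z * D1 n z" by eventually_elim (rule dg)
    qed simp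
    also have "\<dots> = deriv (g n) (of_real t) * D1 n (of_real t) + g n (of_real t) * (- of_real (real (Suc n)) * deriv (deriv f) (of_real t))"
    proof (rule DERIV_imp_deriv)
      have "(deriv f has_field_derivative deriv (deriv f) (of_real t)) (at (of_real t))"
        using f1h tB by (intro holomorphic_derivI) auto
      hence d1: "(D1 n has_field_derivative (- of_real (real (Suc n)) * deriv (deriv f) (of_real t))) (at (of_real t))"
        unfolding D1_def by (auto intro!: derivative_eq_intros simp del: of_nat_Suc)
      have "(g n has_field_derivative deriv (g n) (of_real t)) (at (of_real t))"
        using gh tB by (intro holomorphic_derivI) auto
      from DERIV_mult[OF this d1] show "((\<lambda>z. g n z * D1 n z) has_field_derivative
        deriv (g n) (of_real t) * D1 n (of_real t) + g n (of_real t) * (- of_real (real (Suc n)) * deriv (deriv f) (of_real t))) (at (of_real t))"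
        by (simp add: algebra_simps)
    qed
    finally show ?thesis unfolding dg[OF tB(1)] by (simp add: power2_eq_square algebra_simps)
  qed
  have f1: "deriv f (of_real y) = of_real (al y)" if y: "\<bar>y - t\<bar> < r" for y
  proof -
    have "(f has_field_derivative deriv f (of_real y)) (at (of_real y))"
      by (rule holomorphic_derivI[OF f]) (use y in \<open>auto simp: of_real_ball_iff simp del: mem_ball\<close>)
    note A = of_real_derivative[OF this, of "r - \<bar>y - t\<bar>" Pr]
    have B: "f (of_real w) = of_real (Pr w)" if "\<bar>w - y\<bar> < r - \<bar>y - t\<bar>" for w using fP that by auto
    have "(Pr has_real_derivative Re (deriv f (of_real y))) (at y)" "deriv f (of_real y) = of_real (Re (deriv f (of_real y)))"
      using A B y by auto
    thus ?thesis unfolding al_def using DERIV_imp_deriv by metis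
  qed
  have f2: "deriv (deriv f) (of_real t) = of_real (deriv al t)"
  proof -
    have "(deriv f has_field_derivative deriv (deriv f) (of_real t)) (at (of_real t))"
      using f1h tB by (intro holomorphic_derivI) auto
    note A = of_real_derivative[OF this r, of al]
    have "(al has_real_derivative Re (deriv (deriv f) (of_real t))) (at t)"
       "deriv (deriv f) (of_real t) = of_real (Re (deriv (deriv f) (of_real t)))"
      using A f1 by auto
    thus ?thesis using DERIV_imp_deriv by metis
  qed
  define P where "P n = p t (exp (- Pr t)) n" for n
  have P0: "0 \<le> P n" for n unfolding P_def by (rule p_nonneg) simp
  have gP: "g n (of_real t) = of_real (P n)" for n
    unfolding g_def P_def using fP[of t] r by (simp add: en_real)
  have r1: "(\<lambda>n. P n * (S n q - real (Suc n) * al t)) sums 0"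
  proof -
    have "(\<lambda>n. complex_of_real (P n * (S n q - real (Suc n) * al t))) sums of_real 0"
      using sums1[OF tB(1)] unfolding dg[OF tB(1)] gP D1_def using f1[of t] r by simp
    thus ?thesis unfolding sums_of_real_iff .
  qed
  have r2: "(\<lambda>n. P n * ((S n q - real (Suc n) * al t)\<^sup>2 - real (Suc n) * deriv al t)) sums 0"
  proof -
    have "(\<lambda>n. complex_of_real (P n * ((S n q - real (Suc n) * al t)\<^sup>2 - real (Suc n) * deriv al t))) sums of_real 0"
      using sums2 unfolding ddg gP D1_def f2 using f1[of t] r by simp
    thus ?thesis unfolding sums_of_real_iff .
  qed
  have mean: "summable (\<lambda>n. P n * real (Suc n))"
  proof -
    obtain d K \<theta> where d: "d > 0" and th: "0 < \<theta>" "\<theta> < 1" "0 < K"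
      and bnd: "\<And>z s n. cmod (z - of_real t) \<le> d \<Longrightarrow> cmod (s - of_real (Pr t)) \<le> d \<Longrightarrow> cmod (en n z s) \<le> K * \<theta> ^ n"
      using en_bound[of t] by metis
    show ?thesis
    proof (rule summable_comparison_test'[OF summable_Suc_geometric[OF th(1,2), of K], of 0])
      fix n
      have "P n \<le> K * \<theta> ^ n" using bnd[of "of_real t" "of_real (Pr t)" n] d P0[of n] by (simp add: en_real P_def)
      hence "P n * real (Suc n) \<le> K * \<theta> ^ n * real (Suc n)" by (intro mult_right_mono) auto
      thus "norm (P n * real (Suc n)) \<le> K * (real (Suc n) * \<theta> ^ n)" using P0[of n] by (simp add: abs_mult algebra_simps)
    qed
  qed
  define m where "m = (\<Sum>n. P n * real (Suc n))"
  have msums: "(\<lambda>n. P n * real (Suc n)) sums m" using mean by (simp add: m_def sums_iff)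
  have "0 < m" unfolding m_def using mean
    by (rule suminf_pos2[where i=0]) (use P0 in \<open>auto simp: P_def p_def q0\<close>)
  \<comment> \<open>The term of index 0 contains \<open>S 0 q\<close> = 0, so positivity of the mean
    has to come from a later digit 1.\<close>
  obtain k where k: "k \<ge> 1" "q k = 1" using q_inf by blast
  have Pk: "0 < P n" if "q n = 1" for n using that H_pos by (simp add: P_def p_def)
  have "S k q \<ge> 1"
  proof -
    have "real (q 0) \<le> S k q" unfolding S_def using k by (intro member_le_sum) auto
    thus ?thesis by (simp add: q0)
  qed
  have e1: "(\<lambda>n. P n * S n q) sums (al t * m)"
    using sums_add[OF r1 sums_mult[OF msums, of "al t"]] by (simp add: algebra_simps)
  have "0 < (\<Sum>n. P n * S n q)"
    by (rule suminf_pos2[where i=k]) (use e1 P0 S_nonneg[of _ q] Pk[OF k(2)] \<open>S k q \<ge> 1\<close> in \<open>auto simp: sums_iff\<close>)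
  hence "0 < al t * m" using e1 by (simp add: sums_iff)
  thus al: "0 < al t" using \<open>0 < m\<close> by (simp add: zero_less_mult_iff)
  have e2: "(\<lambda>n. P n * (S n q - real (Suc n) * al t)\<^sup>2) sums (deriv al t * m)"
    using sums_add[OF r2 sums_mult[OF msums, of "deriv al t"]] by (simp add: algebra_simps)
  \<comment> \<open>Here the term of index 0 is positive, because \<open>S 0 q\<close> = 0 and
    \<open>al t\<close> has just been shown to be positive.\<close>
  have "0 < (\<Sum>n. P n * (S n q - real (Suc n) * al t)\<^sup>2)"
    by (rule suminf_pos2[where i=0]) (use e2 P0 Pk[OF q0] al in \<open>auto simp: sums_iff\<close>)
  hence "0 < deriv al t * m" using e2 by (simp add: sums_iff)
  thus "0 < deriv al t" using \<open>0 < m\<close> by (simp add: zero_less_mult_iff)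
qed

end

section \<open>Entropy of finite partitions\<close>

lemma fekete:
  fixes a :: "nat \<Rightarrow> real"
  assumes sub: "\<And>n m. a (n + m) \<le> a n + a m" and nn: "\<And>n. 0 \<le> a n"
  shows "\<exists>l. (\<lambda>n. a n / real n) \<longlonglongrightarrow> l \<and> (\<forall>n. real n * l \<le> a n)"
proof -
  define l where "l = Inf ((\<lambda>n. a n / real n) ` {1..})"
  have bdd: "bdd_below ((\<lambda>n. a n / real n) ` {1..})" using nn by (intro bdd_belowI2[of _ 0]) auto
  have low: "l \<le> a n / real n" if "n \<ge> 1" for n
    unfolding l_def using bdd that by (intro cINF_lower) auto
  have "(\<lambda>n. a n / real n) \<longlonglongrightarrow> l"
  proof (rule LIMSEQ_I)
    fix e :: real assume e: "e > 0"
    have "\<exists>k\<in>{1..}. a k / real k < l + e/2"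
      unfolding l_def using bdd e by (subst cINF_less_iff[symmetric]) auto
    then obtain k where k: "k \<ge> 1" "a k / real k < l + e/2" by auto
    \<comment> \<open>A bound for a at every remainder modulo k.\<close>
    define B where "B = (\<Sum>r<k. a r)"
    have mul: "a (j * k + r) \<le> real j * a k + a r" for j r
    proof (induction j)
      case (Suc j)
      have "a (Suc j * k + r) \<le> a k + a (j * k + r)" using sub[of k "j * k + r"] by (simp add: algebra_simps)
      with Suc show ?case by (simp add: algebra_simps)
    qed simp
    obtain n0 :: nat where n0: "2 * B / e < real n0" using reals_Archimedean2 by blast
    show "\<exists>no. \<forall>n\<ge>no. norm (a n / real n - l) < e"
    proof (intro exI[of _ "max 1 n0"] allI impI)
      fix n assume n: "n \<ge> max 1 n0"
      have "a n \<le> real (n div k) * a k + a (n mod k)" using mul[of "n div k" "n mod k"] by simp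
      also have "a (n mod k) \<le> B" unfolding B_def using k nn by (intro member_le_sum) auto
      also have "real (n div k) * a k = (real (n div k) * real k) * (a k / real k)" using k by simp
      also have "\<dots> \<le> real n * (a k / real k)"
        using nn[of k] by (intro mult_right_mono) (auto simp flip: of_nat_mult)
      also have "\<dots> \<le> real n * (l + e/2)" using k by (intro mult_left_mono) auto
      finally have "a n \<le> real n * (l + e/2) + B" by simp
      moreover have "B < real n * (e/2)"
      proof -
        have "2 * B / e < real n" using n0 n by linarith
        thus ?thesis using e by (simp add: field_simps)
      qed
      ultimately have "a n < real n * (l + e)" by (simp add: algebra_simps)
      hence "a n / real n < l + e" using n by (simp add: pos_divide_less_eq mult.commute)
      thus "norm (a n / real n - l) < e" using low[of n] n e by auto
    qed
  qed
  moreover have "real n * l \<le> a n" for n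
    using low[of n] nn[of n] by (cases "n = 0") (auto simp: pos_le_divide_eq mult.commute)
  ultimately show ?thesis by blast
qed

text \<open>Partitions are handled as labellings with finitely many values: a join becomes a
  pairing, a coarsening becomes a composition, and labels that never occur need no special
  treatment.\<close>

definition fin :: "'a measure \<Rightarrow> ('a \<Rightarrow> 'b) \<Rightarrow> 'b set \<Rightarrow> bool" where
  "fin M K E \<longleftrightarrow> finite E \<and> (\<forall>x\<in>space M. K x \<in> E) \<and> (\<forall>e\<in>E. {x \<in> space M. K x = e} \<in> sets M)"

definition pm :: "'a measure \<Rightarrow> ('a \<Rightarrow> 'b) \<Rightarrow> 'b \<Rightarrow> real" where
  "pm M K e = measure M {x \<in> space M. K x = e}"

lemma pm_nonneg: "0 \<le> pm M K e" by (simp add: pm_def)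

lemma fin_sets: "fin M K E \<Longrightarrow> {x \<in> space M. K x = e} \<in> sets M"
proof (cases "e \<in> E")
  case False
  assume "fin M K E"
  hence "{x \<in> space M. K x = e} = {}" using False unfolding fin_def by auto
  thus ?thesis by (simp only: sets.empty_sets)
qed (auto simp: fin_def)

lemma fin_integral:
  fixes F :: "'b \<Rightarrow> real"
  assumes "prob_space M" "fin M K E"
  shows "integrable M (\<lambda>x. F (K x))" "(\<integral>x. F (K x) \<partial>M) = (\<Sum>e\<in>E. pm M K e * F e)"
proof -
  interpret prob_space M by fact
  have eq: "F (K x) = (\<Sum>e\<in>E. F e * indicator {x \<in> space M. K x = e} x)" if "x \<in> space M" for x
  proof -
    have "(\<Sum>e\<in>E. F e * indicator {x \<in> space M. K x = e} x) = (\<Sum>e\<in>E. if e = K x then F e else 0)"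
      using that by (intro sum.cong) (auto simp: indicator_def)
    thus ?thesis using assms(2) that by (simp add: fin_def sum.delta')
  qed
  have int: "integrable M (\<lambda>x. F e * indicator {x \<in> space M. K x = e} x)" for e
    using fin_sets[OF assms(2), of e] by (intro integrable_mult_right integrable_real_indicator) (auto simp: less_top[symmetric])
  show "integrable M (\<lambda>x. F (K x))"
    by (subst Bochner_Integration.integrable_cong[OF refl eq]) (auto intro!: int)
  have "(\<integral>x. F (K x) \<partial>M) = (\<integral>x. (\<Sum>e\<in>E. F e * indicator {x \<in> space M. K x = e} x) \<partial>M)"
    by (rule Bochner_Integration.integral_cong[OF refl eq])
  also have "\<dots> = (\<Sum>e\<in>E. F e * pm M K e)"
    using fin_sets[OF assms(2)] int by (simp add: Bochner_Integration.integral_sum pm_def)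
  finally show "(\<integral>x. F (K x) \<partial>M) = (\<Sum>e\<in>E. pm M K e * F e)" by (simp add: mult.commute)
qed

lemma fin_sum_1: "prob_space M \<Longrightarrow> fin M K E \<Longrightarrow> (\<Sum>e\<in>E. pm M K e) = 1"
  using fin_integral(2)[of M K E "\<lambda>_. 1"] prob_space.prob_space by fastforce

lemma fin_compose:
  assumes "fin M K E" "finite D" "\<And>e. e \<in> E \<Longrightarrow> \<psi> e \<in> D"
  shows "fin M (\<lambda>x. \<psi> (K x)) D"
  unfolding fin_def
proof (intro conjI ballI)
  fix d assume "d \<in> D"
  have "{x \<in> space M. \<psi> (K x) = d} = (\<Union>e\<in>{e\<in>E. \<psi> e = d}. {x \<in> space M. K x = e})"
    using assms(1) unfolding fin_def by auto
  also have "\<dots> \<in> sets M" using assms(1) unfolding fin_def by (intro sets.finite_UN) auto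
  finally show "{x \<in> space M. \<psi> (K x) = d} \<in> sets M" .
qed (use assms in \<open>auto simp: fin_def\<close>)

lemma fin_pair:
  assumes "fin M K E" "fin M L F" shows "fin M (\<lambda>x. (K x, L x)) (E \<times> F)"
  unfolding fin_def
proof (intro conjI ballI)
  fix d assume "d \<in> E \<times> F"
  have "{x \<in> space M. (K x, L x) = d} = {x \<in> space M. K x = fst d} \<inter> {x \<in> space M. L x = snd d}" by auto
  thus "{x \<in> space M. (K x, L x) = d} \<in> sets M" using fin_sets[OF assms(1)] fin_sets[OF assms(2)] by auto
qed (use assms in \<open>auto simp: fin_def\<close>)

lemma fin_push:
  fixes F :: "'d \<Rightarrow> real"
  assumes "prob_space M" "fin M K E" "finite D" "\<And>e. e \<in> E \<Longrightarrow> \<psi> e \<in> D"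
  shows "(\<Sum>e\<in>E. pm M K e * F (\<psi> e)) = (\<Sum>d\<in>D. pm M (\<lambda>x. \<psi> (K x)) d * F d)"
  using fin_integral(2)[OF assms(1,2), where F="\<lambda>e. F (\<psi> e)"]
    fin_integral(2)[OF assms(1) fin_compose[OF assms(2,3), of \<psi>, OF assms(4)], where F=F] by simp

lemma pm_compose_ge:
  assumes "prob_space M" "fin M K E" "finite D" "\<And>e. e \<in> E \<Longrightarrow> \<psi> e \<in> D"
  shows "pm M K e \<le> pm M (\<lambda>x. \<psi> (K x)) (\<psi> e)"
proof -
  interpret prob_space M by fact
  show ?thesis unfolding pm_def
    using fin_sets[OF fin_compose[OF assms(2-4)]] by (intro finite_measure_mono) auto
qed

text \<open>Gibbs' inequality, combined with the fact that coarsening does not increase entropy.\<close>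

lemma entropy_le:
  assumes M: "prob_space M" and K: "fin M K E" and D: "finite D" "\<And>e. e \<in> E \<Longrightarrow> \<psi> e \<in> D"
    and \<pi>: "\<And>e. e \<in> E \<Longrightarrow> 0 \<le> \<pi> e" "(\<Sum>e\<in>E. \<pi> e) \<le> 1" "\<And>e. e \<in> E \<Longrightarrow> 0 < pm M K e \<Longrightarrow> 0 < \<pi> e"
  shows "- (\<Sum>d\<in>D. pm M (\<lambda>x. \<psi> (K x)) d * ln (pm M (\<lambda>x. \<psi> (K x)) d)) \<le> - (\<Sum>e\<in>E. pm M K e * ln (\<pi> e))"
proof -
  have "(\<Sum>e\<in>E. pm M K e * ln (\<pi> e)) \<le> (\<Sum>e\<in>E. pm M K e * ln (pm M (\<lambda>x. \<psi> (K x)) (\<psi> e)) + (\<pi> e - pm M K e))"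
  proof (rule sum_mono)
    fix e assume e: "e \<in> E"
    show "pm M K e * ln (\<pi> e) \<le> pm M K e * ln (pm M (\<lambda>x. \<psi> (K x)) (\<psi> e)) + (\<pi> e - pm M K e)"
    proof (cases "pm M K e = 0")
      case False
      hence P: "0 < pm M K e" using pm_nonneg[of M K e] by simp
      have p: "0 < \<pi> e" by (rule \<pi>(3)[OF e P])
      have ge: "pm M K e \<le> pm M (\<lambda>x. \<psi> (K x)) (\<psi> e)" by (rule pm_compose_ge[OF M K D])
      have "ln (\<pi> e / pm M K e) \<le> \<pi> e / pm M K e - 1" by (rule ln_le_minus_one) (use p P in auto)
      hence "pm M K e * ln (\<pi> e / pm M K e) \<le> pm M K e * (\<pi> e / pm M K e - 1)" using P by (intro mult_left_mono) auto
      hence "pm M K e * ln (\<pi> e) \<le> pm M K e * ln (pm M K e) + (\<pi> e - pm M K e)"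
        using P p by (simp add: ln_div right_diff_distrib)
      moreover have "pm M K e * ln (pm M K e) \<le> pm M K e * ln (pm M (\<lambda>x. \<psi> (K x)) (\<psi> e))"
        using P ge by (intro mult_left_mono) auto
      ultimately show ?thesis by linarith
    qed (use \<pi>(1)[OF e] in auto)
  qed
  also have "\<dots> \<le> (\<Sum>e\<in>E. pm M K e * ln (pm M (\<lambda>x. \<psi> (K x)) (\<psi> e)))"
    using \<pi>(2) fin_sum_1[OF M K] by (simp add: sum.distrib sum_subtractf)
  also have "\<dots> = (\<Sum>d\<in>D. pm M (\<lambda>x. \<psi> (K x)) d * ln (pm M (\<lambda>x. \<psi> (K x)) d))"
    by (rule fin_push[OF M K D])
  finally show ?thesis by simp
qed

section \<open>Entropy rate of a finite partition under a measure preserving map\<close>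

locale mpt = prob_space M for M :: "'a measure" +
  fixes T :: "'a \<Rightarrow> 'a"
  assumes T_meas: "T \<in> measurable M M" and T_inv: "distr M M T = M"
begin

lemma T_pow_meas: "(T ^^ n) \<in> measurable M M"
proof (induction n)
  case (Suc n)
  from measurable_comp[OF this T_meas] show ?case by (simp only: funpow.simps)
qed simp

lemma T_pow_space: "x \<in> space M \<Longrightarrow> (T ^^ n) x \<in> space M"
  using T_pow_meas measurable_space by metis

lemma distr_T_pow: "distr M M (T ^^ n) = M"
proof (induction n)
  case (Suc n)
  have "distr M M (T ^^ Suc n) = distr (distr M M (T ^^ n)) M T"
    unfolding distr_distr[OF T_meas T_pow_meas] by (simp only: funpow.simps)
  thus ?case by (simp only: Suc T_inv)
qed (simp add: distr_id2 id_def)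

lemma integral_T_pow:
  fixes f :: "'a \<Rightarrow> real"
  assumes "f \<in> borel_measurable M" shows "(\<integral>x. f ((T ^^ n) x) \<partial>M) = (\<integral>x. f x \<partial>M)"
  using integral_distr[OF T_pow_meas assms, of n] by (simp add: distr_T_pow)

lemma fin_T_pow:
  assumes "fin M K E" shows "fin M (\<lambda>x. K ((T ^^ n) x)) E" "pm M (\<lambda>x. K ((T ^^ n) x)) e = pm M K e"
proof -
  have pre: "{x \<in> space M. K ((T ^^ n) x) = e} = (T ^^ n) -` {x \<in> space M. K x = e} \<inter> space M" for e
    using T_pow_space by auto
  have "{x \<in> space M. K ((T ^^ n) x) = e} \<in> sets M" for e
    unfolding pre by (rule measurable_sets[OF T_pow_meas fin_sets[OF assms]])
  thus "fin M (\<lambda>x. K ((T ^^ n) x)) E" using assms T_pow_space unfolding fin_def by auto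
  have "measure M {x \<in> space M. K x = e} = measure (distr M M (T ^^ n)) {x \<in> space M. K x = e}"
    by (simp only: distr_T_pow)
  also have "\<dots> = measure M ((T ^^ n) -` {x \<in> space M. K x = e} \<inter> space M)"
    by (rule measure_distr[OF T_pow_meas fin_sets[OF assms]])
  finally show "pm M (\<lambda>x. K ((T ^^ n) x)) e = pm M K e" unfolding pm_def pre by simp
qed

definition cell :: "'a set set \<Rightarrow> 'a \<Rightarrow> 'a set" where "cell \<xi> x = (THE A. A \<in> \<xi> \<and> x \<in> A)"
definition it :: "'a set set \<Rightarrow> nat \<Rightarrow> 'a \<Rightarrow> nat \<Rightarrow> 'a set" where
  "it \<xi> n x = (\<lambda>i\<in>{..<n}. cell \<xi> ((T ^^ i) x))"

context
  fixes \<xi> assumes \<xi>: "\<xi> \<in> finite_partitions M"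
begin

lemma finite_\<xi>: "finite \<xi>" using \<xi> by (simp add: finite_partitions_def)

lemma cell_unique: "A \<in> \<xi> \<Longrightarrow> x \<in> A \<Longrightarrow> cell \<xi> x = A"
  unfolding cell_def using \<xi> partition_onD2[of "space M" \<xi>]
  by (intro the_equality) (auto simp: finite_partitions_def disjoint_def)

lemma cell_in: "x \<in> space M \<Longrightarrow> cell \<xi> x \<in> \<xi>" and in_cell: "x \<in> space M \<Longrightarrow> x \<in> cell \<xi> x"
proof -
  assume "x \<in> space M"
  moreover have "space M = \<Union>\<xi>" using \<xi> unfolding finite_partitions_def by (blast dest: partition_onD1)
  ultimately obtain A where A: "A \<in> \<xi>" "x \<in> A" by blast
  thus "cell \<xi> x \<in> \<xi>" "x \<in> cell \<xi> x" using cell_unique[OF A] by auto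
qed

lemma cell_iff: "x \<in> space M \<Longrightarrow> A \<in> \<xi> \<Longrightarrow> cell \<xi> x = A \<longleftrightarrow> x \<in> A"
  using cell_unique in_cell by auto

lemma fin_cell: "fin M (cell \<xi>) \<xi>"
  unfolding fin_def
proof (intro conjI ballI)
  fix A assume A: "A \<in> \<xi>"
  hence "A \<in> sets M" using \<xi> by (auto simp: finite_partitions_def)
  moreover have "{x \<in> space M. cell \<xi> x = A} = A"
    using cell_iff[OF _ A] sets.sets_into_space[OF calculation] by auto
  ultimately show "{x \<in> space M. cell \<xi> x = A} \<in> sets M" by simp
qed (use finite_\<xi> cell_in in auto)

abbreviation (input) words :: "nat \<Rightarrow> (nat \<Rightarrow> 'a set) set" where "words n \<equiv> {..<n} \<rightarrow>\<^sub>E \<xi>"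

lemma it_iff:
  assumes "x \<in> space M" "a \<in> words n" shows "it \<xi> n x = a \<longleftrightarrow> (\<forall>i<n. (T ^^ i) x \<in> a i)"
proof -
  have "it \<xi> n x = a \<longleftrightarrow> (\<forall>i<n. cell \<xi> ((T ^^ i) x) = a i)"
    using assms(2) unfolding it_def by (auto simp: fun_eq_iff PiE_def extensional_def restrict_def)
  also have "\<dots> \<longleftrightarrow> (\<forall>i<n. (T ^^ i) x \<in> a i)"
  proof (intro all_cong)
    fix i assume "i < n"
    thus "cell \<xi> ((T ^^ i) x) = a i \<longleftrightarrow> (T ^^ i) x \<in> a i"
      using assms(2) by (intro cell_iff T_pow_space assms(1)) (auto simp: PiE_def Pi_def)
  qed
  finally show ?thesis .
qed

lemma fin_it: "fin M (it \<xi> n) (words n)"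
  unfolding fin_def
proof (intro conjI ballI)
  show "finite (words n)" using finite_\<xi> by (intro finite_PiE) auto
  show "it \<xi> n x \<in> words n" if "x \<in> space M" for x
    using that T_pow_space cell_in by (auto simp: it_def)
  fix a assume a: "a \<in> words n"
  have "{x \<in> space M. it \<xi> n x = a} = {x \<in> space M. \<forall>i\<in>{..<n}. cell \<xi> ((T ^^ i) x) = a i}"
    using a unfolding it_def by (auto simp: fun_eq_iff PiE_def extensional_def restrict_def)
  moreover have "{x \<in> space M. cell \<xi> ((T ^^ i) x) = a i} \<in> sets M" for i
    by (rule fin_sets[OF fin_T_pow(1)[OF fin_cell]])
  ultimately show "{x \<in> space M. it \<xi> n x = a} \<in> sets M"
    by (auto intro: sets.sets_Collect_finite_All')
qed

definition Hn :: "nat \<Rightarrow> real" where "Hn n = - (\<Sum>a\<in>words n. pm M (it \<xi> n) a * ln (pm M (it \<xi> n) a))"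

text \<open>\<open>iterated_join\<close> is a set of sets, so distinct words may name the same set.
  This happens only for the empty set, which contributes nothing.\<close>

lemma partition_entropy_join: "partition_entropy M (iterated_join M T \<xi> n) = Hn n"
proof -
  let ?J = "\<lambda>a. {x \<in> space M. \<forall>i<n. (T ^^ i) x \<in> a i}"
  have J: "?J a = {x \<in> space M. it \<xi> n x = a}" if "a \<in> words n" for a
    using it_iff[OF _ that] by auto
  have "(\<Sum>A\<in>?J ` words n. measure M A * ln (measure M A)) = (\<Sum>a\<in>words n. measure M (?J a) * ln (measure M (?J a)))"
  proof (rule sum.reindex_nontrivial[unfolded o_def])
    show "finite (words n)" using fin_it by (simp add: fin_def)
    fix a b assume ab: "a \<in> words n" "b \<in> words n" "a \<noteq> b" "?J a = ?J b"
    hence "?J a = {}" using J[OF ab(1)] J[OF ab(2)] by auto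
    thus "measure M (?J a) * ln (measure M (?J a)) = 0" by (simp only: measure_empty mult_zero_left)
  qed
  also have "\<dots> = (\<Sum>a\<in>words n. pm M (it \<xi> n) a * ln (pm M (it \<xi> n) a))"
    unfolding pm_def by (intro sum.cong) (simp_all only: J)
  finally show ?thesis unfolding partition_entropy_def iterated_join_def Hn_def by simp
qed

lemma Hn_nonneg: "0 \<le> Hn n"
proof -
  have "pm M (it \<xi> n) a * ln (pm M (it \<xi> n) a) \<le> 0" for a
  proof (cases "pm M (it \<xi> n) a = 0")
    case False
    hence "0 < pm M (it \<xi> n) a" using pm_nonneg[of M "it \<xi> n" a] by simp
    moreover have "pm M (it \<xi> n) a \<le> 1" unfolding pm_def by (rule prob_le_1)
    ultimately show ?thesis by (intro mult_nonneg_nonpos) auto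
  qed simp
  thus ?thesis unfolding Hn_def by (simp add: sum_nonpos)
qed

text \<open>Gibbs' inequality for the pair of the first n and the next m labels, against the product
  of their laws; by invariance the second law is that of the first m labels. The support condition
  holds because each marginal dominates the joint law.\<close>

lemma Hn_subadd: "Hn (n + m) \<le> Hn n + Hn m"
proof -
  define K where "K x = (it \<xi> n x, it \<xi> m ((T ^^ n) x))" for x
  define \<psi> where "\<psi> = (\<lambda>(a, b). \<lambda>i\<in>{..<n+m}. if i < n then a i else b (i - n) :: 'a set)"
  let ?P = "\<lambda>k. pm M (it \<xi> k)"
  have fm: "fin M (\<lambda>x. it \<xi> m ((T ^^ n) x)) (words m)" by (rule fin_T_pow(1)[OF fin_it])
  have fK: "fin M K (words n \<times> words m)" unfolding K_def by (rule fin_pair[OF fin_it fm])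
  have \<psi>K: "\<psi> (K x) = it \<xi> (n + m) x" for x
    by (auto simp: \<psi>_def K_def it_def fun_eq_iff restrict_def funpow_add[symmetric, THEN fun_cong, unfolded o_apply])
  have \<psi>: "\<psi> e \<in> words (n + m)" if "e \<in> words n \<times> words m" for e
    using that by (auto simp: \<psi>_def PiE_def Pi_def)
  have fst_in: "\<And>e. e \<in> words n \<times> words m \<Longrightarrow> fst e \<in> words n"
    and snd_in: "\<And>e. e \<in> words n \<times> words m \<Longrightarrow> snd e \<in> words m" by (auto simp only: mem_Times_iff)
  have fw: "finite (words k)" for k using fin_it[of k] by (simp add: fin_def)
  have ge: "pm M K e \<le> ?P n (fst e) \<and> pm M K e \<le> ?P m (snd e)" for e
    using pm_compose_ge[OF prob_space_axioms fK fw, of fst n e] pm_compose_ge[OF prob_space_axioms fK fw, of snd m e]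
      fin_T_pow(2)[OF fin_it, of m n "snd e"] by (auto simp: K_def)
  have "Hn (n + m) = - (\<Sum>d\<in>words (n + m). pm M (\<lambda>x. \<psi> (K x)) d * ln (pm M (\<lambda>x. \<psi> (K x)) d))"
    unfolding Hn_def \<psi>K ..
  also have "\<dots> \<le> - (\<Sum>e\<in>words n \<times> words m. pm M K e * ln (?P n (fst e) * ?P m (snd e)))"
  proof (rule entropy_le[OF prob_space_axioms fK fw \<psi>])
    have "(\<Sum>e\<in>words n \<times> words m. ?P n (fst e) * ?P m (snd e)) = (\<Sum>a\<in>words n. ?P n a) * (\<Sum>b\<in>words m. ?P m b)"
      by (simp add: sum_product sum.cartesian_product split_beta)
    thus "(\<Sum>e\<in>words n \<times> words m. ?P n (fst e) * ?P m (snd e)) \<le> 1"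
      using fin_sum_1[OF prob_space_axioms fin_it] by simp
    show "0 < ?P n (fst e) * ?P m (snd e)" if "0 < pm M K e" for e
      using ge[of e] that by (intro mult_pos_pos) auto
  qed (auto simp: pm_nonneg)
  also have "(\<Sum>e\<in>words n \<times> words m. pm M K e * ln (?P n (fst e) * ?P m (snd e))) =
      (\<Sum>e\<in>words n \<times> words m. pm M K e * ln (?P n (fst e)) + pm M K e * ln (?P m (snd e)))"
  proof (rule sum.cong[OF refl])
    fix e
    show "pm M K e * ln (?P n (fst e) * ?P m (snd e)) = pm M K e * ln (?P n (fst e)) + pm M K e * ln (?P m (snd e))"
    proof (cases "pm M K e = 0")
      case False
      hence "0 < pm M K e" using pm_nonneg[of M K e] by simp
      hence "0 < ?P n (fst e)" "0 < ?P m (snd e)" using ge[of e] by auto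
      thus ?thesis by (simp add: ln_mult algebra_simps)
    qed simp
  qed
  also have "\<dots> = (\<Sum>a\<in>words n. ?P n a * ln (?P n a)) + (\<Sum>b\<in>words m. ?P m b * ln (?P m b))"
  proof -
    have "(\<Sum>e\<in>words n \<times> words m. pm M K e * ln (?P n (fst e))) = (\<Sum>a\<in>words n. ?P n a * ln (?P n a))"
      using fin_push[where \<psi>=fst and F="\<lambda>a. ln (?P n a)" and D="words n", OF prob_space_axioms fK fw fst_in] by (simp add: K_def)
    moreover have "(\<Sum>e\<in>words n \<times> words m. pm M K e * ln (?P m (snd e))) = (\<Sum>b\<in>words m. ?P m b * ln (?P m b))"
      using fin_push[where \<psi>=snd and F="\<lambda>a. ln (?P m a)" and D="words m", OF prob_space_axioms fK fw snd_in] fin_T_pow(2)[OF fin_it, of m n]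
      by (simp add: K_def)
    ultimately show ?thesis by (simp add: sum.distrib)
  qed
  finally show ?thesis unfolding Hn_def by simp
qed

definition h\<xi> :: real where "h\<xi> = lim (\<lambda>n. partition_entropy M (iterated_join M T \<xi> n) / real n)"

lemma h\<xi>_le: "real n * h\<xi> \<le> Hn n" and h\<xi>_lim: "(\<lambda>n. Hn n / real n) \<longlonglongrightarrow> h\<xi>"
proof -
  obtain l where l: "(\<lambda>n. Hn n / real n) \<longlonglongrightarrow> l" "\<And>n. real n * l \<le> Hn n"
    using fekete[of Hn, OF Hn_subadd Hn_nonneg] by blast
  have "h\<xi> = l" unfolding h\<xi>_def partition_entropy_join using l(1) by (rule limI)
  thus "real n * h\<xi> \<le> Hn n" "(\<lambda>n. Hn n / real n) \<longlonglongrightarrow> h\<xi>" using l by auto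
qed

end

end

context beta_setting
begin

section \<open>The variational inequality\<close>

abbreviation XB :: "digits measure" where "XB \<equiv> restrict_space borel X"
text \<open>The empty set is added to make the family closed under intersections.\<close>

definition gen :: "digits set set" where "gen = insert {} {cyl n w | n w. w \<in> W n}"

lemma space_XB [simp]: "space XB = X" by (simp add: space_restrict_space)

lemma coord_set: "{x::digits. x i = a} \<in> sets borel"
proof -
  have "(\<lambda>x::digits. x i) -` {a} \<inter> space borel \<in> sets borel"
    by (rule measurable_sets[of _ _ "borel :: nat measure"]) (auto intro: measurable_product_coordinates)
  moreover have "(\<lambda>x::digits. x i) -` {a} \<inter> space borel = {x. x i = a}" by auto
  ultimately show ?thesis by simp
qed

lemma cyl_sets: "cyl n w \<in> sets XB"
proof -
  have "cyl n w = X \<inter> {x. trunc n x = w}" by (auto simp: cyl_def)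
  moreover have "{x. trunc n x = w} \<in> sets borel"
  \<comment> \<open>\<open>cyl n w\<close> is defined for every w; it is empty unless w vanishes
    from n on.\<close>
  proof (cases "\<forall>i\<ge>n. w i = 0")
    case True
    have "{x. trunc n x = w} = (\<Inter>i\<in>{..<n}. {x. x i = w i}) \<inter> UNIV"
      using True by (auto simp: trunc_def fun_eq_iff)
    also have "\<dots> \<in> sets borel"
      by (cases "n = 0") (use coord_set in \<open>auto intro!: sets.finite_INT\<close>)
    finally show ?thesis .
  next
    case False
    then obtain i where i: "i \<ge> n" "w i \<noteq> 0" by blast
    have "trunc n x \<noteq> w" for x
    proof
      assume "trunc n x = w"
      hence "trunc n x i = w i" by simp
      thus False using i by (simp add: trunc_def)
    qed
    hence "{x. trunc n x = w} = {}" by blast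
    thus ?thesis by (simp only: sets.empty_sets)
  qed
  ultimately show ?thesis by (auto simp: sets_restrict_space)
qed

lemma X_subset_cyl: "X \<subseteq> (\<Union>w\<in>W n. cyl n w)"
  using trunc_in_W by (auto simp: cyl_def)

lemma coord_cyl: "{x \<in> X. x i = a} = (\<Union>w\<in>{w \<in> W (Suc i). w i = a}. cyl (Suc i) w)"
proof safe
  fix x assume "x \<in> X" 
  thus "x \<in> (\<Union>w\<in>{w \<in> W (Suc i). w i = x i}. cyl (Suc i) w)"
    by (intro UN_I[of "trunc (Suc i) x"]) (auto simp: cyl_def trunc_in_W, auto simp: trunc_def)
qed (auto simp: cyl_def trunc_def)

lemma gen_sub: "gen \<subseteq> Pow X" by (auto simp: gen_def cyl_def)

lemma sets_XB: "sets XB = sigma_sets X gen"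
proof
  have id: "(\<lambda>x. x) \<in> measurable (sigma X gen) (borel :: digits measure)"
  proof (rule measurable_coordinatewise_then_product)
    fix i
    show "(\<lambda>x. x i) \<in> borel_measurable (sigma X gen)"
    proof (rule borel_measurableI)
      fix A :: "nat set"
      have "(\<lambda>x. x i) -` A \<inter> space (sigma X gen) = (\<Union>a\<in>A. {x \<in> X. x i = a})"
        using gen_sub by (auto simp: space_measure_of)
      also have "\<dots> \<in> sets (sigma X gen)"
      proof (rule sets.countable_UN'[OF countableI_type], rule image_subsetI)
        fix a
        have "cyl (Suc i) w \<in> sets (sigma X gen)" if "w \<in> W (Suc i)" for w
        proof -
          have "cyl (Suc i) w \<in> gen" unfolding gen_def using that by blast
          thus ?thesis using gen_sub by (simp only: sets_measure_of sigma_sets.Basic)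
        qed
        moreover have "finite {w \<in> W (Suc i). w i = a}" using finite_W by simp
        ultimately show "{x \<in> X. x i = a} \<in> sets (sigma X gen)"
          unfolding coord_cyl by (intro sets.finite_UN) blast+
      qed
      finally show "(\<lambda>x. x i) -` A \<inter> space (sigma X gen) \<in> sets (sigma X gen)" .
    qed
  qed
  show "sets XB \<subseteq> sigma_sets X gen"
  proof
    fix A assume "A \<in> sets XB"
    then obtain B where B: "B \<in> sets borel" "A = X \<inter> B" by (auto simp: sets_restrict_space)
    have "(\<lambda>x. x) -` B \<inter> space (sigma X gen) \<in> sets (sigma X gen)" by (rule measurable_sets[OF id B(1)])
    moreover have "(\<lambda>x. x) -` B \<inter> space (sigma X gen) = A" using gen_sub B by (auto simp: space_measure_of)
    ultimately show "A \<in> sigma_sets X gen" using gen_sub by (simp add: sets_measure_of)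
  qed
  have "gen \<subseteq> sets XB" using cyl_sets by (auto simp: gen_def)
  thus "sigma_sets X gen \<subseteq> sets XB" using sets.sigma_sets_subset[of gen XB] by simp
qed

lemma trunc_trunc: "n \<le> m \<Longrightarrow> trunc n (trunc m x) = trunc n x"
  by (auto simp: trunc_def fun_eq_iff)

lemma gen_Int_stable: "Int_stable gen"
proof (rule Int_stableI)
  have *: "cyl n w \<inter> cyl m w' \<in> gen" if "n \<le> m" "w \<in> W n" "w' \<in> W m" for n m w w'
  proof (cases "trunc n w' = w")
    case True
    have "cyl n w \<inter> cyl m w' = cyl m w'" using True trunc_trunc[OF that(1)] by (auto simp: cyl_def)
    thus ?thesis using that(3) by (auto simp: gen_def)
  next
    case False
    have "cyl n w \<inter> cyl m w' = {}" using False trunc_trunc[OF that(1)] by (auto simp: cyl_def)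
    thus ?thesis by (auto simp: gen_def)
  qed
  fix a b assume "a \<in> gen" "b \<in> gen"
  then consider "a = {}" | "b = {}" | n w m w' where "a = cyl n w" "w \<in> W n" "b = cyl m w'" "w' \<in> W m"
    unfolding gen_def by blast
  thus "a \<inter> b \<in> gen"
  proof cases
    case 3
    thus ?thesis using *[of n m w w'] *[of m n w' w] by (metis inf_commute nat_le_linear)
  qed (auto simp: gen_def)
qed

lemma trunc_shift: "i < n \<Longrightarrow> trunc k ((shift ^^ i) (trunc (n + k) x)) = trunc k ((shift ^^ i) x)"
  by (auto simp: trunc_def shift_pow fun_eq_iff)

text \<open>Truncation at n can change the potential only at the last k of the n shifts.\<close>

lemma birk_trunc:
  assumes x: "x \<in> X" and dep: "\<And>x y. x \<in> X \<Longrightarrow> y \<in> X \<Longrightarrow> trunc k x = trunc k y \<Longrightarrow> \<Phi> x = \<Phi> y"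
    and b: "\<And>x. x \<in> X \<Longrightarrow> \<bar>\<Phi> x\<bar> \<le> b"
  shows "\<bar>birk \<Phi> n x - birk \<Phi> n (trunc n x)\<bar> \<le> 2 * b * real k"
proof -
  have tX: "trunc n x \<in> X" using trunc_in_W[OF x] W_X by blast
  have b0: "0 \<le> b" using b[OF zero_in_X] by simp
  let ?d = "\<lambda>i. \<Phi> ((shift ^^ i) x) - \<Phi> ((shift ^^ i) (trunc n x))"
  have z: "?d i = 0" if "i + k \<le> n" for i
  proof -
    have "trunc k ((shift ^^ i) x) = trunc k ((shift ^^ i) (trunc n x))"
      using that by (auto simp: trunc_def shift_pow fun_eq_iff)
    from dep[OF shift_pow_in_X[OF x] shift_pow_in_X[OF tX] this] show ?thesis by simp
  qed
  have le: "\<bar>?d i\<bar> \<le> 2 * b" for i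
    using b[OF shift_pow_in_X[OF x, of i]] b[OF shift_pow_in_X[OF tX, of i]] by linarith
  have "\<bar>birk \<Phi> n x - birk \<Phi> n (trunc n x)\<bar> = \<bar>\<Sum>i<n. ?d i\<bar>" by (simp add: birk_def sum_subtractf)
  also have "\<dots> \<le> (\<Sum>i<n. \<bar>?d i\<bar>)" by (rule sum_abs)
  also have "\<dots> \<le> (\<Sum>i\<in>{n-k..<n}. 2 * b)"
  proof -
    have "(\<Sum>i<n. \<bar>?d i\<bar>) = (\<Sum>i\<in>{n-k..<n}. \<bar>?d i\<bar>)"
      by (rule sum.mono_neutral_right) (use z in auto)
    also have "\<dots> \<le> (\<Sum>i\<in>{n-k..<n}. 2 * b)" using le by (intro sum_mono)
    finally show ?thesis .
  qed
  also have "\<dots> \<le> 2 * b * real k" using b0 by (simp add: mult.commute mult_left_mono)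
  finally show ?thesis .
qed

lemma invariant_mpt:
  assumes "m \<in> invariant_measures \<beta>" shows "mpt m shift" "space m = X" "sets m = sets XB"
proof -
  have m: "prob_space m" "sets m = sets XB" "shift \<in> measurable m m" "distr m m shift = m"
    using assms by (auto simp: invariant_measures_def)
  show "mpt m shift" by (intro mpt.intro mpt_axioms.intro m)
  show "sets m = sets XB" by fact
  show "space m = X" using sets_eq_imp_space_eq[OF m(2)] by simp
qed

text \<open>The inequality ln y \<le> y - 1 gives the bound 1 - x when applied to 1/x, and the bound
  2 sqrt x \<le> e + x/e when applied to 1/sqrt x. The result is small near x = 0 and near x = 1, as
  needed for a cylinder almost disjoint from a set or almost contained in it.\<close>

lemma \<eta>_bound:
  assumes "0 \<le> x" "x \<le> 1" "0 < e" "e \<le> (1::real)"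
  shows "- (x * ln x) \<le> e + min x (1 - x) / e"
proof (cases "x = 0")
  case False
  hence x: "0 < x" using assms by simp
  have "- ln x = ln (1 / x)" using x by (simp add: ln_div)
  also have "\<dots> \<le> 1 / x - 1" using x by (intro ln_le_minus_one) auto
  finally have "x * (- ln x) \<le> x * (1 / x - 1)" using x by (intro mult_left_mono) auto
  hence 1: "- (x * ln x) \<le> 1 - x" using x by (simp add: right_diff_distrib)
  have "- ln x = 2 * ln (1 / sqrt x)" using x by (simp add: ln_div ln_sqrt)
  also have "\<dots> \<le> 2 * (1 / sqrt x - 1)" using x ln_le_minus_one[of "1 / sqrt x"] by simp
  also have "\<dots> \<le> 2 / sqrt x" by simp
  finally have "x * (- ln x) \<le> x * (2 / sqrt x)" using x by (intro mult_left_mono) auto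
  also have "\<dots> = 2 * (x / sqrt x)" by simp
  also have "x / sqrt x = sqrt x" using x by (intro real_div_sqrt) simp
  finally have "- (x * ln x) \<le> 2 * sqrt x" by simp
  moreover have "2 * sqrt x * e \<le> e * e + x"
  proof -
    have "0 \<le> (e - sqrt x)\<^sup>2" by simp
    also have "\<dots> = e * e + x - 2 * sqrt x * e"
      unfolding power2_diff using x by (simp add: power2_eq_square)
    finally show ?thesis by simp
  qed
  ultimately have "- (x * ln x) * e \<le> e * e + x"
    using assms(3) by (smt (verit) mult_right_mono)
  hence 2: "- (x * ln x) \<le> e + x / e" using assms(3) by (simp add: field_simps)
  have "1 - x \<le> (1 - x) / e" using assms by (simp add: pos_le_divide_eq mult_left_le)
  hence "- (x * ln x) \<le> e + (1 - x) / e" using 1 assms(3) by linarith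
  thus ?thesis using 2 by (auto simp: min_def)
qed (use assms in auto)

section \<open>Approximation of partitions by cylinders and the variational inequality\<close>

context
  fixes m assumes m: "m \<in> invariant_measures \<beta>"
begin

interpretation m: mpt m shift using invariant_mpt[OF m] by blast

lemma m_space: "space m = X" and m_sets: "sets m = sets XB" using invariant_mpt[OF m] by auto

lemma m_cyl: "cyl n w \<in> sets m" unfolding m_sets by (rule cyl_sets)

lemma fin_trunc: "fin m (trunc n) (W n)"
  unfolding fin_def using finite_W trunc_in_W m_space m_cyl by (auto simp: cyl_def)

lemma pm_trunc: "pm m (trunc n) w = measure m (cyl n w)"
  by (simp add: pm_def cyl_def m_space)

definition approximable :: "digits set \<Rightarrow> bool" where
  "approximable A \<longleftrightarrow> (\<forall>d>0. \<exists>k V. V \<subseteq> W k \<and> measure m (A - (\<Union>w\<in>V. cyl k w)) + measure m ((\<Union>w\<in>V. cyl k w) - A) < d)"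

abbreviation U where "U k V \<equiv> (\<Union>w\<in>V. cyl k w)"

lemma U_sets: "V \<subseteq> W k \<Longrightarrow> U k V \<in> sets m"
  using finite_subset[OF _ finite_W] m_cyl by (intro sets.finite_UN) auto

lemma U_refine: "k \<le> k' \<Longrightarrow> V \<subseteq> W k \<Longrightarrow> U k V = U k' {w \<in> W k'. trunc k w \<in> V}"
  using trunc_in_W trunc_trunc[of k k'] by (auto simp: cyl_def)

lemma approximable_all:
  assumes "A \<in> sets m" shows "approximable A"
proof -
  have "A \<in> sigma_sets X gen" using assms m_sets sets_XB by simp
  thus ?thesis
  proof (induction rule: sigma_sets.induct)
    case (Basic a)
    then consider "a = {}" | n w where "w \<in> W n" "a = cyl n w" unfolding gen_def by blast
    thus ?case
    proof cases
      case 1 thus ?thesis unfolding approximable_def by (intro allI impI exI[of _ 0] exI[of _ "{}"]) auto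
    next
      case 2 thus ?thesis unfolding approximable_def by (intro allI impI exI[of _ n] exI[of _ "{w}"]) auto
    qed
  next
    case Empty
    thus ?case unfolding approximable_def by (intro allI impI exI[of _ 0] exI[of _ "{}"]) auto
  next
    case (Compl a)
    show ?case unfolding approximable_def
    proof (intro allI impI)
      fix d :: real assume "d > 0"
      then obtain k V where V: "V \<subseteq> W k" "measure m (a - U k V) + measure m (U k V - a) < d"
        using Compl.IH unfolding approximable_def by blast
      have aX: "a \<subseteq> X" using Compl.hyps by (metis gen_sub sigma_sets_into_sp)
      have "U k (W k - V) = X - U k V" using V(1) trunc_in_W by (auto simp: cyl_def)
      hence "X - a - U k (W k - V) = U k V - a" "U k (W k - V) - (X - a) = a - U k V"
        using aX by (auto simp: cyl_def)
      thus "\<exists>k V. V \<subseteq> W k \<and> measure m (X - a - U k V) + measure m (U k V - (X - a)) < d"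
        using V(2) by (intro exI[of _ k] exI[of _ "W k - V"]) auto
    qed
  next
    case (Union a)
    have aS: "a i \<in> sets m" for i using Union.hyps m_sets sets_XB by auto
    show ?case unfolding approximable_def
    proof (intro allI impI)
      fix d :: real assume d: "d > 0"
      let ?A = "\<Union>i. a i" and ?B = "\<lambda>n. \<Union>i<n. a i"
      have lim: "(\<lambda>n. measure m (?B n)) \<longlonglongrightarrow> measure m (\<Union>n. ?B n)"
        by (rule m.finite_Lim_measure_incseq) (use aS in \<open>auto simp: incseq_def intro: order_less_le_trans\<close>)
      moreover have "(\<Union>n. ?B n) = ?A" by auto
      ultimately have "eventually (\<lambda>n. measure m ?A - d / 2 < measure m (?B n)) sequentially"
        using d by (intro order_tendstoD(1)) auto
      then obtain n where n: "measure m ?A - d / 2 < measure m (?B n)"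
        using eventually_happens'[OF sequentially_bot] by blast
      have "measure m (?A - ?B n) = measure m ?A - measure m (?B n)"
        using aS by (intro m.finite_measure_Diff) auto
      hence tail: "measure m (?A - ?B n) < d / 2" using n by simp
      define d' where "d' = d / (2 * real (Suc n))"
      have d': "d' > 0" using d by (simp add: d'_def)
      have "\<exists>g. snd g \<subseteq> W (fst g) \<and> measure m (a i - U (fst g) (snd g)) + measure m (U (fst g) (snd g) - a i) < d'" for i
        using Union.IH[of i] d' unfolding approximable_def by force
      then obtain g where g: "\<forall>i. snd (g i) \<subseteq> W (fst (g i)) \<and>
          measure m (a i - U (fst (g i)) (snd (g i))) + measure m (U (fst (g i)) (snd (g i)) - a i) < d'"
        using choice[of "\<lambda>i g. snd g \<subseteq> W (fst g) \<and> measure m (a i - U (fst g) (snd g)) + measure m (U (fst g) (snd g) - a i) < d'"] by blast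
      define k V where "k i = fst (g i)" and "V i = snd (g i)" for i
      have V: "\<And>i. V i \<subseteq> W (k i)" "\<And>i. measure m (a i - U (k i) (V i)) + measure m (U (k i) (V i) - a i) < d'"
        using g by (auto simp: k_def V_def)
      \<comment> \<open>A common length, so that the finitely many approximants become unions of
        cylinders of one level.\<close>
      define K where "K = (\<Sum>i<n. k i)"
      define V' where "V' i = {w \<in> W K. trunc (k i) w \<in> V i}" for i
      have UV: "U K (V' i) = U (k i) (V i)" if "i < n" for i
      proof -
        have "k i \<le> K" unfolding K_def using that by (intro member_le_sum) auto
        from U_refine[OF this V(1)[of i]] show ?thesis unfolding V'_def by simp
      qed
      define Z where "Z = (\<Union>i<n. V' i)"
      have Z: "Z \<subseteq> W K" by (auto simp: Z_def V'_def)
      have UZ: "U K Z = (\<Union>i<n. U (k i) (V i))" using UV by (auto simp: Z_def)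
      have S: "a i - U (k i) (V i) \<in> sets m" "U (k i) (V i) - a i \<in> sets m" for i
        using aS U_sets[OF V(1)] by auto
      have "measure m (?A - U K Z) \<le> measure m ((?A - ?B n) \<union> (\<Union>i<n. a i - U (k i) (V i)))"
        unfolding UZ using aS S by (intro m.finite_measure_mono) auto
      also have "\<dots> \<le> measure m (?A - ?B n) + measure m (\<Union>i<n. a i - U (k i) (V i))"
        using aS S by (intro measure_Un_le) auto
      also have "measure m (\<Union>i<n. a i - U (k i) (V i)) \<le> (\<Sum>i<n. measure m (a i - U (k i) (V i)))"
        using S by (intro m.finite_measure_subadditive_finite) auto
      finally have 1: "measure m (?A - U K Z) \<le> measure m (?A - ?B n) + (\<Sum>i<n. measure m (a i - U (k i) (V i)))" by simp
      have "measure m (U K Z - ?A) \<le> measure m (\<Union>i<n. U (k i) (V i) - a i)"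
        unfolding UZ using S by (intro m.finite_measure_mono) auto
      also have "\<dots> \<le> (\<Sum>i<n. measure m (U (k i) (V i) - a i))"
        using S by (intro m.finite_measure_subadditive_finite) auto
      finally have 2: "measure m (U K Z - ?A) \<le> (\<Sum>i<n. measure m (U (k i) (V i) - a i))" .
      have "(\<Sum>i<n. measure m (a i - U (k i) (V i)) + measure m (U (k i) (V i) - a i)) \<le> (\<Sum>i<n. d')"
        using V(2) by (intro sum_mono) (auto intro: less_imp_le)
      also have "\<dots> \<le> d / 2" using d by (simp add: d'_def field_simps)
      finally have "measure m (?A - U K Z) + measure m (U K Z - ?A) < d"
        using 1 2 tail by (simp add: sum.distrib)
      thus "\<exists>k V. V \<subseteq> W k \<and> measure m (?A - U k V) + measure m (U k V - ?A) < d" using Z by blast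
    qed
  qed
qed

lemma measure_disjoint_union:
  assumes "V \<subseteq> W k" "\<And>w. w \<in> V \<Longrightarrow> B w \<in> sets m" "\<And>w. w \<in> V \<Longrightarrow> B w \<subseteq> cyl k w"
  shows "measure m (\<Union>w\<in>V. B w) = (\<Sum>w\<in>V. measure m (B w))"
proof (rule m.finite_measure_finite_Union)
  show "finite V" using assms(1) finite_W by (rule finite_subset)
  show "disjoint_family_on B V" using assms(3) unfolding disjoint_family_on_def cyl_def by blast
qed (use assms(2) in blast)

text \<open>The conditional entropy of the partition given the cylinders of length k.\<close>

definition Hc :: "digits set set \<Rightarrow> nat \<Rightarrow> real" where
  "Hc \<xi> k = - (\<Sum>(A, w)\<in>\<xi> \<times> W k. measure m (A \<inter> cyl k w) * ln (measure m (A \<inter> cyl k w) / measure m (cyl k w)))"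

text \<open>Each atom is approximated up to d * d by a union of k-cylinders. Applying
  \<open>\<eta>_bound\<close> with parameter d on every cylinder and summing gives at most d plus
  the total mismatch divided by d, so at most 2d per atom.\<close>

lemma Hc_small:
  assumes \<xi>: "\<xi> \<in> finite_partitions m" and e: "e > 0"
  shows "\<exists>k. Hc \<xi> k \<le> e"
proof -
  have fin: "finite \<xi>" using \<xi> by (simp add: finite_partitions_def)
  have sets: "A \<in> sets m" if "A \<in> \<xi>" for A using \<xi> that by (auto simp: finite_partitions_def)
  define d where "d = min 1 (e / (2 * (real (card \<xi>) + 1)))"
  have d: "0 < d" "d \<le> 1" "d \<le> e / (2 * (real (card \<xi>) + 1))" using e by (auto simp: d_def)
  have "\<forall>A\<in>\<xi>. \<exists>g. snd g \<subseteq> W (fst g) \<and> measure m (A - U (fst g) (snd g)) + measure m (U (fst g) (snd g) - A) < d * d"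
    using approximable_all[OF sets] d(1) unfolding approximable_def by (metis fst_conv mult_pos_pos snd_conv)
  from bchoice[OF this] obtain g where g: "\<And>A. A \<in> \<xi> \<Longrightarrow> snd (g A) \<subseteq> W (fst (g A))"
      "\<And>A. A \<in> \<xi> \<Longrightarrow> measure m (A - U (fst (g A)) (snd (g A))) + measure m (U (fst (g A)) (snd (g A)) - A) < d * d"
    by blast
  define k where "k = (\<Sum>A\<in>\<xi>. fst (g A))"
  have per: "(\<Sum>w\<in>W k. - (measure m (A \<inter> cyl k w) * ln (measure m (A \<inter> cyl k w) / measure m (cyl k w)))) \<le> 2 * d"
    if A: "A \<in> \<xi>" for A
  proof -
    define V where "V = {w \<in> W k. trunc (fst (g A)) w \<in> snd (g A)}"
    have "fst (g A) \<le> k" unfolding k_def using A fin by (intro member_le_sum) auto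
    from U_refine[OF this g(1)[OF A]] have U: "U (fst (g A)) (snd (g A)) = U k V" unfolding V_def .
    have VW: "V \<subseteq> W k" by (auto simp: V_def)
    have As: "A \<in> sets m" by (rule sets[OF A])
    have "U k (W k) = X" using X_subset_cyl[of k] by (auto simp: cyl_def)
    have AX: "A \<subseteq> X" using sets.sets_into_space[OF As] m_space by simp
    have s1: "measure m (A - U k V) = (\<Sum>w\<in>W k - V. measure m (A \<inter> cyl k w))"
    proof -
      have "A - U k V = (\<Union>w\<in>W k - V. A \<inter> cyl k w)"
        using AX trunc_in_W by (auto simp: cyl_def)
      thus ?thesis using As m_cyl by (simp only:) (rule measure_disjoint_union; auto)
    qed
    have s2: "measure m (U k V - A) = (\<Sum>w\<in>V. measure m (cyl k w - A))"
    proof -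
      have "U k V - A = (\<Union>w\<in>V. cyl k w - A)" by auto
      thus ?thesis using As m_cyl VW by (simp only:) (rule measure_disjoint_union; auto)
    qed
    \<comment> \<open>The mismatch on one cylinder: its part outside A if it was chosen to
      approximate A, its part inside A otherwise.\<close>
    define x where "x w = (if w \<in> V then measure m (cyl k w - A) else measure m (A \<inter> cyl k w))" for w
    have split: "measure m (cyl k w) = measure m (A \<inter> cyl k w) + measure m (cyl k w - A)" for w
    proof -
      have "measure m ((A \<inter> cyl k w) \<union> (cyl k w - A)) = measure m (A \<inter> cyl k w) + measure m (cyl k w - A)"
        by (rule m.finite_measure_Union) (use As m_cyl in auto)
      moreover have "(A \<inter> cyl k w) \<union> (cyl k w - A) = cyl k w" by blast
      ultimately show ?thesis by simp
    qed
    have "(\<Sum>w\<in>W k. - (measure m (A \<inter> cyl k w) * ln (measure m (A \<inter> cyl k w) / measure m (cyl k w))))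
        \<le> (\<Sum>w\<in>W k. measure m (cyl k w) * d + x w / d)"
    proof (rule sum_mono)
      fix w assume "w \<in> W k"
      let ?a = "measure m (A \<inter> cyl k w)" and ?b = "measure m (cyl k w)"
      have ab: "0 \<le> ?a" "?a \<le> ?b" using split[of w] measure_nonneg[of m "cyl k w - A"] by auto
      have x: "?b * min (?a / ?b) (1 - ?a / ?b) \<le> x w"
      proof (cases "?b = 0")
        case False
        have "?b * (?a / ?b) = ?a" "?b * (1 - ?a / ?b) = ?b - ?a" using False by (auto simp: right_diff_distrib)
        moreover have "?b * min (?a / ?b) (1 - ?a / ?b) = min (?b * (?a / ?b)) (?b * (1 - ?a / ?b))"
          using ab by (simp add: mult_min_right)
        ultimately show ?thesis using split[of w] by (auto simp: x_def min_def)
      qed (simp add: x_def)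
      show "- (?a * ln (?a / ?b)) \<le> ?b * d + x w / d"
      proof (cases "?b = 0")
        case True thus ?thesis using ab d x by (simp add: x_def)
      next
        case False
        hence b: "?b > 0" using measure_nonneg[of m "cyl k w"] by linarith
        have "- ((?a / ?b) * ln (?a / ?b)) \<le> d + min (?a / ?b) (1 - ?a / ?b) / d"
          by (rule \<eta>_bound) (use ab b d in auto)
        hence "?b * - ((?a / ?b) * ln (?a / ?b)) \<le> ?b * (d + min (?a / ?b) (1 - ?a / ?b) / d)"
          using b by (intro mult_left_mono) auto
        also have "?b * - ((?a / ?b) * ln (?a / ?b)) = - (?a * ln (?a / ?b))" using b by simp
        also have "?b * (d + min (?a / ?b) (1 - ?a / ?b) / d) = ?b * d + (?b * min (?a / ?b) (1 - ?a / ?b)) / d"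
          by (simp add: distrib_left)
        also have "\<dots> \<le> ?b * d + x w / d" using x d by (intro add_left_mono divide_right_mono) auto
        finally show ?thesis .
      qed
    qed
    also have "\<dots> = d * (\<Sum>w\<in>W k. pm m (trunc k) w) + (\<Sum>w\<in>W k. x w) / d"
      by (simp add: sum.distrib sum_distrib_left sum_divide_distrib mult.commute pm_trunc)
    also have "(\<Sum>w\<in>W k. pm m (trunc k) w) = 1" by (rule fin_sum_1[OF m.prob_space_axioms fin_trunc])
    also have "(\<Sum>w\<in>W k. x w) = (\<Sum>w\<in>W k - V. x w) + (\<Sum>w\<in>V. x w)"
      by (rule sum.subset_diff[OF VW finite_W])
    also have "\<dots> = measure m (A - U k V) + measure m (U k V - A)" unfolding s1 s2 by (simp add: x_def)
    also have "d * 1 + (measure m (A - U k V) + measure m (U k V - A)) / d \<le> d * 1 + d * d / d"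
      using g(2)[OF A] d unfolding U by (intro add_left_mono divide_right_mono) auto
    also have "\<dots> = 2 * d" using d by simp
    finally show ?thesis .
  qed
  have "Hc \<xi> k = (\<Sum>A\<in>\<xi>. \<Sum>w\<in>W k. - (measure m (A \<inter> cyl k w) * ln (measure m (A \<inter> cyl k w) / measure m (cyl k w))))"
    unfolding Hc_def by (simp add: sum.cartesian_product sum_negf)
  also have "\<dots> \<le> (\<Sum>A\<in>\<xi>. 2 * d)" by (intro sum_mono per)
  also have "\<dots> = 2 * real (card \<xi>) * d" by simp
  also have "\<dots> \<le> 2 * (real (card \<xi>) + 1) * (e / (2 * (real (card \<xi>) + 1)))"
    using d by (intro mult_mono) auto
  also have "\<dots> = e" by simp
  finally show ?thesis by blast
qed

text \<open>Gibbs' inequality for the pair of the \<xi>-itinerary and the word of length n + k,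
  against a trial law that draws the word from \<omega> and then each cell from its conditional law
  given the next k digits. By invariance each of the n conditional factors costs exactly
  \<open>Hc\<close>. The extra length k lets the last cell see k digits as well.\<close>

lemma entropy_upper:
  assumes \<xi>: "\<xi> \<in> finite_partitions m"
    and \<omega>: "\<And>w. w \<in> W (n + k) \<Longrightarrow> 0 < \<omega> w" "(\<Sum>w\<in>W (n + k). \<omega> w) \<le> 1"
  shows "m.Hn \<xi> n \<le> - (\<Sum>w\<in>W (n + k). pm m (trunc (n + k)) w * ln (\<omega> w)) + real n * Hc \<xi> k"
proof -
  let ?I = "{..<n} \<rightarrow>\<^sub>E \<xi>" and ?V = "W (n + k)"
  define K where "K x = (m.it \<xi> n x, trunc (n + k) x)" for x
  have fi: "fin m (m.it \<xi> n) ?I" by (rule m.fin_it[OF \<xi>])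
  have fK: "fin m K (?I \<times> ?V)" unfolding K_def by (rule fin_pair[OF fi fin_trunc])
  have fI: "finite ?I" using fi by (simp add: fin_def)
  have finx: "finite \<xi>" by (rule m.finite_\<xi>[OF \<xi>])
  define J where "J x = (m.cell \<xi> x, trunc k x)" for x
  have fJ: "fin m J (\<xi> \<times> W k)" unfolding J_def by (rule fin_pair[OF m.fin_cell[OF \<xi>] fin_trunc])
  have pJ: "pm m J (A, w) = measure m (A \<inter> cyl k w)" if "A \<in> \<xi>" for A w
  proof -
    have "A \<subseteq> X" using \<xi> that sets.sets_into_space[of A m] m_space by (auto simp: finite_partitions_def)
    hence "{x \<in> space m. J x = (A, w)} = A \<inter> cyl k w"
      using m.cell_iff[OF \<xi> _ that] m_space by (auto simp: J_def cyl_def)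
    thus ?thesis by (simp add: pm_def)
  qed
  define \<kappa> where "\<kappa> = (\<lambda>(A, w). pm m J (A, w) / pm m (trunc k) w)"
  define \<psi> where "\<psi> i = (\<lambda>(a, w). (a i :: digits set, trunc k ((shift ^^ i) w)))" for i :: nat
  define \<pi> where "\<pi> e = \<omega> (snd e) * (\<Prod>i<n. \<kappa> (\<psi> i e))" for e
  have \<kappa>0: "0 \<le> \<kappa> e" for e by (auto simp: \<kappa>_def pm_nonneg split: prod.split)
  have \<psi>K: "\<psi> i (K x) = J ((shift ^^ i) x)" if "i < n" for i x
    using that by (simp add: \<psi>_def K_def J_def m.it_def trunc_shift)
  have \<psi>in: "\<psi> i e \<in> \<xi> \<times> W k" if "i < n" "e \<in> ?I \<times> ?V" for i e
    using that W_X shift_pow_in_X trunc_in_W by (auto simp: \<psi>_def PiE_def Pi_def)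
  have pJ_shift: "pm m (\<lambda>x. \<psi> i (K x)) e = pm m J e" if "i < n" for i e
    unfolding \<psi>K[OF that] by (rule m.fin_T_pow(2)[OF fJ])
  have finJ: "finite (\<xi> \<times> W k)" using finx finite_W by simp
  \<comment> \<open>Over a cylinder of measure 0 all quotients are 0 by the convention for division,
    so the sum may be 0 instead of 1.\<close>
  have sum\<kappa>: "(\<Sum>A\<in>\<xi>. \<kappa> (A, w)) \<le> 1" for w
  proof -
    have "(\<Sum>A\<in>\<xi>. pm m J (A, w)) \<le> pm m (trunc k) w"
    proof -
      have "(\<Sum>A\<in>\<xi>. pm m J (A, w)) = (\<Sum>A\<in>\<xi>. measure m (A \<inter> cyl k w))" by (intro sum.cong pJ) auto
      also have "\<dots> = measure m (\<Union>A\<in>\<xi>. A \<inter> cyl k w)"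
      proof (rule m.finite_measure_finite_Union[symmetric, OF finx])
        have "A \<inter> B = {}" if "A \<in> \<xi>" "B \<in> \<xi>" "A \<noteq> B" for A B
          using \<xi> that partition_onD2[of "space m" \<xi>] by (auto simp only: finite_partitions_def disjoint_def)
        thus "disjoint_family_on (\<lambda>A. A \<inter> cyl k w) \<xi>" unfolding disjoint_family_on_def by blast
      qed (use \<xi> m_cyl in \<open>auto simp: finite_partitions_def\<close>)
      also have "\<dots> \<le> measure m (cyl k w)" using m_cyl by (intro m.finite_measure_mono) auto
      finally show ?thesis by (simp add: pm_trunc)
    qed
    thus ?thesis using pm_nonneg[of m "trunc k" w]
      by (cases "pm m (trunc k) w = 0") (auto simp: \<kappa>_def sum_divide_distrib[symmetric] divide_le_eq)
  qed
  have pos: "0 < \<kappa> (\<psi> i e)" if e: "0 < pm m K e" and i: "i < n" and E: "e \<in> ?I \<times> ?V" for i e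
  proof -
    have "pm m K e \<le> pm m (\<lambda>x. \<psi> i (K x)) (\<psi> i e)"
      by (rule pm_compose_ge[OF m.prob_space_axioms fK finJ \<psi>in[OF i]])
    hence 1: "0 < pm m J (\<psi> i e)" using e pJ_shift[OF i] by simp
    have "pm m J (\<psi> i e) \<le> pm m (\<lambda>x. snd (J x)) (snd (\<psi> i e))"
      by (rule pm_compose_ge[OF m.prob_space_axioms fJ finite_W[of k]]) auto
    hence "0 < pm m (trunc k) (snd (\<psi> i e))" using 1 by (simp add: J_def)
    thus ?thesis using 1 by (simp add: \<kappa>_def split_beta)
  qed
  have fst_in: "fst e \<in> ?I" if "e \<in> ?I \<times> ?V" for e using that by (rule mem_Sigma_iff[THEN iffD1, THEN conjunct1, of "fst e" "snd e", unfolded prod.collapse])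
  have "m.Hn \<xi> n = - (\<Sum>a\<in>?I. pm m (\<lambda>x. fst (K x)) a * ln (pm m (\<lambda>x. fst (K x)) a))"
    by (simp add: m.Hn_def[OF \<xi>] K_def)
  also have "\<dots> \<le> - (\<Sum>e\<in>?I \<times> ?V. pm m K e * ln (\<pi> e))"
  proof (rule entropy_le[OF m.prob_space_axioms fK fI fst_in])
    show "0 \<le> \<pi> e" if "e \<in> ?I \<times> ?V" for e
      unfolding \<pi>_def using that \<omega>(1)[of "snd e"] \<kappa>0 by (intro mult_nonneg_nonneg prod_nonneg) (auto intro: less_imp_le)
    show "0 < \<pi> e" if "e \<in> ?I \<times> ?V" "0 < pm m K e" for e
      unfolding \<pi>_def using that \<omega>(1)[of "snd e"] pos[of e] by (intro mult_pos_pos prod_pos) auto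
    have "(\<Sum>e\<in>?I \<times> ?V. \<pi> e) = (\<Sum>w\<in>?V. \<Sum>a\<in>?I. \<pi> (a, w))"
      by (subst sum.swap) (simp add: sum.cartesian_product)
    also have "\<dots> = (\<Sum>w\<in>?V. \<omega> w * (\<Sum>a\<in>?I. \<Prod>i<n. \<kappa> (a i, trunc k ((shift ^^ i) w))))"
      by (simp add: \<pi>_def \<psi>_def sum_distrib_left)
    also have "\<dots> = (\<Sum>w\<in>?V. \<omega> w * (\<Prod>i<n. \<Sum>A\<in>\<xi>. \<kappa> (A, trunc k ((shift ^^ i) w))))"
      using finx by (subst prod_sum_PiE) auto
    also have "\<dots> \<le> (\<Sum>w\<in>?V. \<omega> w * 1)"
      using sum\<kappa> \<kappa>0 \<omega>(1) by (intro sum_mono mult_left_mono prod_le_1) (auto intro: less_imp_le sum_nonneg)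
    also have "\<dots> \<le> 1" using \<omega>(2) by simp
    finally show "(\<Sum>e\<in>?I \<times> ?V. \<pi> e) \<le> 1" .
  qed
  also have "(\<Sum>e\<in>?I \<times> ?V. pm m K e * ln (\<pi> e)) =
      (\<Sum>e\<in>?I \<times> ?V. pm m K e * ln (\<omega> (snd e)) + (\<Sum>i<n. pm m K e * ln (\<kappa> (\<psi> i e))))"
  proof (rule sum.cong[OF refl])
    fix e assume e: "e \<in> ?I \<times> ?V"
    show "pm m K e * ln (\<pi> e) = pm m K e * ln (\<omega> (snd e)) + (\<Sum>i<n. pm m K e * ln (\<kappa> (\<psi> i e)))"
    proof (cases "pm m K e = 0")
      case False
      hence P: "0 < pm m K e" using pm_nonneg[of m K e] by simp
      have "ln (\<pi> e) = ln (\<omega> (snd e)) + ln (\<Prod>i<n. \<kappa> (\<psi> i e))"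
        unfolding \<pi>_def using e \<omega>(1)[of "snd e"] pos[OF P _ e] by (intro ln_mult_pos prod_pos) auto
      also have "ln (\<Prod>i<n. \<kappa> (\<psi> i e)) = (\<Sum>i<n. ln (\<kappa> (\<psi> i e)))"
        by (rule ln_prod) (use pos[OF P _ e] in \<open>force+\<close>)
      finally show ?thesis by (simp add: distrib_left sum_distrib_left)
    qed simp
  qed
  also have "\<dots> = (\<Sum>e\<in>?I \<times> ?V. pm m K e * ln (\<omega> (snd e))) + (\<Sum>i<n. \<Sum>e\<in>?I \<times> ?V. pm m K e * ln (\<kappa> (\<psi> i e)))"
    by (simp only: sum.distrib sum.swap[of _ "{..<n}"])
  also have "(\<Sum>e\<in>?I \<times> ?V. pm m K e * ln (\<omega> (snd e))) = (\<Sum>w\<in>?V. pm m (trunc (n + k)) w * ln (\<omega> w))"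
    using fin_push[where \<psi>=snd and F="\<lambda>w. ln (\<omega> w)" and D="?V", OF m.prob_space_axioms fK finite_W] by (simp add: K_def mem_Times_iff)
  also have "(\<Sum>i<n. \<Sum>e\<in>?I \<times> ?V. pm m K e * ln (\<kappa> (\<psi> i e))) = (\<Sum>i<n. - Hc \<xi> k)"
  proof (rule sum.cong[OF refl])
    fix i assume "i \<in> {..<n}"
    hence i: "i < n" by simp
    have "(\<Sum>e\<in>?I \<times> ?V. pm m K e * ln (\<kappa> (\<psi> i e))) = (\<Sum>d\<in>\<xi> \<times> W k. pm m (\<lambda>x. \<psi> i (K x)) d * ln (\<kappa> d))"
      by (rule fin_push[OF m.prob_space_axioms fK finJ \<psi>in[OF i]])
    also have "\<dots> = (\<Sum>(A, w)\<in>\<xi> \<times> W k. measure m (A \<inter> cyl k w) * ln (measure m (A \<inter> cyl k w) / measure m (cyl k w)))"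
      unfolding pJ_shift[OF i] by (intro sum.cong) (auto simp: \<kappa>_def pJ pm_trunc)
    finally show "(\<Sum>e\<in>?I \<times> ?V. pm m K e * ln (\<kappa> (\<psi> i e))) = - Hc \<xi> k" by (simp add: Hc_def)
  qed
  finally show ?thesis by simp
qed

text \<open>With \<omega> in \<open>entropy_upper\<close> proportional to the exponential of the
  Birkhoff sum, entropy plus integral over n steps is at most the logarithm of the partition
  function, up to bounded terms and n \<open>Hc\<close>. Growth is assumed along multiples of r
  only, because for the perturbed potentials in \<open>equilibrium_cyl\<close> it comes from
  iterating a block of fixed length.\<close>

lemma variational_inequality:
  assumes dep: "\<And>x y. x \<in> X \<Longrightarrow> y \<in> X \<Longrightarrow> trunc l x = trunc l y \<Longrightarrow> \<Phi> x = \<Phi> y"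
    and b: "\<And>x. x \<in> X \<Longrightarrow> \<bar>\<Phi> x\<bar> \<le> b" and r: "r \<ge> 1" and C: "C > 0"
    and Z: "\<And>j. (tr \<Phi> ^^ (r * j)) (\<lambda>_. 1) zero \<le> C * exp (Q * real (r * j))"
  shows "integrable m \<Phi>" "metric_entropy m shift + ereal (\<integral>x. \<Phi> x \<partial>m) \<le> ereal Q"
proof -
  have "\<Phi> x = \<Phi> (trunc l x)" if "x \<in> X" for x
    using that trunc_in_W W_X by (intro dep) (auto simp: trunc_trunc)
  thus int: "integrable m \<Phi>"
    using fin_integral(1)[OF m.prob_space_axioms fin_trunc[of l], where F=\<Phi>] m_space
    by (subst Bochner_Integration.integrable_cong[of m m \<Phi> "\<lambda>x. \<Phi> (trunc l x)"]) auto
  define I where "I = (\<integral>x. \<Phi> x \<partial>m)"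
  have meas: "\<Phi> \<in> borel_measurable m" using int by simp
  have intn: "integrable m (\<lambda>x. \<Phi> ((shift ^^ i) x))" for i
    using integrable_distr[OF m.T_pow_meas[of i], of \<Phi>] int m.distr_T_pow[of i] by simp
  have birkI: "(\<integral>x. birk \<Phi> n x \<partial>m) = real n * I" "integrable m (birk \<Phi> n)" for n
    unfolding birk_def[abs_def] using intn m.integral_T_pow[OF meas] by (auto simp: I_def)
  have le: "m.h\<xi> \<xi> \<le> Q - I" if \<xi>: "\<xi> \<in> finite_partitions m" for \<xi>
  proof (rule field_le_epsilon)
    fix e :: real assume e: "e > 0"
    obtain k where k: "Hc \<xi> k \<le> e / 2" using Hc_small[OF \<xi>, of "e/2"] e by auto
    \<comment> \<open>The terms that do not grow with n; the last one compensates for the entropy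
      rate being multiplied by n and not by n + k.\<close>
    define R where "R = ln C + 2 * b * real l + real k * (m.h\<xi> \<xi> - e / 2)"
    show "m.h\<xi> \<xi> \<le> Q - I + e"
    proof (rule ccontr)
      assume "\<not> ?thesis"
      hence big: "m.h\<xi> \<xi> - e / 2 - (Q - I) > e / 2" by simp
      obtain j :: nat where j: "real j > 2 * \<bar>R\<bar> / e + real k" using reals_Archimedean2 by blast
      have jN: "real j \<le> real (r * j)" using r by (simp add: mult_le_cancel_right1)
      define n where "n = r * j - k"
      have "real k \<le> real j" using j e by (smt (verit) divide_nonneg_pos)
      hence nk: "r * j = n + k" unfolding n_def using jN by linarith
      let ?Z = "(tr \<Phi> ^^ (n + k)) (\<lambda>_. 1) zero"
      have Zs: "?Z = (\<Sum>w\<in>W (n + k). exp (birk \<Phi> (n + k) w))" using tr_pow_zero[of "n + k" \<Phi> "\<lambda>_. 1"] by simp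
      have "zero \<in> W (n + k)" using zero_in_X by (simp add: W_def)
      hence Zpos: "?Z > 0" unfolding Zs using finite_W by (intro sum_pos) auto
      have "m.Hn \<xi> n \<le> - (\<Sum>w\<in>W (n + k). pm m (trunc (n + k)) w * ln (exp (birk \<Phi> (n + k) w) / ?Z)) + real n * Hc \<xi> k"
        by (rule entropy_upper[OF \<xi>]) (use Zpos in \<open>auto simp: Zs sum_divide_distrib[symmetric]\<close>)
      also have "(\<Sum>w\<in>W (n + k). pm m (trunc (n + k)) w * ln (exp (birk \<Phi> (n + k) w) / ?Z)) =
          (\<integral>x. birk \<Phi> (n + k) (trunc (n + k) x) - ln ?Z \<partial>m)"
        unfolding fin_integral(2)[OF m.prob_space_axioms fin_trunc[of "n + k"], where F="\<lambda>w. birk \<Phi> (n + k) w - ln ?Z"]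
        using Zpos by (simp add: ln_div)
      finally have Hle: "m.Hn \<xi> n \<le> - (\<integral>x. birk \<Phi> (n + k) (trunc (n + k) x) - ln ?Z \<partial>m) + real n * Hc \<xi> k" .
      have "(\<integral>x. birk \<Phi> (n + k) x - 2 * b * real l - ln ?Z \<partial>m) \<le>
          (\<integral>x. birk \<Phi> (n + k) (trunc (n + k) x) - ln ?Z \<partial>m)"
      proof (rule integral_mono)
        show "integrable m (\<lambda>x. birk \<Phi> (n + k) x - 2 * b * real l - ln ?Z)" using birkI by auto
        show "integrable m (\<lambda>x. birk \<Phi> (n + k) (trunc (n + k) x) - ln ?Z)"
          by (rule fin_integral(1)[OF m.prob_space_axioms fin_trunc])
        fix x assume "x \<in> space m"
        hence "\<bar>birk \<Phi> (n + k) x - birk \<Phi> (n + k) (trunc (n + k) x)\<bar> \<le> 2 * b * real l"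
          using m_space by (intro birk_trunc dep b) auto
        thus "birk \<Phi> (n + k) x - 2 * b * real l - ln ?Z \<le> birk \<Phi> (n + k) (trunc (n + k) x) - ln ?Z" by linarith
      qed
      hence "m.Hn \<xi> n \<le> - (\<integral>x. birk \<Phi> (n + k) x - 2 * b * real l - ln ?Z \<partial>m) + real n * Hc \<xi> k"
        using Hle by linarith
      also have "(\<integral>x. birk \<Phi> (n + k) x - 2 * b * real l - ln ?Z \<partial>m) = real (n + k) * I - 2 * b * real l - ln ?Z"
        using birkI m.prob_space by (simp add: Bochner_Integration.integral_diff)
      finally have 1: "m.Hn \<xi> n \<le> ln ?Z + 2 * b * real l - real (n + k) * I + real n * Hc \<xi> k" by simp
      have "ln ?Z \<le> ln (C * exp (Q * real (n + k)))" using Z[of j] Zpos unfolding nk by (subst ln_le_cancel_iff) auto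
      also have "\<dots> = ln C + Q * real (n + k)" using C by (simp add: ln_mult)
      finally have 2: "ln ?Z \<le> ln C + Q * real (n + k)" .
      have 3: "real n * Hc \<xi> k \<le> real n * (e / 2)" using k by (intro mult_left_mono) auto
      have "real n * m.h\<xi> \<xi> \<le> m.Hn \<xi> n" by (rule m.h\<xi>_le[OF \<xi>])
      hence "real n * m.h\<xi> \<xi> \<le> ln C + Q * real (n + k) + 2 * b * real l - real (n + k) * I + real n * (e / 2)"
        using 1 2 3 by linarith
      hence "real (n + k) * (m.h\<xi> \<xi> - e / 2 - (Q - I)) \<le> R"
        by (simp add: R_def algebra_simps add_divide_distrib)
      moreover have "real (n + k) * (e / 2) \<le> real (n + k) * (m.h\<xi> \<xi> - e / 2 - (Q - I))"
        using big by (intro mult_left_mono) auto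
      moreover have "\<bar>R\<bar> < real j * (e / 2)" using j e by (simp add: field_simps) (smt (verit) mult_nonneg_nonneg of_nat_0_le_iff)
      moreover have "real j * (e / 2) \<le> real (n + k) * (e / 2)" using jN nk e by (intro mult_right_mono) auto
      ultimately show False by linarith
    qed
  qed
  have "metric_entropy m shift \<le> ereal (Q - I)"
    unfolding metric_entropy_def using le by (intro SUP_least) (simp add: m.h\<xi>_def)
  hence "metric_entropy m shift + ereal I \<le> ereal (Q - I) + ereal I" by (rule add_right_mono)
  thus "metric_entropy m shift + ereal (\<integral>x. \<Phi> x \<partial>m) \<le> ereal Q" by (simp add: I_def)
qed

end

section \<open>Pressure\<close>

text \<open>The upper bound is \<open>N_one_bound\<close>. The lower one compares 1 with h /
  \<open>Ch t\<close>, which is at most 1 and fixed by the normalised operator.\<close>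

lemma Zn_bounds:
  "\<exists>C>0. \<forall>n. lam t ^ n / Ch t \<le> (L t ^^ n) (\<lambda>_. 1) zero \<and> (L t ^^ n) (\<lambda>_. 1) zero \<le> C * lam t ^ n"
proof -
  obtain C where C: "C > 0" "\<forall>x\<in>X. \<forall>n. N t n (\<lambda>_. 1) x \<le> C" using N_one_bound by blast
  have eq: "(L t ^^ n) (\<lambda>_. 1) zero = lam t ^ n * N t n (\<lambda>_. 1) zero" for n
    using zt[of t] by (simp add: N_def lam_def power_divide)
  have "1 / Ch t \<le> N t n (\<lambda>_. 1) zero" for n
  proof -
    have "1 / Ch t \<le> h t zero / Ch t" using h_ge1[OF zero_in_X, of t] Ch_ge1[of t] by (intro divide_right_mono) auto
    also have "\<dots> = N t n (\<lambda>x. (1 / Ch t) * h t x) zero" unfolding N_cmult N_h[OF zero_in_X] by simp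
    also have "\<dots> \<le> N t n (\<lambda>_. 1) zero"
      using N_abs_le[of "\<lambda>x. (1 / Ch t) * h t x" "\<lambda>_. 1" zero t n] h_le[of t] h_nonneg[of t] Ch_ge1[of t] zero_in_X
      by (auto simp: divide_le_eq)
    finally show ?thesis .
  qed
  hence "lam t ^ n * (1 / Ch t) \<le> lam t ^ n * N t n (\<lambda>_. 1) zero" for n
    using lam_gt1[of t] by (intro mult_left_mono) auto
  moreover have "lam t ^ n * N t n (\<lambda>_. 1) zero \<le> lam t ^ n * C" for n
    using C zero_in_X lam_gt1[of t] by (intro mult_left_mono) auto
  ultimately show ?thesis using C(1) unfolding eq by (intro exI[of _ C]) (auto simp: mult.commute)
qed

lemma lam_pow: "lam t ^ n = exp (Pr t * real n)"
  by (simp add: exp_Pr[symmetric] exp_of_nat_mult[symmetric] mult.commute)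

lemma pressure_sum:
  "(\<Sum>A\<in>cylinders \<beta> n. exp (SUP x\<in>A. \<Sum>i<n. t * chi \<beta> ((shift ^^ i) x))) = (L t ^^ n) (\<lambda>_. 1) zero"
proof -
  have cyl_eq: "{x \<in> X. \<forall>i<n. x i = w i} = cyl n (trunc n w)" for w
    by (auto simp: cyl_def trunc_def fun_eq_iff)
  have cylW: "cylinders \<beta> n = cyl n ` W n"
  proof
    show "cylinders \<beta> n \<subseteq> cyl n ` W n"
      unfolding cylinders_def cyl_eq using trunc_in_W by auto
    show "cyl n ` W n \<subseteq> cylinders \<beta> n"
    proof
      fix A assume "A \<in> cyl n ` W n"
      then obtain w where w: "w \<in> W n" "A = cyl n w" by blast
      have "A = {x \<in> X. \<forall>i<n. x i = w i}" unfolding cyl_eq w(2) trunc_W[OF w(1)] ..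
      thus "A \<in> cylinders \<beta> n" unfolding cylinders_def using W_X[OF w(1)] by blast
    qed
  qed
  have self: "w \<in> cyl n w" if "w \<in> W n" for w using that trunc_W W_X by (auto simp: cyl_def)
  have inj: "inj_on (cyl n) (W n)"
  proof (rule inj_onI)
    fix w w' assume "w \<in> W n" "w' \<in> W n" "cyl n w = cyl n w'"
    thus "w = w'" using self[of w] trunc_W[of w n] by (auto simp: cyl_def)
  qed
  \<comment> \<open>The potential depends on one digit, so the Birkhoff sum is constant on an
    n-cylinder and the supremum is that constant.\<close>
  have sup: "(SUP x\<in>cyl n w. \<Sum>i<n. t * chi \<beta> ((shift ^^ i) x)) = t * S n w" if w: "w \<in> W n" for w
  proof -
    have "(\<Sum>i<n. t * chi \<beta> ((shift ^^ i) x)) = t * S n w" if "x \<in> cyl n w" for x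
    proof -
      have x: "x \<in> X" "trunc n x = w" using that by (auto simp: cyl_def)
      have "x i = w i" if "i < n" for i using x(2) that by (auto simp: trunc_def)
      hence "S n x = S n w" by (simp add: S_def)
      thus ?thesis using birk_chit[OF x(1), of t n] by (simp add: birk_def chit_def)
    qed
    hence "(\<lambda>x. \<Sum>i<n. t * chi \<beta> ((shift ^^ i) x)) ` cyl n w = {t * S n w}" using self[OF w] by force
    thus ?thesis by simp
  qed
  show ?thesis
    unfolding cylW sum.reindex[OF inj] o_def tr_pow_zero
    using birk_chit[OF W_X] by (intro sum.cong) (auto simp: sup)
qed

lemma pressure_Pr: "pressure_fun \<beta> t = Pr t"
proof -
  let ?Z = "\<lambda>n. (L t ^^ n) (\<lambda>_. 1) zero"
  obtain C where C: "C > 0" "\<And>n. lam t ^ n / Ch t \<le> ?Z n" "\<And>n. ?Z n \<le> C * lam t ^ n"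
    using Zn_bounds[of t] by blast
  have lp: "0 < lam t ^ n" for n using lam_gt1[of t] by simp
  have Chp: "Ch t > 0" using Ch_ge1[of t] by simp
  have "(\<lambda>n. ln (?Z n) / real n) \<longlonglongrightarrow> Pr t"
  proof (rule tendsto_sandwich)
    show "\<forall>\<^sub>F n in sequentially. Pr t - ln (Ch t) / real n \<le> ln (?Z n) / real n"
      using eventually_gt_at_top[of 0]
    proof eventually_elim
      case (elim n)
      have "ln (lam t ^ n / Ch t) \<le> ln (?Z n)" using C(2)[of n] lp[of n] Chp by (intro ln_mono) auto
      moreover have "ln (lam t ^ n / Ch t) = Pr t * real n - ln (Ch t)" using Chp by (simp add: ln_div lam_pow)
      ultimately have "(Pr t * real n - ln (Ch t)) / real n \<le> ln (?Z n) / real n" by (intro divide_right_mono) auto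
      thus ?case using elim by (simp add: diff_divide_distrib)
    qed
    show "\<forall>\<^sub>F n in sequentially. ln (?Z n) / real n \<le> Pr t + ln C / real n"
      using eventually_gt_at_top[of 0]
    proof eventually_elim
      case (elim n)
      have "0 < ?Z n" using C(2)[of n] lp[of n] Chp by (smt (verit) divide_pos_pos)
      hence "ln (?Z n) \<le> ln (C * lam t ^ n)" using C(3)[of n] by (intro ln_mono) auto
      also have "\<dots> = Pr t * real n + ln C" using C(1) by (simp add: ln_mult lam_pow)
      finally have "ln (?Z n) / real n \<le> (Pr t * real n + ln C) / real n" by (intro divide_right_mono) auto
      thus ?case using elim by (simp add: add_divide_distrib)
    qed
    have z: "(\<lambda>n. a / real n) \<longlonglongrightarrow> 0" for a by (rule lim_const_over_n)
    show "(\<lambda>n. Pr t - ln (Ch t) / real n) \<longlonglongrightarrow> Pr t" using tendsto_diff[OF tendsto_const z, of "Pr t" "ln (Ch t)"] by simp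
    show "(\<lambda>n. Pr t + ln C / real n) \<longlonglongrightarrow> Pr t" using tendsto_add[OF tendsto_const z, of "Pr t" "ln C"] by simp
  qed
  thus ?thesis unfolding pressure_fun_def pressure_def pressure_sum by (rule limI)
qed

section \<open>Uniqueness of equilibrium states\<close>

lemma tr_mult_shift: "g x * tr \<Phi> f x = tr \<Phi> (\<lambda>y. g (shift y) * f y) x"
  unfolding tr_def sum_distrib_left by (intro sum.cong) auto

text \<open>All j-th preimages of x have x as their j-th shift, so a factor depending on x can be
  moved inside the iterate.\<close>

lemma tr_pow_mult_shift: "g x * (tr \<Phi> ^^ j) f x = (tr \<Phi> ^^ j) (\<lambda>y. g ((shift ^^ j) y) * f y) x"
proof (induction j arbitrary: f)
  case (Suc j)
  have "g x * (tr \<Phi> ^^ Suc j) f x = (tr \<Phi> ^^ j) (\<lambda>y. g ((shift ^^ j) y) * tr \<Phi> f y) x"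
    using Suc[of "tr \<Phi> f"] by (simp add: funpow_swap1)
  also have "(\<lambda>y. g ((shift ^^ j) y) * tr \<Phi> f y) = tr \<Phi> (\<lambda>y. g ((shift ^^ Suc j) y) * f y)"
    using tr_mult_shift[of "\<lambda>y. g ((shift ^^ j) y)" _ \<Phi> f] by (auto simp: funpow_swap1)
  finally show ?case by (simp add: funpow_swap1)
qed simp

lemma tr_add_potential: "(tr (\<lambda>x. \<Phi> x + \<Psi> x) ^^ n) f x = (tr \<Phi> ^^ n) (\<lambda>y. exp (birk \<Psi> n y) * f y) x"
proof (induction n arbitrary: f)
  case (Suc n)
  have 1: "tr (\<lambda>x. \<Phi> x + \<Psi> x) f = tr \<Phi> (\<lambda>y. exp (\<Psi> y) * f y)"
    unfolding tr_def by (simp add: exp_add algebra_simps)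
  have "(tr (\<lambda>x. \<Phi> x + \<Psi> x) ^^ Suc n) f x = (tr (\<lambda>x. \<Phi> x + \<Psi> x) ^^ n) (tr (\<lambda>x. \<Phi> x + \<Psi> x) f) x"
    by (simp add: funpow_swap1)
  also have "\<dots> = (tr \<Phi> ^^ n) (\<lambda>y. exp (birk \<Psi> n y) * tr \<Phi> (\<lambda>y. exp (\<Psi> y) * f y) y) x"
    unfolding Suc.IH 1 ..
  also have "(\<lambda>y. exp (birk \<Psi> n y) * tr \<Phi> (\<lambda>y. exp (\<Psi> y) * f y) y) = tr \<Phi> (\<lambda>y. exp (birk \<Psi> (Suc n) y) * f y)"
    unfolding tr_mult_shift[of "\<lambda>y. exp (birk \<Psi> n y)"]
    by (simp add: birk_Suc_shift exp_add mult.assoc mult.left_commute)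
  finally show ?case by (simp add: funpow_swap1)
qed (simp add: birk_def)

lemma exp_le_quadratic: "\<bar>y\<bar> \<le> 1 \<Longrightarrow> exp y \<le> 1 + y + (y::real)\<^sup>2"
proof (cases "0 \<le> y")
  case False
  define a where "a = - y"
  have a: "a > 0" using False by (simp add: a_def)
  have "1 + a \<le> exp a" by (rule exp_ge_add_one_self)
  hence "exp y \<le> 1 / (1 + a)" using a by (simp add: a_def exp_minus field_simps)
  also have "\<dots> \<le> 1 - a + a\<^sup>2"
  proof -
    have "(1 - a + a\<^sup>2) * (1 + a) = 1 + a ^ 3" by (simp add: algebra_simps power2_eq_square power3_eq_cube)
    hence "1 \<le> (1 - a + a\<^sup>2) * (1 + a)" using a by simp
    thus ?thesis using a by (simp add: divide_le_eq)
  qed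
  finally show ?thesis by (simp add: a_def)
qed (use exp_bound in auto)

text \<open>By the pull-out rule and the invariance of h, the j-th summand of the Birkhoff sum
  contributes the (k - j)-th normalised iterate of \<psi> h. These tend to \<kappa> h, hence so do
  their averages.\<close>

lemma birk_average:
  assumes \<kappa>: "asym t (\<lambda>x. \<psi> x * h t x) \<kappa>" and \<psi>: "\<And>x. x \<in> X \<Longrightarrow> 0 \<le> \<psi> x \<and> \<psi> x \<le> 1" and e: "e > 0"
  shows "\<exists>k\<ge>1. \<forall>x\<in>X. \<bar>N t k (\<lambda>y. birk \<psi> k y * h t y) x - real k * \<kappa> * h t x\<bar> \<le> real k * e"
proof -
  let ?f = "\<lambda>x. \<psi> x * h t x"
  from \<kappa>[unfolded asym_def uniform_limit_iff, rule_format, of "e/2"] e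
  obtain M where M: "\<And>n x. n \<ge> M \<Longrightarrow> x \<in> X \<Longrightarrow> dist (N t n ?f x) (\<kappa> * h t x) < e/2"
    unfolding eventually_sequentially by auto
  define B where "B = (1 + \<bar>\<kappa>\<bar>) * Ch t"
  have B0: "B \<ge> 0" using Ch_ge1[of t] by (simp add: B_def)
  have bnd: "\<bar>N t n ?f x - \<kappa> * h t x\<bar> \<le> B" if "x \<in> X" for n x
  proof -
    have fb: "\<bar>?f y\<bar> \<le> h t y" if "y \<in> X" for y
      using \<psi>[OF that] h_nonneg[of t y] by (simp add: abs_mult mult_left_le_one_le)
    have "\<bar>N t n ?f x\<bar> \<le> N t n (h t) x" by (rule N_abs_le[OF fb \<open>x \<in> X\<close>])
    hence "\<bar>N t n ?f x\<bar> \<le> h t x" using N_h[OF \<open>x \<in> X\<close>] by simp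
    moreover have "\<bar>\<kappa> * h t x\<bar> = \<bar>\<kappa>\<bar> * h t x" using h_nonneg[of t x] by (simp add: abs_mult)
    ultimately have "\<bar>N t n ?f x - \<kappa> * h t x\<bar> \<le> (1 + \<bar>\<kappa>\<bar>) * h t x"
      using abs_triangle_ineq4[of "N t n ?f x" "\<kappa> * h t x"] by (simp add: distrib_right)
    also have "\<dots> \<le> B" unfolding B_def using h_le[of t x] by (intro mult_left_mono) auto
    finally show ?thesis .
  qed
  obtain k :: nat where k: "real k > max 1 (2 * (real M * B) / e)" using reals_Archimedean2 by blast
  have "\<bar>N t k (\<lambda>y. birk \<psi> k y * h t y) x - real k * \<kappa> * h t x\<bar> \<le> real k * e" if x: "x \<in> X" for x
  proof -
    have shift: "N t k (\<lambda>y. \<psi> ((shift ^^ j) y) * h t y) x = N t (k - j) ?f x" if "j < k" for j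
    proof -
      have "N t k (\<lambda>y. \<psi> ((shift ^^ j) y) * h t y) x = N t (k - j) (N t j (\<lambda>y. \<psi> ((shift ^^ j) y) * h t y)) x"
        using that by (simp add: N_compose)
      also have "\<dots> = N t (k - j) ?f x"
      proof (rule N_cong[OF _ x])
        fix y assume y: "y \<in> X"
        have "N t j (\<lambda>y. \<psi> ((shift ^^ j) y) * h t y) y = \<psi> y * N t j (h t) y"
          unfolding N_def tr_pow_mult_shift[symmetric] by simp
        thus "N t j (\<lambda>y. \<psi> ((shift ^^ j) y) * h t y) y = ?f y" using N_h[OF y] by simp
      qed
      finally show ?thesis .
    qed
    have "N t k (\<lambda>y. birk \<psi> k y * h t y) x = N t k (\<lambda>y. \<Sum>j<k. \<psi> ((shift ^^ j) y) * h t y) x"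
      by (simp add: birk_def sum_distrib_right)
    also have "\<dots> = (\<Sum>j<k. N t (k - j) ?f x)" unfolding N_sum using shift by (intro sum.cong) auto
    finally have "N t k (\<lambda>y. birk \<psi> k y * h t y) x - real k * \<kappa> * h t x = (\<Sum>j<k. N t (k - j) ?f x - \<kappa> * h t x)"
      by (simp add: sum_subtractf)
    also have "\<bar>\<dots>\<bar> \<le> (\<Sum>j<k. \<bar>N t (k - j) ?f x - \<kappa> * h t x\<bar>)" by (rule sum_abs)
    also have "\<dots> \<le> (\<Sum>j<k. e / 2 + (if k - j < M then B else 0))"
    proof (rule sum_mono)
      fix j
      show "\<bar>N t (k - j) ?f x - \<kappa> * h t x\<bar> \<le> e / 2 + (if k - j < M then B else 0)"
        using M[of "k - j" x] bnd[OF x, of "k - j"] x e by (auto simp: dist_real_def intro: less_imp_le)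
    qed
    also have "\<dots> = real k * (e / 2) + real (card {j \<in> {..<k}. k - j < M}) * B"
      by (simp add: sum.distrib sum.If_cases Int_def)
    also have "card {j \<in> {..<k}. k - j < M} \<le> card {k - M..<k}" by (rule card_mono) auto
    hence "real (card {j \<in> {..<k}. k - j < M}) * B \<le> real M * B" using B0 by (intro mult_right_mono) auto
    also have "real M * B \<le> real k * (e / 2)"
      using k e by (simp add: field_simps)
    finally show ?thesis by (simp add: algebra_simps)
  qed
  thus ?thesis using k by (intro exI[of _ k]) auto
qed

lemma invariant_upper:
  assumes m: "m \<in> invariant_measures \<beta>"
  shows "integrable m (chit t)" "metric_entropy m shift + ereal (\<integral>x. chit t x \<partial>m) \<le> ereal (Pr t)"
proof -
  obtain C where C: "C > 0" "\<And>n. (L t ^^ n) (\<lambda>_. 1) zero \<le> C * lam t ^ n" using Zn_bounds[of t] by blast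
  have dep: "chit t x = chit t y" if "x \<in> X" "y \<in> X" "trunc 1 x = trunc 1 y" for x y
  proof -
    have "trunc 1 x 0 = trunc 1 y 0" using that(3) by simp
    thus ?thesis using that by (simp add: chit_def chi_eq trunc_def)
  qed
  have b: "\<bar>chit t x\<bar> \<le> \<bar>t\<bar>" if "x \<in> X" for x
    using X_le1[OF that, of 0] by (simp add: chit_def chi_eq[OF that] abs_mult mult_left_le)
  have Z: "(L t ^^ (1 * j)) (\<lambda>_. 1) zero \<le> C * exp (Pr t * real (1 * j))" for j
    using C(2)[of j] by (simp add: lam_pow)
  show "integrable m (chit t)" "metric_entropy m shift + ereal (\<integral>x. chit t x \<partial>m) \<le> ereal (Pr t)"
    using variational_inequality[OF m dep b order_refl C(1) Z] by auto
qed

text \<open>Differentiability of the pressure in the direction of a cylinder. Adding s times its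
  indicator raises the growth rate by at most s \<kappa> + |s| e + s^2 k, by expanding the
  exponential over blocks of length k. The variational inequality then bounds s times the measure by
  the same amount, for both signs of s. As \<kappa> does not involve the measure, equilibrium states
  agree on cylinders.\<close>

lemma equilibrium_cyl:
  assumes m: "m \<in> invariant_measures \<beta>"
    and eq: "metric_entropy m shift + ereal (\<integral>x. chit t x \<partial>m) = ereal (Pr t)"
    and w: "w \<in> W l" and \<kappa>: "asym t (\<lambda>x. indicator (cyl l w) x * h t x) \<kappa>"
  shows "measure m (cyl l w) = \<kappa>"
proof -
  interpret m: mpt m shift using invariant_mpt[OF m] by blast
  let ?\<psi> = "indicator (cyl l w) :: digits \<Rightarrow> real"
  have main: "s * (measure m (cyl l w) - \<kappa>) \<le> \<bar>s\<bar> * e + s\<^sup>2 * real k"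
    if e: "e > 0" and k: "k \<ge> 1" "\<forall>x\<in>X. \<bar>N t k (\<lambda>y. birk ?\<psi> k y * h t y) x - real k * \<kappa> * h t x\<bar> \<le> real k * e"
      and s: "\<bar>s\<bar> * real k \<le> 1" for e k s
  proof -
    define \<Phi> where "\<Phi> x = chit t x + s * ?\<psi> x" for x
    \<comment> \<open>The growth over one block relative to the unperturbed one: first-order
      average, its error, and the quadratic remainder of the exponential.\<close>
    define \<rho> where "\<rho> = 1 + s * real k * \<kappa> + \<bar>s\<bar> * real k * e + s\<^sup>2 * (real k)\<^sup>2"
    have birk0: "0 \<le> birk ?\<psi> k y" "birk ?\<psi> k y \<le> real k" for y
      unfolding birk_def using sum_mono[of "{..<k}" "\<lambda>i. ?\<psi> ((shift ^^ i) y)" "\<lambda>_. 1"]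
      by (auto intro!: sum_nonneg simp: indicator_def)
    have step: "zt t ^ k * (tr \<Phi> ^^ k) (h t) x \<le> \<rho> * h t x" if x: "x \<in> X" for x
    proof -
      have "zt t ^ k * (tr \<Phi> ^^ k) (h t) x = N t k (\<lambda>y. exp (birk (\<lambda>x. s * ?\<psi> x) k y) * h t y) x"
        unfolding \<Phi>_def[abs_def] tr_add_potential N_def ..
      also have "\<dots> \<le> N t k (\<lambda>y. h t y + (s * (birk ?\<psi> k y * h t y) + (s\<^sup>2 * (real k)\<^sup>2) * h t y)) x"
      proof -
        have "exp (birk (\<lambda>x. s * ?\<psi> x) k y) * h t y \<le> h t y + (s * (birk ?\<psi> k y * h t y) + (s\<^sup>2 * (real k)\<^sup>2) * h t y)" for y
        proof -
          have b: "birk (\<lambda>x. s * ?\<psi> x) k y = s * birk ?\<psi> k y" by (simp add: birk_def sum_distrib_left)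
          have "\<bar>s * birk ?\<psi> k y\<bar> \<le> \<bar>s\<bar> * real k"
            unfolding abs_mult using birk0[of y] by (intro mult_left_mono) auto
          hence "exp (s * birk ?\<psi> k y) \<le> 1 + s * birk ?\<psi> k y + (s * birk ?\<psi> k y)\<^sup>2" using s by (intro exp_le_quadratic) linarith
          also have "(s * birk ?\<psi> k y)\<^sup>2 \<le> s\<^sup>2 * (real k)\<^sup>2"
            unfolding power_mult_distrib using birk0[of y] by (intro mult_left_mono power_mono) auto
          finally have "exp (s * birk ?\<psi> k y) * h t y \<le> (1 + s * birk ?\<psi> k y + s\<^sup>2 * (real k)\<^sup>2) * h t y"
            using h_nonneg[of t y] by (intro mult_right_mono) auto
          thus ?thesis unfolding b by (simp add: algebra_simps)
        qed
        thus ?thesis unfolding N_def using tr_pow_mono[of _ _ x k "chit t"] x zt[of t] by (intro mult_left_mono) auto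
      qed
      also have "\<dots> = h t x + (s * N t k (\<lambda>y. birk ?\<psi> k y * h t y) x + (s\<^sup>2 * (real k)\<^sup>2) * h t x)"
        unfolding N_add N_cmult N_h[OF x] ..
      also have "s * N t k (\<lambda>y. birk ?\<psi> k y * h t y) x \<le> s * (real k * \<kappa> * h t x) + \<bar>s\<bar> * (real k * e * h t x)"
      proof -
        let ?d = "N t k (\<lambda>y. birk ?\<psi> k y * h t y) x - real k * \<kappa> * h t x"
        have "s * ?d \<le> \<bar>s\<bar> * \<bar>?d\<bar>" by (simp add: abs_mult[symmetric])
        also have "\<dots> \<le> \<bar>s\<bar> * (real k * e * 1)" using k(2) x by (intro mult_left_mono) auto
        also have "\<dots> \<le> \<bar>s\<bar> * (real k * e * h t x)" using h_ge1[OF x, of t] e by (intro mult_left_mono) auto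
        finally show ?thesis by (simp add: right_diff_distrib)
      qed
      finally show ?thesis by (simp add: \<rho>_def algebra_simps)
    qed
    \<comment> \<open>The iterate at \<open>zero\<close> is a sum of positive terms, so its upper
      bound is positive even when s is negative.\<close>
    have \<rho>: "\<rho> > 0"
    proof -
      have "(tr \<Phi> ^^ k) (h t) zero = (\<Sum>w\<in>W k. exp (birk \<Phi> k w) * h t w)" by (rule tr_pow_zero)
      also have "\<dots> > 0"
      proof (rule sum_pos)
        show "W k \<noteq> {}" using trunc_in_W[OF zero_in_X] by blast
        show "0 < exp (birk \<Phi> k w) * h t w" if "w \<in> W k" for w using h_ge1[OF W_X[OF that], of t] by simp
      qed (rule finite_W)
      finally have "0 < zt t ^ k * (tr \<Phi> ^^ k) (h t) zero" using zt[of t] by simp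
      hence "0 < \<rho> * h t zero" using step[OF zero_in_X] by linarith
      thus ?thesis using h_ge1[OF zero_in_X, of t] by (simp add: zero_less_mult_iff)
    qed
    have iter: "(tr \<Phi> ^^ (k * j)) (h t) x \<le> (lam t ^ k * \<rho>) ^ j * h t x" if "x \<in> X" for x j
      using that
    proof (induction j arbitrary: x)
      case (Suc j)
      have "(tr \<Phi> ^^ (k * Suc j)) (h t) x = (tr \<Phi> ^^ k) ((tr \<Phi> ^^ (k * j)) (h t)) x"
        by (simp add: funpow_add)
      also have "\<dots> \<le> (tr \<Phi> ^^ k) (\<lambda>x. (lam t ^ k * \<rho>) ^ j * h t x) x" by (rule tr_pow_mono) (use Suc in auto)
      also have "\<dots> = (lam t ^ k * \<rho>) ^ j * (tr \<Phi> ^^ k) (h t) x" by (simp add: tr_pow_cmult)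
      also have "(tr \<Phi> ^^ k) (h t) x = lam t ^ k * (zt t ^ k * (tr \<Phi> ^^ k) (h t) x)"
        using zt[of t] by (simp add: lam_def power_divide)
      also have "(lam t ^ k * \<rho>) ^ j * (lam t ^ k * (zt t ^ k * (tr \<Phi> ^^ k) (h t) x)) \<le> (lam t ^ k * \<rho>) ^ j * (lam t ^ k * (\<rho> * h t x))"
        using step[OF Suc.prems] \<rho> lam_gt1[of t] by (intro mult_left_mono) auto
      finally show ?case by (simp add: algebra_simps)
    qed simp
    have Z: "(tr \<Phi> ^^ (k * j)) (\<lambda>_. 1) zero \<le> Ch t * exp ((Pr t + ln \<rho> / real k) * real (k * j))" for j
    proof -
      have "(tr \<Phi> ^^ (k * j)) (\<lambda>_. 1) zero \<le> (tr \<Phi> ^^ (k * j)) (h t) zero"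
        by (rule tr_pow_mono) (use h_ge1 zero_in_X in auto)
      also have "\<dots> \<le> (lam t ^ k * \<rho>) ^ j * h t zero" by (rule iter[OF zero_in_X])
      also have "\<dots> \<le> (lam t ^ k * \<rho>) ^ j * Ch t" using h_le \<rho> lam_gt1[of t] by (intro mult_left_mono) auto
      also have "lam t ^ k * \<rho> = exp (Pr t * real k + ln \<rho>)" using \<rho> by (simp add: lam_pow exp_add)
      also have "exp (Pr t * real k + ln \<rho>) ^ j = exp ((Pr t + ln \<rho> / real k) * real (k * j))"
        using k(1) by (simp add: exp_of_nat_mult[symmetric] field_simps)
      finally show ?thesis by (simp add: mult.commute)
    qed
    have dep: "\<Phi> x = \<Phi> y" if "x \<in> X" "y \<in> X" "trunc (Suc l) x = trunc (Suc l) y" for x y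
    proof -
      have "trunc (Suc l) x 0 = trunc (Suc l) y 0" using that(3) by simp
      hence "x 0 = y 0" by (simp add: trunc_def)
      moreover have "trunc l x = trunc l y" using that(3) by (metis trunc_trunc le_SucI order_refl)
      ultimately show ?thesis using that by (simp add: \<Phi>_def chit_def chi_eq indicator_def cyl_def)
    qed
    have b: "\<bar>\<Phi> x\<bar> \<le> \<bar>t\<bar> + \<bar>s\<bar>" if "x \<in> X" for x
    proof -
      have "\<bar>chit t x\<bar> \<le> \<bar>t\<bar>" using X_le1[OF that, of 0] by (simp add: chit_def chi_eq[OF that] abs_mult mult_left_le)
      moreover have "\<bar>s * ?\<psi> x\<bar> \<le> \<bar>s\<bar>" by (simp add: indicator_def)
      ultimately show ?thesis unfolding \<Phi>_def by linarith
    qed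
    have "0 < Ch t" using Ch_ge1[of t] by simp
    from variational_inequality[OF m dep b k(1) this Z]
    have V: "metric_entropy m shift + ereal (\<integral>x. \<Phi> x \<partial>m) \<le> ereal (Pr t + ln \<rho> / real k)" by blast
    have "cyl l w \<in> sets m" using cyl_sets invariant_mpt[OF m] by auto
    hence "integrable m (\<lambda>x. s * ?\<psi> x)" by (intro integrable_mult_right integrable_real_indicator) (auto simp: less_top[symmetric])
    hence "(\<integral>x. \<Phi> x \<partial>m) = (\<integral>x. chit t x \<partial>m) + s * measure m (cyl l w)"
      unfolding \<Phi>_def using invariant_upper(1)[OF m, of t] \<open>cyl l w \<in> sets m\<close> by simp
    hence "ereal (Pr t) + ereal (s * measure m (cyl l w)) \<le> ereal (Pr t + ln \<rho> / real k)"
      using V eq by (simp add: add.assoc[symmetric] flip: plus_ereal.simps(1))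
    hence "s * measure m (cyl l w) \<le> ln \<rho> / real k" by simp
    also have "\<dots> \<le> (\<rho> - 1) / real k" using \<rho> ln_le_minus_one[of \<rho>] by (intro divide_right_mono) auto
    also have "\<dots> = s * \<kappa> + \<bar>s\<bar> * e + s\<^sup>2 * real k"
      using k(1) by (simp add: \<rho>_def field_simps power2_eq_square)
    finally show ?thesis by (simp add: algebra_simps)
  qed
  have close: "\<bar>measure m (cyl l w) - \<kappa>\<bar> \<le> e" if e: "e > 0" for e
  proof -
    define D where "D = measure m (cyl l w) - \<kappa>"
    have "e / 2 > 0" using e by simp
    obtain k where k: "k \<ge> 1" "\<forall>x\<in>X. \<bar>N t k (\<lambda>y. birk ?\<psi> k y * h t y) x - real k * \<kappa> * h t x\<bar> \<le> real k * (e/2)"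
      using birk_average[OF \<kappa> _ \<open>e / 2 > 0\<close>] indicator_pos_le indicator_le_1 by blast
    \<comment> \<open>Small enough for the quadratic expansion, s k \<le> 1, and for the remainder s
      k to be at most half of e.\<close>
    define s where "s = min (1 / real k) (e / (2 * real k))"
    have s: "s > 0" "s * real k \<le> 1" "s * real k \<le> e/2" using k(1) e by (auto simp: s_def min_def field_simps)
    have "s * D \<le> \<bar>s\<bar> * (e/2) + s\<^sup>2 * real k"
      unfolding D_def by (rule main[OF \<open>e / 2 > 0\<close> k]) (use s in auto)
    also have "\<dots> = s * (e/2 + s * real k)" using s by (simp add: power2_eq_square algebra_simps)
    also have "\<dots> \<le> s * e" using s by (intro mult_left_mono) auto
    finally have 1: "D \<le> e" using s by simp
    have "(- s) * D \<le> \<bar>- s\<bar> * (e/2) + (- s)\<^sup>2 * real k"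
      unfolding D_def by (rule main[OF \<open>e / 2 > 0\<close> k]) (use s in auto)
    also have "\<dots> = s * (e/2 + s * real k)" using s by (simp add: power2_eq_square algebra_simps)
    also have "\<dots> \<le> s * e" using s by (intro mult_left_mono) auto
    finally have "s * (- D) \<le> s * e" by simp
    hence 2: "- D \<le> e" using s(1) by (simp only: mult_le_cancel_left_pos)
    show ?thesis using 1 2 by (simp add: D_def abs_le_iff)
  qed
  show ?thesis
  proof (rule ccontr)
    assume "\<not> ?thesis"
    thus False using close[of "\<bar>measure m (cyl l w) - \<kappa>\<bar> / 2"] by simp
  qed
qed

lemma equilibrium_unique:
  assumes m: "m \<in> invariant_measures \<beta>" "metric_entropy m shift + ereal (\<integral>x. chit t x \<partial>m) = ereal (Pr t)"
    and m': "m' \<in> invariant_measures \<beta>" "metric_entropy m' shift + ereal (\<integral>x. chit t x \<partial>m') = ereal (Pr t)"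
  shows "m = m'"
proof (rule measure_eqI_generator_eq[OF gen_Int_stable gen_sub, where A="\<lambda>_. X"])
  interpret m: mpt m shift using invariant_mpt[OF m(1)] by blast
  interpret m': mpt m' shift using invariant_mpt[OF m'(1)] by blast
  fix A assume "A \<in> gen"
  then consider "A = {}" | n w where "w \<in> W n" "A = cyl n w" unfolding gen_def by blast
  thus "emeasure m A = emeasure m' A"
  proof cases
    case 2
    obtain \<kappa> where \<kappa>: "asym t (\<lambda>x. indicator (cyl n w) x * h t x) \<kappa>" using asym_cyl_h[OF 2(1)] by blast
    have "measure m A = measure m' A"
      unfolding 2(2) using equilibrium_cyl[OF m 2(1) \<kappa>] equilibrium_cyl[OF m' 2(1) \<kappa>] by simp
    thus ?thesis by (simp add: m.emeasure_eq_measure m'.emeasure_eq_measure)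
  qed simp
next
  show "sets m = sigma_sets X gen" "sets m' = sigma_sets X gen"
    using invariant_mpt(3)[OF m(1)] invariant_mpt(3)[OF m'(1)] sets_XB by auto
  have "cyl 0 zero = X" by (auto simp: cyl_def trunc_def)
  moreover have "cyl 0 zero \<in> gen" unfolding gen_def using W_0 by blast
  ultimately show "range (\<lambda>_. X) \<subseteq> gen" by simp
  interpret m: mpt m shift using invariant_mpt[OF m(1)] by blast
  show "emeasure m X \<noteq> \<infinity>" by simp
qed auto

section \<open>Existence of equilibrium states\<close>

text \<open>The equilibrium state is the law of the digits of a generalised beta-transformation of the unit
  interval with slopes \<open>lam t\<close> and \<open>lam t * exp (- t)\<close>, under its invariant density.\<close>

definition val :: "real \<Rightarrow> digits \<Rightarrow> real" where
  "val t x = (\<Sum>n. real (x n) * exp (t * S n x) * zt t ^ Suc n)"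

lemma val_summable:
  assumes "x \<in> X" shows "summable (\<lambda>n. real (x n) * exp (t * S n x) * zt t ^ Suc n)"
    and "\<exists>B. \<forall>x\<in>X. val t x \<le> B"
proof -
  obtain \<theta> C where th: "0 < \<theta>" "\<theta> < 1" "0 < C"
    and dec: "\<And>x n. x \<in> X \<Longrightarrow> exp (t * S n x) * zt t ^ n \<le> C * \<theta> ^ n" using decay[of t] by metis
  have sg: "summable (\<lambda>n. C * \<theta> ^ n)" using th by (intro summable_mult summable_geometric) auto
  have le: "real (x n) * exp (t * S n x) * zt t ^ Suc n \<le> C * \<theta> ^ n" if "x \<in> X" for x n
  proof -
    have "real (x n) * exp (t * S n x) * zt t ^ Suc n = (real (x n) * zt t) * (exp (t * S n x) * zt t ^ n)" by simp
    also have "\<dots> \<le> 1 * (C * \<theta> ^ n)"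
    proof (rule mult_mono)
      show "real (x n) * zt t \<le> 1" using X_le1[OF that, of n] zt[of t] by (intro mult_le_one) auto
    qed (use dec[OF that, of n] zt[of t] in auto)
    finally show ?thesis by simp
  qed
  have s: "summable (\<lambda>n. real (x n) * exp (t * S n x) * zt t ^ Suc n)" if "x \<in> X" for x
    by (rule summable_comparison_test'[OF sg, of 0]) (use le[OF that] zt[of t] in auto)
  show "summable (\<lambda>n. real (x n) * exp (t * S n x) * zt t ^ Suc n)" by (rule s[OF assms])
  have "val t x \<le> (\<Sum>n. C * \<theta> ^ n)" if "x \<in> X" for x
    unfolding val_def by (rule suminf_le[OF le[OF that] s[OF that] sg])
  thus "\<exists>B. \<forall>x\<in>X. val t x \<le> B" by blast
qed

lemma val_nonneg: "x \<in> X \<Longrightarrow> 0 \<le> val t x"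
  unfolding val_def using zt[of t] by (intro suminf_nonneg val_summable) auto

lemma val_step:
  assumes "x \<in> X"
  shows "val t x = real (x 0) * zt t + exp (t * real (x 0)) * zt t * val t (shift x)"
proof -
  have S: "S (Suc n) x = real (x 0) + S n (shift x)" for n
    by (simp add: S_def sum.lessThan_Suc_shift shift_def del: sum.lessThan_Suc)
  let ?f = "\<lambda>n. real (x n) * exp (t * S n x) * zt t ^ Suc n"
  have "?f (Suc n) = (exp (t * real (x 0)) * zt t) * (real (shift x n) * exp (t * S n (shift x)) * zt t ^ Suc n)" for n
    by (simp add: S distrib_left exp_add shift_def)
  hence "(\<lambda>n. ?f (Suc n)) = (\<lambda>n. (exp (t * real (x 0)) * zt t) * (real (shift x n) * exp (t * S n (shift x)) * zt t ^ Suc n))"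
    by (rule ext)
  hence "(\<Sum>n. ?f (Suc n)) = (exp (t * real (x 0)) * zt t) * val t (shift x)"
    unfolding val_def by (simp only: suminf_mult[OF val_summable(1)[OF shift_in_X[OF assms], of t]])
  moreover have "val t x = ?f 0 + (\<Sum>n. ?f (Suc n))"
    unfolding val_def using suminf_split_head[OF val_summable(1)[OF assms, of t]] by simp
  ultimately show ?thesis by simp
qed

lemma val_q: "val t q = 1"
proof -
  have "(\<lambda>n. real (q n) * exp (t * S n q) * zt t ^ Suc n) = p t (zt t)" by (rule ext) (simp add: p_def H_def)
  thus ?thesis unfolding val_def using zt(3)[of t] by (simp add: sums_iff)
qed

lemma val_agree:
  assumes "x \<in> X" "\<And>i. i < n \<Longrightarrow> x i = q i"
  shows "val t x = (\<Sum>i<n. p t (zt t) i) + c t (zt t) n * val t ((shift ^^ n) x)"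
  using assms(2)
proof (induction n)
  case (Suc n)
  have "val t ((shift ^^ n) x) = real (q n) * zt t + exp (t * real (q n)) * zt t * val t ((shift ^^ Suc n) x)"
    using val_step[OF shift_pow_in_X[OF assms(1), of n], of t] Suc.prems[of n] by (simp add: shift_pow shift_def)
  moreover have "val t x = (\<Sum>i<n. p t (zt t) i) + c t (zt t) n * val t ((shift ^^ n) x)" using Suc by simp
  ultimately show ?case by (simp add: p_eq_c c_def H_Suc algebra_simps)
qed simp

text \<open>Comparison at the first digit where x differs from \<open>q\<close> bounds
  \<open>val t x\<close> by 1 + p (s - 1), where s is the supremum of \<open>val t\<close> and p is
  a term of the probability sequence. The terms stay away from 1 uniformly, so s \<le> 1.\<close>

lemma val_le1: "x \<in> X \<Longrightarrow> val t x \<le> 1"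
proof -
  obtain B where B: "\<And>x. x \<in> X \<Longrightarrow> val t x \<le> B" using val_summable(2)[OF q_in_X] by blast
  define s where "s = (SUP x\<in>X. val t x)"
  have bdd: "bdd_above (val t ` X)" using B by (rule bdd_aboveI2)
  have le_s: "val t x \<le> s" if "x \<in> X" for x unfolding s_def using bdd that by (intro cSUP_upper) auto
  \<comment> \<open>The term of index 0 equals \<open>zt t\<close>, and every other term is at most
    the remaining mass 1 - \<open>zt t\<close>.\<close>
  define P where "P = max (zt t) (1 - zt t)"
  have P: "0 \<le> P" "P < 1" using zt[of t] by (auto simp: P_def)
  have key: "val t x \<le> 1 + P * (s - 1)" if s: "s \<ge> 1" and x: "x \<in> X" for x
  proof (cases "x = q")
    case True
    thus ?thesis using val_q P s by simp
  next
    case False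
    hence "lex_less x q" using X_le_q[OF x] by (simp add: lex_le_def)
    then obtain n where n: "\<forall>k<n. x k = q k" "x n < q n" unfolding lex_less_def by blast
    hence xn: "x n = 0" "q n = 1" using q01[of n] by auto
    have "val t x = (\<Sum>i<n. p t (zt t) i) + c t (zt t) n * val t ((shift ^^ n) x)"
      by (rule val_agree[OF x]) (use n in auto)
    also have "val t ((shift ^^ n) x) = zt t * val t (shift ((shift ^^ n) x))"
      using val_step[OF shift_pow_in_X[OF x, of n], of t] xn by (simp add: shift_pow)
    also have "c t (zt t) n * (zt t * val t (shift ((shift ^^ n) x))) = p t (zt t) n * val t (shift ((shift ^^ n) x))"
      using xn by (simp add: p_eq_c)
    also have "\<dots> \<le> p t (zt t) n * s"
      using le_s[OF shift_in_X[OF shift_pow_in_X[OF x]]] p_nonneg[of "zt t" t n] zt[of t] by (intro mult_left_mono) auto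
    also have "(\<Sum>i<n. p t (zt t) i) \<le> 1 - p t (zt t) n" using p_partial[of t "Suc n"] by simp
    finally have 1: "val t x \<le> 1 + p t (zt t) n * (s - 1)" by (simp add: algebra_simps)
    have "p t (zt t) n \<le> P"
    proof (cases "n = 0")
      case True thus ?thesis by (simp add: p_def q0 P_def)
    next
      case False
      have "(\<Sum>i\<in>{0, n}. p t (zt t) i) \<le> (\<Sum>i<Suc n. p t (zt t) i)"
        using p_nonneg[of "zt t" t] zt[of t] by (intro sum_mono2) auto
      also have "\<dots> \<le> 1" by (rule p_partial)
      finally show ?thesis using False by (simp add: p_def q0 P_def)
    qed
    hence "p t (zt t) n * (s - 1) \<le> P * (s - 1)" using s by (intro mult_right_mono) auto
    thus ?thesis using 1 by linarith
  qed
  have s1: "s \<ge> 1" using le_s[OF q_in_X] val_q by simp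
  have "s \<le> 1 + P * (s - 1)" unfolding s_def[symmetric] using key[OF s1] zero_in_X
    by (subst s_def) (intro cSUP_least, auto)
  hence "(1 - P) * (s - 1) \<le> 0" by (simp add: algebra_simps)
  hence "s \<le> 1" using P by (simp add: mult_le_0_iff)
  assume "x \<in> X"
  thus "val t x \<le> 1" using le_s \<open>s \<le> 1\<close> order_trans by blast
qed

text \<open>The points coded by the shifts of \<open>q\<close>; they play the part of the orbit of
  the endpoint 1.\<close>

definition r :: "real \<Rightarrow> nat \<Rightarrow> real" where "r t j = val t (qs j)"

lemma r_range: "0 \<le> r t j" "r t j \<le> 1"
  using val_nonneg[OF qs_in_X] val_le1[OF qs_in_X] by (auto simp: r_def)
lemma r_0: "r t 0 = 1" by (simp add: r_def qs_0 val_q)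
lemma r_step: "r t j = real (q j) * zt t + exp (t * real (q j)) * zt t * r t (Suc j)"
  using val_step[OF qs_in_X[of j], of t] by (simp add: r_def qs_app shift_qs)

section \<open>The interval map and its digit expansion\<close>

definition Tm :: "real \<Rightarrow> real \<Rightarrow> real" where
  "Tm t y = (if y < zt t then y / zt t else (y - zt t) / (zt t * exp t))"
definition dig :: "real \<Rightarrow> real \<Rightarrow> digits" where
  "dig t y = (\<lambda>n. if (Tm t ^^ n) y < zt t then 0 else 1)"

text \<open>The second branch carries the interval from \<open>zt t\<close> to 1 onto [0, r t 1), so
  the map sends [0,1) into itself.\<close>

lemma one_eq: "1 = zt t + zt t * exp t * r t 1"
  using r_step[of t 0] by (simp add: r_0 q0 mult.commute)

lemma Tm_range: "0 \<le> y \<Longrightarrow> y < 1 \<Longrightarrow> 0 \<le> Tm t y \<and> Tm t y < 1"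
proof -
  assume y: "0 \<le> y" "y < 1"
  have z: "0 < zt t" "0 < zt t * exp t" using zt[of t] by auto
  show ?thesis
  proof (cases "y < zt t")
    case True thus ?thesis using y z by (simp add: Tm_def)
  next
    case False
    have "y - zt t < zt t * exp t * r t 1" using y one_eq[of t] by linarith
    also have "\<dots> \<le> zt t * exp t * 1" using r_range[of t 1] z by (intro mult_left_mono) auto
    finally show ?thesis using False z by (simp add: Tm_def)
  qed
qed

lemma Tm_pow_range: "0 \<le> y \<Longrightarrow> y < 1 \<Longrightarrow> 0 \<le> (Tm t ^^ n) y \<and> (Tm t ^^ n) y < 1"
  by (induction n) (use Tm_range in auto)

lemma dig_shift: "shift (dig t y) = dig t (Tm t y)"
  by (simp add: shift_def dig_def funpow_swap1)

lemma dig_shift_pow: "(shift ^^ n) (dig t y) = dig t ((Tm t ^^ n) y)"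
  by (induction n) (auto simp: dig_shift)

text \<open>If the digits of y first exceeded \<open>q\<close> at n, the orbit of y would stay
  strictly below \<open>r t k\<close> up to k = n, since both use the same branches before n. But
  \<open>q n\<close> = 0 gives \<open>r t n\<close> \<le> \<open>zt t\<close>, so the digit of y at
  n is 0.\<close>

lemma dig_le_q:
  assumes y: "0 \<le> y" "y < 1" shows "lex_le (dig t y) q"
proof (rule ccontr)
  assume "\<not> ?thesis"
  hence "lex_less q (dig t y)" using lex_less_iff_not_le by blast
  then obtain n where n: "\<forall>k<n. q k = dig t y k" "q n < dig t y n" unfolding lex_less_def by blast
  have z: "0 < zt t" "0 < zt t * exp t" using zt[of t] by auto
  have "(Tm t ^^ k) y < r t k" if "k \<le> n" for k
    using that
  proof (induction k)
    case (Suc k)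
    let ?v = "(Tm t ^^ k) y"
    have v: "?v < r t k" using Suc by simp
    have d: "q k = dig t y k" using n Suc.prems by simp
    show ?case
    proof (cases "?v < zt t")
      case True
      hence "q k = 0" using d by (simp add: dig_def)
      hence "?v < zt t * r t (Suc k)" using v r_step[of t k] by simp
      thus ?thesis using True z by (simp add: Tm_def[of t ?v] pos_divide_less_eq mult.commute)
    next
      case False
      hence "q k = 1" using d by (simp add: dig_def)
      hence "?v - zt t < zt t * exp t * r t (Suc k)" using v r_step[of t k] by (simp add: mult.commute)
      thus ?thesis using False z by (simp add: Tm_def[of t ?v] pos_divide_less_eq mult.commute)
    qed
  qed (use y r_0 in auto)
  from this[of n] have "(Tm t ^^ n) y < r t n" by simp
  moreover have "q n = 0" using n(2) q01[of n] by (auto simp: dig_def split: if_splits)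
  hence "r t n \<le> zt t" using r_step[of t n] r_range[of t "Suc n"] z by (simp add: mult_left_le)
  ultimately have "dig t y n = 0" by (simp add: dig_def)
  thus False using n(2) by simp
qed

lemma dig_X: "0 \<le> y \<Longrightarrow> y < 1 \<Longrightarrow> dig t y \<in> X"
  unfolding in_X_iff dig_shift_pow using dig_le_q Tm_pow_range by (auto simp: dig_def)

text \<open>Both points follow the same affine branches, whose n-fold inverse contracts by the
  weight of the word. This bounds the length of the interval coded by a word.\<close>

lemma dig_diff:
  assumes "trunc n (dig t y) = trunc n (dig t y')"
  shows "y - y' = exp (t * S n (dig t y)) * zt t ^ n * ((Tm t ^^ n) y - (Tm t ^^ n) y')"
  using assms
proof (induction n)
  case (Suc n)
  have "trunc n (dig t y) = trunc n (dig t y')" using Suc.prems by (metis trunc_trunc le_SucI order_refl)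
  note IH = Suc.IH[OF this]
  have "trunc (Suc n) (dig t y) n = trunc (Suc n) (dig t y') n" using Suc.prems by simp
  hence d: "dig t y n = dig t y' n" by (simp add: trunc_def)
  have "(Tm t ^^ n) y - (Tm t ^^ n) y' = exp (t * real (dig t y n)) * zt t * ((Tm t ^^ Suc n) y - (Tm t ^^ Suc n) y')"
    using d zt[of t] by (auto simp: dig_def Tm_def divide_simps split: if_splits)
  thus ?case using IH by (simp add: S_Suc distrib_left exp_add)
qed simp

text \<open>The series of h, with the initial segment below \<open>qs j\<close> replaced by the
  interval from 0 to \<open>r t j\<close>.\<close>

definition Hd :: "real \<Rightarrow> real \<Rightarrow> real" where
  "Hd t y = (if 0 \<le> y \<and> y < 1 then (\<Sum>j. cc t j * (if y < r t j then 1 else 0)) else 0)"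

lemma Hd_summable: "summable (\<lambda>j. cc t j * (if y < r t j then 1 else 0))"
  by (rule summable_comparison_test'[OF cc_summable[of t], of 0]) (use cc_pos[of t] in \<open>auto simp: less_imp_le\<close>)

lemma Hd_bounds: "0 \<le> Hd t y" "Hd t y \<le> Ch t" "0 \<le> y \<Longrightarrow> y < 1 \<Longrightarrow> 1 \<le> Hd t y"
proof -
  let ?s = "\<Sum>j. cc t j * (if y < r t j then 1 else 0)"
  have "0 \<le> ?s" using cc_pos[of t] by (intro suminf_nonneg Hd_summable) (auto simp: less_imp_le)
  moreover have "?s \<le> Ch t" unfolding Ch_def
    using cc_pos[of t] by (intro suminf_le Hd_summable cc_summable) (auto simp: less_imp_le)
  ultimately show "0 \<le> Hd t y" "Hd t y \<le> Ch t" using Ch_ge1[of t] by (auto simp: Hd_def)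
  assume y: "0 \<le> y" "y < 1"
  have "(\<Sum>j<1. cc t j * (if y < r t j then 1 else 0)) \<le> ?s"
    using cc_pos[of t] by (intro sum_le_suminf Hd_summable) (auto simp: less_imp_le)
  thus "1 \<le> Hd t y" using y by (simp add: Hd_def cc_0 r_0)
qed

lemma Hd_measurable [measurable]: "Hd t \<in> borel_measurable borel"
  unfolding Hd_def by measurable

text \<open>The fixed point equation of the transfer operator of \<open>Tm t\<close>, by the
  computation of \<open>L_u\<close> and \<open>L_h\<close>. The conditions y < 1 and 0 \<le> y
  describe the images of the branch domains {..<zt t} and {zt t..}, taken on the whole line.\<close>

lemma Hd_transfer:
  "Hd t y = (if y < 1 then zt t * Hd t (zt t * y) else 0) + (if 0 \<le> y then zt t * exp t * Hd t (zt t + zt t * exp t * y) else 0)"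
proof -
  have z: "0 < zt t" "zt t < 1" "0 < zt t * exp t" using zt[of t] by auto
  consider "y < 0" | "y \<ge> 1" | "0 \<le> y" "y < 1" by linarith
  thus ?thesis
  proof cases
    case 1
    thus ?thesis using z by (simp add: Hd_def mult_less_0_iff not_le zero_le_mult_iff)
  next
    case 2
    have "zt t * exp t * r t 1 \<le> zt t * exp t * y" using 2 r_range[of t 1] z by (intro mult_left_mono) auto
    hence "1 \<le> zt t + zt t * exp t * y" using one_eq[of t] by linarith
    thus ?thesis using 2 by (simp add: Hd_def)
  next
    case 3
    let ?v = "zt t + zt t * exp t * y"
    let ?I = "\<lambda>a b. if a < (b::real) then 1 else (0::real)"
    have v0: "zt t \<le> ?v" using 3 z by simp
    have "zt t * y < zt t * 1" using 3 z by (intro mult_strict_left_mono) auto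
    hence zu: "0 \<le> zt t * y" "zt t * y < 1" "zt t * y < zt t" using 3(1) z by (simp, linarith, simp)
    have a: "?I (zt t * y) (r t j) = real (q j) + (1 - real (q j)) * ?I y (r t (Suc j))" for j
      using q01[of j]
    proof
      assume "q j = 0" thus ?thesis using r_step[of t j] z by simp
    next
      assume q: "q j = 1"
      have "0 \<le> exp t * zt t * r t (Suc j)" using r_range[of t "Suc j"] z by (intro mult_nonneg_nonneg) auto
      thus ?thesis using r_step[of t j] q zu by simp
    qed
    have b: "?I ?v (r t j) = real (q j) * ?I y (r t (Suc j))" for j
      using q01[of j]
    proof
      assume "q j = 0" 
      moreover have "zt t * r t (Suc j) \<le> zt t" using z r_range[of t "Suc j"] by (simp add: mult_left_le)
      ultimately show ?thesis using r_step[of t j] v0 by simp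
    next
      assume "q j = 1" thus ?thesis using r_step[of t j] z by (simp add: mult.commute)
    qed
    have h1: "Hd t (zt t * y) = (\<Sum>j. cc t j * ?I (zt t * y) (r t j))" using zu by (simp add: Hd_def)
    have h2: "Hd t ?v = (\<Sum>j. cc t j * ?I ?v (r t j))"
    proof (cases "?v < 1")
      case True thus ?thesis using v0 z by (simp add: Hd_def)
    next
      case False
      have "?I ?v (r t j) = 0" for j using False r_range[of t j] by simp
      thus ?thesis using False by (simp add: Hd_def)
    qed
    have e: "zt t * (cc t j * ?I (zt t * y) (r t j)) + zt t * exp t * (cc t j * ?I ?v (r t j)) =
        p t (zt t) j + cc t (Suc j) * ?I y (r t (Suc j))" for j
      unfolding a b using q01[of j] by (auto simp: p_eq_c cc_def c_def H_Suc algebra_simps)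
    have "zt t * Hd t (zt t * y) + zt t * exp t * Hd t ?v =
        (\<Sum>j. zt t * (cc t j * ?I (zt t * y) (r t j)) + zt t * exp t * (cc t j * ?I ?v (r t j)))"
      unfolding h1 h2 using suminf_add[OF summable_mult[OF Hd_summable[of t "zt t * y"], of "zt t"]
        summable_mult[OF Hd_summable[of t ?v], of "zt t * exp t"]]
      unfolding suminf_mult[OF Hd_summable] .
    also have "\<dots> = (\<Sum>j. p t (zt t) j + cc t (Suc j) * ?I y (r t (Suc j)))" unfolding e ..
    also have "\<dots> = 1 + (\<Sum>j. cc t (Suc j) * ?I y (r t (Suc j)))"
      using zt(3)[of t] Hd_summable[of t y]
      by (subst suminf_add[symmetric]) (auto simp: sums_iff summable_Suc_iff[of "\<lambda>j. cc t j * ?I y (r t j)"])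
    also have "\<dots> = Hd t y"
      unfolding Hd_def using 3 suminf_split_head[OF Hd_summable[of t y]] by (simp add: cc_0 r_0)
    finally show ?thesis using 3 by simp
  qed
qed

section \<open>The absolutely continuous invariant measure and the law of its digits\<close>

definition mass :: "real \<Rightarrow> ennreal" where "mass t = (\<integral>\<^sup>+y. ennreal (Hd t y) \<partial>lborel)"
definition ac :: "real \<Rightarrow> real measure" where "ac t = density lborel (\<lambda>y. ennreal (Hd t y) / mass t)"

lemma mass: "1 \<le> mass t" "mass t \<le> ennreal (Ch t)" "mass t \<noteq> 0" "mass t \<noteq> \<infinity>"
proof -
  have "1 = (\<integral>\<^sup>+y. indicator {0..<1::real} y \<partial>lborel)" by simp
  also have "\<dots> \<le> mass t" unfolding mass_def
    by (intro nn_integral_mono) (use Hd_bounds(3)[of _ t] in \<open>auto simp: indicator_def\<close>)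
  finally show 1: "1 \<le> mass t" .
  have "mass t \<le> (\<integral>\<^sup>+y. ennreal (Ch t) * indicator {0..<1::real} y \<partial>lborel)" unfolding mass_def
  proof (intro nn_integral_mono)
    show "ennreal (Hd t y) \<le> ennreal (Ch t) * indicator {0..<1} y" for y
      using Hd_bounds(2)[of t y] by (cases "0 \<le> y \<and> y < 1") (auto simp: Hd_def ennreal_leI)
  qed
  also have "\<dots> = ennreal (Ch t)" by (subst nn_integral_cmult_indicator) auto
  finally show 2: "mass t \<le> ennreal (Ch t)" .
  show "mass t \<noteq> 0" using 1 by auto
  show "mass t \<noteq> \<infinity>" using 2 by (auto simp: top_unique)
qed

lemma sets_ac [measurable_cong]: "sets (ac t) = sets borel" by (simp add: ac_def)
lemma space_ac: "space (ac t) = UNIV" by (simp add: ac_def)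

lemma Tm_measurable [measurable]: "Tm t \<in> borel_measurable borel"
  unfolding Tm_def by measurable

lemma Tm_pow_measurable [measurable]: "(Tm t ^^ n) \<in> borel_measurable borel"
proof (induction n)
  case (Suc n)
  from measurable_comp[OF this Tm_measurable] show ?case by (simp only: funpow.simps)
qed (simp add: id_def)

lemma prob_ac: "prob_space (ac t)"
proof
  have "emeasure (ac t) UNIV = (\<integral>\<^sup>+y. ennreal (Hd t y) / mass t \<partial>lborel)"
    unfolding ac_def by (subst emeasure_density) auto
  also have "\<dots> = mass t / mass t" unfolding mass_def by (subst nn_integral_divide) auto
  also have "\<dots> = 1" using mass[of t] by (intro ennreal_divide_self) (auto simp: top.not_eq_extremum)
  finally show "emeasure (ac t) (space (ac t)) = 1" by (simp add: space_ac)
qed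

lemma Tm_integral:
  assumes [measurable]: "f \<in> borel_measurable borel"
  shows "(\<integral>\<^sup>+y. f (Tm t y) * ennreal (Hd t y) \<partial>lborel) = (\<integral>\<^sup>+y. f y * ennreal (Hd t y) \<partial>lborel)"
proof -
  have z: "0 < zt t" "0 < zt t * exp t" "\<not> exp t * zt t \<le> 0" using zt[of t] by (auto simp: not_le)
  let ?A = "\<lambda>y. f (y / zt t) * ennreal (Hd t y) * indicator {..<zt t} y"
  let ?B = "\<lambda>y. f ((y - zt t) / (zt t * exp t)) * ennreal (Hd t y) * indicator {zt t..} y"
  have "(\<integral>\<^sup>+y. f (Tm t y) * ennreal (Hd t y) \<partial>lborel) = (\<integral>\<^sup>+y. ?A y + ?B y \<partial>lborel)"
    by (intro nn_integral_cong) (auto simp: Tm_def indicator_def)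
  also have "\<dots> = (\<integral>\<^sup>+y. ?A y \<partial>lborel) + (\<integral>\<^sup>+y. ?B y \<partial>lborel)" by (rule nn_integral_add) auto
  also have "(\<integral>\<^sup>+y. ?A y \<partial>lborel) = ennreal (zt t) * (\<integral>\<^sup>+y. ?A (0 + zt t * y) \<partial>lborel)"
    using nn_integral_real_affine[of ?A "zt t" 0] z by simp
  also have "\<dots> = (\<integral>\<^sup>+y. f y * ennreal (if y < 1 then zt t * Hd t (zt t * y) else 0) \<partial>lborel)"
    using z Hd_bounds(1)[of t]
    by (subst nn_integral_cmult[symmetric]) (auto simp: indicator_def ennreal_mult ac_simps intro!: nn_integral_cong)
  also have "(\<integral>\<^sup>+y. ?B y \<partial>lborel) = ennreal (zt t * exp t) * (\<integral>\<^sup>+y. ?B (zt t + zt t * exp t * y) \<partial>lborel)"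
    using nn_integral_real_affine[of ?B "zt t * exp t" "zt t"] z by simp
  also have "\<dots> = (\<integral>\<^sup>+y. f y * ennreal (if 0 \<le> y then zt t * exp t * Hd t (zt t + zt t * exp t * y) else 0) \<partial>lborel)"
    using z Hd_bounds(1)[of t]
    by (subst nn_integral_cmult[symmetric])
       (use z(3) in \<open>auto simp: indicator_def ennreal_mult ac_simps zero_le_mult_iff intro!: nn_integral_cong\<close>)
  also have "(\<integral>\<^sup>+y. f y * ennreal (if y < 1 then zt t * Hd t (zt t * y) else 0) \<partial>lborel) + \<dots> =
      (\<integral>\<^sup>+y. f y * ennreal (if y < 1 then zt t * Hd t (zt t * y) else 0) +
        f y * ennreal (if 0 \<le> y then zt t * exp t * Hd t (zt t + zt t * exp t * y) else 0) \<partial>lborel)"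
    by (rule nn_integral_add[symmetric]) auto
  also have "\<dots> = (\<integral>\<^sup>+y. f y * ennreal (Hd t y) \<partial>lborel)"
  proof (rule nn_integral_cong)
    fix y
    show "f y * ennreal (if y < 1 then zt t * Hd t (zt t * y) else 0) +
        f y * ennreal (if 0 \<le> y then zt t * exp t * Hd t (zt t + zt t * exp t * y) else 0) = f y * ennreal (Hd t y)"
      unfolding Hd_transfer[of t y] using z Hd_bounds(1)[of t]
      by (subst ennreal_plus) (auto simp: distrib_left)
  qed
  finally show ?thesis .
qed

lemma ac_invariant: "distr (ac t) borel (Tm t) = ac t"
proof (rule measure_eqI)
  fix A assume "A \<in> sets (distr (ac t) borel (Tm t))"
  hence A [measurable]: "A \<in> sets borel" by simp
  have dens: "emeasure (ac t) B = (\<integral>\<^sup>+y. indicator B y * ennreal (Hd t y) \<partial>lborel) / mass t" if [measurable]: "B \<in> sets borel" for B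
    unfolding ac_def by (subst emeasure_density) (auto simp: ennreal_times_divide mult.commute nn_integral_divide[symmetric] intro!: nn_integral_cong)
  have "emeasure (distr (ac t) borel (Tm t)) A = emeasure (ac t) (Tm t -` A)"
    by (subst emeasure_distr) (auto simp: space_ac)
  also have "\<dots> = (\<integral>\<^sup>+y. indicator (Tm t -` A) y * ennreal (Hd t y) \<partial>lborel) / mass t"
    by (rule dens) (use measurable_sets[OF Tm_measurable A, of t] in simp)
  also have "(\<integral>\<^sup>+y. indicator (Tm t -` A) y * ennreal (Hd t y) \<partial>lborel) = (\<integral>\<^sup>+y. indicator A (Tm t y) * ennreal (Hd t y) \<partial>lborel)"
    by (simp add: indicator_def)
  also have "\<dots> = (\<integral>\<^sup>+y. indicator A y * ennreal (Hd t y) \<partial>lborel)" by (rule Tm_integral) auto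
  also have "\<dots> / mass t = emeasure (ac t) A" by (rule dens[symmetric]) auto
  finally show "emeasure (distr (ac t) borel (Tm t)) A = emeasure (ac t) A" .
qed (simp add: sets_ac)

text \<open>Outside [0,1), a null set of \<open>ac t\<close>, an admissible constant makes the map
  take values in X everywhere.\<close>

definition dig' :: "real \<Rightarrow> real \<Rightarrow> digits" where
  "dig' t y = (if 0 \<le> y \<and> y < 1 then dig t y else zero)"

definition mu :: "real \<Rightarrow> digits measure" where "mu t = distr (ac t) XB (dig' t)"

lemma dig'_measurable: "dig' t \<in> measurable (ac t) XB"
proof (rule measurable_restrict_space2)
  show "dig' t \<in> space (ac t) \<rightarrow> X" using dig_X zero_in_X by (auto simp: dig'_def)
  show "dig' t \<in> borel_measurable (ac t)"
  proof (rule measurable_coordinatewise_then_product)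
    fix i
    have "(\<lambda>y. dig' t y i) = (\<lambda>y. if 0 \<le> y \<and> y < 1 \<and> \<not> (Tm t ^^ i) y < zt t then 1 else 0)"
      by (auto simp: dig'_def dig_def)
    moreover have "\<dots> \<in> borel_measurable borel" by measurable
    ultimately show "(\<lambda>y. dig' t y i) \<in> borel_measurable (ac t)" by (simp add: ac_def)
  qed
qed

lemma sets_mu: "sets (mu t) = sets XB" by (simp add: mu_def)
lemma space_mu: "space (mu t) = X" using sets_eq_imp_space_eq[OF sets_mu] by simp

lemma prob_mu: "prob_space (mu t)"
  unfolding mu_def by (rule prob_space.prob_space_distr[OF prob_ac dig'_measurable])

lemma shift_measurable: "shift \<in> measurable XB XB"
proof (rule measurable_restrict_space3)
  show "shift \<in> X \<rightarrow> X" using shift_in_X by auto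
  show "shift \<in> borel_measurable borel"
    by (rule measurable_coordinatewise_then_product) (auto simp: shift_def intro: measurable_product_coordinates)
qed

lemma ac_AE: "AE y in ac t. 0 \<le> y \<and> y < 1"
  unfolding ac_def by (subst AE_density) (auto simp: Hd_def)

lemma mu_invariant: "mu t \<in> invariant_measures \<beta>"
proof -
  have "distr (mu t) (mu t) shift = distr (mu t) XB shift" by (rule distr_cong) (auto simp: sets_mu)
  also have "\<dots> = distr (ac t) XB (shift \<circ> dig' t)"
    unfolding mu_def by (rule distr_distr[OF shift_measurable dig'_measurable])
  also have "\<dots> = distr (ac t) XB (dig' t \<circ> Tm t)"
  proof (rule distr_cong_AE)
    show "AE y in ac t. (shift \<circ> dig' t) y = (dig' t \<circ> Tm t) y"
      using ac_AE by eventually_elim (use Tm_range in \<open>auto simp: dig'_def dig_shift\<close>)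
    show "shift \<circ> dig' t \<in> measurable (ac t) XB" by (rule measurable_comp[OF dig'_measurable shift_measurable])
    show "dig' t \<circ> Tm t \<in> measurable (ac t) XB"
      by (rule measurable_comp[OF _ dig'_measurable]) (simp add: measurable_cong_sets[OF sets_ac sets_ac])
  qed auto
  also have "\<dots> = distr (distr (ac t) borel (Tm t)) XB (dig' t)"
  proof (rule distr_distr[symmetric])
    show "dig' t \<in> measurable borel XB" using dig'_measurable[of t] by (simp add: measurable_cong_sets[OF sets_ac refl])
    show "Tm t \<in> measurable (ac t) borel" by (simp add: measurable_cong_sets[OF sets_ac refl])
  qed
  also have "\<dots> = mu t" by (simp add: ac_invariant mu_def)
  finally have "distr (mu t) (mu t) shift = mu t" .
  moreover have "shift \<in> measurable (mu t) (mu t)"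
    using shift_measurable by (simp add: measurable_cong_sets[OF sets_mu sets_mu])
  ultimately show ?thesis unfolding invariant_measures_def using prob_mu sets_mu by auto
qed

text \<open>By \<open>dig_diff\<close> all points with the same n-word lie within c0 of any one of
  them, and the normalised density is at most \<open>Ch t\<close> because the total mass is at least
  1. The factor 2 comes from an interval reaching c0 to both sides.\<close>

lemma mu_cyl: "measure (mu t) (cyl n w) \<le> 2 * Ch t * (exp (t * S n w) * zt t ^ n)"
proof (cases "\<exists>y. 0 \<le> y \<and> y < 1 \<and> trunc n (dig t y) = w")
  case False
  have "AE y in ac t. y \<notin> dig' t -` cyl n w"
    using ac_AE by eventually_elim (use False in \<open>auto simp: dig'_def cyl_def\<close>)
  hence "emeasure (ac t) (dig' t -` cyl n w \<inter> space (ac t)) = 0"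
    using emeasure_eq_0_AE[of "\<lambda>y. y \<in> dig' t -` cyl n w" "ac t"] by (simp add: vimage_def space_ac)
  hence "measure (mu t) (cyl n w) = 0"
    unfolding mu_def measure_def using emeasure_distr[OF dig'_measurable cyl_sets] by simp
  moreover have "0 \<le> 2 * Ch t * (exp (t * S n w) * zt t ^ n)" using Ch_ge1[of t] zt[of t] by simp
  ultimately show ?thesis by simp
next
  case True
  then obtain v where v: "0 \<le> v" "v < 1" "trunc n (dig t v) = w" by blast
  define c0 where "c0 = exp (t * S n w) * zt t ^ n"
  have c0: "0 \<le> c0" using zt[of t] by (simp add: c0_def)
  have S: "S n (dig t v) = S n w" unfolding v(3)[symmetric] by (simp add: S_def trunc_def)
  have sub: "y \<in> {v - c0..v + c0}" if y: "0 \<le> y" "y < 1" "trunc n (dig t y) = w" for y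
  proof -
    have "v - y = c0 * ((Tm t ^^ n) v - (Tm t ^^ n) y)"
      using dig_diff[of n t v y] v(3) y(3) S by (simp add: c0_def)
    moreover have "\<bar>(Tm t ^^ n) v - (Tm t ^^ n) y\<bar> \<le> 1"
      using Tm_pow_range[OF v(1,2), of n t] Tm_pow_range[OF y(1,2), of n t] by linarith
    ultimately have "\<bar>v - y\<bar> \<le> c0" using c0 by (simp add: abs_mult mult_left_le)
    thus ?thesis by auto
  qed
  interpret prob_space "ac t" by (rule prob_ac)
  have "measure (mu t) (cyl n w) = measure (ac t) (dig' t -` cyl n w \<inter> space (ac t))"
    unfolding mu_def by (rule measure_distr[OF dig'_measurable cyl_sets])
  also have "\<dots> \<le> measure (ac t) {v - c0..v + c0}"
  proof (rule finite_measure_mono_AE)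
    show "AE y in ac t. y \<in> dig' t -` cyl n w \<inter> space (ac t) \<longrightarrow> y \<in> {v - c0..v + c0}"
      using ac_AE by eventually_elim (use sub in \<open>auto simp: dig'_def cyl_def\<close>)
  qed (simp add: sets_ac)
  also have "\<dots> \<le> 2 * Ch t * c0"
  proof -
    have "emeasure (ac t) {v - c0..v + c0} = (\<integral>\<^sup>+y. ennreal (Hd t y) / mass t * indicator {v - c0..v + c0} y \<partial>lborel)"
      unfolding ac_def by (subst emeasure_density) auto
    also have "\<dots> \<le> (\<integral>\<^sup>+y. ennreal (Ch t) * indicator {v - c0..v + c0} y \<partial>lborel)"
    proof (intro nn_integral_mono mult_right_mono)
      fix y
      have "0 < mass t" using mass(1)[of t] by (auto intro: less_le_trans[of _ 1])
      moreover have "ennreal (Hd t y) \<le> mass t * ennreal (Hd t y)"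
        using mult_right_mono[OF mass(1)[of t], of "ennreal (Hd t y)"] by simp
      ultimately have "ennreal (Hd t y) / mass t \<le> ennreal (Hd t y)" by (rule divide_le_posI_ennreal)
      also have "\<dots> \<le> ennreal (Ch t)" using Hd_bounds(2)[of t y] by (simp add: ennreal_leI)
      finally show "ennreal (Hd t y) / mass t \<le> ennreal (Ch t)" .
    qed auto
    also have "\<dots> = ennreal (Ch t) * ennreal (2 * c0)" using c0 by (subst nn_integral_cmult_indicator) auto
    also have "\<dots> = ennreal (2 * Ch t * c0)" using c0 Ch_ge1[of t] by (simp add: ennreal_mult[symmetric] algebra_simps)
    finally show ?thesis using c0 Ch_ge1[of t] by (simp add: emeasure_eq_measure)
  qed
  finally show ?thesis by (simp add: c0_def)
qed

text \<open>After \<open>invariant_upper\<close> only the lower bound is left. For the partition by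
  the first digit the itinerary determines the word, and \<open>mu_cyl\<close> makes the entropy at
  least n (Pr t - I) minus a constant.\<close>

lemma mu_entropy: "metric_entropy (mu t) shift + ereal (\<integral>x. chit t x \<partial>mu t) = ereal (Pr t)"
proof -
  note inv = mu_invariant[of t]
  interpret m: mpt "mu t" shift using invariant_mpt[OF inv] by blast
  define A0 A1 where "A0 = {x \<in> X. x 0 = 0}" and "A1 = {x \<in> X. x 0 = 1}"
  define \<xi> where "\<xi> = {A0, A1}"
  have A01: "A0 \<in> sets (mu t)" "A1 \<in> sets (mu t)"
    unfolding A0_def A1_def sets_mu using coord_set[of 0] by (auto simp: sets_restrict_space image_iff Int_def)
  have ne: "zero \<in> A0" "q \<in> A1" using zero_in_X q_in_X q0 by (auto simp: A0_def A1_def)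
  have \<xi>: "\<xi> \<in> finite_partitions (mu t)"
  proof -
    have "partition_on X \<xi>"
      using ne X_01[of _ 0] by (intro partition_onI) (auto simp: \<xi>_def A0_def A1_def disjnt_def)
    thus ?thesis using A01 by (auto simp: finite_partitions_def \<xi>_def space_mu)
  qed
  define I where "I = (\<integral>x. chit t x \<partial>mu t)"
  have int: "integrable (mu t) (chit t)" by (rule invariant_upper(1)[OF inv])
  have meas: "chit t \<in> borel_measurable (mu t)" using int by simp
  have birkI: "(\<integral>x. t * S n x \<partial>mu t) = real n * I" for n
  proof -
    have "(\<integral>x. t * S n x \<partial>mu t) = (\<integral>x. birk (chit t) n x \<partial>mu t)"
      by (rule Bochner_Integration.integral_cong) (auto simp: birk_chit space_mu)
    also have "\<dots> = real n * I"
    proof -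
      have "integrable (mu t) (\<lambda>x. chit t ((shift ^^ i) x))" for i
        using integrable_distr[OF m.T_pow_meas[of i], of "chit t"] int m.distr_T_pow[of i] by simp
      thus ?thesis unfolding birk_def using m.integral_T_pow[OF meas] by (simp add: I_def)
    qed
    finally show ?thesis .
  qed
  have ft: "fin (mu t) (trunc n) (W n)" for n by (rule fin_trunc[OF inv])
  have low: "real n * Pr t - real n * I - ln (2 * Ch t) \<le> m.Hn \<xi> n" for n
  proof -
    let ?Wd = "{..<n} \<rightarrow>\<^sub>E \<xi>"
    define \<psi> where "\<psi> a = (\<lambda>i. if i < n \<and> a i = A1 then 1 else 0 :: nat)" for a :: "nat \<Rightarrow> digits set"
    have fi: "fin (mu t) (m.it \<xi> n) ?Wd" by (rule m.fin_it[OF \<xi>])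
    have cellA1: "m.cell \<xi> x = A1 \<longleftrightarrow> x 0 = 1" if "x \<in> X" for x
      using m.cell_iff[OF \<xi>, of x A1] that by (auto simp: \<xi>_def A1_def space_mu)
    have \<psi>it: "\<psi> (m.it \<xi> n x) = trunc n x" if x: "x \<in> X" for x
    proof
      fix i
      have "x i = 0 \<or> x i = 1" by (rule X_01[OF x])
      thus "\<psi> (m.it \<xi> n x) i = trunc n x i"
        using cellA1[OF shift_pow_in_X[OF x, of i]] by (auto simp: \<psi>_def m.it_def trunc_def shift_pow)
    qed
    have ppsi: "pm (mu t) (\<lambda>x. \<psi> (m.it \<xi> n x)) w = pm (mu t) (trunc n) w" for w
    proof -
      have "{x \<in> space (mu t). \<psi> (m.it \<xi> n x) = w} = {x \<in> space (mu t). trunc n x = w}"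
        using \<psi>it by (auto simp: space_mu)
      thus ?thesis by (simp add: pm_def)
    qed
    \<comment> \<open>An itinerary realised by no point may be recoded to a word outside
      \<open>W n\<close>; such words carry mass 0.\<close>
    define D where "D = W n \<union> \<psi> ` ?Wd"
    have fD: "finite D" unfolding D_def using finite_W fi by (simp add: fin_def)
    have zeroD: "pm (mu t) (trunc n) w = 0" if "w \<notin> W n" for w
    proof -
      have "{x \<in> space (mu t). trunc n x = w} = {}" using that trunc_in_W by (auto simp: space_mu)
      thus ?thesis by (simp only: pm_def measure_empty)
    qed
    have "- (\<Sum>d\<in>D. pm (mu t) (\<lambda>x. \<psi> (m.it \<xi> n x)) d * ln (pm (mu t) (\<lambda>x. \<psi> (m.it \<xi> n x)) d)) \<le> m.Hn \<xi> n"
      unfolding m.Hn_def[OF \<xi>]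
      by (rule entropy_le[OF m.prob_space_axioms fi fD]) (auto simp: D_def pm_nonneg fin_sum_1[OF m.prob_space_axioms fi])
    also have "(\<Sum>d\<in>D. pm (mu t) (\<lambda>x. \<psi> (m.it \<xi> n x)) d * ln (pm (mu t) (\<lambda>x. \<psi> (m.it \<xi> n x)) d)) =
        (\<Sum>w\<in>W n. pm (mu t) (trunc n) w * ln (pm (mu t) (trunc n) w))"
      unfolding ppsi by (rule sum.mono_neutral_right[OF fD]) (auto simp: D_def zeroD)
    finally have 1: "- (\<Sum>w\<in>W n. pm (mu t) (trunc n) w * ln (pm (mu t) (trunc n) w)) \<le> m.Hn \<xi> n" .
    have "(\<Sum>w\<in>W n. pm (mu t) (trunc n) w * ln (pm (mu t) (trunc n) w)) \<le>
        (\<Sum>w\<in>W n. pm (mu t) (trunc n) w * (ln (2 * Ch t) + t * S n w - real n * Pr t))"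
    proof (rule sum_mono)
      fix w
      show "pm (mu t) (trunc n) w * ln (pm (mu t) (trunc n) w) \<le> pm (mu t) (trunc n) w * (ln (2 * Ch t) + t * S n w - real n * Pr t)"
      proof (cases "pm (mu t) (trunc n) w = 0")
        case False
        hence P: "0 < pm (mu t) (trunc n) w" using pm_nonneg[of "mu t" "trunc n" w] by simp
        have "pm (mu t) (trunc n) w \<le> 2 * Ch t * (exp (t * S n w) * zt t ^ n)"
          unfolding pm_trunc[OF inv] by (rule mu_cyl)
        hence "ln (pm (mu t) (trunc n) w) \<le> ln (2 * Ch t * (exp (t * S n w) * zt t ^ n))" using P by (intro ln_mono) auto
        also have "\<dots> = ln (2 * Ch t) + (t * S n w + ln (zt t ^ n))"
          using Ch_ge1[of t] zt[of t] by (subst ln_mult_pos) (auto simp: ln_mult_pos)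
        also have "ln (zt t ^ n) = - real n * Pr t"
          using zt[of t] by (simp add: ln_realpow Pr_def lam_def ln_div)
        finally show ?thesis using P by (intro mult_left_mono) auto
      qed simp
    qed
    also have "\<dots> = (\<integral>x. ln (2 * Ch t) + t * S n (trunc n x) - real n * Pr t \<partial>mu t)"
      by (rule fin_integral(2)[OF m.prob_space_axioms ft, symmetric])
    also have "\<dots> = (\<integral>x. (ln (2 * Ch t) - real n * Pr t) + t * S n x \<partial>mu t)"
      by (rule Bochner_Integration.integral_cong) (auto simp: S_def trunc_def)
    also have "\<dots> = (ln (2 * Ch t) - real n * Pr t) + real n * I"
    proof -
      have "integrable (mu t) (\<lambda>x. t * S n (trunc n x))" by (rule fin_integral(1)[OF m.prob_space_axioms ft])
      hence "integrable (mu t) (\<lambda>x. t * S n x)"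
        by (subst Bochner_Integration.integrable_cong[OF refl, of _ _ "\<lambda>x. t * S n (trunc n x)"]) (auto simp: S_def trunc_def)
      thus ?thesis by (subst Bochner_Integration.integral_add) (auto simp: birkI m.prob_space simp del: integral_mult_right_zero)
    qed
    finally show ?thesis using 1 by linarith
  qed
  have "Pr t - I \<le> m.h\<xi> \<xi>"
  proof (rule LIMSEQ_le[OF _ m.h\<xi>_lim[OF \<xi>]])
    show "(\<lambda>n. Pr t - I - ln (2 * Ch t) / real n) \<longlonglongrightarrow> Pr t - I"
      using tendsto_diff[OF tendsto_const lim_const_over_n, of "Pr t - I" "ln (2 * Ch t)"] by simp
    show "\<exists>N. \<forall>n\<ge>N. Pr t - I - ln (2 * Ch t) / real n \<le> m.Hn \<xi> n / real n"
    proof (intro exI[of _ 1] allI impI)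
      fix n :: nat assume n: "n \<ge> 1"
      have "(real n * Pr t - real n * I - ln (2 * Ch t)) / real n \<le> m.Hn \<xi> n / real n"
        using low[of n] by (intro divide_right_mono) auto
      thus "Pr t - I - ln (2 * Ch t) / real n \<le> m.Hn \<xi> n / real n" using n by (simp add: diff_divide_distrib)
    qed
  qed
  hence "ereal (Pr t - I) \<le> ereal (m.h\<xi> \<xi>)" by simp
  also have "\<dots> \<le> metric_entropy (mu t) shift"
    unfolding metric_entropy_def m.h\<xi>_def[OF \<xi>] by (rule SUP_upper[OF \<xi>])
  finally have "ereal (Pr t - I) + ereal I \<le> metric_entropy (mu t) shift + ereal I" by (rule add_right_mono)
  hence "ereal (Pr t) \<le> metric_entropy (mu t) shift + ereal I" by simp
  thus ?thesis using invariant_upper(2)[OF inv, of t] by (simp add: I_def)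
qed

section \<open>Equilibrium states and limits of the pressure\<close>

lemma chit_alt: "chit t = (\<lambda>x. t * chi \<beta> x)" by (rule ext) (simp add: chit_def)

lemma integral_chit: "(\<integral>x. chit t x \<partial>m) = t * (\<integral>x. chi \<beta> x \<partial>m)"
  by (simp add: chit_alt)

lemma equilibrium_iff:
  "is_equilibrium_state \<beta> (\<lambda>x. t * chi \<beta> x) m \<longleftrightarrow>
    m \<in> invariant_measures \<beta> \<and> metric_entropy m shift + ereal (\<integral>x. chit t x \<partial>m) = ereal (Pr t)"
proof -
  have fe: "free_energy (\<lambda>x. t * chi \<beta> x) m = metric_entropy m shift + ereal (\<integral>x. chit t x \<partial>m)" for m
    by (simp add: free_energy_def chit_alt)
  have "(SUP m\<in>invariant_measures \<beta>. free_energy (\<lambda>x. t * chi \<beta> x) m) = ereal (Pr t)"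
  proof (rule antisym)
    show "(SUP m\<in>invariant_measures \<beta>. free_energy (\<lambda>x. t * chi \<beta> x) m) \<le> ereal (Pr t)"
      unfolding fe by (intro SUP_least invariant_upper(2))
    show "ereal (Pr t) \<le> (SUP m\<in>invariant_measures \<beta>. free_energy (\<lambda>x. t * chi \<beta> x) m)"
      using mu_entropy[of t] by (intro SUP_upper2[OF mu_invariant[of t]]) (simp add: fe)
  qed
  thus ?thesis by (simp add: is_equilibrium_state_def fe)
qed

section \<open>Mean frequency as the derivative of the pressure, and the limits at both ends\<close>

lemma entropy_mu: "metric_entropy (mu t) shift = ereal (Pr t - t * (\<integral>x. chi \<beta> x \<partial>mu t))"
  using mu_entropy[of t] by (cases "metric_entropy (mu t) shift") (auto simp: integral_chit)

text \<open>The entropy of \<open>mu t\<close> is known exactly, so the variational inequality for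
  all other s says that Pr s - s I is minimal at s = t, where its derivative must vanish.\<close>

lemma al_mu: "al t = (\<integral>x. chi \<beta> x \<partial>mu t)"
proof -
  let ?I = "\<integral>x. chi \<beta> x \<partial>mu t"
  have le: "Pr t - t * ?I \<le> Pr s - s * ?I" for s
    using invariant_upper(2)[OF mu_invariant[of t], of s] by (simp add: entropy_mu integral_chit)
  have "((\<lambda>s. Pr s - s * ?I) has_real_derivative (al t - ?I)) (at t)"
    using Pr_DERIV[of t] by (auto intro!: derivative_eq_intros simp: al_def)
  hence "al t - ?I = 0" by (rule DERIV_local_min[where d=1]) (use le in auto)
  thus ?thesis by simp
qed

lemma Pr_tangent: "Pr t + (s - t) * al t \<le> Pr s"
  using invariant_upper(2)[OF mu_invariant[of t], of s] by (simp add: entropy_mu integral_chit al_mu algebra_simps)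

lemma metric_entropy_nonneg:
  assumes "m \<in> invariant_measures \<beta>" shows "0 \<le> metric_entropy m shift"
proof -
  interpret m: mpt m shift using invariant_mpt[OF assms] by blast
  have \<xi>: "{space m} \<in> finite_partitions m"
    using m.not_empty by (auto simp: finite_partitions_def intro!: partition_onI)
  have "0 \<le> m.h\<xi> {space m}"
    by (rule LIMSEQ_le_const[OF m.h\<xi>_lim[OF \<xi>]]) (use m.Hn_nonneg[OF \<xi>] in auto)
  hence "0 \<le> ereal (lim (\<lambda>n. partition_entropy m (iterated_join m shift {space m} n) / real n))"
    by (simp add: m.h\<xi>_def[OF \<xi>])
  also have "\<dots> \<le> metric_entropy m shift" unfolding metric_entropy_def by (rule SUP_upper[OF \<xi>])
  finally show ?thesis .
qed

lemma freq_le: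
  assumes "m \<in> invariant_measures \<beta>"
  shows "s * (\<integral>x. chi \<beta> x \<partial>m) \<le> Pr s"
proof -
  have "0 + ereal (\<integral>x. chit s x \<partial>m) \<le> metric_entropy m shift + ereal (\<integral>x. chit s x \<partial>m)"
    by (rule add_right_mono) (rule metric_entropy_nonneg[OF assms])
  also note invariant_upper(2)[OF assms, of s]
  finally show ?thesis by (simp add: integral_chit)
qed

text \<open>The tangent at s, evaluated at 0, turns s b \<le> Pr s into a bound by the slope at s
  plus an error of order 1/s. It serves invariant measures and points of a level set alike.\<close>

lemma freq_le_tangent:
  assumes "0 < s" "s * b \<le> Pr s"
  shows "b \<le> Pr 0 / s + al s"
proof -
  have "s * b \<le> Pr 0 + s * al s" using Pr_tangent[of s 0] assms(2) by simp
  thus ?thesis using assms(1) by (simp add: field_simps)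
qed

lemma freq_le_max:
  assumes "m \<in> invariant_measures \<beta>" shows "(\<integral>x. chi \<beta> x \<partial>m) \<le> max_frequency \<beta>"
proof -
  have "bdd_above ((\<lambda>m. \<integral>x. chi \<beta> x \<partial>m) ` invariant_measures \<beta>)"
    using freq_le[of _ 1] by (intro bdd_aboveI2[of _ _ "Pr 1"]) simp
  thus ?thesis unfolding max_frequency_def using assms by (intro cSUP_upper)
qed

lemma max_frequency_le: "0 < s \<Longrightarrow> max_frequency \<beta> \<le> Pr 0 / s + al s"
  unfolding max_frequency_def using mu_invariant freq_le_tangent freq_le by (intro cSUP_least) auto

lemma al_strict_mono: "strict_mono al"
proof (rule strict_monoI)
  fix x y :: real assume "x < y"
  thus "al x < al y"
    by (rule DERIV_pos_imp_increasing) (intro exI conjI, rule al_DERIV, rule al_deriv_pos)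
qed

lemma al_less_max: "al t < max_frequency \<beta>"
proof -
  have "al t < al (t + 1)" using al_strict_mono by (simp add: strict_mono_less)
  also have "\<dots> \<le> max_frequency \<beta>" unfolding al_mu by (rule freq_le_max[OF mu_invariant])
  finally show ?thesis .
qed

lemma al_at_top: "(al \<longlongrightarrow> max_frequency \<beta>) at_top"
proof (rule tendsto_sandwich)
  show "\<forall>\<^sub>F s in at_top. max_frequency \<beta> - Pr 0 / s \<le> al s"
    using eventually_gt_at_top[of 0]
  proof eventually_elim
    case (elim s)
    show ?case using max_frequency_le[OF elim] by linarith
  qed
  show "\<forall>\<^sub>F s in at_top. al s \<le> max_frequency \<beta>" by (intro always_eventually allI less_imp_le al_less_max)
  have "((\<lambda>s. max_frequency \<beta> - Pr 0 / s) \<longlongrightarrow> max_frequency \<beta> - 0) at_top"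
    by (intro tendsto_intros tendsto_divide_0[OF tendsto_const] filterlim_at_top_imp_at_infinity filterlim_ident)
  thus "((\<lambda>s. max_frequency \<beta> - Pr 0 / s) \<longlongrightarrow> max_frequency \<beta>) at_top" by simp
qed (rule tendsto_const)

text \<open>From index 1 on, every term contains the weight of the digit \<open>q 0\<close> = 1. So
  for s \<le> 0 the sum of these terms, 1 - \<open>zt s\<close>, is at most exp s / (1 -
  \<open>zt s\<close>), whence (1 - \<open>zt s\<close>)^2 \<le> exp s.\<close>

lemma zt_at_bot: "(zt \<longlongrightarrow> 1) at_bot"
proof (rule tendsto_sandwich)
  have "1 - exp (s / 2) \<le> zt s" for s
  proof -
    let ?z = "zt s"
    have z: "0 < ?z" "?z < 1" "p s ?z sums 1" using zt[of s] by auto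
    have le: "p s ?z (Suc n) \<le> exp s * ?z ^ n" if s: "s \<le> 0" for n
    proof -
      have "1 \<le> S (Suc n) q" unfolding S_def using q0 member_le_sum[of 0 "{..<Suc n}" "\<lambda>i. real (q i)"] by simp
      hence "s * S (Suc n) q \<le> s * 1" using s by (intro mult_left_mono_neg) auto
      hence H: "H s (Suc n) \<le> exp s" by (simp add: H_def)
      have "p s ?z (Suc n) = real (q (Suc n)) * (H s (Suc n) * (?z\<^sup>2 * ?z ^ n))" by (simp add: p_def power2_eq_square)
      also have "\<dots> \<le> 1 * (exp s * (1 * ?z ^ n))"
        using z H q_le1[of "Suc n"] H_pos[of s "Suc n"] by (intro mult_mono) (auto simp: power_le_one less_imp_le)
      finally show ?thesis by simp
    qed
    show ?thesis
    proof (cases "s \<le> 0")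
      case True
      have "(\<lambda>n. p s ?z (Suc n)) sums (1 - ?z)" using z(3) by (subst sums_Suc_iff) (simp add: p_def q0)
      moreover have "(\<lambda>n. exp s * ?z ^ n) sums (exp s * (1 / (1 - ?z)))"
        using z by (intro sums_mult geometric_sums) auto
      ultimately have "1 - ?z \<le> exp s * (1 / (1 - ?z))" by (rule sums_le[OF le[OF True]])
      hence "(1 - ?z)\<^sup>2 \<le> exp s" using z by (simp add: pos_le_divide_eq power2_eq_square)
      also have "\<dots> = (exp (s / 2))\<^sup>2" by (simp add: power2_eq_square flip: exp_add)
      finally have "1 - ?z \<le> exp (s / 2)" by (rule power2_le_imp_le) simp
      thus ?thesis by simp
    next
      case False
      hence "1 \<le> exp (s / 2)" by simp
      thus ?thesis using z by linarith
    qed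
  qed
  thus "\<forall>\<^sub>F s in at_bot. 1 - exp (s / 2) \<le> zt s" by simp
  show "\<forall>\<^sub>F s in at_bot. zt s \<le> 1" by (intro always_eventually allI less_imp_le zt(2))
  have "filterlim (\<lambda>s::real. s / 2) at_bot at_bot" by real_asymp
  from filterlim_compose[OF exp_at_bot this] have "((\<lambda>s::real. 1 - exp (s / 2)) \<longlongrightarrow> 1 - 0) at_bot"
    by (intro tendsto_intros)
  thus "((\<lambda>s::real. 1 - exp (s / 2)) \<longlongrightarrow> 1) at_bot" by simp
qed (rule tendsto_const)

lemma lam_at_bot: "(lam \<longlongrightarrow> 1) at_bot"
  unfolding lam_def[abs_def] using tendsto_divide[OF tendsto_const zt_at_bot, of 1] by simp

text \<open>The tangent inequality bounds the slope at s by the increment of the pressure over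
  [s, s + 1], and the pressure tends to 0.\<close>

lemma al_at_bot: "(al \<longlongrightarrow> 0) at_bot"
proof (rule tendsto_sandwich)
  show "\<forall>\<^sub>F s in at_bot. 0 \<le> al s" by (intro always_eventually allI less_imp_le al_pos)
  show "\<forall>\<^sub>F s in at_bot. al s \<le> Pr (s + 1) - Pr s"
  proof (intro always_eventually allI)
    fix s :: real show "al s \<le> Pr (s + 1) - Pr s" using Pr_tangent[of s "s + 1"] by simp
  qed
  have P: "(Pr \<longlongrightarrow> 0) at_bot" unfolding Pr_def[abs_def] using tendsto_ln[OF lam_at_bot] by simp
  have "filterlim (\<lambda>s::real. s + 1) at_bot at_bot" by real_asymp
  from tendsto_diff[OF filterlim_compose[OF P this] P]
  show "((\<lambda>s. Pr (s + 1) - Pr s) \<longlongrightarrow> 0) at_bot" by simp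
qed (rule tendsto_const)

lemma Pr_strict_mono: "strict_mono Pr"
proof (rule strict_monoI)
  fix x y :: real assume "x < y"
  thus "Pr x < Pr y"
    by (rule DERIV_pos_imp_increasing) (intro exI conjI, rule Pr_DERIV, rule al_pos[unfolded al_def])
qed

lemma lam_strict_mono: "strict_mono lam"
  using Pr_strict_mono unfolding strict_mono_def exp_Pr[symmetric] by simp

lemma lam_at_top: "filterlim lam at_top at_top"
proof -
  have "filterlim (\<lambda>s. Pr 0 + al 0 * s) at_top at_top"
    using al_pos[of 0]
    by (intro filterlim_tendsto_add_at_top[OF tendsto_const] filterlim_tendsto_pos_mult_at_top[OF tendsto_const] filterlim_ident) auto
  hence "filterlim Pr at_top at_top"
    by (rule filterlim_at_top_mono) (use Pr_tangent[of 0] in \<open>auto simp: mult.commute\<close>)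
  from filterlim_compose[OF exp_at_top this] show ?thesis by (simp add: exp_Pr)
qed

lemma cyl_sum_le: "\<exists>C>0. \<forall>n. (\<Sum>w\<in>W n. exp (t * S n w)) \<le> C * exp (real n * Pr t)"
proof -
  obtain C where C: "C > 0" "\<And>n. (L t ^^ n) (\<lambda>_. 1) zero \<le> C * lam t ^ n" using Zn_bounds[of t] by blast
  have "(\<Sum>w\<in>W n. exp (t * S n w)) = (L t ^^ n) (\<lambda>_. 1) zero" for n
    unfolding tr_pow_zero by (intro sum.cong) (auto simp: birk_chit W_X)
  thus ?thesis using C by (intro exI[of _ C]) (simp add: lam_pow mult.commute)
qed

text \<open>The word of x is one of those summed in the partition function, so exp (s
  \<open>S n x\<close>) is at most a constant times exp (n Pr s).\<close>

lemma level_set_le: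
  assumes x: "x \<in> level_set \<beta> b" shows "s * b \<le> Pr s"
proof -
  obtain C where C: "C > 0" "\<And>n. (\<Sum>w\<in>W n. exp (s * S n w)) \<le> C * exp (real n * Pr s)" using cyl_sum_le by blast
  have xX: "x \<in> X" and lim: "(\<lambda>n. S n x / real n) \<longlonglongrightarrow> b" using x by (auto simp: level_set_def S_def)
  have bound: "s * (S n x / real n) \<le> ln C / real n + Pr s" if n: "n \<ge> 1" for n
  proof -
    have "exp (s * S n x) = exp (s * S n (trunc n x))" by (simp add: S_def trunc_def)
    also have "\<dots> \<le> (\<Sum>w\<in>W n. exp (s * S n w))"
      by (rule member_le_sum[OF trunc_in_W[OF xX]]) (auto simp: finite_W)
    also have "\<dots> \<le> exp (ln C + real n * Pr s)" using C(2)[of n] C(1) by (simp add: exp_add)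
    finally have "s * S n x \<le> ln C + real n * Pr s" by simp
    thus ?thesis using n by (simp add: field_simps)
  qed
  have "(\<lambda>n. s * (S n x / real n)) \<longlonglongrightarrow> s * b" by (intro tendsto_intros lim)
  moreover have "(\<lambda>n. ln C / real n + Pr s) \<longlonglongrightarrow> 0 + Pr s" by (intro tendsto_intros lim_const_over_n)
  ultimately have "s * b \<le> 0 + Pr s" by (rule LIMSEQ_le) (use bound in blast)
  thus ?thesis by simp
qed

lemma level_set_empty:
  assumes "b \<notin> {0..max_frequency \<beta>}" shows "level_set \<beta> b = {}"
proof (rule ccontr)
  assume "level_set \<beta> b \<noteq> {}"
  then obtain x where x: "x \<in> level_set \<beta> b" by blast
  have "0 \<le> b"
    using x by (intro LIMSEQ_le_const[of "\<lambda>n. (\<Sum>i<n. real (x i)) / real n" b 0]) (auto simp: level_set_def sum_nonneg)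
  moreover have "b \<le> max_frequency \<beta>"
  proof (rule tendsto_le[OF _ _ tendsto_const])
    have "((\<lambda>s. Pr 0 / s + al s) \<longlongrightarrow> 0 + max_frequency \<beta>) at_top"
      by (intro tendsto_intros al_at_top tendsto_divide_0[OF tendsto_const] filterlim_at_top_imp_at_infinity filterlim_ident)
    thus "((\<lambda>s. Pr 0 / s + al s) \<longlongrightarrow> max_frequency \<beta>) at_top" by simp
    show "\<forall>\<^sub>F s in at_top. b \<le> Pr 0 / s + al s"
      using eventually_gt_at_top[of 0] by eventually_elim (rule freq_le_tangent[OF _ level_set_le[OF x]])
  qed simp
  ultimately show False using assms by simp
qed

lemma al_isCont: "isCont al t" using al_DERIV by (rule DERIV_isCont)

lemma al_solution:
  assumes "b \<in> {0<..<max_frequency \<beta>}" shows "\<exists>!t. al t = b"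
proof -
  obtain s1 where s1: "al s1 < b"
    using order_tendstoD(2)[OF al_at_bot, of b] assms by (auto dest: eventually_happens)
  obtain s2 where s2: "b < al s2"
    using order_tendstoD(1)[OF al_at_top, of b] assms by (auto dest: eventually_happens)
  have "s1 \<le> s2" using s1 s2 strict_mono_less_eq[OF al_strict_mono, of s1 s2] by simp
  then obtain t where t: "al t = b" using IVT[of al s1 b s2] s1 s2 al_isCont by auto
  show ?thesis
  proof (rule ex1I[where a=t], rule t)
    fix s assume "al s = b"
    thus "s = t" using t strict_mono_eq[OF al_strict_mono, of s t] by simp
  qed
qed

lemma alpha_al: "alpha \<beta> t = al t"
proof -
  have "pressure_fun \<beta> = Pr" by (rule ext) (rule pressure_Pr)
  thus ?thesis by (simp add: alpha_def al_def)
qed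

lemma al_alpha_inverse: "b \<in> {0<..<max_frequency \<beta>} \<Longrightarrow> al (alpha_inverse \<beta> b) = b"
  unfolding alpha_inverse_def alpha_al by (rule theI'[OF al_solution])

lemma alpha_inverse_al: "alpha_inverse \<beta> (al t) = t"
  using al_alpha_inverse[of "al t"] al_pos al_less_max strict_mono_eq[OF al_strict_mono] by simp

lemma alpha_inverse_rext:
  assumes "b \<in> {0<..<max_frequency \<beta>}" shows "rext (alpha_inverse \<beta>) b"
proof -
  define t where "t = alpha_inverse \<beta> b"
  have t: "al t = b" unfolding t_def by (rule al_alpha_inverse[OF assms])
  have "rext (alpha_inverse \<beta>) (al t)"
  proof (rule rext_inverse[OF al_rext])
    show "deriv al t \<noteq> 0" using al_deriv_pos[of t] by simp
    show "isCont (alpha_inverse \<beta>) (al t)"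
      by (rule isCont_inverse_function[of 1]) (auto simp: alpha_inverse_al al_isCont)
    have "eventually (\<lambda>b. b \<in> {0<..<max_frequency \<beta>}) (nhds (al t))"
      by (rule eventually_nhds_in_open) (use al_pos al_less_max in auto)
    thus "eventually (\<lambda>b. al (alpha_inverse \<beta> b) = b) (nhds (al t))"
      by eventually_elim (rule al_alpha_inverse)
  qed (rule alpha_inverse_al)
  thus ?thesis by (simp add: t)
qed

section \<open>The Legendre transform of the pressure\<close>

lemma Pr_0: "Pr 0 = ln \<beta>"
proof -
  have b: "0 < 1 / \<beta>" using beta1 by simp
  have "p 0 (1 / \<beta>) = (\<lambda>n. real (q n) / \<beta> ^ Suc n)" by (rule ext) (simp add: p_def H_def power_divide)
  hence "p 0 (1 / \<beta>) sums 1" using q_sums by simp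
  from zt_unique[OF b this] have "lam 0 = \<beta>" unfolding lam_def by (metis inverse_eq_divide inverse_inverse_eq)
  thus ?thesis by (simp add: Pr_def)
qed

text \<open>The entropy of the equilibrium state with mean frequency b, divided by ln \<beta>: the
  value to be proved for the dimension.\<close>

definition dm :: "real \<Rightarrow> real" where
  "dm b = (Pr (alpha_inverse \<beta> b) - alpha_inverse \<beta> b * b) / ln \<beta>"

lemma dm_al: "dm (al t) = (Pr t - t * al t) / ln \<beta>"
  by (simp add: dm_def alpha_inverse_al)

lemma ln_beta_pos: "0 < ln \<beta>" using beta1 by simp

lemma dm_nonneg: assumes "b \<in> {0<..<max_frequency \<beta>}" shows "0 \<le> dm b"
proof -
  have "0 \<le> Pr t - t * al t" for t
    using metric_entropy_nonneg[OF mu_invariant, of t] by (simp add: entropy_mu al_mu)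
  from this[of "alpha_inverse \<beta> b"] show ?thesis
    using ln_beta_pos by (simp add: dm_def al_alpha_inverse[OF assms])
qed

lemma dm_le:
  assumes "b \<in> {0<..<max_frequency \<beta>}" shows "dm b \<le> (Pr s - s * b) / ln \<beta>"
proof -
  have "Pr (alpha_inverse \<beta> b) - alpha_inverse \<beta> b * b \<le> Pr s - s * b"
    using Pr_tangent[of "alpha_inverse \<beta> b" s] by (simp add: al_alpha_inverse[OF assms] algebra_simps)
  thus ?thesis unfolding dm_def using ln_beta_pos by (intro divide_right_mono) auto
qed

lemma dm_le_1: assumes "b \<in> {0<..<max_frequency \<beta>}" shows "dm b \<le> 1"
  using dm_le[OF assms, of 0] ln_beta_pos by (simp add: Pr_0)

lemma dm_rext: assumes "b \<in> {0<..<max_frequency \<beta>}" shows "rext dm b"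
proof -
  note T = alpha_inverse_rext[OF assms]
  have "rext (\<lambda>b. (Pr (alpha_inverse \<beta> b) - alpha_inverse \<beta> b * b) * (1 / ln \<beta>)) b"
    by (intro rext_mult rext_diff rext_compose[OF T Pr_rext] T rext_id rext_const)
  thus ?thesis by (simp add: dm_def[abs_def])
qed

lemma dm_concave: "concave_on {0<..<max_frequency \<beta>} dm"
  unfolding concave_on_iff
proof (intro conjI ballI allI impI)
  fix a b \<kappa> \<kappa>' :: real
  assume a: "a \<in> {0<..<max_frequency \<beta>}" and b: "b \<in> {0<..<max_frequency \<beta>}"
    and k: "0 \<le> \<kappa>" "0 \<le> \<kappa>'" "\<kappa> + \<kappa>' = 1"
  let ?s = "alpha_inverse \<beta> (\<kappa> *\<^sub>R a + \<kappa>' *\<^sub>R b)"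
  have "\<kappa> * dm a + \<kappa>' * dm b \<le> \<kappa> * ((Pr ?s - ?s * a) / ln \<beta>) + \<kappa>' * ((Pr ?s - ?s * b) / ln \<beta>)"
    using dm_le[OF a, of ?s] dm_le[OF b, of ?s] k by (intro add_mono mult_left_mono) auto
  also have "\<dots> = ((\<kappa> + \<kappa>') * Pr ?s - ?s * (\<kappa> *\<^sub>R a + \<kappa>' *\<^sub>R b)) / ln \<beta>"
    by (simp add: add_divide_distrib diff_divide_distrib algebra_simps)
  also have "\<dots> = dm (\<kappa> *\<^sub>R a + \<kappa>' *\<^sub>R b)" by (simp add: k dm_def)
  finally show "\<kappa> * dm a + \<kappa>' * dm b \<le> dm (\<kappa> *\<^sub>R a + \<kappa>' *\<^sub>R b)" .
qed simp

end

section \<open>Hausdorff dimension of the level sets\<close>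

text \<open>The premeasure asks for one sequence of sets. The finite families are enumerated, padded
  with the empty set, which has diameter 0 and contributes 0, and interleaved by the pairing
  function.\<close>

lemma premeasure_le:
  fixes V :: "nat \<Rightarrow> 'a set set"
  assumes fin: "\<And>n. finite (V n)" and cov: "A \<subseteq> (\<Union>n. \<Union>(V n))"
    and small: "\<And>n U. U \<in> V n \<Longrightarrow> diam d U \<le> ennreal \<delta>"
  shows "hausdorff_premeasure d s \<delta> A \<le> (\<Sum>n. \<Sum>U\<in>V n. ennreal (enn2real (diam d U) powr s))"
proof -
  have "\<exists>e. bij_betw e {..<card (V n)} (V n)" for n
    using ex_bij_betw_nat_finite[OF fin[of n]] by (simp add: atLeast0LessThan)
  then obtain e where e: "\<And>n. bij_betw (e n) {..<card (V n)} (V n)" by metis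
  define F where "F = (\<lambda>(n, k). if k < card (V n) then e n k else {})"
  define U where "U i = F (prod_decode i)" for i
  let ?g = "\<lambda>U. ennreal (enn2real (diam d U) powr s)"
  have d0: "diam d {} = 0" by (simp add: diam_def bot_ennreal)
  have eV: "e n k \<in> V n" if "k < card (V n)" for n k using bij_betwE[OF e[of n]] that by blast
  have "A \<subseteq> (\<Union>i. U i)"
  proof
    fix x assume "x \<in> A"
    then obtain n B where B: "B \<in> V n" "x \<in> B" using cov by blast
    have "B \<in> e n ` {..<card (V n)}" using bij_betw_imp_surj_on[OF e[of n]] B(1) by simp
    then obtain k where "k < card (V n)" "e n k = B" by auto
    hence "U (prod_encode (n, k)) = B" by (simp add: U_def F_def)
    thus "x \<in> (\<Union>i. U i)" using B(2) by blast
  qed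
  moreover have "diam d (U i) \<le> ennreal \<delta>" for i
    using small eV by (auto simp: U_def F_def d0 split: prod.split)
  ultimately have "hausdorff_premeasure d s \<delta> A \<le> (\<Sum>i. ?g (U i))"
    unfolding hausdorff_premeasure_def by (intro INF_lower) auto
  also have "(\<Sum>i. ?g (U i)) = (\<Sum>n. \<Sum>B\<in>V n. ?g B)"
    unfolding U_def
  proof (rule suminf_ennreal_2dimen)
    fix n
    have "(\<Sum>k. ?g (F (n, k))) = (\<Sum>k<card (V n). ?g (F (n, k)))"
      by (rule suminf_finite) (auto simp: F_def d0)
    also have "\<dots> = (\<Sum>k<card (V n). ?g (e n k))" by (intro sum.cong) (auto simp: F_def)
    also have "\<dots> = (\<Sum>B\<in>V n. ?g B)" by (rule sum.reindex_bij_betw[OF e])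
    finally show "(\<Sum>B\<in>V n. ?g B) = (\<Sum>k. ?g (F (n, k)))" ..
  qed
  finally show ?thesis .
qed

context beta_setting
begin

section \<open>Covers by cylinders and mass distributions on the level sets\<close>

lemma beta_dist_cyl:
  assumes "x \<in> cyl n w" "y \<in> cyl n w" shows "beta_dist \<beta> x y \<le> \<beta> powr - real n"
proof (cases "x = y")
  case False
  have "x i = y i" if "i < n" for i
    using assms that unfolding cyl_def trunc_def by (auto simp: fun_eq_iff) metis
  moreover have "\<exists>k. x k \<noteq> y k" using False by auto
  ultimately have "n \<le> (LEAST k. x k \<noteq> y k)" by (metis (mono_tags, lifting) LeastI_ex not_le)
  thus ?thesis using False beta1 by (simp add: beta_dist_def)
qed (use beta1 in \<open>simp add: beta_dist_def\<close>)

lemma diam_cyl: "diam (beta_dist \<beta>) (cyl n w) \<le> ennreal (\<beta> powr - real n)"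
  unfolding diam_def by (intro SUP_least ennreal_leI beta_dist_cyl)

lemma powr_exp: "(\<beta> powr - real n) powr s = exp (- (real n * s * ln \<beta>))"
  using beta1 by (simp add: powr_powr powr_def)

lemma S_trunc: "S n (trunc n x) = S n x" by (simp add: S_def trunc_def)

lemma cyl_self: "x \<in> X \<Longrightarrow> x \<in> cyl n (trunc n x)" by (simp add: cyl_def)

text \<open>Cover by the cylinders of length n \<ge> M whose digit frequency is within e of b. On
  these, exp (t \<open>S n w\<close>) is at least exp (n t b - n |t| e), so the partition function
  controls their number.\<close>

lemma dim_upper:
  assumes s: "0 < s" "(Pr t - t * b) / ln \<beta> < s"
  shows "hausdorff_measure (beta_dist \<beta>) s (level_set \<beta> b) = 0"
proof -
  define \<eta> where "\<eta> = s * ln \<beta> - (Pr t - t * b)"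
  have \<eta>: "0 < \<eta>" using s(2) ln_beta_pos by (simp add: \<eta>_def pos_divide_less_eq)
  \<comment> \<open>Keeps the frequency error |t| e below half of the gap \<eta>, leaving geometric
    decay at rate \<eta>/2; the summand 1 covers t = 0.\<close>
  define e where "e = \<eta> / (2 * (\<bar>t\<bar> + 1))"
  have e: "0 < e" using \<eta> by (simp add: e_def)
  have te: "\<bar>t\<bar> * e \<le> \<eta> / 2" using \<eta> by (simp add: e_def field_simps)
  obtain C where C: "C > 0" "\<And>n. (\<Sum>w\<in>W n. exp (t * S n w)) \<le> C * exp (real n * Pr t)" using cyl_sum_le by blast
  define D where "D n = {w \<in> W n. \<bar>S n w - real n * b\<bar> \<le> real n * e}" for n
  have fD: "finite (D n)" for n using finite_W by (simp add: D_def)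
  have sumD: "(\<Sum>w\<in>D n. (\<beta> powr - real n) powr s) \<le> C * exp (- \<eta> / 2) ^ n" for n
  proof -
    have "(\<beta> powr - real n) powr s \<le> exp (t * S n w) * exp (real n * (\<eta> / 2 - t * b - s * ln \<beta>))" if "w \<in> D n" for w
    proof -
      have "- (t * (S n w - real n * b)) \<le> \<bar>t\<bar> * \<bar>S n w - real n * b\<bar>" by (metis abs_ge_minus_self abs_mult)
      also have "\<dots> \<le> \<bar>t\<bar> * (real n * e)" using that by (intro mult_left_mono) (auto simp: D_def)
      also have "\<dots> \<le> real n * (\<eta> / 2)" using mult_left_mono[OF te, of "real n"] by (simp add: algebra_simps)
      finally have "0 \<le> t * S n w + real n * (\<eta> / 2 - t * b)" by (simp add: algebra_simps)
      thus ?thesis unfolding powr_exp exp_add[symmetric] by (simp add: algebra_simps)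
    qed
    hence "(\<Sum>w\<in>D n. (\<beta> powr - real n) powr s) \<le> (\<Sum>w\<in>D n. exp (t * S n w) * exp (real n * (\<eta> / 2 - t * b - s * ln \<beta>)))"
      by (rule sum_mono)
    also have "\<dots> \<le> (\<Sum>w\<in>W n. exp (t * S n w) * exp (real n * (\<eta> / 2 - t * b - s * ln \<beta>)))"
      by (rule sum_mono2[OF finite_W]) (auto simp: D_def)
    also have "\<dots> \<le> (C * exp (real n * Pr t)) * exp (real n * (\<eta> / 2 - t * b - s * ln \<beta>))"
      unfolding sum_distrib_right[symmetric] by (rule mult_right_mono[OF C(2)]) simp
    also have "\<dots> = C * exp (real n * Pr t + real n * (\<eta> / 2 - t * b - s * ln \<beta>))"
      by (simp only: exp_add mult.assoc)
    also have "real n * Pr t + real n * (\<eta> / 2 - t * b - s * ln \<beta>) = real n * (- \<eta> / 2)"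
      by (simp add: \<eta>_def field_simps)
    also have "C * exp (real n * (- \<eta> / 2)) = C * exp (- \<eta> / 2) ^ n" by (simp only: exp_of_nat_mult)
    finally show ?thesis .
  qed
  let ?\<theta> = "exp (- \<eta> / 2)"
  have th: "0 < ?\<theta>" "?\<theta> < 1" using \<eta> by auto
  have pre: "hausdorff_premeasure (beta_dist \<beta>) s \<delta> (level_set \<beta> b) \<le> ennreal (C / (1 - ?\<theta>) * ?\<theta> ^ M)"
    if M: "\<beta> powr - real M \<le> \<delta>" for \<delta> M
  proof -
    let ?V = "\<lambda>n. cyl (n + M) ` D (n + M)" and ?g = "\<lambda>U. ennreal (enn2real (diam (beta_dist \<beta>) U) powr s)"
    have "hausdorff_premeasure (beta_dist \<beta>) s \<delta> (level_set \<beta> b) \<le> (\<Sum>n. \<Sum>U\<in>?V n. ?g U)"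
    proof (rule premeasure_le)
      show "finite (?V n)" for n using fD by simp
      show "level_set \<beta> b \<subseteq> (\<Union>n. \<Union>(?V n))"
      proof
        fix x assume x: "x \<in> level_set \<beta> b"
        hence xX: "x \<in> X" and "(\<lambda>n. S n x / real n) \<longlonglongrightarrow> b" by (auto simp: level_set_def S_def)
        from LIMSEQ_D[OF this(2) e] obtain k where k: "\<And>n. n \<ge> k \<Longrightarrow> norm (S n x / real n - b) < e" by blast
        define n where "n = max 1 (max k M)"
        have n: "1 \<le> n" "k \<le> n" "M \<le> n" by (auto simp: n_def)
        have "S n x - real n * b = real n * (S n x / real n - b)" using n(1) by (simp add: right_diff_distrib)
        hence "\<bar>S n x - real n * b\<bar> = real n * \<bar>S n x / real n - b\<bar>" by (simp only: abs_mult abs_of_nat)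
        also have "\<dots> \<le> real n * e" using k[OF n(2)] by (intro mult_left_mono) auto
        finally have "trunc n x \<in> D n" using trunc_in_W[OF xX] by (simp add: D_def S_trunc)
        hence "cyl n (trunc n x) \<in> ?V (n - M)" using n(3) by simp
        thus "x \<in> (\<Union>n. \<Union>(?V n))" using cyl_self[OF xX, of n] by blast
      qed
      fix n U assume "U \<in> ?V n"
      then obtain w where U: "U = cyl (n + M) w" by blast
      have "diam (beta_dist \<beta>) U \<le> ennreal (\<beta> powr - real (n + M))" unfolding U by (rule diam_cyl)
      also have "\<dots> \<le> ennreal \<delta>"
      proof (rule ennreal_leI)
        have "\<beta> powr - real (n + M) \<le> \<beta> powr - real M" using beta1 by (intro powr_mono) auto
        thus "\<beta> powr - real (n + M) \<le> \<delta>" using M by simp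
      qed
      finally show "diam (beta_dist \<beta>) U \<le> ennreal \<delta>" .
    qed
    also have "\<dots> \<le> (\<Sum>n. ennreal (C * ?\<theta> ^ (n + M)))"
    proof (rule suminf_le)
      fix n
      have g: "?g (cyl (n + M) w) \<le> ennreal ((\<beta> powr - real (n + M)) powr s)" for w
      proof (intro ennreal_leI powr_mono2)
        show "enn2real (diam (beta_dist \<beta>) (cyl (n + M) w)) \<le> \<beta> powr - real (n + M)"
          by (rule enn2real_leI[OF _ diam_cyl]) simp
      qed (use s in auto)
      have "(\<Sum>U\<in>?V n. ?g U) \<le> (\<Sum>w\<in>D (n + M). ?g (cyl (n + M) w))"
        using sum_image_le[OF fD, where f="cyl (n + M)" and g="?g"] by (simp add: o_def)
      also have "\<dots> \<le> (\<Sum>w\<in>D (n + M). ennreal ((\<beta> powr - real (n + M)) powr s))" by (intro sum_mono g)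
      also have "\<dots> = ennreal (\<Sum>w\<in>D (n + M). (\<beta> powr - real (n + M)) powr s)" by (rule sum_ennreal) simp
      also have "\<dots> \<le> ennreal (C * ?\<theta> ^ (n + M))" by (rule ennreal_leI[OF sumD])
      finally show "(\<Sum>U\<in>?V n. ?g U) \<le> ennreal (C * ?\<theta> ^ (n + M))" .
    qed auto
    also have "\<dots> = ennreal (C / (1 - ?\<theta>) * ?\<theta> ^ M)"
    proof (rule suminf_ennreal_eq)
      have "(\<lambda>n. (C * ?\<theta> ^ M) * ?\<theta> ^ n) sums ((C * ?\<theta> ^ M) * (1 / (1 - ?\<theta>)))"
        using th by (intro sums_mult geometric_sums) auto
      thus "(\<lambda>n. C * ?\<theta> ^ (n + M)) sums (C / (1 - ?\<theta>) * ?\<theta> ^ M)" by (simp add: power_add mult_ac)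
    qed (use C th in auto)
    finally show ?thesis .
  qed
  have "hausdorff_premeasure (beta_dist \<beta>) s \<delta> (level_set \<beta> b) = 0" if \<delta>: "0 < \<delta>" for \<delta>
  proof -
    have l1: "(\<lambda>M. ennreal (C / (1 - ?\<theta>) * ?\<theta> ^ M)) \<longlonglongrightarrow> ennreal (C / (1 - ?\<theta>) * 0)"
      using th by (intro tendsto_ennrealI tendsto_mult tendsto_const LIMSEQ_power_zero) auto
    have "(\<lambda>M. (1 / \<beta>) ^ M) \<longlonglongrightarrow> 0" using beta1 by (intro LIMSEQ_power_zero) auto
    hence "eventually (\<lambda>M. (1 / \<beta>) ^ M < \<delta>) sequentially" using \<delta> by (rule order_tendstoD)
    hence "eventually (\<lambda>M. hausdorff_premeasure (beta_dist \<beta>) s \<delta> (level_set \<beta> b) \<le> ennreal (C / (1 - ?\<theta>) * ?\<theta> ^ M)) sequentially"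
    proof eventually_elim
      case (elim M)
      have "\<beta> powr - real M = (1 / \<beta>) ^ M" using beta1 by (simp add: powr_minus powr_realpow power_divide inverse_eq_divide)
      thus ?case using elim by (intro pre) simp
    qed
    from tendsto_lowerbound[OF l1 this] show ?thesis by simp
  qed
  thus ?thesis unfolding hausdorff_measure_def by (simp add: SUP_eq_const[where x = 0 and I = "{0<..}"])
qed

text \<open>An exponential Markov inequality: on the event exp (\<tau> (\<open>S n x\<close> - n a))
  is at least exp (n |\<tau>| e), and summing the Gibbs bound with this factor gives the partition
  function at t + \<tau>. The sign of \<tau> selects upper or lower deviations.\<close>

lemma deviation_bound:
  fixes a t \<tau> e :: real
  defines "\<kappa> \<equiv> Pr (t + \<tau>) - Pr t - \<tau> * a - \<bar>\<tau>\<bar> * e"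
  shows "\<exists>K>0. \<forall>n. measure (mu t) {x \<in> X. real n * (\<bar>\<tau>\<bar> * e) \<le> \<tau> * (S n x - real n * a)} \<le> K * exp \<kappa> ^ n"
proof -
  interpret prob_space "mu t" by (rule prob_mu)
  obtain C where C: "C > 0" "\<And>n. (\<Sum>w\<in>W n. exp ((t + \<tau>) * S n w)) \<le> C * exp (real n * Pr (t + \<tau>))" using cyl_sum_le by blast
  have Ch: "0 < Ch t" using Ch_ge1[of t] by simp
  have "measure (mu t) {x \<in> X. real n * (\<bar>\<tau>\<bar> * e) \<le> \<tau> * (S n x - real n * a)} \<le> (2 * Ch t * C) * exp \<kappa> ^ n" for n
  proof -
    define D where "D = {w \<in> W n. real n * (\<bar>\<tau>\<bar> * e) \<le> \<tau> * (S n w - real n * a)}"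
    have fD: "finite D" using finite_W by (simp add: D_def)
    have cs: "cyl n w \<in> events" for w using cyl_sets sets_mu by simp
    have "{x \<in> X. real n * (\<bar>\<tau>\<bar> * e) \<le> \<tau> * (S n x - real n * a)} \<subseteq> (\<Union>w\<in>D. cyl n w)"
    proof
      fix x assume "x \<in> {x \<in> X. real n * (\<bar>\<tau>\<bar> * e) \<le> \<tau> * (S n x - real n * a)}"
      hence "trunc n x \<in> D" "x \<in> X" using trunc_in_W by (auto simp: D_def S_trunc)
      thus "x \<in> (\<Union>w\<in>D. cyl n w)" using cyl_self by blast
    qed
    hence "measure (mu t) {x \<in> X. real n * (\<bar>\<tau>\<bar> * e) \<le> \<tau> * (S n x - real n * a)} \<le> measure (mu t) (\<Union>w\<in>D. cyl n w)"
      using fD cs by (intro finite_measure_mono) auto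
    also have "\<dots> \<le> (\<Sum>w\<in>D. measure (mu t) (cyl n w))" using fD cs by (intro finite_measure_subadditive_finite) auto
    also have "\<dots> \<le> (\<Sum>w\<in>D. (2 * Ch t * exp (- real n * (Pr t + \<tau> * a + \<bar>\<tau>\<bar> * e))) * exp ((t + \<tau>) * S n w))"
    proof (rule sum_mono)
      fix w assume w: "w \<in> D"
      have "zt t ^ n = exp (- real n * Pr t)"
        by (simp add: exp_minus_Pr[symmetric] exp_of_nat_mult[symmetric])
      hence "exp (t * S n w) * zt t ^ n = exp (t * S n w - real n * Pr t)" by (simp add: exp_diff exp_minus field_simps)
      also have "\<dots> \<le> exp (- real n * (Pr t + \<tau> * a + \<bar>\<tau>\<bar> * e) + (t + \<tau>) * S n w)"
        using w by (simp add: D_def algebra_simps)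
      finally have "exp (t * S n w) * zt t ^ n \<le> exp (- real n * (Pr t + \<tau> * a + \<bar>\<tau>\<bar> * e)) * exp ((t + \<tau>) * S n w)"
        by (simp only: exp_add)
      hence "2 * Ch t * (exp (t * S n w) * zt t ^ n) \<le> 2 * Ch t * (exp (- real n * (Pr t + \<tau> * a + \<bar>\<tau>\<bar> * e)) * exp ((t + \<tau>) * S n w))"
        using Ch by (intro mult_left_mono) auto
      thus "measure (mu t) (cyl n w) \<le> (2 * Ch t * exp (- real n * (Pr t + \<tau> * a + \<bar>\<tau>\<bar> * e))) * exp ((t + \<tau>) * S n w)"
        using mu_cyl[of t n w] by (simp only: mult.assoc)
    qed
    also have "\<dots> \<le> (\<Sum>w\<in>W n. (2 * Ch t * exp (- real n * (Pr t + \<tau> * a + \<bar>\<tau>\<bar> * e))) * exp ((t + \<tau>) * S n w))"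
      using Ch by (intro sum_mono2 finite_W) (auto simp: D_def)
    also have "\<dots> \<le> (2 * Ch t * exp (- real n * (Pr t + \<tau> * a + \<bar>\<tau>\<bar> * e))) * (C * exp (real n * Pr (t + \<tau>)))"
      unfolding sum_distrib_left[symmetric] using Ch by (intro mult_left_mono C(2)) auto
    also have "\<dots> = (2 * Ch t * C) * exp (- real n * (Pr t + \<tau> * a + \<bar>\<tau>\<bar> * e) + real n * Pr (t + \<tau>))"
      by (simp only: exp_add mult_ac)
    also have "- real n * (Pr t + \<tau> * a + \<bar>\<tau>\<bar> * e) + real n * Pr (t + \<tau>) = real n * \<kappa>" by (simp add: \<kappa>_def algebra_simps)
    finally show ?thesis by (simp only: exp_of_nat_mult)
  qed
  thus ?thesis using C Ch by (intro exI[of _ "2 * Ch t * C"]) auto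
qed

lemma S_measurable: "S n \<in> borel_measurable (mu t)"
proof -
  have "(\<lambda>x::digits. real (x i)) \<in> borel_measurable borel" for i
    by (rule measurable_compose[OF measurable_product_coordinates[of i]])
      (intro borel_measurable_continuous_onI continuous_on_of_nat continuous_on_id)
  hence "S n \<in> borel_measurable borel" unfolding S_def[abs_def] by (intro borel_measurable_sum)
  hence "S n \<in> borel_measurable XB" by (rule measurable_restrict_space1)
  thus ?thesis using measurable_cong_sets[OF sets_mu refl] by blast
qed

text \<open>As \<open>al t\<close> is the derivative of the pressure, the exponent in
  \<open>deviation_bound\<close> is negative for small \<tau> of either sign. The deviation
  probabilities are then summable and Borel-Cantelli applies.\<close>

lemma mu_typical:
  assumes e: "0 < e"
  shows "AE x in mu t. \<forall>\<^sub>F n in sequentially. \<bar>S n x - real n * al t\<bar> \<le> real n * e"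
proof -
  interpret prob_space "mu t" by (rule prob_mu)
  note [measurable] = S_measurable
  have "((\<lambda>y. (Pr y - Pr t) / (y - t)) \<longlongrightarrow> al t) (at t)"
    using Pr_DERIV[of t] unfolding al_def by (simp add: has_field_derivative_iff)
  from tendstoD[OF this e] obtain d where d: "d > 0"
    "\<And>y. y \<noteq> t \<Longrightarrow> dist y t < d \<Longrightarrow> dist ((Pr y - Pr t) / (y - t)) (al t) < e"
    unfolding eventually_at by auto
  have half: "AE x in mu t. \<forall>\<^sub>F n in sequentially. sgn \<tau> * (S n x - real n * al t) < real n * e"
    if \<tau>: "\<tau> \<noteq> 0" "\<bar>\<tau>\<bar> < d" for \<tau>
  proof -
    let ?\<kappa> = "Pr (t + \<tau>) - Pr t - \<tau> * al t - \<bar>\<tau>\<bar> * e"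
    have "\<bar>(Pr (t + \<tau>) - Pr t) / \<tau> - al t\<bar> < e" using d(2)[of "t + \<tau>"] \<tau> by (simp add: dist_real_def)
    hence "\<bar>\<tau>\<bar> * \<bar>(Pr (t + \<tau>) - Pr t) / \<tau> - al t\<bar> < \<bar>\<tau>\<bar> * e" using \<tau> by (intro mult_strict_left_mono) auto
    moreover have "Pr (t + \<tau>) - Pr t - \<tau> * al t = \<tau> * ((Pr (t + \<tau>) - Pr t) / \<tau> - al t)"
      using \<tau> by (simp add: field_simps)
    ultimately have "\<bar>Pr (t + \<tau>) - Pr t - \<tau> * al t\<bar> < \<bar>\<tau>\<bar> * e" by (simp only: abs_mult)
    hence \<kappa>: "?\<kappa> < 0" by linarith
    define A where "A n = {x \<in> X. real n * (\<bar>\<tau>\<bar> * e) \<le> \<tau> * (S n x - real n * al t)}" for n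
    obtain K where K: "K > 0 \<and> (\<forall>n. measure (mu t) (A n) \<le> K * exp ?\<kappa> ^ n)"
      unfolding A_def by (rule exE[OF deviation_bound[where t=t and \<tau>=\<tau> and a="al t" and e=e]])
    have "A n = {x \<in> space (mu t). real n * (\<bar>\<tau>\<bar> * e) \<le> \<tau> * (S n x - real n * al t)}" for n by (simp add: A_def space_mu)
    hence Am: "A n \<in> events" for n by simp
    have "summable (\<lambda>n. K * exp ?\<kappa> ^ n)" using \<kappa> by (intro summable_mult summable_geometric) auto
    hence "summable (\<lambda>n. measure (mu t) (A n))"
      by (rule summable_comparison_test'[where N=0]) (use K in simp)
    hence "AE x in mu t. \<forall>\<^sub>F n in sequentially. x \<in> space (mu t) - A n"
      by (intro borel_cantelli_AE1 Am) (auto simp: less_top[symmetric])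
    thus ?thesis
    proof eventually_elim
      case (elim x)
      thus ?case
      proof eventually_elim
        case (elim n)
        hence "\<tau> * (S n x - real n * al t) < real n * (\<bar>\<tau>\<bar> * e)" by (auto simp: A_def space_mu)
        moreover have "\<tau> * (S n x - real n * al t) = \<bar>\<tau>\<bar> * (sgn \<tau> * (S n x - real n * al t))"
          by (simp only: mult.assoc[symmetric] abs_mult_sgn mult.commute[of "\<bar>\<tau>\<bar>"] linordered_idom_class.mult_sgn_abs)
        ultimately have "\<bar>\<tau>\<bar> * (sgn \<tau> * (S n x - real n * al t)) < \<bar>\<tau>\<bar> * (real n * e)" by (simp only: mult_ac)
        thus ?case using \<tau>(1) by (subst (asm) mult_less_cancel_left_pos) auto
      qed
    qed
  qed
  have "AE x in mu t. \<forall>\<^sub>F n in sequentially. sgn (d / 2) * (S n x - real n * al t) < real n * e"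
    by (rule half) (use d in auto)
  moreover have "AE x in mu t. \<forall>\<^sub>F n in sequentially. sgn (- d / 2) * (S n x - real n * al t) < real n * e"
    by (rule half) (use d in auto)
  ultimately show ?thesis
  proof eventually_elim
    case (elim x)
    from elim show ?case
    proof eventually_elim
      case (elim n)
      thus ?case using d(1) by (simp add: sgn_if abs_le_iff)
    qed
  qed
qed

lemma mu_level_set: "AE x in mu t. x \<in> level_set \<beta> (al t)"
proof -
  have "AE x in mu t. \<forall>k. \<forall>\<^sub>F n in sequentially. \<bar>S n x - real n * al t\<bar> \<le> real n * (1 / real (Suc k))"
    unfolding AE_all_countable by (intro allI mu_typical) simp
  thus ?thesis using AE_space
  proof eventually_elim
    case (elim x)
    have "(\<lambda>n. S n x / real n) \<longlonglongrightarrow> al t"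
    proof (rule tendstoI)
      fix e :: real assume "e > 0"
      then obtain k where k: "1 / real (Suc k) < e" using nat_approx_posE by blast
      have "\<forall>\<^sub>F n in sequentially. \<bar>S n x - real n * al t\<bar> \<le> real n * (1 / real (Suc k))" using elim(1) by blast
      thus "\<forall>\<^sub>F n in sequentially. dist (S n x / real n) (al t) < e"
        using eventually_gt_at_top[of 0]
      proof eventually_elim
        case (elim n)
        have "real n * \<bar>S n x / real n - al t\<bar> = \<bar>real n * (S n x / real n - al t)\<bar>" by (simp add: abs_mult)
        also have "\<dots> = \<bar>S n x - real n * al t\<bar>" using elim(2) by (simp add: right_diff_distrib)
        also note elim(1)
        finally have "\<bar>S n x / real n - al t\<bar> \<le> 1 / real (Suc k)" using elim(2) by (subst (asm) mult_le_cancel_left_pos) auto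
        thus ?case using k by (simp add: dist_real_def)
      qed
    qed
    thus ?case using elim(2) by (simp add: level_set_def S_def space_mu)
  qed
qed

text \<open>Choose y in B with the earliest disagreement k from x, that is, at the largest distance.
  All of B agrees with x before k, while the diameter is at least the distance \<beta>^(-k). A
  singleton offers no such y and is excluded.\<close>

lemma diam_cover:
  assumes x: "x \<in> B" "x \<in> X" and B: "B \<noteq> {x}" and d: "diam (beta_dist \<beta>) B \<le> ennreal (\<beta> powr - real M)"
  shows "\<exists>k\<ge>M. B \<inter> X \<subseteq> cyl k (trunc k x) \<and> \<beta> powr - real k \<le> enn2real (diam (beta_dist \<beta>) B)"
proof -
  define f where "f y = (LEAST k. x k \<noteq> y k)" for y
  obtain y0 where y0: "y0 \<in> B" "y0 \<noteq> x" using B x by blast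
  obtain y where y: "y \<in> B" "y \<noteq> x" "\<And>z. z \<in> B \<Longrightarrow> z \<noteq> x \<Longrightarrow> f y \<le> f z"
    using ex_has_least_nat[of "\<lambda>y. y \<in> B \<and> y \<noteq> x" y0 f] y0 by blast
  have dist: "beta_dist \<beta> x y = \<beta> powr - real (f y)" using y(2) by (auto simp: beta_dist_def f_def)
  have le: "ennreal (\<beta> powr - real (f y)) \<le> diam (beta_dist \<beta>) B"
    unfolding diam_def dist[symmetric] by (rule SUP_upper2[OF x(1)], rule SUP_upper[OF y(1)])
  hence "ennreal (\<beta> powr - real (f y)) \<le> ennreal (\<beta> powr - real M)" using d by (rule order_trans)
  hence "\<beta> powr - real (f y) \<le> \<beta> powr - real M" by simp
  hence "M \<le> f y" using beta1 by simp
  moreover have "B \<inter> X \<subseteq> cyl (f y) (trunc (f y) x)"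
  proof
    fix z assume z: "z \<in> B \<inter> X"
    have "x i = z i" if "i < f y" for i
    proof (cases "z = x")
      case False
      hence "i < (LEAST k. x k \<noteq> z k)" using y(3)[of z] z that by (simp add: f_def)
      thus ?thesis using not_less_Least by blast
    qed simp
    thus "z \<in> cyl (f y) (trunc (f y) x)" using z by (auto simp: cyl_def trunc_def)
  qed
  moreover have "\<beta> powr - real (f y) \<le> enn2real (diam (beta_dist \<beta>) B)"
  proof -
    have "diam (beta_dist \<beta>) B < \<top>" using d by (rule le_less_trans) simp
    from enn2real_mono[OF le this] show ?thesis by simp
  qed
  ultimately show ?thesis by blast
qed

text \<open>The mass distribution principle. On the set \<open>E M\<close> the frequency bound holds
  from M on, so for k \<ge> M the Gibbs bound of a k-cylinder around a point of it is at most a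
  constant times \<beta>^(-ks).\<close>

lemma dim_lower:
  assumes s: "0 < s" "s < (Pr t - t * al t) / ln \<beta>"
  shows "hausdorff_measure (beta_dist \<beta>) s (level_set \<beta> (al t)) \<noteq> 0"
proof -
  interpret prob_space "mu t" by (rule prob_mu)
  note [measurable] = S_measurable
  define a where "a = al t"
  define \<eta> where "\<eta> = Pr t - t * a - s * ln \<beta>"
  have \<eta>: "0 < \<eta>" using s(2) ln_beta_pos by (simp add: \<eta>_def a_def pos_less_divide_eq)
  define e where "e = \<eta> / (\<bar>t\<bar> + 1)"
  have e: "0 < e" using \<eta> by (simp add: e_def)
  have te: "\<bar>t\<bar> * e \<le> \<eta>" using \<eta> by (simp add: e_def field_simps)
  have Ch: "0 < Ch t" using Ch_ge1[of t] by simp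
  define E where "E M = {x \<in> space (mu t). \<forall>n\<ge>M. \<bar>S n x - real n * a\<bar> \<le> real n * e}" for M
  have Em: "E M \<in> events" for M unfolding E_def by measurable
  obtain Z where Z: "{x \<in> space (mu t). x \<notin> level_set \<beta> a} \<subseteq> Z" "Z \<in> null_sets (mu t)"
    using mu_level_set[of t] unfolding a_def eventually_ae_filter by blast
  \<comment> \<open>Almost every point lies in some \<open>E M\<close>, so these countably many sets
    cannot all be null.\<close>
  obtain M where M: "emeasure (mu t) (E M) \<noteq> 0"
  proof (rule ccontr)
    assume "\<not> thesis"
    hence "E M \<in> null_sets (mu t)" for M using that Em by (auto simp: null_sets_def)
    hence "(\<Union>M. E M) \<in> null_sets (mu t)" by (rule null_sets_UN)
    hence "AE x in mu t. x \<notin> (\<Union>M. E M)" by (rule AE_not_in)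
    moreover have "AE x in mu t. x \<in> (\<Union>M. E M)"
      using mu_typical[OF e, of t] AE_space by eventually_elim (auto simp: E_def a_def eventually_sequentially)
    ultimately have "AE x in mu t. False" by eventually_elim blast
    thus False by simp
  qed
  define G where "G = E M - Z"
  have G: "G \<in> events" "emeasure (mu t) G = emeasure (mu t) (E M)"
    using Em Z(2) by (auto simp: G_def emeasure_Diff_null_set null_sets_def)
  have GX: "G \<subseteq> X" by (auto simp: G_def E_def space_mu)
  have GL: "G \<subseteq> level_set \<beta> a" using Z(1) by (auto simp: G_def E_def)
  have mcyl: "emeasure (mu t) (cyl k (trunc k x)) \<le> ennreal (2 * Ch t * (\<beta> powr - real k) powr s)"
    if x: "x \<in> G" and k: "M \<le> k" for x k
  proof -
    have "\<bar>S k x - real k * a\<bar> \<le> real k * e" using x k by (auto simp: G_def E_def)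
    hence "t * (S k x - real k * a) \<le> \<bar>t\<bar> * (real k * e)"
      by (metis abs_ge_self abs_ge_zero abs_mult mult_left_mono order_trans)
    also have "\<dots> \<le> real k * \<eta>" using mult_left_mono[OF te, of "real k"] by (simp add: mult_ac)
    finally have le: "t * S k x - real k * Pr t \<le> - (real k * s * ln \<beta>)" by (simp add: \<eta>_def algebra_simps)
    have "zt t ^ k = exp (- real k * Pr t)"
      by (simp add: exp_minus_Pr[symmetric] exp_of_nat_mult[symmetric])
    hence "exp (t * S k (trunc k x)) * zt t ^ k = exp (t * S k x - real k * Pr t)"
      by (simp add: S_trunc exp_diff exp_minus field_simps)
    also have "\<dots> \<le> (\<beta> powr - real k) powr s" unfolding powr_exp using le by simp
    finally have "2 * Ch t * (exp (t * S k (trunc k x)) * zt t ^ k) \<le> 2 * Ch t * (\<beta> powr - real k) powr s"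
      using Ch by (intro mult_left_mono) auto
    hence "measure (mu t) (cyl k (trunc k x)) \<le> 2 * Ch t * (\<beta> powr - real k) powr s"
      using mu_cyl[of t k "trunc k x"] by simp
    thus ?thesis unfolding emeasure_eq_measure by (rule ennreal_leI)
  qed
  have cs: "cyl k w \<in> events" for k w using cyl_sets sets_mu by simp
  \<comment> \<open>Covering sets are arbitrary, so the trace of each on G is enclosed in an event V
    before the measure is applied.\<close>
  have cover: "\<exists>V\<in>events. U \<inter> G \<subseteq> V \<and> emeasure (mu t) V \<le> ennreal (2 * Ch t) * ennreal (enn2real (diam (beta_dist \<beta>) U) powr s)"
    if d: "diam (beta_dist \<beta>) U \<le> ennreal (\<beta> powr - real M)" for U
  proof (cases "U \<inter> G = {}")
    case True
    thus ?thesis by (intro bexI[of _ "{}"]) auto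
  next
    case False
    then obtain x where x: "x \<in> U" "x \<in> G" by blast
    show ?thesis
    \<comment> \<open>A singleton has diameter 0, so it must be given mass 0: the cylinders around x
      shrink to a null set.\<close>
    proof (cases "U = {x}")
      case True
      let ?V = "\<Inter>k. cyl k (trunc k x)"
      have V: "?V \<in> events" using cs by (intro sets.countable_INT) auto
      have "emeasure (mu t) ?V \<le> 0"
      proof (rule tendsto_lowerbound)
        have "(\<lambda>k. 2 * Ch t * (\<beta> powr - s) ^ k) \<longlonglongrightarrow> 2 * Ch t * 0"
          using beta1 s(1) by (intro tendsto_intros LIMSEQ_power_zero) (auto simp: powr_less_one)
        moreover have "(\<beta> powr - real k) powr s = (\<beta> powr - s) ^ k" for k
          using beta1 by (simp add: powr_powr powr_realpow[symmetric] mult.commute)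
        ultimately show "(\<lambda>k. ennreal (2 * Ch t * (\<beta> powr - real k) powr s)) \<longlonglongrightarrow> 0"
          by (auto dest: tendsto_ennrealI)
        show "\<forall>\<^sub>F k in sequentially. emeasure (mu t) ?V \<le> ennreal (2 * Ch t * (\<beta> powr - real k) powr s)"
          using eventually_ge_at_top[of M]
        proof eventually_elim
          case (elim k)
          have "emeasure (mu t) ?V \<le> emeasure (mu t) (cyl k (trunc k x))" by (rule emeasure_mono[OF _ cs]) blast
          also note mcyl[OF x(2) elim]
          finally show ?case .
        qed
      qed simp
      moreover have "U \<inter> G \<subseteq> ?V" using True x GX cyl_self by blast
      ultimately show ?thesis using V by (intro bexI[of _ ?V]) auto
    next
      case False
      obtain k where k: "k \<ge> M" "U \<inter> X \<subseteq> cyl k (trunc k x)" "\<beta> powr - real k \<le> enn2real (diam (beta_dist \<beta>) U)"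
        using diam_cover[OF x(1) _ False d] x(2) GX by blast
      have "emeasure (mu t) (cyl k (trunc k x)) \<le> ennreal (2 * Ch t * (\<beta> powr - real k) powr s)" by (rule mcyl[OF x(2) k(1)])
      also have "\<dots> \<le> ennreal (2 * Ch t * enn2real (diam (beta_dist \<beta>) U) powr s)"
        using k(3) Ch s(1) by (intro ennreal_leI mult_left_mono powr_mono2) auto
      also have "\<dots> = ennreal (2 * Ch t) * ennreal (enn2real (diam (beta_dist \<beta>) U) powr s)"
        using Ch by (intro ennreal_mult) auto
      finally show ?thesis using k(2) GX cs by (intro bexI[of _ "cyl k (trunc k x)"]) auto
    qed
  qed
  let ?\<delta> = "\<beta> powr - real M"
  have \<delta>: "0 < ?\<delta>" using beta1 by simp
  have "emeasure (mu t) G \<le> ennreal (2 * Ch t) * hausdorff_premeasure (beta_dist \<beta>) s ?\<delta> (level_set \<beta> a)"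
  proof -
    have "emeasure (mu t) G / ennreal (2 * Ch t) \<le> hausdorff_premeasure (beta_dist \<beta>) s ?\<delta> (level_set \<beta> a)"
      unfolding hausdorff_premeasure_def
    proof (rule INF_greatest)
      fix U :: "nat \<Rightarrow> digits set"
      assume "U \<in> {U. level_set \<beta> a \<subseteq> (\<Union>i. U i) \<and> (\<forall>i. diam (beta_dist \<beta>) (U i) \<le> ennreal ?\<delta>)}"
      hence U: "level_set \<beta> a \<subseteq> (\<Union>i. U i)" "\<And>i. diam (beta_dist \<beta>) (U i) \<le> ennreal ?\<delta>" by auto
      have "\<exists>V. V \<in> events \<and> U i \<inter> G \<subseteq> V \<and> emeasure (mu t) V \<le> ennreal (2 * Ch t) * ennreal (enn2real (diam (beta_dist \<beta>) (U i)) powr s)" for i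
        using cover[OF U(2)[of i]] by blast
      then obtain V where V: "\<And>i. V i \<in> events" "\<And>i. U i \<inter> G \<subseteq> V i"
         "\<And>i. emeasure (mu t) (V i) \<le> ennreal (2 * Ch t) * ennreal (enn2real (diam (beta_dist \<beta>) (U i)) powr s)" by metis
      have "G \<subseteq> (\<Union>i. V i)" using GL U(1) V(2) by blast
      hence "emeasure (mu t) G \<le> emeasure (mu t) (\<Union>i. V i)" using V(1) by (intro emeasure_mono) auto
      also have "\<dots> \<le> (\<Sum>i. emeasure (mu t) (V i))" using V(1) by (intro emeasure_subadditive_countably) auto
      also have "\<dots> \<le> (\<Sum>i. ennreal (2 * Ch t) * ennreal (enn2real (diam (beta_dist \<beta>) (U i)) powr s))"
        by (intro suminf_le V(3)) auto
      also have "\<dots> = ennreal (2 * Ch t) * (\<Sum>i. ennreal (enn2real (diam (beta_dist \<beta>) (U i)) powr s))" by simp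
      finally show "emeasure (mu t) G / ennreal (2 * Ch t) \<le> (\<Sum>i. ennreal (enn2real (diam (beta_dist \<beta>) (U i)) powr s))"
        using Ch by (intro divide_le_posI_ennreal) (auto simp: ennreal_less_zero_iff)
    qed
    hence "ennreal (2 * Ch t) * (emeasure (mu t) G / ennreal (2 * Ch t)) \<le>
        ennreal (2 * Ch t) * hausdorff_premeasure (beta_dist \<beta>) s ?\<delta> (level_set \<beta> a)" by (rule mult_left_mono) simp
    thus ?thesis using Ch by (simp add: ennreal_times_divide ennreal_mult_divide_eq mult.commute)
  qed
  hence "hausdorff_premeasure (beta_dist \<beta>) s ?\<delta> (level_set \<beta> a) \<noteq> 0" using M G(2) by auto
  moreover have "hausdorff_premeasure (beta_dist \<beta>) s ?\<delta> (level_set \<beta> a) \<le> hausdorff_measure (beta_dist \<beta>) s (level_set \<beta> a)"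
    unfolding hausdorff_measure_def using \<delta> by (intro SUP_upper) simp
  ultimately show ?thesis by (auto simp: a_def)
qed

lemma hausdorff_dim_level_set:
  assumes b: "b \<in> {0<..<max_frequency \<beta>}"
  shows "hausdorff_dim (beta_dist \<beta>) (level_set \<beta> b) = ennreal (dm b)"
proof -
  define t where "t = alpha_inverse \<beta> b"
  have t: "al t = b" unfolding t_def by (rule al_alpha_inverse[OF b])
  have D: "dm b = (Pr t - t * b) / ln \<beta>" using dm_al[of t] t by simp
  show ?thesis unfolding hausdorff_dim_def
  proof (rule antisym)
    show "(INF s\<in>{s. 0 < s \<and> hausdorff_measure (beta_dist \<beta>) s (level_set \<beta> b) = 0}. ennreal s) \<le> ennreal (dm b)"
    proof (rule ennreal_le_epsilon)
      fix e :: real assume e: "0 < e"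
      have pos: "0 < dm b + e" using dm_nonneg[OF b] e by simp
      have "hausdorff_measure (beta_dist \<beta>) (dm b + e) (level_set \<beta> b) = 0"
        by (rule dim_upper[of _ t]) (use pos e D in auto)
      hence "(INF s\<in>{s. 0 < s \<and> hausdorff_measure (beta_dist \<beta>) s (level_set \<beta> b) = 0}. ennreal s) \<le> ennreal (dm b + e)"
        using pos by (intro INF_lower) auto
      also have "\<dots> = ennreal (dm b) + ennreal e" using dm_nonneg[OF b] e by simp
      finally show "(INF s\<in>{s. 0 < s \<and> hausdorff_measure (beta_dist \<beta>) s (level_set \<beta> b) = 0}. ennreal s) \<le> ennreal (dm b) + ennreal e" .
    qed
    show "ennreal (dm b) \<le> (INF s\<in>{s. 0 < s \<and> hausdorff_measure (beta_dist \<beta>) s (level_set \<beta> b) = 0}. ennreal s)"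
    proof (rule INF_greatest)
      fix s assume "s \<in> {s. 0 < s \<and> hausdorff_measure (beta_dist \<beta>) s (level_set \<beta> b) = 0}"
      hence "\<not> s < dm b" using dim_lower[of s t] by (auto simp: D t)
      thus "ennreal (dm b) \<le> ennreal s" by (intro ennreal_leI) simp
    qed
  qed
qed

section \<open>Regularity of the dimension spectrum\<close>

lemma enn2real_dim: "b \<in> {0<..<max_frequency \<beta>} \<Longrightarrow> enn2real (hausdorff_dim (beta_dist \<beta>) (level_set \<beta> b)) = dm b"
  by (simp add: hausdorff_dim_level_set dm_nonneg)

lemma rext_analytic: "(\<And>x. x \<in> A \<Longrightarrow> rext f x) \<Longrightarrow> real_analytic_on f A"
  unfolding real_analytic_on_def using rext_power_series by blast

lemma dim_analytic:
  "real_analytic_on (\<lambda>a. enn2real (hausdorff_dim (beta_dist \<beta>) (level_set \<beta> a))) {0<..<max_frequency \<beta>}"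
proof (rule rext_analytic)
  fix b assume b: "b \<in> {0<..<max_frequency \<beta>}"
  then obtain d where d: "d > 0" "ball b d \<subseteq> {0<..<max_frequency \<beta>}"
    using openE[OF open_greaterThanLessThan] by blast
  show "rext (\<lambda>a. enn2real (hausdorff_dim (beta_dist \<beta>) (level_set \<beta> a))) b"
  proof (rule rext_cong_near[OF dm_rext[OF b] d(1)])
    fix y assume "\<bar>y - b\<bar> < d"
    hence "y \<in> ball b d" by (simp add: dist_real_def abs_minus_commute)
    thus "dm y = enn2real (hausdorff_dim (beta_dist \<beta>) (level_set \<beta> y))" using d(2) enn2real_dim by auto
  qed
qed

lemma dim_concave:
  "concave_on {0<..<max_frequency \<beta>} (\<lambda>a. enn2real (hausdorff_dim (beta_dist \<beta>) (level_set \<beta> a)))"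
proof -
  have cvx: "\<kappa> *\<^sub>R a + \<kappa>' *\<^sub>R b \<in> {0<..<max_frequency \<beta>}"
    if "a \<in> {0<..<max_frequency \<beta>}" "b \<in> {0<..<max_frequency \<beta>}" "0 \<le> \<kappa>" "0 \<le> \<kappa>'" "\<kappa> + \<kappa>' = 1" for a b \<kappa> \<kappa>' :: real
    using that convexD[OF convex_real_interval(8)] by blast
  show ?thesis using dm_concave cvx unfolding concave_on_iff by (simp add: enn2real_dim)
qed

end

theorem proposition5p1:
  fixes \<beta> :: real
  assumes "1 < \<beta>" and "\<beta> \<le> 2"
  shows
    "((\<forall>t. is_leading_eigenvalue \<beta> t (complex_of_real (leading_eigenvalue \<beta> t)) \<and>
           1 < leading_eigenvalue \<beta> t) \<and>
      strict_mono (leading_eigenvalue \<beta>) \<and>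
      (leading_eigenvalue \<beta> \<longlongrightarrow> 1) at_bot \<and>
      filterlim (leading_eigenvalue \<beta>) at_top at_top) \<and>

     ((\<exists>G F. open G \<and> connected G \<and> \<real> \<subseteq> G \<and> F analytic_on G \<and>
           (\<forall>t. F (complex_of_real t) = complex_of_real (leading_eigenvalue \<beta> t))) \<and>
      real_analytic_on (leading_eigenvalue \<beta>) UNIV) \<and>

     (\<forall>t. pressure_fun \<beta> t = ln (leading_eigenvalue \<beta> t) \<and>
          (pressure_fun \<beta> has_real_derivative alpha \<beta> t) (at t) \<and>
          (\<exists>!\<mu>. is_equilibrium_state \<beta> (\<lambda>x. t * chi \<beta> x) \<mu>) \<and>
          (\<forall>\<mu>. is_equilibrium_state \<beta> (\<lambda>x. t * chi \<beta> x) \<mu> \<longrightarrow>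
               alpha \<beta> t = (\<integral>x. chi \<beta> x \<partial>\<mu>))) \<and>

     ((\<forall>t. 0 < alpha \<beta> t) \<and> strict_mono (alpha \<beta>) \<and>
      (alpha \<beta> \<longlongrightarrow> 0) at_bot \<and>
      (alpha \<beta> \<longlongrightarrow> max_frequency \<beta>) at_top \<and>
      (\<forall>a. a \<notin> {0..max_frequency \<beta>} \<longrightarrow> level_set \<beta> a = {})) \<and>

     ((\<forall>p\<in>{0<..<max_frequency \<beta>}. \<exists>!t. alpha \<beta> t = p) \<and>
      real_analytic_on (alpha_inverse \<beta>) {0<..<max_frequency \<beta>}) \<and>

     ((\<forall>a\<in>{0<..<max_frequency \<beta>}. hausdorff_dim (beta_dist \<beta>) (level_set \<beta> a) \<le> 1) \<and>
      real_analytic_on (\<lambda>a. enn2real (hausdorff_dim (beta_dist \<beta>) (level_set \<beta> a)))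
        {0<..<max_frequency \<beta>} \<and>
      concave_on {0<..<max_frequency \<beta>}
        (\<lambda>a. enn2real (hausdorff_dim (beta_dist \<beta>) (level_set \<beta> a))))"
proof -
  interpret beta_setting \<beta> using assms by unfold_locales
  have le: "leading_eigenvalue \<beta> = lam" by (rule ext) (rule leading_eigenvalue_lam(2))
  have pf: "pressure_fun \<beta> = Pr" by (rule ext) (rule pressure_Pr)
  have ae: "alpha \<beta> = al" by (rule ext) (rule alpha_al)
  have eig: "\<forall>t. is_leading_eigenvalue \<beta> t (complex_of_real (lam t)) \<and> 1 < lam t"
    using leading_eigenvalue_lam(1) lam_gt1 by blast
  have eq: "(\<exists>!m. is_equilibrium_state \<beta> (\<lambda>x. t * chi \<beta> x) m) \<and>
      (\<forall>m. is_equilibrium_state \<beta> (\<lambda>x. t * chi \<beta> x) m \<longrightarrow> al t = (\<integral>x. chi \<beta> x \<partial>m))" for t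
  proof -
    have m: "is_equilibrium_state \<beta> (\<lambda>x. t * chi \<beta> x) m \<longleftrightarrow> m = mu t" for m
      unfolding equilibrium_iff using mu_invariant mu_entropy equilibrium_unique by blast
    show ?thesis unfolding m by (simp add: al_mu)
  qed
  have pr: "\<forall>t. Pr t = ln (lam t) \<and> (Pr has_real_derivative al t) (at t) \<and>
      (\<exists>!m. is_equilibrium_state \<beta> (\<lambda>x. t * chi \<beta> x) m) \<and>
      (\<forall>m. is_equilibrium_state \<beta> (\<lambda>x. t * chi \<beta> x) m \<longrightarrow> al t = (\<integral>x. chi \<beta> x \<partial>m))"
    using eq Pr_DERIV unfolding al_def Pr_def by simp
  have sol: "\<forall>b\<in>{0<..<max_frequency \<beta>}. \<exists>!t. al t = b" by (intro ballI al_solution)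
  have dim: "\<forall>a\<in>{0<..<max_frequency \<beta>}. hausdorff_dim (beta_dist \<beta>) (level_set \<beta> a) \<le> 1"
    by (simp add: hausdorff_dim_level_set dm_le_1)
  show ?thesis
    unfolding le pf ae
    by (intro conjI eig lam_strict_mono lam_at_bot lam_at_top rext_global lam_rext pr
      al_strict_mono al_at_bot al_at_top sol dim dim_analytic dim_concave
      rext_analytic[of UNIV lam] rext_analytic[OF alpha_inverse_rext])
      (simp_all add: al_pos level_set_empty)
qed

end
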